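(* Each of the following decision problems is PSPACE-complete, where the input regular language $L$ is given either by a nondeterministic finite automaton (NFA) or by a regular expression: decide whether $L$ is prefix-convex; suffix-convex; factor-convex; subword-convex; prefix-closed; suffix-closed; factor-closed; subword-closed.
   Context: Relations on words: $v$ is a prefix of $w$ if $w = vx$; a suffix if $w = xv$; a factor if $w = xvy$ (for some words $x,y$); a subword if $v$ is obtained from $w$ by deleting some not necessarily contiguous letters. For such a relation $\unlhd$: $L$ is $\unlhd$-convex if $u,w \in L$ and $u \unlhd v \unlhd w$ imply $v \in L$; $L$ is $\unlhd$-closed if $w \in L$ and $v \unlhd w$ imply $v \in L$. *)

theory Defs
  imports
    Main
    "HOL-Library.Sublist"
    "HOL-Computational_Algebra.Polynomial"
begin

section \<open>Deterministic multi-tape Turing machines\<close>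

text \<open>
  Tapes are infinite in both directions. Tape symbols are the numbers below \<open>tm_symbols M\<close>, where
  0 is the blank; states are the numbers below \<open>tm_states M\<close>. A transition sends a state and the
  list of scanned symbols (one per tape) to the new state and, for each tape, the symbol written
  and the head movement.
\<close>

datatype move = MLeft | MStay | MRight

fun offset :: "move \<Rightarrow> int" where
  "offset MLeft = -1"
| "offset MStay = 0"
| "offset MRight = 1"

record tm =
  tm_tapes :: nat
  tm_symbols :: nat
  tm_states :: nat
  tm_delta :: "nat \<Rightarrow> nat list \<Rightarrow> nat \<times> (nat \<times> move) list"
  tm_start :: nat
  tm_accept :: nat
  tm_reject :: nat

definition wf_tm :: "tm \<Rightarrow> bool" where
  "wf_tm M \<longleftrightarrow>
     tm_tapes M \<ge> 1 \<and> tm_symbols M \<ge> 1 \<and>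
     tm_start M < tm_states M \<and> tm_accept M < tm_states M \<and> tm_reject M < tm_states M \<and>
     tm_accept M \<noteq> tm_reject M \<and>
     (\<forall>q < tm_states M. \<forall>ss. length ss = tm_tapes M \<and> set ss \<subseteq> {..<tm_symbols M} \<longrightarrow>
        fst (tm_delta M q ss) < tm_states M \<and>
        length (snd (tm_delta M q ss)) = tm_tapes M \<and>
        fst ` set (snd (tm_delta M q ss)) \<subseteq> {..<tm_symbols M})"

text \<open>A tape consists of its contents and its head position.\<close>

type_synonym tape = "(int \<Rightarrow> nat) \<times> int"
type_synonym tm_config = "nat \<times> tape list"

fun tape_read :: "tape \<Rightarrow> nat" where
  "tape_read (c, h) = c h"

fun tape_act :: "nat \<times> move \<Rightarrow> tape \<Rightarrow> tape" where
  "tape_act (s, d) (c, h) = (c(h := s), h + offset d)"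

definition halted :: "tm \<Rightarrow> tm_config \<Rightarrow> bool" where
  "halted M C \<longleftrightarrow> fst C \<in> {tm_accept M, tm_reject M}"

definition tm_step :: "tm \<Rightarrow> tm_config \<Rightarrow> tm_config" where
  "tm_step M C =
     (if halted M C then C
      else (case tm_delta M (fst C) (map tape_read (snd C)) of
        (q, acts) \<Rightarrow> (q, map2 tape_act acts (snd C))))"

text \<open>
  Words over an \<open>m\<close>-letter alphabet are lists over \<open>{..<m}\<close>; since 0 is the blank, letter \<open>a\<close> is
  written on tape as the symbol \<open>Suc a\<close>.
\<close>

definition word_contents :: "nat list \<Rightarrow> int \<Rightarrow> nat" where
  "word_contents w i = (if 0 \<le> i \<and> i < int (length w) then Suc (w ! nat i) else 0)"

definition tm_init :: "tm \<Rightarrow> nat list \<Rightarrow> tm_config" where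
  "tm_init M w =
     (tm_start M, (word_contents w, 0) # replicate (tm_tapes M - 1) (word_contents [], 0))"

definition tm_run :: "tm \<Rightarrow> nat list \<Rightarrow> nat \<Rightarrow> tm_config" where
  "tm_run M w t = (tm_step M ^^ t) (tm_init M w)"

definition tm_halts :: "tm \<Rightarrow> nat list \<Rightarrow> bool" where
  "tm_halts M w \<longleftrightarrow> (\<exists>t. halted M (tm_run M w t))"

definition tm_accepts :: "tm \<Rightarrow> nat list \<Rightarrow> bool" where
  "tm_accepts M w \<longleftrightarrow> (\<exists>t. fst (tm_run M w t) = tm_accept M)"

text \<open>
  Space counts the cells scanned on all tapes, including the input tape. The sets of head positions
  are finite on halting runs, and space is only used for those.
\<close>

definition tm_space :: "tm \<Rightarrow> nat list \<Rightarrow> nat" where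
  "tm_space M w = (\<Sum>i < tm_tapes M. card {snd (snd (tm_run M w t) ! i) | t. True})"


section \<open>PSPACE-completeness\<close>

definition PSPACE :: "nat \<Rightarrow> nat list set set" where
  "PSPACE m = {A. A \<subseteq> lists {..<m} \<and>
     (\<exists>M (p :: nat poly). wf_tm M \<and> m < tm_symbols M \<and>
        (\<forall>w \<in> lists {..<m}. tm_halts M w \<and> (tm_accepts M w \<longleftrightarrow> w \<in> A) \<and>
           tm_space M w \<le> poly p (length w)))}"

text \<open>The output of a machine computing a function is the contents of its last tape.\<close>

definition polytime_computable :: "nat \<Rightarrow> (nat list \<Rightarrow> nat list) \<Rightarrow> bool" where
  "polytime_computable m f \<longleftrightarrow>
     (\<exists>M (p :: nat poly). wf_tm M \<and> m < tm_symbols M \<and>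
        (\<forall>w \<in> lists {..<m}. \<exists>t \<le> poly p (length w).
           halted M (tm_run M w t) \<and>
           fst (last (snd (tm_run M w t))) = word_contents (f w)))"

definition polytime_reducible ::
    "nat \<Rightarrow> nat list set \<Rightarrow> nat \<Rightarrow> nat list set \<Rightarrow> bool" where
  "polytime_reducible m A n B \<longleftrightarrow>
     (\<exists>f. polytime_computable m f \<and>
        (\<forall>w \<in> lists {..<m}. f w \<in> lists {..<n} \<and> (w \<in> A \<longleftrightarrow> f w \<in> B)))"

definition PSPACE_hard :: "nat \<Rightarrow> nat list set \<Rightarrow> bool" where
  "PSPACE_hard n B \<longleftrightarrow> (\<forall>m. \<forall>A \<in> PSPACE m. polytime_reducible m A n B)"

definition PSPACE_complete :: "nat \<Rightarrow> nat list set \<Rightarrow> bool" where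
  "PSPACE_complete n B \<longleftrightarrow> B \<in> PSPACE n \<and> PSPACE_hard n B"


section \<open>Finite automata and regular expressions\<close>

text \<open>Lists present the finite sets of states, letters, transitions and final states.\<close>

record ('q, 'a) nfa =
  nfa_states :: "'q list"
  nfa_alphabet :: "'a list"
  nfa_trans :: "('q \<times> 'a \<times> 'q) list"
  nfa_start :: 'q
  nfa_final :: "'q list"

definition wf_nfa :: "('q, 'a) nfa \<Rightarrow> bool" where
  "wf_nfa N \<longleftrightarrow>
     set (nfa_trans N) \<subseteq> set (nfa_states N) \<times> set (nfa_alphabet N) \<times> set (nfa_states N) \<and>
     nfa_start N \<in> set (nfa_states N) \<and>
     set (nfa_final N) \<subseteq> set (nfa_states N)"

fun nfa_reach :: "('q, 'a) nfa \<Rightarrow> 'q set \<Rightarrow> 'a list \<Rightarrow> 'q set" where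
  "nfa_reach N S [] = S"
| "nfa_reach N S (a # w) = nfa_reach N {q. \<exists>p \<in> S. (p, a, q) \<in> set (nfa_trans N)} w"

definition nfa_lang :: "('q, 'a) nfa \<Rightarrow> 'a list set" where
  "nfa_lang N = {w. nfa_reach N {nfa_start N} w \<inter> set (nfa_final N) \<noteq> {}}"

datatype 'a rexp =
    Zero
  | One
  | Atom 'a
  | Plus "'a rexp" "'a rexp"
  | Times "'a rexp" "'a rexp"
  | Star "'a rexp"

fun rexp_lang :: "'a rexp \<Rightarrow> 'a list set" where
  "rexp_lang Zero = {}"
| "rexp_lang One = {[]}"
| "rexp_lang (Atom a) = {[a]}"
| "rexp_lang (Plus r s) = rexp_lang r \<union> rexp_lang s"
| "rexp_lang (Times r s) = {u @ v | u v. u \<in> rexp_lang r \<and> v \<in> rexp_lang s}"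
| "rexp_lang (Star r) = {concat ws | ws. set ws \<subseteq> rexp_lang r}"


section \<open>Encoding of inputs\<close>

text \<open>
  The alphabet of the input language is part of the input, so letters (like states) are named by
  bit strings. In encodings the letters 0 and 1 are the bits and 2 terminates a name.
\<close>

type_synonym name = "bool list"

definition enc_name :: "name \<Rightarrow> nat list" where
  "enc_name x = map of_bool x @ [2]"

definition enc_names :: "name list \<Rightarrow> nat list" where
  "enc_names xs = concat (map enc_name xs) @ [3]"

definition enc_trans :: "(name \<times> name \<times> name) list \<Rightarrow> nat list" where
  "enc_trans ts = concat (map (\<lambda>(p, a, q). enc_name p @ enc_name a @ enc_name q) ts) @ [3]"

definition enc_nfa :: "(name, name) nfa \<Rightarrow> nat list" where
  "enc_nfa N =
     enc_names (nfa_states N) @ enc_names (nfa_alphabet N) @ enc_trans (nfa_trans N) @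
     enc_name (nfa_start N) @ enc_names (nfa_final N)"

text \<open>Expressions are written in Polish notation, which needs no parentheses.\<close>

fun enc_rexp :: "name rexp \<Rightarrow> nat list" where
  "enc_rexp (Atom a) = enc_name a"
| "enc_rexp Zero = [3]"
| "enc_rexp One = [4]"
| "enc_rexp (Plus r s) = 5 # enc_rexp r @ enc_rexp s"
| "enc_rexp (Times r s) = 6 # enc_rexp r @ enc_rexp s"
| "enc_rexp (Star r) = 7 # enc_rexp r"

lemma enc_name_append_eq:
  "enc_name a @ x = enc_name b @ y \<Longrightarrow> a = b \<and> x = y"
proof (induction a arbitrary: b)
  case Nil
  then show ?case by (cases b) (auto simp: enc_name_def of_bool_def split: if_splits)
next
  case (Cons c a)
  then show ?case by (cases b) (auto simp: enc_name_def of_bool_def split: if_splits)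
qed

lemma enc_name_hd:
  assumes "n \<ge> 3"
  shows "enc_name a @ x \<noteq> n # y" and "n # y \<noteq> enc_name a @ x"
  using assms by (cases a; auto simp: enc_name_def of_bool_def split: if_splits)+

lemma enc_names_append_eq:
  "enc_names a @ x = enc_names b @ y \<Longrightarrow> a = b \<and> x = y"
proof (induction a arbitrary: b)
  case Nil
  then show ?case
    by (cases b) (auto simp: enc_names_def enc_name_hd)
next
  case (Cons c a)
  show ?case
  proof (cases b)
    case Nil
    then show ?thesis using Cons.prems by (simp add: enc_names_def enc_name_hd)
  next
    case (Cons d b')
    with Cons.prems have "enc_name c @ enc_names a @ x = enc_name d @ enc_names b' @ y"
      by (simp add: enc_names_def)
    then have "c = d" "enc_names a @ x = enc_names b' @ y"
      by (auto dest: enc_name_append_eq)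
    with Cons.IH[of b'] Cons show ?thesis by simp
  qed
qed

lemma enc_trans_append_eq:
  "enc_trans a @ x = enc_trans b @ y \<Longrightarrow> a = b \<and> x = y"
proof (induction a arbitrary: b)
  case Nil
  then show ?case
    by (cases b) (auto simp: enc_trans_def enc_name_hd)
next
  case (Cons c a)
  obtain p l q where c: "c = (p, l, q)" by (cases c)
  show ?case
  proof (cases b)
    case Nil
    then show ?thesis using Cons.prems c by (simp add: enc_trans_def enc_name_hd)
  next
    case (Cons d b')
    obtain p' l' q' where d: "d = (p', l', q')" by (cases d)
    from Cons.prems have
      "enc_name p @ enc_name l @ enc_name q @ enc_trans a @ x =
       enc_name p' @ enc_name l' @ enc_name q' @ enc_trans b' @ y"
      by (simp add: enc_trans_def c d Cons)
    then have "c = d" "enc_trans a @ x = enc_trans b' @ y"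
      by (auto simp: c d dest!: enc_name_append_eq)
    with Cons.IH[of b'] Cons show ?thesis by simp
  qed
qed

lemma inj_enc_nfa: "inj enc_nfa"
proof (rule injI)
  fix N N' :: "(name, name) nfa"
  assume "enc_nfa N = enc_nfa N'"
  then have eq: "enc_names (nfa_states N) @ enc_names (nfa_alphabet N) @ enc_trans (nfa_trans N) @
      enc_name (nfa_start N) @ enc_names (nfa_final N) @ [] =
    enc_names (nfa_states N') @ enc_names (nfa_alphabet N') @ enc_trans (nfa_trans N') @
      enc_name (nfa_start N') @ enc_names (nfa_final N') @ []"
    by (simp add: enc_nfa_def)
  note 1 = enc_names_append_eq[OF eq]
  note 2 = enc_names_append_eq[OF conjunct2[OF 1]]
  note 3 = enc_trans_append_eq[OF conjunct2[OF 2]]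
  note 4 = enc_name_append_eq[OF conjunct2[OF 3]]
  note 5 = enc_names_append_eq[OF conjunct2[OF 4]]
  show "N = N'"
    using 1 2 3 4 5 by (intro nfa.equality) simp_all
qed

lemma enc_rexp_append_eq:
  "enc_rexp r @ x = enc_rexp s @ y \<Longrightarrow> r = s \<and> x = y"
proof (induction r arbitrary: s x y)
  case Zero
  then show ?case by (cases s) (simp_all add: enc_name_hd)
next
  case One
  then show ?case by (cases s) (simp_all add: enc_name_hd)
next
  case (Atom a)
  then show ?case by (cases s) (auto simp: enc_name_hd dest: enc_name_append_eq)
next
  case (Plus r1 r2)
  from Plus.prems obtain s1 s2 where s: "s = Plus s1 s2"
    by (cases s) (simp_all add: enc_name_hd)
  with Plus.prems have "enc_rexp r1 @ enc_rexp r2 @ x = enc_rexp s1 @ enc_rexp s2 @ y" by simp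
  from Plus.IH(1)[OF this] Plus.IH(2)[of x s2 y] s show ?case by simp
next
  case (Times r1 r2)
  from Times.prems obtain s1 s2 where s: "s = Times s1 s2"
    by (cases s) (simp_all add: enc_name_hd)
  with Times.prems have "enc_rexp r1 @ enc_rexp r2 @ x = enc_rexp s1 @ enc_rexp s2 @ y" by simp
  from Times.IH(1)[OF this] Times.IH(2)[of x s2 y] s show ?case by simp
next
  case (Star r)
  from Star.prems obtain s' where s: "s = Star s'"
    by (cases s) (simp_all add: enc_name_hd)
  with Star.prems Star.IH[of x s' y] show ?case by simp
qed

lemma inj_enc_rexp: "inj enc_rexp"
proof (rule injI)
  fix r s assume "enc_rexp r = enc_rexp s"
  then have "enc_rexp r @ [] = enc_rexp s @ []" by simp
  from enc_rexp_append_eq[OF this] show "r = s" by simp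
qed

definition nfa_problem :: "(name list set \<Rightarrow> bool) \<Rightarrow> nat list set" where
  "nfa_problem P = {enc_nfa N | N. wf_nfa N \<and> P (nfa_lang N)}"

definition rexp_problem :: "(name list set \<Rightarrow> bool) \<Rightarrow> nat list set" where
  "rexp_problem P = {enc_rexp r | r. P (rexp_lang r)}"


section \<open>Convex and closed languages\<close>

definition convex_lang :: "('a list \<Rightarrow> 'a list \<Rightarrow> bool) \<Rightarrow> 'a list set \<Rightarrow> bool" where
  "convex_lang le L \<longleftrightarrow> (\<forall>u v w. u \<in> L \<and> w \<in> L \<and> le u v \<and> le v w \<longrightarrow> v \<in> L)"

definition closed_lang :: "('a list \<Rightarrow> 'a list \<Rightarrow> bool) \<Rightarrow> 'a list set \<Rightarrow> bool" where
  "closed_lang le L \<longleftrightarrow> (\<forall>v w. w \<in> L \<and> le v w \<longrightarrow> v \<in> L)"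

end

theory Submission
  imports Defs "HOL-Library.Countable"
begin

text \<open>
  Membership: a violation of convexity is a word \<open>w\<close> in which two subsets of the positions mark \<open>v\<close> and
  \<open>u\<close>, so it can be read letter by letter while the three sets of reachable states are tracked. The
  search for such a path through triples of sets is a formula with transitive closure over words of
  polynomial length, and Savitch's algorithm evaluates these formulas in polynomial space.

  Hardness: for a machine with polynomial space bound and an input, call a word good if it lists the
  configurations of the rejecting computation. The language of words that are not good has a
  polynomial-size automaton and expression, since every error is local. If the input is accepted, no
  word is good and the language contains all words, so it is closed under subwords. Otherwise a
  good word is missing, although the empty word and the extensions of the good word by a suitable
  letter on the left or right are present, so the language is not even prefix-convex or suffix-convex.
\<close>

section \<open>Stack programs\<close>

text \<open>Machines enter only through one translation: a stack occupies one tape, so a bound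
  \<open>B\<close> on the heights of the stacks is a bound on space. Membership is then shown by
  formulas instead of programs. Savitch's recursion is verified once, as the code for transitive
  closure; a fixed formula nests a constant number of closures, so the space stays polynomial.

  The relation matters only through the admissible markings of the positions of \<open>w\<close>.
  For all four relations these form a regular language, which the search graph follows. The states
  of an automaton are their names; those of an expression are continuations in Polish notation, at
  most \<open>n + 1\<close> many and of length at most \<open>n^2\<close>, which is why the
  quantifiers get a cubic bound.

  For hardness one language serves convexity and closedness alike, because every closed language is
  convex and a missing word between two members refutes convexity. The instance is positive exactly
  if no good word exists; so good words must record rejection, and determinism together with halting
  makes rejection the complement of acceptance.\<close>

datatype com =
    Done
  | Push nat nat
  | Write nat nat
  | Pop nat
  | Emit nat
  | Seq com com (infixr ";;" 60)
  | Branch nat "nat \<Rightarrow> bool" com com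
  | Loop nat "nat \<Rightarrow> bool" com

text \<open>The same coding as on tapes, where 0 is the blank, so a test on \<open>peek\<close> is a
  test on the scanned symbol.\<close>

definition peek :: "nat list \<Rightarrow> nat" where
  "peek xs = (case xs of [] \<Rightarrow> 0 | a # _ \<Rightarrow> Suc a)"

lemma peek_simps [simp]: "peek [] = 0" "peek (a # xs) = Suc a" "peek xs = 0 \<longleftrightarrow> xs = []" "0 < peek xs \<longleftrightarrow> xs \<noteq> []"
  by (auto simp: peek_def split: list.splits)

type_synonym store = "nat \<Rightarrow> nat list"

text \<open>The bound \<open>B\<close> is checked where a stack grows. The number is the exact count
  of machine steps, including those that only change the control state, such as the step from
  \<open>Done ;; d\<close> to \<open>d\<close>; the list is the output.\<close>

inductive exec :: "nat \<Rightarrow> com \<Rightarrow> store \<Rightarrow> nat \<Rightarrow> nat list \<Rightarrow> store \<Rightarrow> bool" for B where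
  exec_Done: "exec B Done \<sigma> 0 [] \<sigma>"
| exec_Push: "length (\<sigma> i) < B \<Longrightarrow> exec B (Push i a) \<sigma> 2 [] (\<sigma>(i := a # \<sigma> i))"
| exec_Pop: "exec B (Pop i) \<sigma> 1 [] (\<sigma>(i := tl (\<sigma> i)))"
| exec_Emit: "exec B (Emit a) \<sigma> 1 [a] \<sigma>"
| exec_Seq: "exec B c \<sigma> t os \<sigma>' \<Longrightarrow> exec B d \<sigma>' t' os' \<sigma>'' \<Longrightarrow>
    exec B (c ;; d) \<sigma> (Suc (t + t')) (os @ os') \<sigma>''"
| exec_BranchT: "p (peek (\<sigma> i)) \<Longrightarrow> exec B c \<sigma> t os \<sigma>' \<Longrightarrow> exec B (Branch i p c d) \<sigma> (Suc t) os \<sigma>'"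
| exec_BranchF: "\<not> p (peek (\<sigma> i)) \<Longrightarrow> exec B d \<sigma> t os \<sigma>' \<Longrightarrow> exec B (Branch i p c d) \<sigma> (Suc t) os \<sigma>'"
| exec_LoopF: "\<not> p (peek (\<sigma> i)) \<Longrightarrow> exec B (Loop i p c) \<sigma> 1 [] \<sigma>"
| exec_LoopT: "p (peek (\<sigma> i)) \<Longrightarrow> exec B c \<sigma> t os \<sigma>' \<Longrightarrow> exec B (Loop i p c) \<sigma>' t' os' \<sigma>'' \<Longrightarrow>
    exec B (Loop i p c) \<sigma> (Suc (Suc (t + t'))) (os @ os') \<sigma>''"

text \<open>
  The control states of the Turing machine are the residual programs. A push needs two machine
  steps, since a machine writes before it moves; the residual \<^term>\<open>Write i a\<close> is the second one.
\<close>

fun cnext :: "nat \<Rightarrow> com \<Rightarrow> nat list \<Rightarrow> com \<times> (nat \<times> nat \<times> move) option" where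
  "cnext k Done ss = (Done, None)"
| "cnext k (Push i a) ss = (Write i a, Some (i, ss ! i, MLeft))"
| "cnext k (Write i a) ss = (Done, Some (i, Suc a, MStay))"
| "cnext k (Pop i) ss = (Done, if ss ! i = 0 then None else Some (i, 0, MRight))"
| "cnext k (Emit a) ss = (Done, Some (k, Suc a, MRight))"
| "cnext k (c ;; d) ss =
     (if c = Done then (d, None) else (case cnext k c ss of (c', x) \<Rightarrow> (c' ;; d, x)))"
| "cnext k (Branch i p c d) ss = (if p (ss ! i) then c else d, None)"
| "cnext k (Loop i p c) ss = (if p (ss ! i) then c ;; Loop i p c else Done, None)"

definition cstep :: "nat \<Rightarrow> com \<times> tape list \<Rightarrow> com \<times> tape list" where
  "cstep k C = (case cnext k (fst C) (map tape_read (snd C)) of (c', x) \<Rightarrow>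
     (c', case x of None \<Rightarrow> snd C | Some (i, a) \<Rightarrow> (snd C)[i := tape_act a (snd C ! i)]))"

text \<open>The set is finite because an unfolded loop leads back to the loop itself; so the
  residual programs can serve as the states of a machine.\<close>

fun residuals :: "com \<Rightarrow> com set" where
  "residuals Done = {Done}"
| "residuals (Push i a) = {Push i a, Write i a, Done}"
| "residuals (Write i a) = {Write i a, Done}"
| "residuals (Pop i) = {Pop i, Done}"
| "residuals (Emit a) = {Emit a, Done}"
| "residuals (c ;; d) = (\<lambda>c'. c' ;; d) ` residuals c \<union> residuals d"
| "residuals (Branch i p c d) = {Branch i p c d} \<union> residuals c \<union> residuals d"
| "residuals (Loop i p c) = {Loop i p c, Done} \<union> (\<lambda>c'. c' ;; Loop i p c) ` residuals c"

lemma finite_residuals: "finite (residuals c)"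
  by (induction c) auto

lemma self_in_residuals: "c \<in> residuals c"
  by (induction c) auto

lemma Done_in_residuals: "Done \<in> residuals c"
  by (induction c) auto

lemma residuals_cnext: "c' \<in> residuals c \<Longrightarrow> fst (cnext k c' ss) \<in> residuals c"
proof (induction c arbitrary: c')
  case (Seq c d)
  have "fst (cnext k (e ;; d) ss) \<in> residuals (c ;; d)" if "e \<in> residuals c" for e
    using Seq.IH(1)[OF that] by (auto simp: self_in_residuals case_prod_beta)
  then show ?case using Seq.prems Seq.IH(2)[of c'] by fastforce
next
  case (Loop i p c)
  have "fst (cnext k (e ;; Loop i p c) ss) \<in> residuals (Loop i p c)" if "e \<in> residuals c" for e
    using Loop.IH[OF that] by (auto simp: case_prod_beta)
  then show ?case using Loop.prems self_in_residuals[of c] by fastforce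
qed (auto simp: self_in_residuals split: if_splits)

fun fits :: "nat \<Rightarrow> nat \<Rightarrow> com \<Rightarrow> bool" where
  "fits k K Done \<longleftrightarrow> True"
| "fits k K (Push i a) \<longleftrightarrow> i < k \<and> a < K"
| "fits k K (Write i a) \<longleftrightarrow> i < k \<and> a < K"
| "fits k K (Pop i) \<longleftrightarrow> i < k"
| "fits k K (Emit a) \<longleftrightarrow> a < K"
| "fits k K (c ;; d) \<longleftrightarrow> fits k K c \<and> fits k K d"
| "fits k K (Branch i p c d) \<longleftrightarrow> i < k \<and> fits k K c \<and> fits k K d"
| "fits k K (Loop i p c) \<longleftrightarrow> i < k \<and> fits k K c"

lemma fits_mono: "fits k K c \<Longrightarrow> k \<le> k' \<Longrightarrow> K \<le> K' \<Longrightarrow> fits k' K' c"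
  by (induction c) auto

lemma ex_fits: "\<exists>k \<ge> k0. \<exists>K \<ge> K0. fits k K c"
proof (induction c)
  case (Seq c d)
  then obtain k K k' K' where "k0 \<le> k" "K0 \<le> K" "fits k K c" "fits k' K' d" by auto
  then show ?case
    by (intro exI[of _ "max k k'"] conjI exI[of _ "max K K'"]) (auto intro: fits_mono)
next
  case (Branch i p c d)
  then obtain k K k' K' where "k0 \<le> k" "K0 \<le> K" "fits k K c" "fits k' K' d" by auto
  then show ?case
    by (intro exI[of _ "max (max k k') (Suc i)"] conjI exI[of _ "max K K'"]) (auto intro: fits_mono)
next
  case (Loop i p c)
  then obtain k K where "k0 \<le> k" "K0 \<le> K" "fits k K c" by auto
  then show ?case
    by (intro exI[of _ "max k (Suc i)"] conjI exI[of _ K]) (auto intro: fits_mono)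
next
  case (Push i a)
  then show ?case
    by (intro exI[of _ "max k0 (Suc i)"] conjI exI[of _ "max K0 (Suc a)"]) auto
next
  case (Write i a)
  then show ?case
    by (intro exI[of _ "max k0 (Suc i)"] conjI exI[of _ "max K0 (Suc a)"]) auto
next
  case (Pop i)
  then show ?case by (intro exI[of _ "max k0 (Suc i)"] conjI exI[of _ "K0"]) auto
next
  case (Emit a)
  then show ?case by (intro exI[of _ "k0"] conjI exI[of _ "max K0 (Suc a)"]) auto
qed auto

lemma fits_residuals: "c' \<in> residuals c \<Longrightarrow> fits k K c \<Longrightarrow> fits k K c'"
  by (induction c arbitrary: c') auto

lemma fits_cnext:
  assumes "fits k K c" "cnext k c ss = (c', Some (i, s, d))" "length ss = Suc k" "set ss \<subseteq> {..K}"
  shows "i \<le> k \<and> s \<le> K"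
  using assms
proof (induction c arbitrary: c')
  case (Push j a)
  then have "ss ! j \<in> set ss" by (intro nth_mem) auto
  with Push.prems(4) have "ss ! j \<le> K" by auto
  with Push.prems(1-3) show ?case by auto
qed (auto split: if_splits prod.splits)

section \<open>Stacks and output as tape contents\<close>

text \<open>
  A stack occupies the cells left of a fixed position \<open>z\<close>, and the head is on its first letter (or
  on cell \<open>z\<close> if it is empty). So the head position is determined by the height of the stack.
\<close>

definition stack_tape :: "int \<Rightarrow> nat list \<Rightarrow> tape" where
  "stack_tape z xs = ((\<lambda>y. word_contents xs (y - (z - int (length xs)))), z - int (length xs))"

lemma read_stack_tape [simp]: "tape_read (stack_tape z xs) = peek xs"
  by (cases xs) (auto simp: stack_tape_def word_contents_def)

lemma push_stack_tape:
  "tape_act (Suc a, MStay) (tape_act (peek xs, MLeft) (stack_tape z xs)) = stack_tape z (a # xs)"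
proof -
  have "nat (y - (z - (1 + int (length xs)))) = Suc (nat (y - (z - int (length xs))))"
    if "y \<ge> z - int (length xs)" for y using that by linarith
  then show ?thesis
    by (cases xs) (auto simp: stack_tape_def word_contents_def fun_eq_iff)
qed

lemma pop_stack_tape:
  "tape_act (0, MRight) (stack_tape z (a # xs)) = stack_tape z xs"
proof -
  have "nat (y - (z - (1 + int (length xs)))) = Suc (nat (y - (z - int (length xs))))"
    if "y \<ge> z - int (length xs)" for y using that by linarith
  then show ?thesis
    by (auto simp: stack_tape_def word_contents_def fun_eq_iff)
qed

lemma emit_tape:
  "tape_act (Suc a, MRight) (word_contents os, int (length os)) =
     (word_contents (os @ [a]), int (length (os @ [a])))"
  by (auto simp: word_contents_def fun_eq_iff nth_append)

lemma read_emit_tape [simp]: "tape_read (word_contents os, int (length os)) = 0"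
  by (auto simp: word_contents_def)

text \<open>With its bottom at cell \<open>n\<close>, stack 0 coincides with the input word of
  length \<open>n\<close> that starts at cell 0; so the machine starts in a configuration that
  already represents a store.\<close>

definition base :: "nat \<Rightarrow> nat \<Rightarrow> int" where
  "base n i = (if i = 0 then int n else 0)"

definition tapes :: "nat \<Rightarrow> nat \<Rightarrow> nat list \<Rightarrow> store \<Rightarrow> tape list" where
  "tapes k n os \<sigma> = map (\<lambda>i. stack_tape (base n i) (\<sigma> i)) [0..<k] @ [(word_contents os, int (length os))]"

lemma length_tapes [simp]: "length (tapes k n os \<sigma>) = Suc k"
  by (simp add: tapes_def)

lemma nth_tapes [simp]: "i < k \<Longrightarrow> tapes k n os \<sigma> ! i = stack_tape (base n i) (\<sigma> i)"
  by (simp add: tapes_def nth_append)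

lemma nth_tapes_last [simp]: "tapes k n os \<sigma> ! k = (word_contents os, int (length os))"
  by (simp add: tapes_def nth_append)

lemma tapes_upd: "i < k \<Longrightarrow> (tapes k n os \<sigma>)[i := stack_tape (base n i) xs] = tapes k n os (\<sigma>(i := xs))"
  by (rule nth_equalityI) (auto simp: nth_list_update less_Suc_eq)

lemma tapes_upd_last:
  "(tapes k n os \<sigma>)[k := (word_contents os', int (length os'))] = tapes k n os' \<sigma>"
  by (rule nth_equalityI) (auto simp: nth_list_update less_Suc_eq)

text \<open>The invariant behind the space bound: each stack head stays within \<open>B\<close>
  cells of its bottom, and tape \<open>k\<close> carries the output.\<close>

definition heads_ok :: "nat \<Rightarrow> nat \<Rightarrow> nat \<Rightarrow> nat \<Rightarrow> tape list \<Rightarrow> bool" where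
  "heads_ok k n B m ts \<longleftrightarrow> (\<forall>i<k. snd (ts ! i) \<in> {base n i - int B..base n i}) \<and> snd (ts ! k) \<in> {0..int m}"

lemma heads_ok_tapes:
  assumes "\<forall>i. length (\<sigma> i) \<le> B" "length os \<le> m"
  shows "heads_ok k n B m (tapes k n os \<sigma>)"
  using assms by (auto simp: heads_ok_def stack_tape_def)

text \<open>In contrast to a mere iteration of \<open>cstep\<close>, a path records that all visited
  tape lists satisfy \<open>G\<close>; this carries the bound on the heads through the
  simulation.\<close>

inductive path :: "nat \<Rightarrow> (tape list \<Rightarrow> bool) \<Rightarrow> com \<times> tape list \<Rightarrow> nat \<Rightarrow> com \<times> tape list \<Rightarrow> bool"
  for k G where
  path_nil: "G ts \<Longrightarrow> path k G (c, ts) 0 (c, ts)"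
| path_step: "c \<noteq> Done \<Longrightarrow> G ts \<Longrightarrow> path k G (cstep k (c, ts)) t C \<Longrightarrow> path k G (c, ts) (Suc t) C"

lemma path_trans: "path k G C t C' \<Longrightarrow> path k G C' t' C'' \<Longrightarrow> path k G C (t + t') C''"
  by (induction rule: path.induct) (auto intro: path_step)

lemma path_Seq:
  "path k G C t C' \<Longrightarrow> path k G (fst C ;; d, snd C) t (fst C' ;; d, snd C')"
proof (induction rule: path.induct)
  case (path_nil ts c)
  then show ?case by (auto intro: path.path_nil)
next
  case (path_step c ts t C)
  have "(fst (cstep k (c, ts)) ;; d, snd (cstep k (c, ts))) = cstep k (c ;; d, ts)"
    using path_step.hyps(1) by (auto simp: cstep_def split: prod.splits option.splits)
  with path_step show ?case by (auto intro!: path.path_step)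
qed

lemma path_one:
  "c \<noteq> Done \<Longrightarrow> G ts \<Longrightarrow> path k G (cstep k (c, ts)) t C \<Longrightarrow> t' = Suc t \<Longrightarrow> path k G (c, ts) t' C"
  by (auto intro: path_step)

text \<open>Induction on the execution. The one visited tape list that represents no store lies
  between the two steps of a push; its head is one cell further left, which is still in range
  because the stack was lower than \<open>B\<close>.\<close>

lemma exec_path:
  assumes "exec B c \<sigma> t os \<sigma>'" "fits k K c" "\<forall>i. length (\<sigma> i) \<le> B" "length (out @ os) \<le> m"
  shows "path k (heads_ok k n B m) (c, tapes k n out \<sigma>) t (Done, tapes k n (out @ os) \<sigma>') \<and>
    (\<forall>i. length (\<sigma>' i) \<le> B)"
  using assms
proof (induction arbitrary: out rule: exec.induct)
  case (exec_Done \<sigma>)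
  then show ?case by (auto intro!: path_nil heads_ok_tapes)
next
  case (exec_Push \<sigma> i a)
  define ts where "ts = (tapes k n out \<sigma>)[i := tape_act (peek (\<sigma> i), MLeft) (stack_tape (base n i) (\<sigma> i))]"
  have i: "i < k" using exec_Push by simp
  have 1: "cstep k (Push i a, tapes k n out \<sigma>) = (Write i a, ts)"
    using i by (simp add: cstep_def ts_def)
  have 2: "cstep k (Write i a, ts) = (Done, tapes k n out (\<sigma>(i := a # \<sigma> i)))"
    using i push_stack_tape[of a "\<sigma> i" "base n i"]
    by (simp add: cstep_def ts_def flip: tapes_upd)
  have h: "heads_ok k n B m (tapes k n out \<sigma>)" "heads_ok k n B m (tapes k n out (\<sigma>(i := a # \<sigma> i)))"
    using exec_Push by (auto intro!: heads_ok_tapes)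
  then have "heads_ok k n B m ts"
    using exec_Push.hyps i
    by (auto simp: heads_ok_def ts_def nth_list_update stack_tape_def)
  with h 1 2 have "path k (heads_ok k n B m) (Push i a, tapes k n out \<sigma>) (Suc (Suc 0))
      (Done, tapes k n out (\<sigma>(i := a # \<sigma> i)))"
    by (intro path_step; simp; intro path_step) (auto intro: path_nil)
  moreover have "length ((\<sigma>(i := a # \<sigma> i)) j) \<le> B" for j using exec_Push by auto
  ultimately show ?case by (metis append_Nil2 numeral_2_eq_2)
next
  case (exec_Pop i \<sigma>)
  have i: "i < k" using exec_Pop by simp
  have "cstep k (Pop i, tapes k n out \<sigma>) = (Done, tapes k n out (\<sigma>(i := tl (\<sigma> i))))"
  proof (cases "\<sigma> i")
    case Nil
    then have "\<sigma>(i := tl (\<sigma> i)) = \<sigma>" by auto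
    then show ?thesis using i Nil by (simp add: cstep_def)
  next
    case (Cons a xs)
    then show ?thesis using i pop_stack_tape[of "base n i" a xs]
      by (simp add: cstep_def flip: tapes_upd)
  qed
  moreover have l: "length ((\<sigma>(i := tl (\<sigma> i))) j) \<le> B" for j
    using exec_Pop by (auto intro: le_trans[OF diff_le_self])
  moreover have "heads_ok k n B m (tapes k n out \<sigma>)"
    "heads_ok k n B m (tapes k n out (\<sigma>(i := tl (\<sigma> i))))"
    using exec_Pop l by (auto intro!: heads_ok_tapes simp del: fun_upd_apply)
  ultimately have "path k (heads_ok k n B m) (Pop i, tapes k n out \<sigma>) (Suc 0)
      (Done, tapes k n out (\<sigma>(i := tl (\<sigma> i))))"
    by (intro path_step) (simp_all add: path_nil)
  then show ?case using l by (metis append_Nil2 One_nat_def)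
next
  case (exec_Emit a \<sigma>)
  have "cstep k (Emit a, tapes k n out \<sigma>) = (Done, tapes k n (out @ [a]) \<sigma>)"
    unfolding cstep_def using emit_tape[of a out] tapes_upd_last[of k n out \<sigma> "out @ [a]"] by (simp add: add.commute)
  then show ?case
    using exec_Emit by (auto intro!: path_one[of "Emit a"] path_nil heads_ok_tapes)
next
  case (exec_Seq c \<sigma> t os \<sigma>' d t' os' \<sigma>'')
  have 1: "path k (heads_ok k n B m) (c, tapes k n out \<sigma>) t (Done, tapes k n (out @ os) \<sigma>') \<and>
      (\<forall>i. length (\<sigma>' i) \<le> B)"
    using exec_Seq.IH(1)[of out] exec_Seq.prems by simp
  have 2: "path k (heads_ok k n B m) (d, tapes k n (out @ os) \<sigma>') t' (Done, tapes k n ((out @ os) @ os') \<sigma>'')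
      \<and> (\<forall>i. length (\<sigma>'' i) \<le> B)"
    using exec_Seq.IH(2)[of "out @ os"] exec_Seq.prems 1 by simp
  have "path k (heads_ok k n B m) (Done ;; d, tapes k n (out @ os) \<sigma>') (Suc t')
     (Done, tapes k n ((out @ os) @ os') \<sigma>'')"
    using 1 2 exec_Seq by (intro path_step) (auto simp: cstep_def intro!: heads_ok_tapes)
  from path_trans[OF path_Seq[OF conjunct1[OF 1], of d, simplified] this] show ?case using 2 by simp
next
  case (exec_BranchT p \<sigma> i c t os \<sigma>' d)
  then show ?case
    by (auto intro!: path_one[of "Branch i p c d"] heads_ok_tapes simp: cstep_def)
next
  case (exec_BranchF p \<sigma> i d t os \<sigma>' c)
  then show ?case
    by (auto intro!: path_one[of "Branch i p c d"] heads_ok_tapes simp: cstep_def)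
next
  case (exec_LoopF p \<sigma> i c)
  then show ?case
    by (auto intro!: path_one[of "Loop i p c"] path_nil heads_ok_tapes simp: cstep_def)
next
  case (exec_LoopT p \<sigma> i c t os \<sigma>' t' os' \<sigma>'')
  let ?L = "Loop i p c"
  have 1: "path k (heads_ok k n B m) (c, tapes k n out \<sigma>) t (Done, tapes k n (out @ os) \<sigma>') \<and>
      (\<forall>i. length (\<sigma>' i) \<le> B)"
    using exec_LoopT.IH(1)[of out] exec_LoopT.prems by simp
  have 2: "path k (heads_ok k n B m) (?L, tapes k n (out @ os) \<sigma>') t' (Done, tapes k n ((out @ os) @ os') \<sigma>'')
      \<and> (\<forall>i. length (\<sigma>'' i) \<le> B)"
    using exec_LoopT.IH(2)[of "out @ os"] exec_LoopT.prems 1 by simp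
  have "path k (heads_ok k n B m) (Done ;; ?L, tapes k n (out @ os) \<sigma>') (Suc t')
     (Done, tapes k n ((out @ os) @ os') \<sigma>'')"
    using 1 2 exec_LoopT by (intro path_step) (auto simp: cstep_def intro!: heads_ok_tapes)
  from path_trans[OF path_Seq[OF conjunct1[OF 1], of ?L, simplified] this]
  have "path k (heads_ok k n B m) (c ;; ?L, tapes k n out \<sigma>) (Suc (t + t'))
     (Done, tapes k n ((out @ os) @ os') \<sigma>'')" by simp
  then have "path k (heads_ok k n B m) (?L, tapes k n out \<sigma>) (Suc (Suc (t + t')))
     (Done, tapes k n ((out @ os) @ os') \<sigma>'')"
    using exec_LoopT by (intro path_step) (auto simp: cstep_def intro!: heads_ok_tapes)
  then show ?case using 2 by simp
qed

section \<open>The Turing machine of a program\<close>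

definition acts :: "nat \<Rightarrow> nat list \<Rightarrow> (nat \<times> nat \<times> move) option \<Rightarrow> (nat \<times> move) list" where
  "acts k ss x = (let as = map (\<lambda>s. (s, MStay)) ss in
     case x of None \<Rightarrow> as | Some (i, a) \<Rightarrow> as[i := a])"

text \<open>The residuals are numbered below \<open>n\<close> by \<open>f\<close>. The states
  \<open>n\<close> and \<open>Suc n\<close> accept and reject; \<open>Done\<close> chooses between
  them by whether stack \<open>r\<close> is nonempty. Letters below \<open>K\<close> occupy the
  symbols 1 to \<open>K\<close>.\<close>

definition machine :: "nat \<Rightarrow> nat \<Rightarrow> nat \<Rightarrow> com \<Rightarrow> (com \<Rightarrow> nat) \<Rightarrow> tm" where
  "machine k K r c f = (let R = residuals c; n = card R in
     \<lparr> tm_tapes = Suc k, tm_symbols = Suc K, tm_states = n + 2,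
       tm_delta = (\<lambda>q ss.
         if q < n then (let d = the_inv_into R f q in
           if d = Done then (if ss ! r \<noteq> 0 then n else Suc n, acts k ss None)
           else (f (fst (cnext k d ss)), acts k ss (snd (cnext k d ss))))
         else (q, acts k ss None)),
       tm_start = f c, tm_accept = n, tm_reject = Suc n \<rparr>)"

lemma acts_stay: "map2 tape_act (acts k (map tape_read ts) None) ts = ts"
proof -
  have "tape_act (tape_read t, MStay) t = t" for t by (cases t) auto
  then show ?thesis by (intro nth_equalityI) (auto simp: acts_def)
qed

lemma acts_upd:
  "i < length ts \<Longrightarrow> map2 tape_act (acts k (map tape_read ts) (Some (i, a))) ts = ts[i := tape_act a (ts ! i)]"
proof -
  have "tape_act (tape_read t, MStay) t = t" for t by (cases t) auto
  then show ?thesis if "i < length ts" using that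
    by (intro nth_equalityI) (auto simp: acts_def nth_list_update)
qed

context
  fixes k K r :: nat and c :: com and f :: "com \<Rightarrow> nat"
  assumes f: "bij_betw f (residuals c) {..<card (residuals c)}"
    and fits: "fits k K c" and r: "r < k"
begin

abbreviation (input) "CM \<equiv> machine k K r c f"

lemma the_inv_f: "d \<in> residuals c \<Longrightarrow> the_inv_into (residuals c) f (f d) = d"
  using f by (auto simp: bij_betw_def intro: the_inv_into_f_f)

lemma f_less: "d \<in> residuals c \<Longrightarrow> f d < card (residuals c)"
  using f by (auto simp: bij_betw_def)

lemma wf_machine: "wf_tm CM"
proof -
  let ?n = "card (residuals c)"
  have acts: "length (acts k ss x) = Suc k \<and> fst ` set (acts k ss x) \<subseteq> {..<Suc K}"
    if "length ss = Suc k" "set ss \<subseteq> {..<Suc K}" "\<forall>i s d. x = Some (i, s, d) \<longrightarrow> s \<le> K" for ss x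
    using that by (auto simp: acts_def Let_def split: option.splits dest!: set_update_subset_insert[THEN subsetD])
  have "fst (tm_delta CM q ss) < ?n + 2 \<and> length (snd (tm_delta CM q ss)) = Suc k \<and>
      fst ` set (snd (tm_delta CM q ss)) \<subseteq> {..<Suc K}"
    if "q < ?n + 2" and ss: "length ss = Suc k" "set ss \<subseteq> {..<Suc K}" for q ss
  proof (cases "q < ?n")
    case True
    with f obtain d where d: "d \<in> residuals c" "q = f d" by (auto simp: bij_betw_def image_iff)
    have 1: "\<forall>i s e. snd (cnext k d ss) = Some (i, s, e) \<longrightarrow> s \<le> K"
      using fits_cnext[OF fits_residuals[OF d(1) fits], of ss] ss
      by (metis prod.collapse lessThan_Suc_atMost)
    have 2: "f (fst (cnext k d ss)) < ?n"
      using d(1) f_less residuals_cnext by blast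
    show ?thesis
      using acts[OF ss, of None] acts[OF ss 1] 2 True d
      by (auto simp: machine_def Let_def the_inv_f)
  next
    case False
    then show ?thesis using acts[OF ss, of None] that by (auto simp: machine_def Let_def)
  qed
  moreover have "f c < ?n" by (rule f_less[OF self_in_residuals])
  ultimately show ?thesis unfolding wf_tm_def by (auto simp: machine_def Let_def)
qed

lemma machine_step:
  assumes "d \<in> residuals c" "d \<noteq> Done" "length ts = Suc k"
  shows "tm_step CM (f d, ts) = (f (fst (cstep k (d, ts))), snd (cstep k (d, ts)))"
    and "fst (cstep k (d, ts)) \<in> residuals c" and "length (snd (cstep k (d, ts))) = Suc k"
proof -
  have d: "f d < card (residuals c)" using assms f_less by auto
  have nh: "\<not> halted CM (f d, ts)"
    using d by (auto simp: halted_def machine_def Let_def)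
  have "i < length ts" if "cnext k d (map tape_read ts) = (d', Some (i, s, m))" for d' i s m
  proof -
    have "fits k K d" by (rule fits_residuals[OF assms(1) fits])
    then have "i \<le> k" using that
    proof (induction d arbitrary: d')
    qed (auto split: if_splits prod.splits)
    then show ?thesis using assms by simp
  qed
  then show "tm_step CM (f d, ts) = (f (fst (cstep k (d, ts))), snd (cstep k (d, ts)))"
    using nh assms d
    by (auto simp: tm_step_def machine_def Let_def the_inv_f cstep_def acts_stay acts_upd
        split: prod.splits option.splits)
  show "fst (cstep k (d, ts)) \<in> residuals c"
    using residuals_cnext[OF assms(1), of k "map tape_read ts"] by (auto simp: cstep_def split: prod.splits)
  show "length (snd (cstep k (d, ts))) = Suc k"
    using assms by (auto simp: cstep_def split: prod.splits option.splits)
qed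

lemma machine_path:
  assumes "path k G C t C'" "fst C \<in> residuals c" "length (snd C) = Suc k"
  shows "(tm_step CM ^^ t) (f (fst C), snd C) = (f (fst C'), snd C') \<and>
    (\<forall>s\<le>t. G (snd ((tm_step CM ^^ s) (f (fst C), snd C)))) \<and>
    fst C' \<in> residuals c \<and> length (snd C') = Suc k"
  using assms
proof (induction rule: path.induct)
  case (path_nil ts c)
  then show ?case by auto
next
  case (path_step d ts t C)
  note st = machine_step[of d ts]
  have eq: "(tm_step CM ^^ Suc s) (f d, ts) = (tm_step CM ^^ s) (f (fst (cstep k (d, ts))), snd (cstep k (d, ts)))"
    for s using st path_step by (simp add: funpow_swap1 del: funpow.simps add: funpow_Suc_right)
  have "G (snd ((tm_step CM ^^ s) (f d, ts)))" if "s \<le> Suc t" for s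
  proof (cases s)
    case 0 with path_step show ?thesis by simp
  next
    case (Suc s')
    with path_step st that eq[of s'] show ?thesis by simp
  qed
  with eq[of t] path_step st show ?case by auto
qed

lemma machine_finish:
  assumes "Done \<in> residuals c" "length ts = Suc k"
  shows "tm_step CM (f Done, ts) =
    (if tape_read (ts ! r) \<noteq> 0 then tm_accept CM else tm_reject CM, ts)"
proof -
  have d: "f Done < card (residuals c)" using assms f_less by auto
  then have nh: "\<not> halted CM (f Done, ts)"
    by (auto simp: halted_def machine_def Let_def)
  with assms d r show ?thesis
    by (auto simp: tm_step_def machine_def Let_def the_inv_f acts_stay)
qed

lemma machine_run:
  assumes "exec B c (\<lambda>i. if i = 0 then w else []) t os \<sigma>" "length w \<le> B"
  shows "tm_run CM w (Suc t) =
      (if \<sigma> r \<noteq> [] then tm_accept CM else tm_reject CM, tapes k (length w) os \<sigma>)"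
    and "s \<le> t \<Longrightarrow> heads_ok k (length w) B (length os) (snd (tm_run CM w s))"
    and "snd (tm_run CM w t) = tapes k (length w) os \<sigma>"
proof -
  let ?\<sigma> = "\<lambda>i::nat. if i = 0 then w else []"
  have "tapes k (length w) [] ?\<sigma> = (word_contents w, 0) # replicate k (word_contents [], 0)"
  proof (rule nth_equalityI)
    fix i assume "i < length (tapes k (length w) [] ?\<sigma>)"
    then have "i = k \<or> i < k" by auto
    then show "tapes k (length w) [] ?\<sigma> ! i = ((word_contents w, 0) # replicate k (word_contents [], 0)) ! i"
      using r by (cases i) (auto simp: stack_tape_def base_def word_contents_def[of "[]"] fun_eq_iff
        simp flip: replicate_Suc simp del: replicate_Suc)
  qed simp
  then have init: "tm_init CM w = (f c, tapes k (length w) [] ?\<sigma>)"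
    by (simp add: tm_init_def machine_def Let_def)
  have *: "path k (heads_ok k (length w) B (length os)) (c, tapes k (length w) [] ?\<sigma>) t
     (Done, tapes k (length w) os \<sigma>)"
    using exec_path[OF assms(1) fits, of "[]" "length os" "length w"] assms(2) by auto
  note p = machine_path[OF *, simplified, OF self_in_residuals]
  from p show "s \<le> t \<Longrightarrow> heads_ok k (length w) B (length os) (snd (tm_run CM w s))"
    by (auto simp: tm_run_def init)
  from p show "snd (tm_run CM w t) = tapes k (length w) os \<sigma>"
    by (auto simp: tm_run_def init)
  from p have "tm_run CM w (Suc t) = tm_step CM (f Done, tapes k (length w) os \<sigma>)"
    by (auto simp: tm_run_def init)
  also have "\<dots> = (if \<sigma> r \<noteq> [] then tm_accept CM else tm_reject CM, tapes k (length w) os \<sigma>)"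
    using machine_finish[OF Done_in_residuals] r by (simp del: machine_finish)
  finally show "tm_run CM w (Suc t) =
      (if \<sigma> r \<noteq> [] then tm_accept CM else tm_reject CM, tapes k (length w) os \<sigma>)" .
qed

end

section \<open>Programs as witnesses for polynomial time and polynomial space\<close>

lemma ex_numbering: "\<exists>f. bij_betw f (residuals c) {..<card (residuals c)}"
  using ex_bij_betw_finite_nat[OF finite_residuals[of c]] by (simp add: atLeast0LessThan)

lemma halted_stable:
  assumes "halted M (tm_run M w t)" "t \<le> s"
  shows "tm_run M w s = tm_run M w t"
  using assms(2)
proof (induction s rule: dec_induct)
  case (step s)
  then show ?case using assms(1) by (auto simp: tm_run_def tm_step_def)
qed simp

theorem polytime_computableI:
  fixes p :: "nat poly"
  assumes "\<And>w. w \<in> lists {..<m} \<Longrightarrow> \<exists>B t \<sigma>. length w \<le> B \<and> t \<le> poly p (length w) \<and>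
    exec B c (\<lambda>i. if i = 0 then w else []) t (f w) \<sigma>"
  shows "polytime_computable m f"
proof -
  obtain g where g: "bij_betw g (residuals c) {..<card (residuals c)}" using ex_numbering by blast
  obtain k K where k: "1 \<le> k" "m \<le> K" "fits k K c" using ex_fits by blast
  let ?M = "machine k K 0 c g"
  \<comment> \<open>The additional step leads from \<open>Done\<close> to a halting state.\<close>
  have "\<exists>t \<le> poly (p + 1) (length w). halted ?M (tm_run ?M w t) \<and>
     fst (last (snd (tm_run ?M w t))) = word_contents (f w)" if w: "w \<in> lists {..<m}" for w
  proof -
    from assms[OF w] obtain B t \<sigma> where *: "length w \<le> B" "t \<le> poly p (length w)"
      "exec B c (\<lambda>i. if i = 0 then w else []) t (f w) \<sigma>" by blast
    have "tm_run ?M w (Suc t) =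
      (if \<sigma> 0 \<noteq> [] then tm_accept ?M else tm_reject ?M, tapes k (length w) (f w) \<sigma>)"
      using machine_run(1)[OF g k(3) _ *(3,1)] k by auto
    then show ?thesis using *(2)
      by (intro exI[of _ "Suc t"]) (auto simp: halted_def tapes_def)
  qed
  moreover have "wf_tm ?M" using wf_machine[OF g k(3)] k by auto
  moreover have "m < tm_symbols ?M" using k by (simp add: machine_def Let_def)
  ultimately show ?thesis unfolding polytime_computable_def by blast
qed

text \<open>The number \<open>t\<close> of steps only witnesses halting. Each of the
  \<open>k\<close> stack tapes has at most \<open>B + 1\<close> scanned cells and the output tape
  one, since nothing is emitted; this gives the polynomial \<open>k * (p + 1) + 1\<close>.\<close>

theorem PSPACE_I:
  fixes p :: "nat poly"
  assumes "A \<subseteq> lists {..<m}"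
    and "\<And>w. w \<in> lists {..<m} \<Longrightarrow> \<exists>B t \<sigma>. length w \<le> B \<and> B \<le> poly p (length w) \<and>
      exec B c (\<lambda>i. if i = 0 then w else []) t [] \<sigma> \<and> (\<sigma> r \<noteq> [] \<longleftrightarrow> w \<in> A)"
  shows "A \<in> PSPACE m"
proof -
  obtain g where g: "bij_betw g (residuals c) {..<card (residuals c)}" using ex_numbering by blast
  obtain k K where k: "Suc r \<le> k" "m \<le> K" "fits k K c" using ex_fits by blast
  let ?M = "machine k K r c g"
  have tt: "tm_tapes ?M = Suc k" "tm_accept ?M \<noteq> tm_reject ?M" by (simp_all add: machine_def Let_def)
  have "tm_halts ?M w \<and> (tm_accepts ?M w \<longleftrightarrow> w \<in> A) \<and>
      tm_space ?M w \<le> poly ([:of_nat k:] * (p + 1) + 1) (length w)" if w: "w \<in> lists {..<m}" for w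
  proof -
    from assms(2)[OF w] obtain B t \<sigma> where *: "length w \<le> B" "B \<le> poly p (length w)"
      "exec B c (\<lambda>i. if i = 0 then w else []) t [] \<sigma>" "\<sigma> r \<noteq> [] \<longleftrightarrow> w \<in> A" by blast
    have run: "tm_run ?M w (Suc t) =
      (if \<sigma> r \<noteq> [] then tm_accept ?M else tm_reject ?M, tapes k (length w) [] \<sigma>)"
      and last: "snd (tm_run ?M w t) = tapes k (length w) [] \<sigma>"
      and ok: "\<And>s. s \<le> t \<Longrightarrow> heads_ok k (length w) B 0 (snd (tm_run ?M w s))"
      using machine_run[OF g k(3) _ *(3,1)] k by auto
    have h: "halted ?M (tm_run ?M w (Suc t))" using run by (simp add: halted_def)
    have st: "tm_run ?M w s = tm_run ?M w (Suc t)" if "\<not> s \<le> t" for s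
      using halted_stable[OF h, of s] that by simp
    have "fst (tm_run ?M w s) = tm_accept ?M \<Longrightarrow> \<sigma> r \<noteq> []" for s
    proof -
      assume a: "fst (tm_run ?M w s) = tm_accept ?M"
      then have "tm_run ?M w (max s (Suc t)) = tm_run ?M w s"
        by (intro halted_stable) (auto simp: halted_def)
      moreover have "tm_run ?M w (max s (Suc t)) = tm_run ?M w (Suc t)"
        by (intro halted_stable[OF h]) auto
      ultimately have "fst (tm_run ?M w (Suc t)) = tm_accept ?M" using a by simp
      then show ?thesis using run tt by (auto split: if_splits)
    qed
    then have acc: "tm_accepts ?M w \<longleftrightarrow> w \<in> A"
      using exI[of "\<lambda>s. fst (tm_run ?M w s) = tm_accept ?M" "Suc t"] run *(4)
      unfolding tm_accepts_def by auto
    have ok': "heads_ok k (length w) B 0 (snd (tm_run ?M w s))" for s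
      using ok[of s] st[of s] ok[of t] last run by (cases "s \<le> t") auto
    have c1: "card {snd (snd (tm_run ?M w s) ! i) |s. True} \<le> Suc B" if "i < k" for i
    proof -
      have "{snd (snd (tm_run ?M w s) ! i) |s. True} \<subseteq> {base (length w) i - int B..base (length w) i}"
        using ok' that unfolding heads_ok_def by blast
      from card_mono[OF _ this] show ?thesis by simp
    qed
    have c2: "card {snd (snd (tm_run ?M w s) ! k) |s. True} \<le> 1"
    proof -
      have "{snd (snd (tm_run ?M w s) ! k) |s. True} \<subseteq> {0..int 0}"
        using ok' unfolding heads_ok_def by blast
      from card_mono[OF _ this] show ?thesis by simp
    qed
    have "tm_space ?M w \<le> (\<Sum>i<k. Suc B) + 1"
      unfolding tm_space_def tt sum.lessThan_Suc using c1 c2 by (intro add_mono sum_mono) blast+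
    also have "\<dots> \<le> k * (poly p (length w) + 1) + 1" using *(2) by simp
    finally show ?thesis using h acc unfolding tm_halts_def by auto
  qed
  moreover have "wf_tm ?M" using wf_machine[OF g k(3)] k by auto
  moreover have "m < tm_symbols ?M" using k by (simp add: machine_def Let_def)
  ultimately show ?thesis using assms(1) unfolding PSPACE_def by blast
qed

section \<open>Program macros\<close>

text \<open>Times are upper bounds here, so that those of subprograms can be rounded up before they
  are added.\<close>

definition run :: "nat \<Rightarrow> com \<Rightarrow> store \<Rightarrow> nat \<Rightarrow> nat list \<Rightarrow> store \<Rightarrow> bool" where
  "run B c \<sigma> T os \<sigma>' \<longleftrightarrow> (\<exists>t\<le>T. exec B c \<sigma> t os \<sigma>')"

lemma run_cong: "run B c \<sigma> T os \<tau> \<Longrightarrow> \<tau> = \<tau>' \<Longrightarrow> T \<le> T' \<Longrightarrow> os = os' \<Longrightarrow> run B c \<sigma> T' os' \<tau>'"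
  unfolding run_def by (meson order_trans)

lemma run_Done: "run B Done \<sigma> 0 [] \<sigma>"
  unfolding run_def using exec_Done by blast

lemma run_Push: "length (\<sigma> i) < B \<Longrightarrow> run B (Push i a) \<sigma> 2 [] (\<sigma>(i := a # \<sigma> i))"
  unfolding run_def using exec_Push by blast

lemma run_Pop: "run B (Pop i) \<sigma> 1 [] (\<sigma>(i := tl (\<sigma> i)))"
  unfolding run_def using exec_Pop by blast

lemma run_Emit: "run B (Emit a) \<sigma> 1 [a] \<sigma>"
  unfolding run_def using exec_Emit by blast

lemma run_Seq: "run B c \<sigma> T os \<sigma>' \<Longrightarrow> run B d \<sigma>' T' os' \<sigma>'' \<Longrightarrow> run B (c ;; d) \<sigma> (T + T' + 1) (os @ os') \<sigma>''"
  unfolding run_def using exec_Seq by (metis Suc_eq_plus1 add_mono Suc_le_mono)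

lemma run_BranchT: "p (peek (\<sigma> i)) \<Longrightarrow> run B c \<sigma> T os \<sigma>' \<Longrightarrow> run B (Branch i p c d) \<sigma> (T + 1) os \<sigma>'"
  unfolding run_def using exec_BranchT by (metis Suc_eq_plus1 Suc_le_mono)

lemma run_BranchF: "\<not> p (peek (\<sigma> i)) \<Longrightarrow> run B d \<sigma> T os \<sigma>' \<Longrightarrow> run B (Branch i p c d) \<sigma> (T + 1) os \<sigma>'"
  unfolding run_def using exec_BranchF by (metis Suc_eq_plus1 Suc_le_mono)

lemma run_LoopF: "\<not> p (peek (\<sigma> i)) \<Longrightarrow> run B (Loop i p c) \<sigma> 1 [] \<sigma>"
  unfolding run_def using exec_LoopF by blast

lemma run_LoopT:
  assumes "p (peek (\<sigma> i))" "run B c \<sigma> T os \<sigma>'" "run B (Loop i p c) \<sigma>' T' os' \<sigma>''"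
  shows "run B (Loop i p c) \<sigma> (T + T' + 2) (os @ os') \<sigma>''"
proof -
  from assms obtain t t' where "t \<le> T" "t' \<le> T'" "exec B c \<sigma> t os \<sigma>'" "exec B (Loop i p c) \<sigma>' t' os' \<sigma>''"
    by (auto simp: run_def)
  with exec_LoopT[of p \<sigma> i B c t os \<sigma>' t' os' \<sigma>''] assms(1) show ?thesis
    unfolding run_def by (intro exI[of _ "Suc (Suc (t + t'))"]) auto
qed

text \<open>Programs have no variables for letters: a letter read from a stack selects one of
  \<open>K\<close> copies of the code.\<close>

fun switch :: "nat \<Rightarrow> nat \<Rightarrow> (nat \<Rightarrow> com) \<Rightarrow> com" where
  "switch 0 i f = Done"
| "switch (Suc K) i f = Branch i (\<lambda>s. s = Suc K) (f K) (switch K i f)"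

lemma run_switch:
  "\<sigma> i = a # xs \<Longrightarrow> a < K \<Longrightarrow> run B (f a) \<sigma> T os \<sigma>' \<Longrightarrow> run B (switch K i f) \<sigma> (T + K) os \<sigma>'"
proof (induction K)
  case (Suc K)
  show ?case
  proof (cases "a = K")
    case True
    with Suc have "run B (switch (Suc K) i f) \<sigma> (T + 1) os \<sigma>'"
      unfolding switch.simps by (intro run_BranchT) auto
    then show ?thesis by (rule run_cong) auto
  next
    case False
    with Suc have "run B (switch (Suc K) i f) \<sigma> ((T + K) + 1) os \<sigma>'"
      unfolding switch.simps by (intro run_BranchF) auto
    then show ?thesis by (rule run_cong) auto
  qed
qed simp

definition foreach :: "nat \<Rightarrow> nat \<Rightarrow> (nat \<Rightarrow> com) \<Rightarrow> com" where
  "foreach K i body = Loop i (\<lambda>s. s \<noteq> 0) (switch K i (\<lambda>a. Pop i ;; body a))"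

fun suffix_concat :: "(nat list \<Rightarrow> 'a list) \<Rightarrow> nat list \<Rightarrow> 'a list" where
  "suffix_concat g [] = []"
| "suffix_concat g (a # xs) = g (a # xs) @ suffix_concat g xs"

lemma suffix_concat_Nil [simp]: "suffix_concat (\<lambda>_. []) xs = []"
  by (induction xs) auto

text \<open>\<open>S ys\<close> is the store when the part \<open>ys\<close> of the stack remains to be processed.\<close>

lemma run_foreach:
  assumes "\<sigma> i = xs" "set xs \<subseteq> {..<K}" "S xs = \<sigma>"
    and "\<And>ys. suffix ys xs \<Longrightarrow> S ys i = ys"
    and "\<And>a ys. suffix (a # ys) xs \<Longrightarrow> run B (body a) ((S (a # ys))(i := ys)) T (g (a # ys)) (S ys)"
  shows "run B (foreach K i body) \<sigma> (length xs * (T + K + 5) + 1) (suffix_concat g xs) (S [])"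
  using assms
proof (induction xs arbitrary: \<sigma>)
  case Nil
  then show ?case unfolding foreach_def by (auto intro!: run_cong[OF run_LoopF])
next
  case (Cons a xs)
  have sx: "suffix xs (a # xs)" by (simp add: suffix_ConsI)
  have 1: "run B (Pop i ;; body a) \<sigma> (1 + T + 1) ([] @ g (a # xs)) (S xs)"
    using Cons.prems(1,3) Cons.prems(5)[of a xs] by (intro run_Seq run_cong[OF run_Pop]) auto
  have 2: "run B (switch K i (\<lambda>a. Pop i ;; body a)) \<sigma> ((1 + T + 1) + K) ([] @ g (a # xs)) (S xs)"
    using Cons.prems(1,2) 1 by (intro run_switch) auto
  have "run B (foreach K i body) (S xs) (length xs * (T + K + 5) + 1) (suffix_concat g xs) (S [])"
    using Cons.prems sx by (intro Cons.IH) (auto simp: suffix_Cons)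
  with 2 have "run B (foreach K i body) \<sigma> (((1 + T + 1) + K) + (length xs * (T + K + 5) + 1) + 2)
     (([] @ g (a # xs)) @ suffix_concat g xs) (S [])"
    unfolding foreach_def using Cons.prems(1) by (intro run_LoopT) auto
  then show ?case by (rule run_cong) auto
qed

definition clear :: "nat \<Rightarrow> com" where
  "clear i = Loop i (\<lambda>s. s \<noteq> 0) (Pop i)"

lemma run_clear: "run B (clear i) \<sigma> (3 * length (\<sigma> i) + 1) [] (\<sigma>(i := []))"
proof (induction "\<sigma> i" arbitrary: \<sigma>)
  case Nil
  then show ?case unfolding clear_def by (auto intro!: run_cong[OF run_LoopF] simp: fun_eq_iff)
next
  case (Cons a xs)
  from Cons(2) have "run B (clear i) (\<sigma>(i := xs)) (3 * length xs + 1) [] (\<sigma>(i := []))"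
    using Cons(1)[of "\<sigma>(i := xs)"] by auto
  then have "run B (clear i) \<sigma> (1 + (3 * length xs + 1) + 2) ([] @ []) (\<sigma>(i := []))"
    unfolding clear_def using Cons(2)[symmetric]
    by (intro run_LoopT run_cong[OF run_Pop]) auto
  then show ?case by (rule run_cong) (auto simp flip: Cons(2))
qed

definition mv :: "nat \<Rightarrow> nat \<Rightarrow> nat \<Rightarrow> com" where
  "mv K i j = foreach K i (Push j)"

lemma run_mv:
  assumes "i \<noteq> j" "set (\<sigma> i) \<subseteq> {..<K}" "length (\<sigma> i) + length (\<sigma> j) \<le> B"
  shows "run B (mv K i j) \<sigma> (length (\<sigma> i) * (K + 7) + 1) [] (\<sigma>(i := [], j := rev (\<sigma> i) @ \<sigma> j))"
proof -
  let ?xs = "\<sigma> i"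
  let ?S = "\<lambda>ys. \<sigma>(i := ys, j := rev (take (length ?xs - length ys) ?xs) @ \<sigma> j)"
  have "run B (foreach K i (Push j)) \<sigma> (length ?xs * (2 + K + 5) + 1) (suffix_concat (\<lambda>_. []) ?xs) (?S [])"
  proof (rule run_foreach[where S = ?S])
    fix a ys assume s: "suffix (a # ys) ?xs"
    then obtain zs where zs: "?xs = zs @ a # ys" by (auto elim: suffixE)
    have "run B (Push j a) ((?S (a # ys))(i := ys)) 2 []
       (((?S (a # ys))(i := ys))(j := a # ((?S (a # ys))(i := ys)) j))"
      using assms zs by (intro run_Push) auto
    then show "run B (Push j a) ((?S (a # ys))(i := ys)) 2 [] (?S ys)"
      by (rule run_cong) (use assms zs in \<open>auto simp: fun_eq_iff\<close>)
  qed (use assms in \<open>auto simp: fun_eq_iff\<close>)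
  then show ?thesis unfolding mv_def by (rule run_cong) (use assms in auto)
qed

definition mv2 :: "nat \<Rightarrow> nat \<Rightarrow> nat \<Rightarrow> nat \<Rightarrow> com" where
  "mv2 K i j l = foreach K i (\<lambda>a. Push j a ;; Push l a)"

lemma run_mv2:
  assumes "i \<noteq> j" "i \<noteq> l" "j \<noteq> l" "set (\<sigma> i) \<subseteq> {..<K}"
    "length (\<sigma> i) + length (\<sigma> j) \<le> B" "length (\<sigma> i) + length (\<sigma> l) \<le> B"
  shows "run B (mv2 K i j l) \<sigma> (length (\<sigma> i) * (K + 10) + 1) []
    (\<sigma>(i := [], j := rev (\<sigma> i) @ \<sigma> j, l := rev (\<sigma> i) @ \<sigma> l))"
proof -
  let ?xs = "\<sigma> i"
  let ?p = "\<lambda>ys. rev (take (length ?xs - length ys) ?xs)"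
  let ?S = "\<lambda>ys. \<sigma>(i := ys, j := ?p ys @ \<sigma> j, l := ?p ys @ \<sigma> l)"
  have "run B (foreach K i (\<lambda>a. Push j a ;; Push l a)) \<sigma> (length ?xs * (5 + K + 5) + 1)
     (suffix_concat (\<lambda>_. []) ?xs) (?S [])"
  proof (rule run_foreach[where S = ?S])
    fix a ys assume s: "suffix (a # ys) ?xs"
    then obtain zs where zs: "?xs = zs @ a # ys" by (auto elim: suffixE)
    let ?s = "(?S (a # ys))(i := ys)"
    have "run B (Push j a ;; Push l a) ?s (2 + 2 + 1) ([] @ [])
       ((?s(j := a # ?s j))(l := a # (?s(j := a # ?s j)) l))"
      by (rule run_Seq[OF run_Push run_Push]) (use assms zs in auto)
    then show "run B (Push j a ;; Push l a) ?s 5 [] (?S ys)"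
      by (rule run_cong) (use assms zs in \<open>auto simp: fun_eq_iff\<close>)
  qed (use assms in \<open>auto simp: fun_eq_iff\<close>)
  then show ?thesis unfolding mv2_def by (rule run_cong) (use assms in auto)
qed

definition copy :: "nat \<Rightarrow> nat \<Rightarrow> nat \<Rightarrow> nat \<Rightarrow> com" where
  "copy K i j t = mv K i t ;; mv2 K t i j"

lemma run_copy:
  assumes "distinct [i, j, t]" "\<sigma> t = []" "set (\<sigma> i) \<subseteq> {..<K}" "length (\<sigma> i) + length (\<sigma> j) \<le> B"
  shows "run B (copy K i j t) \<sigma> (length (\<sigma> i) * (2 * K + 17) + 3) [] (\<sigma>(j := \<sigma> i @ \<sigma> j))"
proof -
  let ?s = "\<sigma>(i := [], t := rev (\<sigma> i) @ \<sigma> t)"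
  have "run B (copy K i j t) \<sigma> ((length (\<sigma> i) * (K + 7) + 1) + (length (?s t) * (K + 10) + 1) + 1)
     ([] @ []) (?s(t := [], i := rev (?s t) @ ?s i, j := rev (?s t) @ ?s j))"
    unfolding copy_def by (rule run_Seq[OF run_mv run_mv2]) (use assms in auto)
  then show ?thesis
    by (rule run_cong) (use assms in \<open>auto simp: fun_eq_iff algebra_simps\<close>)
qed

fun push_word :: "nat \<Rightarrow> nat list \<Rightarrow> com" where
  "push_word i [] = Done"
| "push_word i (a # w) = push_word i w ;; Push i a"

lemma run_push_word:
  "length w + length (\<sigma> i) \<le> B \<Longrightarrow> run B (push_word i w) \<sigma> (3 * length w) [] (\<sigma>(i := w @ \<sigma> i))"
proof (induction w)
  case Nil
  then show ?case by (auto intro: run_cong[OF run_Done])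
next
  case (Cons a w)
  let ?s = "\<sigma>(i := w @ \<sigma> i)"
  have "run B (push_word i (a # w)) \<sigma> (3 * length w + 2 + 1) ([] @ []) (?s(i := a # ?s i))"
    unfolding push_word.simps by (rule run_Seq[OF Cons.IH run_Push]) (use Cons.prems in auto)
  then show ?case by (rule run_cong) auto
qed

fun emit_word :: "nat list \<Rightarrow> com" where
  "emit_word [] = Done"
| "emit_word (a # w) = Emit a ;; emit_word w"

lemma run_emit_word: "run B (emit_word w) \<sigma> (2 * length w) w \<sigma>"
proof (induction w)
  case Nil
  then show ?case by (auto intro: run_cong[OF run_Done])
next
  case (Cons a w)
  have "run B (emit_word (a # w)) \<sigma> (1 + 2 * length w + 1) ([a] @ w) \<sigma>"
    unfolding emit_word.simps by (rule run_Seq[OF run_Emit Cons])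
  then show ?case by (rule run_cong) auto
qed

subsection \<open>Polynomial bounds\<close>

definition poly_bounded :: "(nat \<Rightarrow> nat) \<Rightarrow> bool" where
  "poly_bounded f \<longleftrightarrow> (\<exists>p :: nat poly. \<forall>n. f n \<le> poly p n)"

lemma poly_bounded_const [intro, simp]: "poly_bounded (\<lambda>n. c)"
  unfolding poly_bounded_def by (rule exI[of _ "[:c:]"]) simp

lemma poly_bounded_id [intro, simp]: "poly_bounded (\<lambda>n. n)"
  unfolding poly_bounded_def by (rule exI[of _ "[:0, 1:]"]) simp

lemma poly_bounded_add [intro]: "poly_bounded f \<Longrightarrow> poly_bounded g \<Longrightarrow> poly_bounded (\<lambda>n. f n + g n)"
  unfolding poly_bounded_def by (metis add_mono poly_add)

lemma poly_bounded_mult [intro]: "poly_bounded f \<Longrightarrow> poly_bounded g \<Longrightarrow> poly_bounded (\<lambda>n. f n * g n)"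
  unfolding poly_bounded_def by (metis mult_le_mono poly_mult)

lemma poly_bounded_Suc [intro]: "poly_bounded f \<Longrightarrow> poly_bounded (\<lambda>n. Suc (f n))"
  using poly_bounded_add[of f "\<lambda>_. 1"] by simp

lemma poly_bounded_power [intro]: "poly_bounded f \<Longrightarrow> poly_bounded (\<lambda>n. f n ^ k)"
  by (induction k) auto

text \<open>Brings the polynomial of a space bound into the form that \<open>ruler\<close> can write
  in unary.\<close>

lemma poly_le_power: "\<exists>c d. \<forall>n. poly (p :: nat poly) n \<le> c * (n + 1) ^ d"
proof (induction p)
  case 0
  then show ?case by auto
next
  case (pCons a p)
  then obtain c d where cd: "\<And>n. poly p n \<le> c * (n + 1) ^ d" by auto
  have "poly (pCons a p) n \<le> (a + c) * (n + 1) ^ (Suc d)" for n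
  proof -
    have "n * poly p n \<le> (n + 1) * (c * (n + 1) ^ d)" using cd by (intro mult_mono) auto
    moreover have "a * 1 \<le> a * (n + 1) ^ Suc d" by (intro mult_left_mono one_le_power) auto
    ultimately show ?thesis by (simp add: algebra_simps)
  qed
  then show ?case by blast
qed

subsection \<open>Unary rulers of polynomial length\<close>

definition mult_unary :: "nat \<Rightarrow> nat \<Rightarrow> nat \<Rightarrow> nat \<Rightarrow> com" where
  "mult_unary x u y t = foreach 1 x (\<lambda>a. copy 1 u y t) ;; mv 1 y x"

lemma run_mult_unary:
  assumes "distinct [x, u, y, t]" "\<sigma> x = replicate r 0" "\<sigma> u = replicate n 0" "\<sigma> y = []" "\<sigma> t = []"
    "r * n \<le> B" "n \<le> B" "r \<le> B"
  shows "run B (mult_unary x u y t) \<sigma> (r * (n * 19 + 9) + n * r * 8 + 3) []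
    (\<sigma>(x := replicate (r * n) 0))"
proof -
  let ?S = "\<lambda>ys. \<sigma>(x := ys, y := replicate ((r - length ys) * n) 0)"
  have 1: "run B (foreach 1 x (\<lambda>a. copy 1 u y t)) \<sigma> (length (\<sigma> x) * ((n * (2 * 1 + 17) + 3) + 1 + 5) + 1)
     (suffix_concat (\<lambda>_. []) (\<sigma> x)) (?S [])"
  proof (rule run_foreach[where S = ?S])
    fix a ys assume "suffix (a # ys) (\<sigma> x)"
    then obtain zs where zs: "replicate r 0 = zs @ a # ys" using assms by (auto elim: suffixE)
    then have "length (replicate r (0::nat)) = length (zs @ a # ys)" by metis
    then have l: "r = length zs + Suc (length ys)" by simp
    let ?s = "(?S (a # ys))(x := ys)"
    have "length zs * n + n \<le> r * n" by (simp add: l algebra_simps)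
    then have "n + length zs * n \<le> B" using assms by linarith
    then have "run B (copy 1 u y t) ?s (length (?s u) * (2 * 1 + 17) + 3) [] (?s(y := ?s u @ ?s y))"
      using assms l by (intro run_copy) auto
    then show "run B (copy 1 u y t) ?s (n * (2 * 1 + 17) + 3) [] (?S ys)"
      by (rule run_cong) (use assms l in \<open>auto simp: fun_eq_iff replicate_add algebra_simps\<close>)
  qed (use assms in \<open>auto simp: fun_eq_iff\<close>)
  have 2: "run B (mv 1 y x) (?S []) (length (?S [] y) * (1 + 7) + 1) []
     ((?S [])(y := [], x := rev (?S [] y) @ ?S [] x))"
    using assms by (intro run_mv) auto
  from run_Seq[OF 1 2] show ?thesis unfolding mult_unary_def
    by (rule run_cong) (use assms in \<open>auto simp: fun_eq_iff algebra_simps\<close>)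
qed

fun power_unary :: "nat \<Rightarrow> nat \<Rightarrow> nat \<Rightarrow> nat \<Rightarrow> nat \<Rightarrow> com" where
  "power_unary 0 x u y t = Done"
| "power_unary (Suc d) x u y t = mult_unary x u y t ;; power_unary d x u y t"

fun power_time :: "nat \<Rightarrow> nat \<Rightarrow> nat \<Rightarrow> nat" where
  "power_time 0 r n = 0"
| "power_time (Suc d) r n = (r * (n * 19 + 9) + n * r * 8 + 3) + power_time d (r * n) n + 1"

lemma poly_bounded_power_time:
  "poly_bounded r \<Longrightarrow> poly_bounded f \<Longrightarrow> poly_bounded (\<lambda>n. power_time d (r n) (f n))"
  by (induction d arbitrary: r) (auto intro!: poly_bounded_add poly_bounded_mult)

lemma run_power_unary:
  assumes "distinct [x, u, y, t]" "\<sigma> x = replicate r 0" "\<sigma> u = replicate n 0" "\<sigma> y = []" "\<sigma> t = []"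
    "1 \<le> n" "r * n ^ d \<le> B" "n \<le> B"
  shows "run B (power_unary d x u y t) \<sigma> (power_time d r n) [] (\<sigma>(x := replicate (r * n ^ d) 0))"
  using assms
proof (induction d arbitrary: \<sigma> r)
  case 0
  then show ?case by (auto intro!: run_cong[OF run_Done])
next
  case (Suc d)
  have le: "r * n \<le> r * n ^ Suc d" "r \<le> r * n ^ Suc d" using Suc.prems(6) by simp_all
  have le': "r * n \<le> B" "r \<le> B" using le Suc.prems(7) by linarith+
  have 1: "run B (mult_unary x u y t) \<sigma> (r * (n * 19 + 9) + n * r * 8 + 3) [] (\<sigma>(x := replicate (r * n) 0))"
    using Suc.prems le' by (intro run_mult_unary) auto
  have 2: "run B (power_unary d x u y t) (\<sigma>(x := replicate (r * n) 0)) (power_time d (r * n) n) []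
     ((\<sigma>(x := replicate (r * n) 0))(x := replicate (r * n * n ^ d) 0))"
    using Suc.prems by (intro Suc.IH) (auto simp: mult.assoc)
  from run_Seq[OF 1 2] show ?case unfolding power_unary.simps
    by (rule run_cong) (auto simp: mult.assoc)
qed

text \<open>Afterwards the input is on stack \<open>i\<close>, stack \<open>u\<close> has height \<open>n + 1\<close> and stack \<open>x\<close> has height \<open>c (n + 1)^d\<close>.\<close>

definition ruler :: "nat \<Rightarrow> nat \<Rightarrow> nat \<Rightarrow> nat \<Rightarrow> nat \<Rightarrow> nat \<Rightarrow> nat \<Rightarrow> nat \<Rightarrow> com" where
  "ruler K c d x u i y t = mv K 0 y ;; foreach K y (\<lambda>a. Push i a ;; Push u 0) ;; Push u 0 ;;
     push_word x (replicate c 0) ;; power_unary d x u y t"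

lemma run_ruler:
  assumes "distinct [x, u, y, t]" "distinct [i, u, y, t]" "i \<noteq> x" "0 \<notin> {u, i, y, t}"
    and "set w \<subseteq> {..<K}" "c * (length w + 1) ^ d \<le> B" "length w + 1 \<le> B"
  shows "run B (ruler K c d x u i y t) ((\<lambda>_. [])(0 := w))
    (length w * (2 * K + 17) + 3 * c + power_time d c (length w + 1) + 10) []
    ((\<lambda>_. [])(i := w, u := replicate (length w + 1) 0, x := replicate (c * (length w + 1) ^ d) 0))"
proof -
  let ?n = "length w"
  let ?s0 = "(\<lambda>_. [])(0 := w) :: store"
  let ?s1 = "(\<lambda>_. [])(y := rev w) :: store"
  have c: "c \<le> B" using assms(6) by (metis le_trans mult_le_mono2 mult.right_neutral one_le_power le_add2)
  have 1: "run B (mv K 0 y) ?s0 (?n * (K + 7) + 1) [] ?s1"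
    by (rule run_cong[OF run_mv]) (use assms in \<open>auto simp: fun_eq_iff\<close>)
  let ?S = "\<lambda>ys. (\<lambda>_. [])(y := ys, i := rev (take (?n - length ys) (rev w)), u := replicate (?n - length ys) 0) :: store"
  have 2: "run B (foreach K y (\<lambda>a. Push i a ;; Push u 0)) ?s1 (length (?s1 y) * ((2 + 2 + 1) + K + 5) + 1)
     (suffix_concat (\<lambda>_. []) (?s1 y)) (?S [])"
  proof (rule run_foreach[where S = ?S])
    fix a ys assume "suffix (a # ys) (?s1 y)"
    then obtain zs where zs: "rev w = zs @ a # ys" by (auto elim: suffixE)
    then have l: "?n = length zs + Suc (length ys)" by (metis length_rev length_append length_Cons)
    let ?s = "(?S (a # ys))(y := ys)"
    have "run B (Push i a ;; Push u 0) ?s (2 + 2 + 1) ([] @ []) ((?s(i := a # ?s i))(u := 0 # (?s(i := a # ?s i)) u))"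
      by (rule run_Seq[OF run_Push run_Push]) (use assms l in auto)
    then show "run B (Push i a ;; Push u 0) ?s (2 + 2 + 1) [] (?S ys)"
      by (rule run_cong) (use assms l zs in \<open>auto simp: fun_eq_iff Suc_diff_le\<close>)
  qed (use assms in \<open>auto simp: fun_eq_iff\<close>)
  let ?s3 = "(\<lambda>_. [])(i := w, u := replicate ?n 0) :: store"
  let ?s4 = "?s3(u := 0 # ?s3 u)"
  have 3: "run B (Push u 0) ?s3 2 [] ?s4"
    using assms by (intro run_Push) auto
  have 4: "run B (push_word x (replicate c 0)) ?s4 (3 * length (replicate c (0::nat))) []
      (?s4(x := replicate c 0 @ ?s4 x))"
    using assms c by (intro run_push_word) auto
  let ?s5 = "(\<lambda>_. [])(i := w, u := replicate (?n + 1) 0, x := replicate c 0) :: store"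
  have e5: "?s4(x := replicate c 0 @ ?s4 x) = ?s5" using assms by (auto simp: fun_eq_iff)
  have 5: "run B (power_unary d x u y t) ?s5 (power_time d c (?n + 1)) [] (?s5(x := replicate (c * (?n + 1) ^ d) 0))"
    using assms by (intro run_power_unary) auto
  have e2: "?S [] = ?s3" using assms by (auto simp: fun_eq_iff)
  from run_Seq[OF 1 run_Seq[OF 2[unfolded e2] run_Seq[OF 3 run_Seq[OF 4[unfolded e5] 5]]]] show ?thesis
    unfolding ruler_def by (rule run_cong) (use assms in \<open>auto simp: fun_eq_iff algebra_simps\<close>)
qed

section \<open>A logic of polynomial space\<close>

subsection \<open>Weakest preconditions\<close>

text \<open>Total correctness of silent programs under the height bound \<open>B\<close>. The
  running time is forgotten, which suits space bounds.\<close>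

definition wp :: "nat \<Rightarrow> com \<Rightarrow> (store \<Rightarrow> bool) \<Rightarrow> store \<Rightarrow> bool" where
  "wp B c Q \<sigma> \<longleftrightarrow> (\<exists>T \<tau>. run B c \<sigma> T [] \<tau> \<and> Q \<tau>)"

lemma wp_run: "run B c \<sigma> T [] \<tau> \<Longrightarrow> Q \<tau> \<Longrightarrow> wp B c Q \<sigma>"
  unfolding wp_def by blast

lemma wp_mono: "wp B c P \<sigma> \<Longrightarrow> (\<And>\<tau>. P \<tau> \<Longrightarrow> Q \<tau>) \<Longrightarrow> wp B c Q \<sigma>"
  unfolding wp_def by blast

lemma wp_Done: "Q \<sigma> \<Longrightarrow> wp B Done Q \<sigma>"
  by (rule wp_run[OF run_Done])

lemma wp_Push: "length (\<sigma> i) < B \<Longrightarrow> Q (\<sigma>(i := a # \<sigma> i)) \<Longrightarrow> wp B (Push i a) Q \<sigma>"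
  by (rule wp_run[OF run_Push])

lemma wp_Pop: "Q (\<sigma>(i := tl (\<sigma> i))) \<Longrightarrow> wp B (Pop i) Q \<sigma>"
  by (rule wp_run[OF run_Pop])

lemma wp_Seq: "wp B c (wp B d Q) \<sigma> \<Longrightarrow> wp B (c ;; d) Q \<sigma>"
  unfolding wp_def using run_Seq by (metis append_Nil)

lemma wp_Branch:
  "(p (peek (\<sigma> i)) \<Longrightarrow> wp B c Q \<sigma>) \<Longrightarrow> (\<not> p (peek (\<sigma> i)) \<Longrightarrow> wp B d Q \<sigma>) \<Longrightarrow> wp B (Branch i p c d) Q \<sigma>"
  unfolding wp_def using run_BranchT[of p \<sigma> i] run_BranchF[of p \<sigma> i] by metis

lemma wp_BranchT: "p (peek (\<sigma> i)) \<Longrightarrow> wp B c Q \<sigma> \<Longrightarrow> wp B (Branch i p c d) Q \<sigma>"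
  by (rule wp_Branch) auto

lemma wp_BranchF: "\<not> p (peek (\<sigma> i)) \<Longrightarrow> wp B d Q \<sigma> \<Longrightarrow> wp B (Branch i p c d) Q \<sigma>"
  by (rule wp_Branch) auto

lemma wp_LoopF: "\<not> p (peek (\<sigma> i)) \<Longrightarrow> Q \<sigma> \<Longrightarrow> wp B (Loop i p c) Q \<sigma>"
  by (rule wp_run[OF run_LoopF])

lemma wp_LoopT: "p (peek (\<sigma> i)) \<Longrightarrow> wp B c (wp B (Loop i p c) Q) \<sigma> \<Longrightarrow> wp B (Loop i p c) Q \<sigma>"
  unfolding wp_def using run_LoopT[of p \<sigma> i] by (metis append_Nil)

text \<open>The premise for all \<open>R\<close> says that the body leads from \<sigma> to exactly
  \<open>s\<close>; so a fact about the loop at \<open>s\<close>, such as an induction hypothesis,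
  can be proved first.\<close>

lemma wp_Loop_via:
  "wp B (Loop i p c) Q s \<Longrightarrow> (\<And>R. R s \<Longrightarrow> wp B c R \<sigma>) \<Longrightarrow> p (peek (\<sigma> i)) \<Longrightarrow> wp B (Loop i p c) Q \<sigma>"
  by (rule wp_LoopT)

lemma wp_switch: "\<sigma> i = a # xs \<Longrightarrow> a < K \<Longrightarrow> wp B (f a) Q \<sigma> \<Longrightarrow> wp B (switch K i f) Q \<sigma>"
  unfolding wp_def using run_switch[of \<sigma> i] by metis

lemma wp_clear: "Q (\<sigma>(i := [])) \<Longrightarrow> wp B (clear i) Q \<sigma>"
  by (rule wp_run[OF run_clear])

lemma wp_mv: "i \<noteq> j \<Longrightarrow> set (\<sigma> i) \<subseteq> {..<K} \<Longrightarrow> length (\<sigma> i) + length (\<sigma> j) \<le> B \<Longrightarrow>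
    Q (\<sigma>(i := [], j := rev (\<sigma> i) @ \<sigma> j)) \<Longrightarrow> wp B (mv K i j) Q \<sigma>"
  by (rule wp_run[OF run_mv])

lemma wp_copy: "distinct [i, j, t] \<Longrightarrow> \<sigma> t = [] \<Longrightarrow> set (\<sigma> i) \<subseteq> {..<K} \<Longrightarrow>
    length (\<sigma> i) + length (\<sigma> j) \<le> B \<Longrightarrow> Q (\<sigma>(j := \<sigma> i @ \<sigma> j)) \<Longrightarrow> wp B (copy K i j t) Q \<sigma>"
  by (rule wp_run[OF run_copy])

lemma wp_push_word: "length w + length (\<sigma> i) \<le> B \<Longrightarrow> Q (\<sigma>(i := w @ \<sigma> i)) \<Longrightarrow> wp B (push_word i w) Q \<sigma>"
  by (rule wp_run[OF run_push_word])

lemmas wp_intros = wp_Seq wp_Push wp_Pop wp_clear wp_mv wp_copy wp_Done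

subsection \<open>Comparing, incrementing and measuring words\<close>

text \<open>The mark on \<open>r\<close> is set in advance and removed at the first difference,
  where clearing \<open>x\<close> also ends the loop. A rest on \<open>y\<close> means that the
  words differ in length.\<close>

definition cmp :: "nat \<Rightarrow> nat \<Rightarrow> nat \<Rightarrow> nat \<Rightarrow> com" where
  "cmp K x y r = Push r 0 ;;
     Loop x (\<lambda>s. s \<noteq> 0) (switch K x (\<lambda>a. Branch y (\<lambda>s. s = Suc a) (Pop x ;; Pop y) (Pop r ;; clear x))) ;;
     Branch y (\<lambda>s. s \<noteq> 0) (clear y ;; Pop r) Done"

lemma wp_cmp_loop:
  assumes "distinct [x, y, r]" "\<sigma> r = [0]" "set (\<sigma> x) \<subseteq> {..<K}"
  shows "wp B (Loop x (\<lambda>s. s \<noteq> 0) (switch K x (\<lambda>a. Branch y (\<lambda>s. s = Suc a) (Pop x ;; Pop y) (Pop r ;; clear x))))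
    (\<lambda>\<tau>. \<exists>zs rs. \<tau> = \<sigma>(x := [], y := zs, r := rs) \<and> (rs = [] \<or> rs = [0]) \<and>
       (\<sigma> x = \<sigma> y \<longleftrightarrow> zs = [] \<and> rs = [0])) \<sigma>" (is "wp B ?L (?Q \<sigma>) \<sigma>")
  using assms
proof (induction "\<sigma> x" arbitrary: \<sigma>)
  case Nil
  then show ?case
    by (intro wp_LoopF) (simp, rule exI[of _ "\<sigma> y"], rule exI[of _ "[0]"], auto simp: fun_eq_iff)
next
  case (Cons a xs)
  show ?case
  proof (cases "peek (\<sigma> y) = Suc a")
    case True
    then obtain ys where ys: "\<sigma> y = a # ys" by (cases "\<sigma> y") auto
    let ?s = "\<sigma>(x := xs, y := ys)"
    have "wp B ?L (?Q ?s) ?s"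
      using Cons.prems ys by (intro Cons(1)) (auto simp flip: Cons(2))
    then have "wp B ?L (?Q \<sigma>) ?s"
    proof (rule wp_mono)
      fix \<tau> assume "?Q ?s \<tau>"
      then obtain zs rs where "\<tau> = ?s(x := [], y := zs, r := rs)" "rs = [] \<or> rs = [0]"
        "?s x = ?s y \<longleftrightarrow> zs = [] \<and> rs = [0]" by blast
      then show "?Q \<sigma> \<tau>" using Cons ys
        by (intro exI[of _ zs] exI[of _ rs]) (auto simp: fun_eq_iff)
    qed
    moreover have "wp B (switch K x (\<lambda>a. Branch y (\<lambda>s. s = Suc a) (Pop x ;; Pop y) (Pop r ;; clear x))) R \<sigma>"
      if "R ?s" for R
      using that Cons(2)[symmetric] Cons.prems ys True
      by (intro wp_switch[of \<sigma> x a xs] wp_BranchT wp_intros) (auto elim!: back_subst[of R] simp: fun_eq_iff)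
    ultimately show ?thesis by (rule wp_Loop_via) (assumption | use Cons.hyps(2)[symmetric] in simp)+
  next
    case False
    let ?s = "\<sigma>(r := [], x := [])"
    have "\<sigma> x \<noteq> \<sigma> y" using False by (metis Cons.hyps(2) peek_simps(2))
    then have "wp B ?L (?Q \<sigma>) ?s"
      using Cons.prems False Cons(2)[symmetric]
      by (intro wp_LoopF) (simp, rule exI[of _ "\<sigma> y"], rule exI[of _ "[]"], auto simp: fun_eq_iff)
    moreover have "wp B (switch K x (\<lambda>a. Branch y (\<lambda>s. s = Suc a) (Pop x ;; Pop y) (Pop r ;; clear x))) R \<sigma>"
      if "R ?s" for R
      using that Cons(2)[symmetric] Cons.prems False
      by (intro wp_switch[of \<sigma> x a xs] wp_BranchF wp_intros) (auto elim!: back_subst[of R] simp: fun_eq_iff)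
    ultimately show ?thesis by (rule wp_Loop_via) (assumption | use Cons.hyps(2)[symmetric] in simp)+
  qed
qed

lemma wp_cmp:
  assumes "distinct [x, y, r]" "\<sigma> r = []" "set (\<sigma> x) \<subseteq> {..<K}" "0 < B"
    and "Q (\<sigma>(x := [], y := [], r := if \<sigma> x = \<sigma> y then [0] else []))"
  shows "wp B (cmp K x y r) Q \<sigma>"
  unfolding cmp_def
proof (intro wp_Seq wp_Push)
  let ?s = "\<sigma>(r := 0 # \<sigma> r)"
  show "wp B (Loop x (\<lambda>s. s \<noteq> 0) (switch K x (\<lambda>a. Branch y (\<lambda>s. s = Suc a) (Pop x ;; Pop y) (Pop r ;; clear x))))
    (wp B (Branch y (\<lambda>s. s \<noteq> 0) (clear y ;; Pop r) Done) Q) ?s"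
  proof (rule wp_mono[OF wp_cmp_loop])
    fix \<tau> assume "\<exists>zs rs. \<tau> = ?s(x := [], y := zs, r := rs) \<and> (rs = [] \<or> rs = [0]) \<and>
       (?s x = ?s y \<longleftrightarrow> zs = [] \<and> rs = [0])"
    then obtain zs rs where *: "\<tau> = ?s(x := [], y := zs, r := rs)" "rs = [] \<or> rs = [0]"
       "\<sigma> x = \<sigma> y \<longleftrightarrow> zs = [] \<and> rs = [0]" using assms(1) by auto
    show "wp B (Branch y (\<lambda>s. s \<noteq> 0) (clear y ;; Pop r) Done) Q \<tau>"
      unfolding * using assms(1,5) *(2,3)
      by (intro wp_Branch wp_intros) (auto simp: fun_upd_twist elim!: back_subst[of Q] split: if_splits)
  qed (use assms in auto)
qed (use assms in auto)

text \<open>The successor in bijective base 15, least significant digit first: starting from the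
  empty word, each word over 15 letters is reached once, and the length never decreases. The letter
  15 stays free as a delimiter.\<close>

fun next_word :: "nat list \<Rightarrow> nat list" where
  "next_word [] = [0]"
| "next_word (d # w) = (if d = 14 then 0 # next_word w else Suc d # w)"

text \<open>The value 15 of \<open>peek\<close> is the letter 14, the largest digit. The loop turns
  such digits into zeros, kept on \<open>t\<close>, until the carry can be absorbed.\<close>

definition inc :: "nat \<Rightarrow> nat \<Rightarrow> com" where
  "inc x t = Loop x (\<lambda>s. s = 15) (Pop x ;; Push t 0) ;;
     Branch x (\<lambda>s. s \<noteq> 0) (switch 15 x (\<lambda>a. Pop x ;; Push x (Suc a))) (Push x 0) ;; mv 15 t x"

lemma wp_inc_loop:
  assumes "x \<noteq> t" "length (\<sigma> x) + length (\<sigma> t) \<le> B"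
  shows "wp B (Loop x (\<lambda>s. s = 15) (Pop x ;; Push t 0))
    (\<lambda>\<tau>. \<exists>j ys. \<sigma> x = replicate j 14 @ ys \<and> peek ys \<noteq> 15 \<and> \<tau> = \<sigma>(x := ys, t := replicate j 0 @ \<sigma> t)) \<sigma>"
  using assms
proof (induction "\<sigma> x" arbitrary: \<sigma>)
  case Nil
  then show ?case by (intro wp_LoopF) auto
next
  case (Cons a xs)
  show ?case
  proof (cases "a = 14")
    case True
    let ?s = "\<sigma>(x := xs, t := 0 # \<sigma> t)"
    have "wp B (Loop x (\<lambda>s. s = 15) (Pop x ;; Push t 0))
     (\<lambda>\<tau>. \<exists>j ys. ?s x = replicate j 14 @ ys \<and> peek ys \<noteq> 15 \<and> \<tau> = ?s(x := ys, t := replicate j 0 @ ?s t)) ?s"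
      using Cons(3,4) by (intro Cons(1)) (auto simp flip: Cons(2))
    then have "wp B (Loop x (\<lambda>s. s = 15) (Pop x ;; Push t 0))
      (\<lambda>\<tau>. \<exists>j ys. \<sigma> x = replicate j 14 @ ys \<and> peek ys \<noteq> 15 \<and> \<tau> = \<sigma>(x := ys, t := replicate j 0 @ \<sigma> t)) ?s"
    proof (rule wp_mono)
      fix \<tau> assume "\<exists>j ys. ?s x = replicate j 14 @ ys \<and> peek ys \<noteq> 15 \<and> \<tau> = ?s(x := ys, t := replicate j 0 @ ?s t)"
      then obtain j ys where "xs = replicate j 14 @ ys" "peek ys \<noteq> 15"
        "\<tau> = ?s(x := ys, t := replicate j 0 @ ?s t)" using Cons(3) by auto
      then show "\<exists>j ys. \<sigma> x = replicate j 14 @ ys \<and> peek ys \<noteq> 15 \<and> \<tau> = \<sigma>(x := ys, t := replicate j 0 @ \<sigma> t)"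
        using Cons(3) True
        by (intro exI[of _ "Suc j"] exI[of _ ys])
          (auto simp: fun_eq_iff replicate_app_Cons_same simp flip: Cons(2))
    qed
    moreover have "wp B (Pop x ;; Push t 0) R \<sigma>" if "R ?s" for R
      using that Cons(3,4) True
      by (intro wp_intros) (auto elim!: back_subst[of R] simp: fun_eq_iff simp flip: Cons(2))
    ultimately show ?thesis by (rule wp_Loop_via) (assumption | use Cons.hyps(2)[symmetric] True in simp)+
  next
    case False
    then show ?thesis using Cons(2)[symmetric]
      by (intro wp_LoopF) (auto intro!: exI[of _ "0::nat"] simp: fun_eq_iff)
  qed
qed

lemma next_word_replicate: "next_word (replicate j 14 @ ys) = replicate j 0 @ next_word ys"
  by (induction j) auto

lemma wp_inc:
  assumes "x \<noteq> t" "\<sigma> t = []" "length (\<sigma> x) < B" "set (\<sigma> x) \<subseteq> {..<15}" "Q (\<sigma>(x := next_word (\<sigma> x)))"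
  shows "wp B (inc x t) Q \<sigma>"
  unfolding inc_def
proof (rule wp_Seq, rule wp_mono[OF wp_inc_loop])
  fix \<tau> assume "\<exists>j ys. \<sigma> x = replicate j 14 @ ys \<and> peek ys \<noteq> 15 \<and> \<tau> = \<sigma>(x := ys, t := replicate j 0 @ \<sigma> t)"
  then obtain j ys where *: "\<sigma> x = replicate j 14 @ ys" "peek ys \<noteq> 15" "\<tau> = \<sigma>(x := ys, t := replicate j 0)"
    using assms(2) by auto
  show "wp B (Branch x (\<lambda>s. s \<noteq> 0) (switch 15 x (\<lambda>a. Pop x ;; Push x (Suc a))) (Push x 0) ;; mv 15 t x) Q \<tau>"
  proof (cases ys)
    case Nil
    then show ?thesis using * assms
      by (auto intro!: wp_Seq wp_BranchF wp_intros elim!: back_subst[of Q]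
          simp: next_word_replicate[of j "[]", simplified] fun_eq_iff)
  next
    case (Cons a zs)
    then show ?thesis using * assms
      by (auto intro!: wp_Seq wp_BranchT wp_switch wp_intros elim!: back_subst[of Q]
          simp: next_word_replicate fun_eq_iff)
  qed
qed (use assms in auto)

text \<open>Leaves a mark on \<open>r\<close> if the word on \<open>x\<close> is longer than the one on \<open>l\<close>.\<close>

definition longer :: "nat \<Rightarrow> nat \<Rightarrow> nat \<Rightarrow> nat \<Rightarrow> nat \<Rightarrow> nat \<Rightarrow> com" where
  "longer x l r t u v = copy 15 x t v ;; copy 15 l u v ;;
     Loop t (\<lambda>s. s \<noteq> 0) (Branch u (\<lambda>s. s \<noteq> 0) (Pop t ;; Pop u) (clear t ;; Push r 0)) ;; clear u"

lemma wp_longer_loop: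
  assumes "distinct [t, u, r]" "\<sigma> r = []" "0 < B"
  shows "wp B (Loop t (\<lambda>s. s \<noteq> 0) (Branch u (\<lambda>s. s \<noteq> 0) (Pop t ;; Pop u) (clear t ;; Push r 0)))
    (\<lambda>\<tau>. \<exists>zs. \<tau> = \<sigma>(t := [], u := zs, r := if length (\<sigma> t) > length (\<sigma> u) then [0] else [])) \<sigma>"
    (is "wp B ?L (?Q \<sigma>) \<sigma>")
  using assms
proof (induction "\<sigma> t" arbitrary: \<sigma>)
  case Nil
  then show ?case by (intro wp_LoopF) (auto simp: fun_eq_iff intro!: exI[of _ "\<sigma> u"])
next
  case (Cons a xs)
  show ?case
  proof (cases "\<sigma> u")
    case Nil
    then have "wp B ?L (?Q \<sigma>) (\<sigma>(t := [], r := [0]))"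
      using Cons by (intro wp_LoopF) (auto simp: fun_eq_iff simp flip: Cons(2))
    moreover have "wp B (Branch u (\<lambda>s. s \<noteq> 0) (Pop t ;; Pop u) (clear t ;; Push r 0)) R \<sigma>"
      if "R (\<sigma>(t := [], r := [0]))" for R
      using that Cons(3-) Nil
      by (intro wp_BranchF wp_intros) (auto elim!: back_subst[of R] simp: fun_eq_iff)
    ultimately show ?thesis by (rule wp_Loop_via) (assumption | use Cons.hyps(2)[symmetric] in simp)+
  next
    case (Cons b ys)
    let ?s = "\<sigma>(t := xs, u := ys)"
    have "wp B ?L (?Q ?s) ?s" using Cons.prems by (intro Cons.hyps(1)) auto
    then have "wp B ?L (?Q \<sigma>) ?s"
    proof (rule wp_mono)
      fix \<tau> assume "?Q ?s \<tau>"
      then obtain zs where "\<tau> = ?s(t := [], u := zs, r := if length (?s t) > length (?s u) then [0] else [])"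
        by blast
      then show "?Q \<sigma> \<tau>" using Cons.prems Cons
        by (intro exI[of _ zs]) (auto simp: fun_eq_iff simp flip: Cons.hyps(2))
    qed
    moreover have "wp B (Branch u (\<lambda>s. s \<noteq> 0) (Pop t ;; Pop u) (clear t ;; Push r 0)) R \<sigma>"
      if "R ?s" for R
      using that Cons.prems Cons
      by (intro wp_BranchT wp_intros) (auto elim!: back_subst[of R] simp: fun_eq_iff simp flip: Cons.hyps(2))
    ultimately show ?thesis by (rule wp_Loop_via) (assumption | use Cons.hyps(2)[symmetric] in simp)+
  qed
qed

lemma wp_longer:
  assumes "distinct [x, l, r, t, u, v]" "\<sigma> r = []" "\<sigma> t = []" "\<sigma> u = []" "\<sigma> v = []"
    "set (\<sigma> x) \<subseteq> {..<15}" "set (\<sigma> l) \<subseteq> {..<15}" "length (\<sigma> x) \<le> B" "length (\<sigma> l) \<le> B" "0 < B"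
    and "Q (\<sigma>(r := if length (\<sigma> x) > length (\<sigma> l) then [0] else []))"
  shows "wp B (longer x l r t u v) Q \<sigma>"
  unfolding longer_def
proof (intro wp_Seq wp_copy)
  let ?s = "\<sigma>(t := \<sigma> x @ \<sigma> t, u := (\<sigma>(t := \<sigma> x @ \<sigma> t)) l @ (\<sigma>(t := \<sigma> x @ \<sigma> t)) u)"
  show "wp B (Loop t (\<lambda>s. s \<noteq> 0) (Branch u (\<lambda>s. s \<noteq> 0) (Pop t ;; Pop u) (clear t ;; Push r 0)))
     (wp B (clear u) Q) ?s"
    by (rule wp_mono[OF wp_longer_loop])
      (use assms in \<open>auto intro!: wp_clear elim!: back_subst[of Q] simp: fun_eq_iff\<close>)
qed (use assms in auto)

subsection \<open>Enumerating words\<close>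

definition words :: "nat \<Rightarrow> nat list set" where
  "words m = {a. set a \<subseteq> {..<15} \<and> length a \<le> m}"

lemma finite_words: "finite (words m)"
  unfolding words_def by (rule finite_lists_length_le) simp

lemma card_words: "card (words m) \<le> 16 ^ m"
proof -
  have "(\<Sum>i\<le>m. 15 ^ i) \<le> (16::nat) ^ m"
  proof (induction m)
    case (Suc m)
    have "(15::nat) ^ Suc m \<le> 15 * 16 ^ m" by (simp add: power_mono)
    with Suc show ?case by simp
  qed simp
  then show ?thesis unfolding words_def by (simp add: card_lists_length_le)
qed

definition nth_word :: "nat \<Rightarrow> nat list" where
  "nth_word i = (next_word ^^ i) []"

lemma nth_word_0 [simp]: "nth_word 0 = []"
  by (simp add: nth_word_def)

lemma nth_word_Suc: "nth_word (Suc i) = next_word (nth_word i)"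
  by (simp add: nth_word_def)

lemma set_next_word: "set w \<subseteq> {..<15} \<Longrightarrow> set (next_word w) \<subseteq> {..<15}"
  by (induction w) auto

lemma set_nth_word: "set (nth_word i) \<subseteq> {..<15}"
  by (induction i) (auto simp: nth_word_Suc dest: set_next_word)

lemma length_next_word: "length w \<le> length (next_word w)" "length (next_word w) \<le> Suc (length w)"
  by (induction w) auto

lemma length_nth_word_mono: "i \<le> j \<Longrightarrow> length (nth_word i) \<le> length (nth_word j)"
  by (induction j rule: dec_induct) (auto simp: nth_word_Suc intro: order_trans length_next_word(1))

text \<open>The number denoted by a word in bijective base 15; it is the measure by which counting
  is shown to reach every word.\<close>

fun bij_value :: "nat list \<Rightarrow> nat" where
  "bij_value [] = 0"
| "bij_value (d # w) = Suc d + 15 * bij_value w"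

lemma bij_value_next: "bij_value (next_word w) = Suc (bij_value w)"
  by (induction w) auto

lemma ex_previous_word:
  "w \<noteq> [] \<Longrightarrow> set w \<subseteq> {..<15} \<Longrightarrow> \<exists>v. set v \<subseteq> {..<15} \<and> next_word v = w"
proof (induction w)
  case (Cons d w)
  show ?case
  proof (cases d)
    case 0
    show ?thesis
    proof (cases "w = []")
      case True
      then show ?thesis using 0 by (intro exI[of _ "[]"]) auto
    next
      case False
      with Cons obtain v where "set v \<subseteq> {..<15}" "next_word v = w" by auto
      then show ?thesis using 0 by (intro exI[of _ "14 # v"]) auto
    qed
  next
    case (Suc d')
    then show ?thesis using Cons by (intro exI[of _ "d' # w"]) auto
  qed
qed simp

lemma nth_word_surj: "set w \<subseteq> {..<15} \<Longrightarrow> \<exists>i. w = nth_word i"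
proof (induction "bij_value w" arbitrary: w rule: less_induct)
  case less
  show ?case
  proof (cases "w = []")
    case True
    then show ?thesis by (intro exI[of _ 0]) simp
  next
    case False
    with less.prems ex_previous_word obtain v where v: "set v \<subseteq> {..<15}" "next_word v = w" by blast
    then have "bij_value v < bij_value w" using bij_value_next[of v] by simp
    with less v obtain i where "v = nth_word i" by blast
    with v show ?thesis by (intro exI[of _ "Suc i"]) (simp add: nth_word_Suc)
  qed
qed

lemma ex_long_nth_word: "\<exists>i. length (nth_word i) > m"
  using nth_word_surj[of "replicate (Suc m) 0"] by (metis length_replicate lessI set_replicate_conv_if
    empty_subsetI insert_subset lessThan_iff zero_less_numeral)

text \<open>Downward induction that follows the search: lengths increase weakly and are unbounded,
  so all words from some index on are too long, and earlier indices reduce to their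
  successors.\<close>

lemma nth_word_induct:
  assumes "\<And>i. length (nth_word i) > m \<Longrightarrow> P i"
    and "\<And>i. length (nth_word i) \<le> m \<Longrightarrow> P (Suc i) \<Longrightarrow> P i"
  shows "P i"
proof -
  obtain N where N: "length (nth_word N) > m" using ex_long_nth_word by blast
  show ?thesis
  proof (induction "N - i" arbitrary: i)
    case 0
    then have "length (nth_word i) > m" using N length_nth_word_mono[of N i] by simp
    then show ?case by (rule assms(1))
  next
    case (Suc k)
    then show ?case using assms[of i] by (cases "length (nth_word i) > m") auto
  qed
qed

lemma ex_words_iff:
  "(\<exists>a\<in>words m. P a) \<longleftrightarrow> (\<exists>j. length (nth_word j) \<le> m \<and> P (nth_word j))"
  unfolding words_def using nth_word_surj set_nth_word by blast

lemma ex_from_Suc: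
  "(\<exists>j\<ge>i. P j) \<longleftrightarrow> P i \<or> (\<exists>j\<ge>Suc i. P j)" for i :: nat
  by (metis Suc_leD Suc_leI le_neq_implies_less order_refl)

subsection \<open>Bounded search\<close>

text \<open>Stack \<open>r\<close> is the status of the search: empty while no witness is known,
  letter 0 after a success, letter 1 once the candidates on \<open>x\<close> are longer than the
  ruler \<open>l\<close>. The final answer replaces the candidate on \<open>x\<close>.\<close>

definition search :: "nat \<Rightarrow> nat \<Rightarrow> nat \<Rightarrow> nat \<Rightarrow> nat \<Rightarrow> nat \<Rightarrow> nat \<Rightarrow> com \<Rightarrow> com" where
  "search x l r t u v f sub = sub ;;
     Loop r (\<lambda>s. s = 0) (inc x t ;; longer x l f t u v ;; Branch f (\<lambda>s. s \<noteq> 0) (Pop f ;; Push r 1) sub) ;;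
     clear x ;; Branch r (\<lambda>s. s = 1) (Pop r ;; Push x 0) (Pop r)"

lemma wp_search_loop:
  assumes d: "distinct [x, l, r, t, u, v, f]"
    and e: "\<forall>i\<in>{r, t, u, v, f}. \<sigma> i = []" and l: "set (\<sigma> l) \<subseteq> {..<15}" "length (\<sigma> l) = m" "m + 1 < B"
    and sub: "\<And>a. a \<in> words m \<Longrightarrow> wp B sub (\<lambda>\<tau>. \<tau> = \<sigma>(x := a, r := if P a then [0] else [])) (\<sigma>(x := a))"
    and i: "length (nth_word i) \<le> m"
  shows "wp B (Loop r (\<lambda>s. s = 0) (inc x t ;; longer x l f t u v ;; Branch f (\<lambda>s. s \<noteq> 0) (Pop f ;; Push r 1) sub))
    (\<lambda>\<tau>. \<exists>a. \<tau> = \<sigma>(x := a, r := if \<exists>j\<ge>i. length (nth_word j) \<le> m \<and> P (nth_word j) then [0] else [1]))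
    (\<sigma>(x := nth_word i, r := if P (nth_word i) then [0] else []))"
  using i
proof (induction i rule: nth_word_induct[of m])
  case (1 i)
  then show ?case by simp
next
  case (2 i)
  let ?L = "Loop r (\<lambda>s. s = 0) (inc x t ;; longer x l f t u v ;; Branch f (\<lambda>s. s \<noteq> 0) (Pop f ;; Push r 1) sub)"
  let ?Q = "\<lambda>i \<tau>. \<exists>a. \<tau> = \<sigma>(x := a, r := if \<exists>j\<ge>i. length (nth_word j) \<le> m \<and> P (nth_word j) then [0] else [1])"
  let ?s = "\<sigma>(x := nth_word (Suc i))"
  show ?case
  proof (cases "P (nth_word i)")
    case True
    with 2 have "\<exists>j\<ge>i. length (nth_word j) \<le> m \<and> P (nth_word j)" by blast
    with True show ?thesis by (intro wp_LoopF) auto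
  next
    case False
    then have iff: "(\<exists>j\<ge>i. length (nth_word j) \<le> m \<and> P (nth_word j)) \<longleftrightarrow>
        (\<exists>j\<ge>Suc i. length (nth_word j) \<le> m \<and> P (nth_word j))"
      using ex_from_Suc[of i "\<lambda>j. length (nth_word j) \<le> m \<and> P (nth_word j)"] by blast
    have "wp B (Branch f (\<lambda>s. s \<noteq> 0) (Pop f ;; Push r 1) sub) (wp B ?L (?Q i))
      (?s(f := if length (nth_word (Suc i)) > m then [0] else []))"
    proof (cases "length (nth_word (Suc i)) > m")
      case True
      then have "\<not> (\<exists>j\<ge>Suc i. length (nth_word j) \<le> m \<and> P (nth_word j))"
        using length_nth_word_mono by (meson leD order_trans)
      then have "?Q i (?s(r := [1]))" using iff by auto
      then have "wp B ?L (?Q i) (?s(r := [1]))" using d by (intro wp_LoopF) auto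
      then have "wp B (Branch f (\<lambda>s. s \<noteq> 0) (Pop f ;; Push r 1) sub) R (?s(f := [0]))"
        if "R = wp B ?L (?Q i)" for R
        using that[symmetric] True e d l
        by (intro wp_BranchT wp_intros) (auto elim!: back_subst[of R] simp: fun_eq_iff)
      with True show ?thesis by simp
    next
      case False
      then have "nth_word (Suc i) \<in> words m" using set_nth_word by (auto simp: words_def)
      from sub[OF this] have "wp B sub (wp B ?L (?Q i)) ?s"
      proof (rule wp_mono)
        fix \<tau> assume "\<tau> = \<sigma>(x := nth_word (Suc i), r := if P (nth_word (Suc i)) then [0] else [])"
        then show "wp B ?L (?Q i) \<tau>" using 2(2) False unfolding iff by (simp only: not_less)
      qed
      moreover have "?s(f := []) = ?s" using e d by (auto simp: fun_eq_iff)
      ultimately show ?thesis using False d e by (intro wp_BranchF) (simp_all only: if_False, auto)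
    qed
    moreover have "wp B (inc x t ;; longer x l f t u v ;; Branch f (\<lambda>s. s \<noteq> 0) (Pop f ;; Push r 1) sub) R
        (\<sigma>(x := nth_word i))"
      if R: "wp B (Branch f (\<lambda>s. s \<noteq> 0) (Pop f ;; Push r 1) sub) R
        (?s(f := if length (nth_word (Suc i)) > m then [0] else []))" for R
    proof (intro wp_Seq wp_inc)
      have "wp B (longer x l f t u v) (wp B (Branch f (\<lambda>s. s \<noteq> 0) (Pop f ;; Push r 1) sub) R) ?s"
        by (rule wp_longer) (use e d l 2(1) R set_nth_word[of "Suc i"] length_next_word(2)[of "nth_word i"] in
          \<open>auto simp: nth_word_Suc split: if_splits\<close>)
      then show "wp B (longer x l f t u v) (wp B (Branch f (\<lambda>s. s \<noteq> 0) (Pop f ;; Push r 1) sub) R)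
        ((\<sigma>(x := nth_word i))(x := next_word ((\<sigma>(x := nth_word i)) x)))"
        by (simp add: nth_word_Suc)
    qed (use e d l 2(1) set_nth_word[of i] in auto)
    ultimately have "wp B ?L (?Q i) (\<sigma>(x := nth_word i))"
      using e d by (intro wp_LoopT) auto
    moreover have "\<sigma>(x := nth_word i, r := []) = \<sigma>(x := nth_word i)" using e d by (auto simp: fun_eq_iff)
    ultimately show ?thesis using False by (simp only: if_False)
  qed
qed

lemma wp_search:
  assumes d: "distinct [x, l, r, t, u, v, f]"
    and e: "\<forall>i\<in>{x, r, t, u, v, f}. \<sigma> i = []" and l: "set (\<sigma> l) \<subseteq> {..<15}" "length (\<sigma> l) = m" "m + 1 < B"
    and sub: "\<And>a. a \<in> words m \<Longrightarrow> wp B sub (\<lambda>\<tau>. \<tau> = \<sigma>(x := a, r := if P a then [0] else [])) (\<sigma>(x := a))"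
    and Q: "Q (\<sigma>(x := if \<exists>a\<in>words m. P a then [0] else []))"
  shows "wp B (search x l r t u v f sub) Q \<sigma>"
  unfolding search_def
proof (rule wp_Seq)
  let ?L = "Loop r (\<lambda>s. s = 0) (inc x t ;; longer x l f t u v ;; Branch f (\<lambda>s. s \<noteq> 0) (Pop f ;; Push r 1) sub)"
  let ?E = "clear x ;; Branch r (\<lambda>s. s = 1) (Pop r ;; Push x 0) (Pop r)"
  have "\<sigma>(x := []) = \<sigma>" using e by (auto simp: fun_eq_iff)
  then have "wp B sub (\<lambda>\<tau>. \<tau> = \<sigma>(x := [], r := if P [] then [0] else [])) \<sigma>"
    using sub[of "[]"] by (simp add: words_def)
  then show "wp B sub (wp B (?L ;; ?E) Q) \<sigma>"
  proof (rule wp_mono)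
    fix \<tau> assume \<tau>: "\<tau> = \<sigma>(x := [], r := if P [] then [0] else [])"
    have "wp B ?L (\<lambda>\<tau>. \<exists>a. \<tau> = \<sigma>(x := a, r := if \<exists>j\<ge>0. length (nth_word j) \<le> m \<and> P (nth_word j) then [0] else [1])) \<tau>"
      using wp_search_loop[OF d _ l sub, of 0] e unfolding \<tau> by simp
    then show "wp B (?L ;; ?E) Q \<tau>"
    proof (rule wp_Seq[OF wp_mono])
      fix \<tau> assume "\<exists>a. \<tau> = \<sigma>(x := a, r := if \<exists>j\<ge>0. length (nth_word j) \<le> m \<and> P (nth_word j) then [0] else [1])"
      then obtain a where \<tau>: "\<tau> = \<sigma>(x := a, r := if \<exists>a\<in>words m. P a then [0] else [1])"
        by (auto simp: ex_words_iff)
      show "wp B ?E Q \<tau>" unfolding \<tau> using d e l Q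
        by (intro wp_Seq wp_clear wp_Branch wp_intros)
          (auto elim!: back_subst[of Q] simp: fun_eq_iff split: if_splits)
    qed
  qed
qed

subsection \<open>Reachability by Savitch's algorithm\<close>

definition push_frame :: "nat \<Rightarrow> nat \<Rightarrow> nat \<Rightarrow> nat \<Rightarrow> nat \<Rightarrow> nat \<Rightarrow> com" where
  "push_frame X Y F C t ph = Push F 15 ;; copy 15 Y F t ;; Push F 15 ;; copy 15 X F t ;;
     Push F 15 ;; copy 15 C F t ;; Push F ph"

text \<open>The delimiter 15 lies outside the alphabet of the stored words; \<open>pop_word\<close>
  recognizes it by the \<open>peek\<close> value 16.\<close>

definition frame :: "nat \<Rightarrow> nat list \<Rightarrow> nat list \<Rightarrow> nat list \<Rightarrow> nat list" where
  "frame ph c x y = ph # c @ 15 # x @ 15 # y @ [15]"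

definition pop_word :: "nat \<Rightarrow> nat \<Rightarrow> nat \<Rightarrow> com" where
  "pop_word F t j = Loop F (\<lambda>s. s \<noteq> 16) (switch 15 F (\<lambda>a. Pop F ;; Push t a)) ;; Pop F ;; mv 15 t j"

definition pop_frame :: "nat \<Rightarrow> nat \<Rightarrow> nat \<Rightarrow> nat \<Rightarrow> nat \<Rightarrow> com" where
  "pop_frame X Y F C t = Pop F ;; pop_word F t C ;; pop_word F t X ;; pop_word F t Y"

lemma wp_pop_word_loop:
  assumes "F \<noteq> t" "\<sigma> F = w @ 15 # xs" "set w \<subseteq> {..<15}" "length w + length (\<sigma> t) \<le> B"
    "R (\<sigma>(F := 15 # xs, t := rev w @ \<sigma> t))"
  shows "wp B (Loop F (\<lambda>s. s \<noteq> 16) (switch 15 F (\<lambda>a. Pop F ;; Push t a))) R \<sigma>"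
  using assms
proof (induction w arbitrary: \<sigma>)
  case Nil
  then have "\<sigma>(F := 15 # xs, t := rev [] @ \<sigma> t) = \<sigma>" by (auto simp: fun_eq_iff)
  with Nil.prems(5) have "R \<sigma>" by (simp only:)
  with Nil show ?case by (intro wp_LoopF) simp_all
next
  case (Cons a w)
  let ?s = "\<sigma>(F := w @ 15 # xs, t := a # \<sigma> t)"
  have "wp B (Loop F (\<lambda>s. s \<noteq> 16) (switch 15 F (\<lambda>a. Pop F ;; Push t a))) R ?s"
    using Cons.prems by (intro Cons.IH) (auto elim!: back_subst[of R] simp: fun_eq_iff)
  moreover have "wp B (switch 15 F (\<lambda>a. Pop F ;; Push t a)) Q \<sigma>" if "Q ?s" for Q
    using Cons.prems that
    by (intro wp_switch[of \<sigma> F a "w @ 15 # xs"] wp_intros) (auto elim!: back_subst[of Q] simp: fun_eq_iff)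
  ultimately show ?case
    by (rule wp_Loop_via) (assumption | use Cons.prems in simp)+
qed

lemma wp_pop_word:
  assumes "distinct [F, t, j]" "\<sigma> F = w @ 15 # xs" "set w \<subseteq> {..<15}" "length w \<le> B" "\<sigma> t = []" "\<sigma> j = []"
    "R (\<sigma>(F := xs, j := w))"
  shows "wp B (pop_word F t j) R \<sigma>"
  unfolding pop_word_def
  by (intro wp_Seq wp_pop_word_loop[of _ _ _ w xs] wp_intros)
    (use assms in \<open>auto elim!: back_subst[of R] simp: fun_eq_iff\<close>)

lemma wp_pop_frame:
  assumes "distinct [X, Y, F, C, t]" "\<sigma> F = frame ph c x y @ fr"
    "set c \<subseteq> {..<15}" "length c \<le> B" "set x \<subseteq> {..<15}" "length x \<le> B" "set y \<subseteq> {..<15}" "length y \<le> B"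
    "\<sigma> t = []" "\<sigma> X = []" "\<sigma> Y = []" "\<sigma> C = []" "R (\<sigma>(F := fr, C := c, X := x, Y := y))"
  shows "wp B (pop_frame X Y F C t) R \<sigma>"
  unfolding pop_frame_def
  by (intro wp_Seq wp_Pop wp_pop_word[of F t C _ c "x @ 15 # y @ 15 # fr"]
      wp_pop_word[of F t X _ x "y @ 15 # fr"] wp_pop_word[of F t Y _ y fr])
    (use assms in \<open>auto elim!: back_subst[of R] simp: fun_eq_iff frame_def\<close>)

lemma wp_push_frame:
  assumes "distinct [X, Y, F, C, t]" "\<sigma> t = []" "set (\<sigma> C) \<subseteq> {..<15}" "set (\<sigma> X) \<subseteq> {..<15}" "set (\<sigma> Y) \<subseteq> {..<15}"
    "length (\<sigma> C) + length (\<sigma> X) + length (\<sigma> Y) + 4 + length (\<sigma> F) \<le> B"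
    "R (\<sigma>(F := frame ph (\<sigma> C) (\<sigma> X) (\<sigma> Y) @ \<sigma> F))"
  shows "wp B (push_frame X Y F C t ph) R \<sigma>"
  unfolding push_frame_def
  by (intro wp_intros)
    (use assms in \<open>auto elim!: back_subst[of R] simp: fun_eq_iff frame_def\<close>)

text \<open>
  The stack \<open>M\<close> holds the mode: 0 asks whether \<open>Y\<close> can be reached from \<open>X\<close> in at most
  \<open>2^|D|\<close> steps, 1 and 2 return the answers yes and no to the topmost frame, 3 and 4 are the final
  answers. A frame \<open>(ph, c, x, y)\<close> records that the midpoint \<open>c\<close> between \<open>x\<close> and \<open>y\<close> is being tried,
  and which half of the way (\<open>ph\<close>) is being explored.
\<close>

definition savitch_call :: "nat \<Rightarrow> nat \<Rightarrow> nat \<Rightarrow> nat \<Rightarrow> nat \<Rightarrow> nat \<Rightarrow> nat \<Rightarrow> nat \<Rightarrow> nat \<Rightarrow> nat \<Rightarrow> nat \<Rightarrow> com \<Rightarrow> com" where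
  "savitch_call X Y F D M C t u v f r sub = Branch D (\<lambda>s. s = 0)
     (copy 15 X t v ;; copy 15 Y u v ;; cmp 15 t u f ;;
      Branch f (\<lambda>s. s \<noteq> 0) (Pop f ;; Push M 1)
        (sub ;; Branch r (\<lambda>s. s \<noteq> 0) (Pop r ;; Push M 1) (Push M 2)) ;;
      clear X ;; clear Y)
     (Pop D ;; push_frame X Y F C t 0 ;; clear Y ;; Push M 0)"

text \<open>An empty \<open>F\<close> means that the outermost question is answered. After the first
  half (\<open>ph = 0\<close>, seen as 1) the second half is explored with the same midpoint; after
  the second half the answer is passed on and \<open>D\<close> regains the unit that the call
  removed.\<close>

definition savitch_yes :: "nat \<Rightarrow> nat \<Rightarrow> nat \<Rightarrow> nat \<Rightarrow> nat \<Rightarrow> nat \<Rightarrow> nat \<Rightarrow> com" where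
  "savitch_yes X Y F D M C t = Branch F (\<lambda>s. s = 0) (Push M 3)
     (Branch F (\<lambda>s. s = 1)
       (pop_frame X Y F C t ;; push_frame X Y F C t 1 ;; clear X ;; copy 15 C X t ;; clear C ;; Push M 0)
       (pop_frame X Y F C t ;; clear C ;; clear X ;; clear Y ;; Push D 0 ;; Push M 1))"

text \<open>Whichever half failed, the next midpoint is tried from its first half; when the
  midpoints are exhausted, the answer no is passed on.\<close>

definition savitch_no :: "nat \<Rightarrow> nat \<Rightarrow> nat \<Rightarrow> nat \<Rightarrow> nat \<Rightarrow> nat \<Rightarrow> nat \<Rightarrow> nat \<Rightarrow> nat \<Rightarrow> nat \<Rightarrow> nat \<Rightarrow> com" where
  "savitch_no l X Y F D M C t u v f = Branch F (\<lambda>s. s = 0) (Push M 4)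
     (pop_frame X Y F C t ;; inc C t ;; longer C l f t u v ;;
      Branch f (\<lambda>s. s \<noteq> 0)
       (Pop f ;; clear C ;; clear X ;; clear Y ;; Push D 0 ;; Push M 2)
       (push_frame X Y F C t 0 ;; clear Y ;; copy 15 C Y t ;; clear C ;; Push M 0))"

definition savitch_loop where
  "savitch_loop l X Y F D M C t u v f r sub = Loop M (\<lambda>s. s = 1 \<or> s = 2 \<or> s = 3)
     (switch 3 M (\<lambda>a. Pop M ;;
       (if a = 0 then savitch_call X Y F D M C t u v f r sub
        else if a = 1 then savitch_yes X Y F D M C t
        else savitch_no l X Y F D M C t u v f)))"

fun halving :: "nat \<Rightarrow> ('a \<Rightarrow> 'a \<Rightarrow> bool) \<Rightarrow> 'a set \<Rightarrow> 'a \<Rightarrow> 'a \<Rightarrow> bool" where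
  "halving 0 P W x y \<longleftrightarrow> x = y \<or> P x y"
| "halving (Suc d) P W x y \<longleftrightarrow> (\<exists>c\<in>W. halving d P W x c \<and> halving d P W c y)"

context
  fixes l X Y F D M C t u v f r B m :: nat and sub :: com and \<sigma> :: store and P :: "nat list \<Rightarrow> nat list \<Rightarrow> bool"
  assumes d: "distinct [l, X, Y, F, D, M, C, t, u, v, f, r]"
    and e: "\<forall>i\<in>{X, Y, F, D, M, C, t, u, v, f, r}. \<sigma> i = []"
    and l: "set (\<sigma> l) \<subseteq> {..<15}" "length (\<sigma> l) = m" "m + 1 < B"
    and sub: "\<And>x y k fr. x \<in> words m \<Longrightarrow> y \<in> words m \<Longrightarrow>
      wp B sub (\<lambda>\<tau>. \<tau> = \<sigma>(X := x, Y := y, D := replicate k 0, F := fr, r := if P x y then [0] else []))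
        (\<sigma>(X := x, Y := y, D := replicate k 0, F := fr))"
begin

text \<open>A normal form for stores: with the eleven working stacks as arguments, a chain of
  updates simplifies by position, and two stores are compared argument by argument.\<close>

definition slots :: "nat list \<Rightarrow> nat list \<Rightarrow> nat list \<Rightarrow> nat list \<Rightarrow> nat list \<Rightarrow> nat list \<Rightarrow>
    nat list \<Rightarrow> nat list \<Rightarrow> nat list \<Rightarrow> nat list \<Rightarrow> nat list \<Rightarrow> store" where
  "slots m1 x y dd fr c t1 u1 v1 f1 r1 = (\<lambda>i.
     if i = M then m1 else if i = X then x else if i = Y then y else if i = D then dd else if i = F then fr else if i = C then c else if i = t then t1 else if i = u then u1 else if i = v then v1 else if i = f then f1 else if i = r then r1 else \<sigma> i)"

lemma d_rev: "distinct [r, f, v, u, t, C, M, D, F, Y, X, l]"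
  using d by auto

lemmas neq = d[simplified] d_rev[simplified]

lemma slots_upd:
  "(slots m1 x y dd fr c t1 u1 v1 f1 r1)(M := z) = slots z x y dd fr c t1 u1 v1 f1 r1"
  "(slots m1 x y dd fr c t1 u1 v1 f1 r1)(X := z) = slots m1 z y dd fr c t1 u1 v1 f1 r1"
  "(slots m1 x y dd fr c t1 u1 v1 f1 r1)(Y := z) = slots m1 x z dd fr c t1 u1 v1 f1 r1"
  "(slots m1 x y dd fr c t1 u1 v1 f1 r1)(D := z) = slots m1 x y z fr c t1 u1 v1 f1 r1"
  "(slots m1 x y dd fr c t1 u1 v1 f1 r1)(F := z) = slots m1 x y dd z c t1 u1 v1 f1 r1"
  "(slots m1 x y dd fr c t1 u1 v1 f1 r1)(C := z) = slots m1 x y dd fr z t1 u1 v1 f1 r1"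
  "(slots m1 x y dd fr c t1 u1 v1 f1 r1)(t := z) = slots m1 x y dd fr c z u1 v1 f1 r1"
  "(slots m1 x y dd fr c t1 u1 v1 f1 r1)(u := z) = slots m1 x y dd fr c t1 z v1 f1 r1"
  "(slots m1 x y dd fr c t1 u1 v1 f1 r1)(v := z) = slots m1 x y dd fr c t1 u1 z f1 r1"
  "(slots m1 x y dd fr c t1 u1 v1 f1 r1)(f := z) = slots m1 x y dd fr c t1 u1 v1 z r1"
  "(slots m1 x y dd fr c t1 u1 v1 f1 r1)(r := z) = slots m1 x y dd fr c t1 u1 v1 f1 z"
  subgoal by (rule ext, rename_tac i, case_tac "i = M") (simp_all add: slots_def neq)
  subgoal by (rule ext, rename_tac i, case_tac "i = X") (simp_all add: slots_def neq)
  subgoal by (rule ext, rename_tac i, case_tac "i = Y") (simp_all add: slots_def neq)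
  subgoal by (rule ext, rename_tac i, case_tac "i = D") (simp_all add: slots_def neq)
  subgoal by (rule ext, rename_tac i, case_tac "i = F") (simp_all add: slots_def neq)
  subgoal by (rule ext, rename_tac i, case_tac "i = C") (simp_all add: slots_def neq)
  subgoal by (rule ext, rename_tac i, case_tac "i = t") (simp_all add: slots_def neq)
  subgoal by (rule ext, rename_tac i, case_tac "i = u") (simp_all add: slots_def neq)
  subgoal by (rule ext, rename_tac i, case_tac "i = v") (simp_all add: slots_def neq)
  subgoal by (rule ext, rename_tac i, case_tac "i = f") (simp_all add: slots_def neq)
  subgoal by (rule ext, rename_tac i, case_tac "i = r") (simp_all add: slots_def neq)
  done

lemma slots_get:
  "slots m1 x y dd fr c t1 u1 v1 f1 r1 M = m1"
  "slots m1 x y dd fr c t1 u1 v1 f1 r1 X = x"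
  "slots m1 x y dd fr c t1 u1 v1 f1 r1 Y = y"
  "slots m1 x y dd fr c t1 u1 v1 f1 r1 D = dd"
  "slots m1 x y dd fr c t1 u1 v1 f1 r1 F = fr"
  "slots m1 x y dd fr c t1 u1 v1 f1 r1 C = c"
  "slots m1 x y dd fr c t1 u1 v1 f1 r1 t = t1"
  "slots m1 x y dd fr c t1 u1 v1 f1 r1 u = u1"
  "slots m1 x y dd fr c t1 u1 v1 f1 r1 v = v1"
  "slots m1 x y dd fr c t1 u1 v1 f1 r1 f = f1"
  "slots m1 x y dd fr c t1 u1 v1 f1 r1 r = r1"
  "slots m1 x y dd fr c t1 u1 v1 f1 r1 l = \<sigma> l"
  by (simp_all add: slots_def neq)

lemma slots_Nil: "slots [] [] [] [] [] [] [] [] [] [] [] = \<sigma>"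
  using e by (intro ext) (auto simp: slots_def)

abbreviation (input) sstate :: "nat \<Rightarrow> nat list \<Rightarrow> nat list \<Rightarrow> nat \<Rightarrow> nat list \<Rightarrow> store" where
  "sstate a x y k fr \<equiv> slots [a] x y (replicate k 0) fr [] [] [] [] [] []"

lemma sub_slots:
  assumes "x \<in> words m" "y \<in> words m"
    "Q (slots [] x y (replicate k 0) fr [] [] [] [] [] (if P x y then [0] else []))"
  shows "wp B sub Q (slots [] x y (replicate k 0) fr [] [] [] [] [] [])"
proof -
  have "\<sigma>(X := x, Y := y, D := replicate k 0, F := fr) = slots [] x y (replicate k 0) fr [] [] [] [] [] []"
    using slots_upd[of "[]" "[]" "[]" "[]" "[]" "[]" "[]" "[]" "[]" "[]" "[]"] by (simp only: slots_Nil slots_upd)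
  from wp_mono[OF sub[OF assms(1,2), of k fr, unfolded this slots_upd], of Q] assms(3) show ?thesis by blast
qed

abbreviation (input) "SL \<equiv> savitch_loop l X Y F D M C t u v f r sub"

lemma savitch_step:
  assumes "wp B SL Q s" "a < 3"
    "\<And>R. R s \<Longrightarrow> wp B (if a = 0 then savitch_call X Y F D M C t u v f r sub
        else if a = 1 then savitch_yes X Y F D M C t
        else savitch_no l X Y F D M C t u v f) R ((sstate a x y k fr)(M := []))"
  shows "wp B SL Q (sstate a x y k fr)"
proof -
  have M: "sstate a x y k fr M = [a]" by (simp add: slots_get)
  have "wp B (switch 3 M (\<lambda>a. Pop M ;;
       (if a = 0 then savitch_call X Y F D M C t u v f r sub
        else if a = 1 then savitch_yes X Y F D M C t
        else savitch_no l X Y F D M C t u v f))) R (sstate a x y k fr)" if "R s" for R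
    by (rule wp_switch[where \<sigma> = "sstate a x y k fr" and i = M, OF M assms(2)], intro wp_Seq wp_Pop) (use assms(3)[of R, OF that] M in simp)
  with assms(1) show ?thesis unfolding savitch_loop_def
    by (rule wp_Loop_via) (assumption | use M assms(2) in auto)+
qed

lemma savitch_descend:
  assumes "wp B SL Q (sstate 0 x [] k (frame 0 [] x y @ fr))" "x \<in> words m" "y \<in> words m"
    "length fr + 3 * m + 4 \<le> B"
  shows "wp B SL Q (sstate 0 x y (Suc k) fr)"
proof (rule savitch_step[OF assms(1)])
  fix R assume R: "R (sstate 0 x [] k (frame 0 [] x y @ fr))"
  have "wp B (savitch_call X Y F D M C t u v f r sub) R ((sstate 0 x y (Suc k) fr)(M := []))"
    unfolding savitch_call_def
    by (intro wp_BranchF wp_Seq wp_Pop wp_push_frame wp_clear wp_Push back_subst[of R, OF R])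
      (use l assms(2-) in \<open>simp_all add: slots_upd slots_get words_def neq frame_def\<close>)
  then show "wp B (if (0::nat) = 0 then savitch_call X Y F D M C t u v f r sub
        else if (0::nat) = 1 then savitch_yes X Y F D M C t
        else savitch_no l X Y F D M C t u v f) R ((sstate 0 x y (Suc k) fr)(M := []))" by simp
qed simp

lemma savitch_base:
  assumes "wp B SL Q (sstate (if x = y \<or> P x y then 1 else 2) [] [] 0 fr)" "x \<in> words m" "y \<in> words m"
  shows "wp B SL Q (sstate 0 x y 0 fr)"
proof (rule savitch_step[OF assms(1)])
  fix R assume R: "R (sstate (if x = y \<or> P x y then 1 else 2) [] [] 0 fr)"
  have "wp B (savitch_call X Y F D M C t u v f r sub) R ((sstate 0 x y 0 fr)(M := []))"
  proof (cases "x = y")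
    case True
    show ?thesis unfolding savitch_call_def
      by (intro wp_BranchT[of _ _ D] wp_Seq wp_copy wp_cmp wp_BranchT[of _ _ f] wp_Pop wp_Push wp_clear
          back_subst[of R, OF R])
        (use l assms(2-) True in \<open>simp_all add: slots_upd slots_get words_def neq\<close>)
  next
    case False
    have "wp B sub (wp B (Branch r (\<lambda>s. s \<noteq> 0) (Pop r ;; Push M 1) (Push M 2))
        (wp B (clear X ;; clear Y) R)) (slots [] x y (replicate 0 0) fr [] [] [] [] [] [])"
    proof (rule sub_slots[OF assms(2,3)], cases "P x y")
      case True
      show "wp B (Branch r (\<lambda>s. s \<noteq> 0) (Pop r ;; Push M 1) (Push M 2)) (wp B (clear X ;; clear Y) R)
          (slots [] x y (replicate 0 0) fr [] [] [] [] [] (if P x y then [0] else []))"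
        by (intro wp_BranchT wp_Seq wp_Pop wp_Push wp_clear back_subst[of R, OF R])
          (use l True False in \<open>simp_all add: slots_upd slots_get\<close>)
    next
      case no: False
      show "wp B (Branch r (\<lambda>s. s \<noteq> 0) (Pop r ;; Push M 1) (Push M 2)) (wp B (clear X ;; clear Y) R)
          (slots [] x y (replicate 0 0) fr [] [] [] [] [] (if P x y then [0] else []))"
        by (intro wp_BranchF wp_Seq wp_Pop wp_Push wp_clear back_subst[of R, OF R])
          (use l no False in \<open>simp_all add: slots_upd slots_get\<close>)
    qed
    then have sub': "wp B sub (wp B (Branch r (\<lambda>s. s \<noteq> 0) (Pop r ;; Push M 1) (Push M 2))
        (wp B (clear X ;; clear Y) R)) s'" if "slots [] x y (replicate 0 0) fr [] [] [] [] [] [] = s'" for s'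
      using that by simp
    show ?thesis unfolding savitch_call_def
      by (intro wp_BranchT[of _ _ D] wp_Seq wp_copy wp_cmp wp_BranchF[of _ _ f] sub')
        (use l assms(2-) False in \<open>simp_all add: slots_upd slots_get words_def neq\<close>)
  qed
  then show "wp B (if (0::nat) = 0 then savitch_call X Y F D M C t u v f r sub
        else if (0::nat) = 1 then savitch_yes X Y F D M C t
        else savitch_no l X Y F D M C t u v f) R ((sstate 0 x y 0 fr)(M := []))" by simp
qed simp

lemma savitch_yes_left:
  assumes "wp B SL Q (sstate 0 c y k (frame 1 c x y @ fr))" "c \<in> words m" "x \<in> words m" "y \<in> words m"
    "length fr + 3 * m + 4 \<le> B"
  shows "wp B SL Q (sstate 1 [] [] k (frame 0 c x y @ fr))"
proof (rule savitch_step[OF assms(1)])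
  fix R assume R: "R (sstate 0 c y k (frame 1 c x y @ fr))"
  have "wp B (savitch_yes X Y F D M C t) R ((sstate 1 [] [] k (frame 0 c x y @ fr))(M := []))"
    unfolding savitch_yes_def
    by (intro wp_BranchF[of _ _ _ _ _ _ "Push M 3"] wp_BranchT wp_Seq wp_pop_frame[of X Y F C t _ 0 c x y fr]
        wp_push_frame wp_clear wp_copy wp_Push back_subst[of R, OF R])
      (use l assms(2-) in \<open>simp_all add: slots_upd slots_get words_def neq frame_def\<close>)
  then show "wp B (if (1::nat) = 0 then savitch_call X Y F D M C t u v f r sub
        else if (1::nat) = 1 then savitch_yes X Y F D M C t
        else savitch_no l X Y F D M C t u v f) R ((sstate 1 [] [] k (frame 0 c x y @ fr))(M := []))" by simp
qed simp

lemma savitch_yes_right: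
  assumes "wp B SL Q (sstate 1 [] [] (Suc k) fr)" "c \<in> words m" "x \<in> words m" "y \<in> words m" "k < B"
  shows "wp B SL Q (sstate 1 [] [] k (frame 1 c x y @ fr))"
proof (rule savitch_step[OF assms(1)])
  fix R assume R: "R (sstate 1 [] [] (Suc k) fr)"
  have "wp B (savitch_yes X Y F D M C t) R ((sstate 1 [] [] k (frame 1 c x y @ fr))(M := []))"
    unfolding savitch_yes_def
    by (intro wp_BranchF wp_Seq wp_pop_frame[of X Y F C t _ 1 c x y fr] wp_clear wp_Push back_subst[of R, OF R])
      (use l assms(2-) in \<open>simp_all add: slots_upd slots_get words_def neq frame_def\<close>)
  then show "wp B (if (1::nat) = 0 then savitch_call X Y F D M C t u v f r sub
        else if (1::nat) = 1 then savitch_yes X Y F D M C t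
        else savitch_no l X Y F D M C t u v f) R ((sstate 1 [] [] k (frame 1 c x y @ fr))(M := []))" by simp
qed simp

lemma savitch_no_step:
  assumes "wp B SL Q (if length (next_word c) \<le> m then sstate 0 x (next_word c) k (frame 0 (next_word c) x y @ fr)
      else sstate 2 [] [] (Suc k) fr)"
    "c \<in> words m" "x \<in> words m" "y \<in> words m" "length fr + 3 * m + 4 \<le> B" "k < B"
  shows "wp B SL Q (sstate 2 [] [] k (frame ph c x y @ fr))"
proof (rule savitch_step[OF assms(1)])
  fix R assume R: "R (if length (next_word c) \<le> m then sstate 0 x (next_word c) k (frame 0 (next_word c) x y @ fr)
      else sstate 2 [] [] (Suc k) fr)"
  have n: "set (next_word c) \<subseteq> {..<15}" "length (next_word c) \<le> m + 1"
    using assms(2) set_next_word length_next_word(2)[of c] by (auto simp: words_def)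
  have "wp B (savitch_no l X Y F D M C t u v f) R ((sstate 2 [] [] k (frame ph c x y @ fr))(M := []))"
  proof (cases "length (next_word c) \<le> m")
    case True
    show ?thesis unfolding savitch_no_def
      by (intro wp_BranchF[of _ _ _ _ _ _ "Push M 4"] wp_Seq wp_pop_frame[of X Y F C t _ ph c x y fr] wp_inc
          wp_longer wp_BranchF[of _ _ f] wp_push_frame wp_clear wp_copy wp_Push back_subst[of R, OF R])
        (use l assms(2-) n True in \<open>simp_all add: slots_upd slots_get words_def neq frame_def\<close>)
  next
    case False
    show ?thesis unfolding savitch_no_def
      by (intro wp_BranchF[of _ _ F] wp_Seq wp_pop_frame[of X Y F C t _ ph c x y fr] wp_inc
          wp_longer wp_BranchT[of _ _ f] wp_Pop wp_clear wp_Push back_subst[of R, OF R])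
        (use l assms(2-) n False in \<open>simp_all add: slots_upd slots_get words_def neq frame_def\<close>)
  qed
  then show "wp B (if (2::nat) = 0 then savitch_call X Y F D M C t u v f r sub
        else if (2::nat) = 1 then savitch_yes X Y F D M C t
        else savitch_no l X Y F D M C t u v f) R ((sstate 2 [] [] k (frame ph c x y @ fr))(M := []))" by simp
qed simp

text \<open>The statement is in continuation style: whatever holds after the loop when started with
  the answer also holds when started with the question. So it can be used for each half inside the
  proof for the whole. Each level of the recursion adds one frame, that is three words and four
  further letters, hence the bound \<open>k * (3 * m + 4)\<close>.\<close>

lemma savitch_query:
  assumes "x \<in> words m" "y \<in> words m" "length fr + k * (3 * m + 4) \<le> B"
    "wp B SL Q (sstate (if halving k P (words m) x y then 1 else 2) [] [] k fr)"
  shows "wp B SL Q (sstate 0 x y k fr)"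
  using assms
proof (induction k arbitrary: x y fr Q)
  case 0
  then show ?case by (intro savitch_base) auto
next
  case (Suc k)
  let ?h = "halving k P (words m)"
  let ?E = "\<lambda>i. \<exists>j\<ge>i. length (nth_word j) \<le> m \<and> ?h x (nth_word j) \<and> ?h (nth_word j) y"
  have B: "length fr + 3 * m + 4 \<le> B" "length fr + (3 * m + 4) + k * (3 * m + 4) \<le> B"
    using Suc.prems(3) by (simp_all add: algebra_simps)
  have "k * 1 \<le> k * (3 * m + 4)" by (intro mult_left_mono) auto
  with B have kB: "k < B" by linarith
  have fl: "length (frame ph c x y @ fr) + k * (3 * m + 4) \<le> B" if "c \<in> words m" for ph c
    using that Suc.prems(1,2) B by (auto simp: frame_def words_def)
  \<comment> \<open>\<open>?E i\<close> says that a midpoint with index at least \<open>i\<close>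
    works. The induction on \<open>i\<close> inside the induction on the depth follows the order in
    which the midpoints are tried.\<close>
  have "wp B SL Q (sstate 0 x (nth_word i) k (frame 0 (nth_word i) x y @ fr))"
    if "length (nth_word i) \<le> m" "wp B SL Q (sstate (if ?E i then 1 else 2) [] [] (Suc k) fr)" for i
    using that
  proof (induction i rule: nth_word_induct[of m])
    case (1 i)
    then show ?case by simp
  next
    case (2 i)
    let ?c = "nth_word i"
    have c: "?c \<in> words m" using 2 set_nth_word by (auto simp: words_def)
    \<comment> \<open>Both halves report failure in the same way; this serves for
      \<open>ph = 0\<close> and for \<open>ph = 1\<close>.\<close>
    have no: "wp B SL Q (sstate 2 [] [] k (frame ph ?c x y @ fr))" if "\<not> (?h x ?c \<and> ?h ?c y)" for ph
    proof (rule savitch_no_step)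
      have E: "?E i \<longleftrightarrow> ?E (Suc i)"
        using that ex_from_Suc[of i "\<lambda>j. length (nth_word j) \<le> m \<and> ?h x (nth_word j) \<and> ?h (nth_word j) y"] by blast
      show "wp B SL Q (if length (next_word ?c) \<le> m then sstate 0 x (next_word ?c) k (frame 0 (next_word ?c) x y @ fr)
        else sstate 2 [] [] (Suc k) fr)"
      proof (cases "length (nth_word (Suc i)) \<le> m")
        case True
        from 2(2)[OF True] 2(4)[unfolded E] True show ?thesis by (simp only: nth_word_Suc[symmetric] if_True)
      next
        case False
        then have "\<not> ?E (Suc i)" using length_nth_word_mono by (meson order_trans)
        with 2(4) E False show ?thesis by (simp only: nth_word_Suc[symmetric] if_False)
      qed
    qed (use c Suc.prems B kB in auto)
    show ?case
    proof (rule Suc.IH)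
      show "wp B SL Q (sstate (if ?h x ?c then 1 else 2) [] [] k (frame 0 ?c x y @ fr))"
      proof (cases "?h x ?c")
        case True
        have "wp B SL Q (sstate 1 [] [] k (frame 0 ?c x y @ fr))"
        proof (rule savitch_yes_left[OF Suc.IH])
          show "wp B SL Q (sstate (if ?h ?c y then 1 else 2) [] [] k (frame 1 ?c x y @ fr))"
          proof (cases "?h ?c y")
            case yes: True
            with True 2(3) have "?E i" by blast
            with 2(4) have "wp B SL Q (sstate 1 [] [] (Suc k) fr)" by simp
            then have "wp B SL Q (sstate 1 [] [] k (frame 1 ?c x y @ fr))"
              by (rule savitch_yes_right) (use c Suc.prems kB in auto)
            with yes show ?thesis by simp
          next
            case False
            with no[of 1] show ?thesis by simp
          qed
        qed (use c Suc.prems fl B in auto)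
        with True show ?thesis by simp
      next
        case False
        with no[of 0] show ?thesis by simp
      qed
    qed (use c Suc.prems fl in auto)
  qed
  from this[of 0] Suc.prems(4)
  have "wp B SL Q (sstate 0 x [] k (frame 0 [] x y @ fr))"
    by (simp add: ex_words_iff)
  then show ?case by (rule savitch_descend) (use Suc.prems B in auto)
qed

lemma savitch_run:
  assumes "x \<in> words m" "y \<in> words m" "k * (3 * m + 4) \<le> B"
    "Q (sstate (if halving k P (words m) x y then 3 else 4) [] [] k [])"
  shows "wp B SL Q (sstate 0 x y k [])"
proof (rule savitch_query[OF assms(1,2)])
  let ?b = "halving k P (words m) x y"
  have "wp B SL Q (sstate a [] [] k [])" if "3 \<le> a" "Q (sstate a [] [] k [])" for a
    unfolding savitch_loop_def
    by (rule wp_LoopF) (use that in \<open>simp_all add: slots_get\<close>)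
  with assms(4) have 1: "wp B SL Q (sstate (if ?b then 3 else 4) [] [] k [])" by simp
  show "wp B SL Q (sstate (if ?b then 1 else 2) [] [] k [])"
  proof (rule savitch_step[OF 1])
    fix R assume R: "R (sstate (if ?b then 3 else 4) [] [] k [])"
    show "wp B (if (if ?b then 1 else 2::nat) = 0 then savitch_call X Y F D M C t u v f r sub
        else if (if ?b then 1 else 2::nat) = 1 then savitch_yes X Y F D M C t
        else savitch_no l X Y F D M C t u v f) R ((sstate (if ?b then 1 else 2) [] [] k [])(M := []))"
    proof (cases ?b)
      case True
      have "wp B (savitch_yes X Y F D M C t) R ((sstate 1 [] [] k [])(M := []))"
        unfolding savitch_yes_def
        by (intro wp_BranchT[of _ _ F] wp_Push back_subst[of R, OF R]) (use l True in \<open>simp_all add: slots_upd slots_get neq\<close>)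
      with True show ?thesis by simp
    next
      case False
      have "wp B (savitch_no l X Y F D M C t u v f) R ((sstate 2 [] [] k [])(M := []))"
        unfolding savitch_no_def
        by (intro wp_BranchT[of _ _ F] wp_Push back_subst[of R, OF R]) (use l False in \<open>simp_all add: slots_upd slots_get neq\<close>)
      with False show ?thesis by simp
    qed
  qed simp
qed (use assms in auto)

lemma wp_savitch:
  assumes "x \<in> words m" "y \<in> words m" "k * (3 * m + 4) \<le> B"
    "Q (\<sigma>(M := [if halving k P (words m) x y then 3 else 4], D := replicate k 0))"
  shows "wp B SL Q (\<sigma>(X := x, Y := y, D := replicate k 0, M := [0]))"
proof -
  note upd = slots_upd[of "[]" "[]" "[]" "[]" "[]" "[]" "[]" "[]" "[]" "[]" "[]"]
  have 1: "\<sigma>(X := x, Y := y, D := replicate k 0, M := [0]) = sstate 0 x y k []"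
    using upd by (simp only: slots_Nil slots_upd)
  have 2: "\<sigma>(M := [a], D := replicate k 0) = sstate a [] [] k []" for a
    using upd by (simp only: slots_Nil slots_upd)
  show ?thesis unfolding 1
    by (rule savitch_run[OF assms(1-3)]) (use assms(4)[unfolded 2] in \<open>simp split: if_splits\<close>)
qed

end

section \<open>Recursive halving and reflexive transitive closure\<close>

lemma halving_relpow:
  assumes "x \<in> W" "y \<in> W"
  shows "halving d P W x y \<longleftrightarrow> (\<exists>n \<le> 2 ^ d. (x, y) \<in> {(a, b). a \<in> W \<and> b \<in> W \<and> P a b} ^^ n)"
    (is "_ \<longleftrightarrow> (\<exists>n \<le> 2 ^ d. (x, y) \<in> ?R ^^ n)")
  using assms
proof (induction d arbitrary: x y)
  case 0
  have "(\<exists>n\<le>2 ^ 0. (x, y) \<in> ?R ^^ n) \<longleftrightarrow> (x, y) \<in> ?R ^^ 0 \<or> (x, y) \<in> ?R ^^ 1"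
    by (auto simp: le_Suc_eq)
  then show ?case using 0 by auto
next
  case (Suc d)
  have "halving (Suc d) P W x y \<longleftrightarrow> (\<exists>c\<in>W. (\<exists>n \<le> 2 ^ d. (x, c) \<in> ?R ^^ n) \<and> (\<exists>n \<le> 2 ^ d. (c, y) \<in> ?R ^^ n))"
    using Suc by auto
  also have "\<dots> \<longleftrightarrow> (\<exists>n \<le> 2 ^ Suc d. (x, y) \<in> ?R ^^ n)"
  proof
    assume "\<exists>c\<in>W. (\<exists>n \<le> 2 ^ d. (x, c) \<in> ?R ^^ n) \<and> (\<exists>n \<le> 2 ^ d. (c, y) \<in> ?R ^^ n)"
    then obtain c n n' where "n \<le> 2 ^ d" "n' \<le> 2 ^ d" "(x, c) \<in> ?R ^^ n" "(c, y) \<in> ?R ^^ n'" by blast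
    then show "\<exists>n \<le> 2 ^ Suc d. (x, y) \<in> ?R ^^ n"
      by (intro exI[of _ "n + n'"]) (auto simp: relpow_add)
  next
    assume "\<exists>n \<le> 2 ^ Suc d. (x, y) \<in> ?R ^^ n"
    then obtain n where n: "n \<le> 2 ^ Suc d" "(x, y) \<in> ?R ^^ n" by blast
    \<comment> \<open>The path is cut here so that neither part has more than \<open>2 ^ d\<close>
      steps; if the path is short, the second part is empty.\<close>
    define k where "k = min n (2 ^ d)"
    have "n = k + (n - k)" by (simp add: k_def)
    with n(2) have "(x, y) \<in> ?R ^^ k O ?R ^^ (n - k)" by (metis relpow_add)
    then obtain c where c: "(x, c) \<in> ?R ^^ k" "(c, y) \<in> ?R ^^ (n - k)" by blast
    have "c \<in> W" using c(1) Suc.prems(1) by (cases k) auto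
    moreover have "k \<le> 2 ^ d" "n - k \<le> 2 ^ d" using n(1) by (auto simp: k_def)
    ultimately show "\<exists>c\<in>W. (\<exists>n \<le> 2 ^ d. (x, c) \<in> ?R ^^ n) \<and> (\<exists>n \<le> 2 ^ d. (c, y) \<in> ?R ^^ n)"
      using c by blast
  qed
  finally show ?case .
qed

text \<open>Some path has at most as many steps as the relation has pairs. There are at most
  \<open>16 ^ m\<close> words and thus at most \<open>2 ^ (8 * m)\<close> pairs, whence the
  recursion depth \<open>8 * m\<close>.\<close>

lemma halving_rtrancl:
  assumes "x \<in> words m" "y \<in> words m"
  shows "halving (8 * m) P (words m) x y \<longleftrightarrow> (x, y) \<in> {(a, b). a \<in> words m \<and> b \<in> words m \<and> P a b}\<^sup>*"
    (is "_ \<longleftrightarrow> (x, y) \<in> ?R\<^sup>*")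
proof -
  have sub: "?R \<subseteq> words m \<times> words m" by auto
  then have fin: "finite ?R" using finite_words finite_subset by blast
  have "card ?R \<le> card (words m \<times> words m)" using sub finite_words by (intro card_mono) auto
  also have "\<dots> \<le> 16 ^ m * 16 ^ m" using card_words[of m] by (simp add: card_cartesian_product mult_mono)
  also have "\<dots> = (2 ^ 4) ^ m * (2 ^ 4) ^ m" by simp
  also have "\<dots> = 2 ^ (8 * m)" by (simp only: power_mult[symmetric] power_add[symmetric]) simp
  finally have c: "card ?R \<le> 2 ^ (8 * m)" .
  show ?thesis
  proof
    assume "halving (8 * m) P (words m) x y"
    then show "(x, y) \<in> ?R\<^sup>*" using assms by (auto simp: halving_relpow dest: relpow_imp_rtrancl)
  next
    assume "(x, y) \<in> ?R\<^sup>*"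
    then obtain n where "n \<le> card ?R" "(x, y) \<in> ?R ^^ n"
      using rtrancl_finite_eq_relpow[OF fin] by auto
    moreover from this(1) c have "n \<le> 2 ^ (8 * m)" by linarith
    ultimately show "halving (8 * m) P (words m) x y" using assms by (subst halving_relpow) blast+
  qed
qed

subsection \<open>Formulas\<close>

datatype trm = Var nat | Lit "nat list"

text \<open>
  Variables are de Bruijn levels: at level \<open>b\<close> the variables below \<open>b\<close> are free, \<open>Ex\<close> binds variable
  \<open>b\<close>, and \<open>TC\<close> binds \<open>b\<close> and \<open>b + 1\<close>. Variable 0 is a ruler whose length bounds the quantifiers.
\<close>

datatype fm =
    Eq nat "trm list"
  | Neg fm
  | And fm fm
  | Ex fm
  | TC fm nat nat

fun val :: "store \<Rightarrow> trm \<Rightarrow> nat list" where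
  "val e (Var v) = e v"
| "val e (Lit w) = w"

fun eval :: "nat \<Rightarrow> store \<Rightarrow> fm \<Rightarrow> bool" where
  "eval b e (Eq x ts) \<longleftrightarrow> e x = concat (map (val e) ts)"
| "eval b e (Neg f) \<longleftrightarrow> \<not> eval b e f"
| "eval b e (And f g) \<longleftrightarrow> eval b e f \<and> eval b e g"
| "eval b e (Ex f) \<longleftrightarrow> (\<exists>a\<in>words (length (e 0)). eval (Suc b) (e(b := a)) f)"
| "eval b e (TC f x y) \<longleftrightarrow> (e x, e y) \<in>
     {(a, a'). a \<in> words (length (e 0)) \<and> a' \<in> words (length (e 0)) \<and>
       eval (b + 2) (e(b := a, Suc b := a')) f}\<^sup>*"

fun ok_trm :: "nat \<Rightarrow> trm \<Rightarrow> bool" where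
  "ok_trm b (Var v) \<longleftrightarrow> v < b"
| "ok_trm b (Lit w) \<longleftrightarrow> set w \<subseteq> {..<15}"

fun ok :: "nat \<Rightarrow> fm \<Rightarrow> bool" where
  "ok b (Eq x ts) \<longleftrightarrow> x < b \<and> (\<forall>t\<in>set ts. ok_trm b t)"
| "ok b (Neg f) \<longleftrightarrow> ok b f"
| "ok b (And f g) \<longleftrightarrow> ok b f \<and> ok b g"
| "ok b (Ex f) \<longleftrightarrow> ok (Suc b) f"
| "ok b (TC f x y) \<longleftrightarrow> x < b \<and> y < b \<and> ok (b + 2) f"

text \<open>The stack of variable \<open>v\<close> is \<open>8 v\<close>; the stacks in between are working space of level \<open>v\<close>.\<close>

fun build :: "nat \<Rightarrow> nat \<Rightarrow> trm list \<Rightarrow> com" where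
  "build s t [] = Done"
| "build s t (Var v # ts) = build s t ts ;; copy 15 (8 * v) s t"
| "build s t (Lit w # ts) = build s t ts ;; push_word s w"

fun copies :: "nat \<Rightarrow> nat \<Rightarrow> nat \<Rightarrow> nat \<Rightarrow> com" where
  "copies 0 x y t = Done"
| "copies (Suc n) x y t = copy 15 x y t ;; copies n x y t"

text \<open>The answer of a formula at level \<open>b\<close> is left on stack \<open>8 * b\<close>,
  which is empty before. So the body of \<open>Ex\<close> answers on \<open>8 * b + 8\<close> and
  the body of \<open>TC\<close>, two levels up, on \<open>8 * b + 16\<close>. The closure keeps its
  endpoints on the stacks of the variables that it binds, where the body reads them; eight copies of
  the ruler give the recursion depth.\<close>

fun comp :: "nat \<Rightarrow> fm \<Rightarrow> com" where
  "comp b (Eq x ts) = build (8*b+1) (8*b+3) ts ;; copy 15 (8*x) (8*b+2) (8*b+3) ;; cmp 15 (8*b+1) (8*b+2) (8*b)"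
| "comp b (Neg f) = comp b f ;; Branch (8*b) (\<lambda>s. s \<noteq> 0) (Pop (8*b)) (Push (8*b) 0)"
| "comp b (And f g) = comp b f ;; Branch (8*b) (\<lambda>s. s \<noteq> 0) (Pop (8*b) ;; comp b g) Done"
| "comp b (Ex f) = search (8*b) 0 (8*b+8) (8*b+1) (8*b+2) (8*b+3) (8*b+4) (comp (Suc b) f)"
| "comp b (TC f x y) = copy 15 (8*x) (8*b) (8*b+5) ;; copy 15 (8*y) (8*b+8) (8*b+5) ;;
     copies 8 0 (8*b+2) (8*b+5) ;; Push (8*b+3) 0 ;;
     savitch_loop 0 (8*b) (8*b+8) (8*b+1) (8*b+2) (8*b+3) (8*b+4) (8*b+5) (8*b+6) (8*b+7) (8*b+9) (8*b+16)
       (comp (b + 2) f) ;;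
     clear (8*b+2) ;; Branch (8*b+3) (\<lambda>s. s = 4) (Pop (8*b+3) ;; Push (8*b) 0) (Pop (8*b+3))"

fun trm_size :: "trm \<Rightarrow> nat" where
  "trm_size (Var v) = 1"
| "trm_size (Lit w) = length w"

text \<open>Chosen so that \<open>cost f * (m + 1)^2\<close> bounds the heights of all stacks. The
  square comes from Savitch's frames: \<open>8 * m\<close> of them with at most
  \<open>3 * m + 4\<close> letters each, which the summand 40 covers.\<close>

fun cost :: "fm \<Rightarrow> nat" where
  "cost (Eq x ts) = 2 + sum_list (map trm_size ts)"
| "cost (Neg f) = cost f + 1"
| "cost (And f g) = cost f + cost g"
| "cost (Ex f) = cost f + 4"
| "cost (TC f x y) = cost f + 40"

section \<open>Correctness of compiled formulas\<close>

lemma wp_build: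
  assumes "\<forall>v. 8 * v \<noteq> s" "\<forall>v. 8 * v \<noteq> t" "s \<noteq> t" "\<sigma> t = []" "\<sigma> s = []"
    "\<forall>v<b. \<sigma> (8 * v) \<in> words m" "\<forall>x\<in>set ts. ok_trm b x" "sum_list (map trm_size ts) * (m + 1) \<le> B"
    "Q (\<sigma>(s := concat (map (val (\<lambda>v. \<sigma> (8 * v))) ts)))"
  shows "wp B (build s t ts) Q \<sigma> \<and>
    length (concat (map (val (\<lambda>v. \<sigma> (8 * v))) ts)) \<le> sum_list (map trm_size ts) * (m + 1) \<and>
    set (concat (map (val (\<lambda>v. \<sigma> (8 * v))) ts)) \<subseteq> {..<15}"
  using assms(7-)
proof (induction ts arbitrary: Q)
  case Nil
  then show ?case using assms(5) by (auto intro!: wp_Done elim!: back_subst[of Q] simp: fun_eq_iff)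
next
  case (Cons x ts)
  let ?c = "concat (map (val (\<lambda>v. \<sigma> (8 * v))) ts)"
  have le: "sum_list (map trm_size ts) * (m + 1) \<le> B" using Cons.prems(2) by (simp add: algebra_simps)
  have IH: "R (\<sigma>(s := ?c)) \<Longrightarrow> wp B (build s t ts) R \<sigma>"
    "length ?c \<le> sum_list (map trm_size ts) * (m + 1)" "set ?c \<subseteq> {..<15}" for R
    using Cons.IH[of R, OF _ le] Cons.IH[of "\<lambda>_. True", OF _ le] Cons.prems(1)
    by (simp_all del: fun_upd_apply length_concat set_concat)
  have Q: "Q (\<sigma>(s := val (\<lambda>v. \<sigma> (8 * v)) x @ ?c))" using Cons.prems(3) by (simp del: fun_upd_apply)
  show ?case
  proof (cases x)
    case (Var v)
    with Cons.prems assms have v: "\<sigma> (8 * v) \<in> words m" by auto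
    have "length (\<sigma> (8 * v) @ ?c) \<le> sum_list (map trm_size (x # ts)) * (m + 1)"
      using IH(2) v Var by (auto simp: words_def)
    moreover have "wp B (copy 15 (8 * v) s t) Q (\<sigma>(s := ?c))"
      by (intro wp_copy)
        (use assms(1-5) v Var calculation Cons.prems(2) IH(3) Q in
          \<open>auto simp: words_def simp del: length_concat fun_upd_apply\<close>, auto simp: words_def)
    ultimately show ?thesis using IH Var v by (auto intro!: wp_Seq simp: words_def)
  next
    case (Lit w)
    have "length (w @ ?c) \<le> sum_list (map trm_size (x # ts)) * (m + 1)"
      using IH(2) Lit by (auto simp: algebra_simps)
    moreover have "wp B (push_word s w) Q (\<sigma>(s := ?c))"
      by (intro wp_push_word)
        (use Lit calculation Cons.prems(2) Q in \<open>auto simp del: length_concat\<close>)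
    ultimately show ?thesis using IH Lit Cons.prems(1) by (auto intro!: wp_Seq)
  qed
qed

lemma wp_copies:
  assumes "distinct [x, y, t]" "\<sigma> t = []" "set (\<sigma> x) \<subseteq> {..<15}" "\<sigma> x = replicate m 0"
    "n * m + length (\<sigma> y) \<le> B" "Q (\<sigma>(y := replicate (n * m) 0 @ \<sigma> y))"
  shows "wp B (copies n x y t) Q \<sigma>"
  using assms
proof (induction n arbitrary: \<sigma>)
  case 0
  then show ?case by (auto intro!: wp_Done)
next
  case (Suc n)
  have eq: "\<sigma>(y := replicate (n * m) 0 @ \<sigma> x @ \<sigma> y) = \<sigma>(y := replicate (Suc n * m) 0 @ \<sigma> y)"
    using Suc.prems(4) by (simp add: replicate_add[symmetric] add.commute del: append_assoc flip: append_assoc)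
  have "wp B (copies n x y t) Q (\<sigma>(y := \<sigma> x @ \<sigma> y))"
    by (rule Suc.IH; (rule back_subst[of Q, OF Suc.prems(6)])?) (use Suc.prems(1-5) eq in \<open>auto simp del: fun_upd_apply simp: fun_upd_same\<close>, auto simp: fun_eq_iff)
  then show ?case unfolding copies.simps
    by (intro wp_Seq wp_copy) (use Suc.prems in auto)
qed

lemma env_upd: "(\<lambda>v. (\<sigma>(8 * b := a)) (8 * v)) = (\<lambda>v. \<sigma> (8 * v))(b := a)" for \<sigma> :: store
  by auto

lemma env_upd2:
  "(\<lambda>v. (\<sigma>(8 * b := x, 8 * b + 8 := y, 8 * b + 2 := z, 8 * b + 1 := z')) (8 * v)) =
   (\<lambda>v. \<sigma> (8 * v))(b := x, Suc b := y)" for \<sigma> :: store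
proof -
  have "8 * v \<noteq> 8 * b + 2" "8 * v \<noteq> 8 * b + 1" "8 * v = 8 * b + 8 \<longleftrightarrow> v = Suc b" for v :: nat by presburger+
  then show ?thesis by (auto simp: fun_eq_iff)
qed

lemma wp_comp:
  assumes "ok b f" "1 \<le> b" "\<forall>i\<ge>8 * b. \<sigma> i = []" "\<forall>v<b. \<sigma> (8 * v) \<in> words m" "\<sigma> 0 = replicate m 0"
    "cost f * ((m + 1) * (m + 1)) \<le> B"
    "Q (\<sigma>(8 * b := if eval b (\<lambda>v. \<sigma> (8 * v)) f then [0] else []))"
  shows "wp B (comp b f) Q \<sigma>"
  using assms
proof (induction f arbitrary: b \<sigma> Q)
  case (Eq x ts)
  let ?e = "\<lambda>v. \<sigma> (8 * v)"
  let ?c = "concat (map (val ?e) ts)"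
  let ?P = "wp B (copy 15 (8*x) (8*b+2) (8*b+3) ;; cmp 15 (8*b+1) (8*b+2) (8*b)) Q"
  have "sum_list (map trm_size ts) * (m + 1) \<le> cost (Eq x ts) * ((m + 1) * (m + 1))"
    by (intro mult_mono) auto
  then have B1: "sum_list (map trm_size ts) * (m + 1) \<le> B" using Eq.prems(6) by linarith
  have "2 * (m + 1) \<le> cost (Eq x ts) * ((m + 1) * (m + 1))" by (intro mult_mono) auto
  then have B2: "2 * (m + 1) \<le> B" using Eq.prems(6) by linarith
  have ne: "\<forall>v. 8 * v \<noteq> 8 * b + 1" "\<forall>v. 8 * v \<noteq> 8 * b + 3" by presburger+
  have x: "x < b" "\<sigma> (8 * x) \<in> words m" using Eq.prems by auto
  have bd: "wp B (build (8*b+1) (8*b+3) ts) R \<sigma> \<and> length ?c \<le> sum_list (map trm_size ts) * (m + 1) \<and> set ?c \<subseteq> {..<15}"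
    if "R (\<sigma>(8 * b + 1 := ?c))" for R
    by (rule wp_build[of _ _ _ b]) (use ne Eq.prems B1 that in auto)
  have c: "set ?c \<subseteq> {..<15}" using bd[of "\<lambda>_. True"] by blast
  have "?P (\<sigma>(8 * b + 1 := ?c))"
    by (intro wp_Seq wp_copy wp_cmp back_subst[of Q, OF Eq.prems(7)])
      (use Eq.prems(3) x B2 c in \<open>auto simp: words_def fun_eq_iff simp del: length_concat set_concat\<close>)
  then show ?case unfolding comp.simps by (intro wp_Seq[of _ "build (8*b+1) (8*b+3) ts"]) (use bd[of ?P] in blast)
next
  case (Neg f)
  let ?b = "eval b (\<lambda>v. \<sigma> (8 * v)) f"
  have "1 * 1 \<le> cost (Neg f) * ((m + 1) * (m + 1))" by (intro mult_mono) auto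
  then have "0 < B" using Neg.prems(6) by linarith
  then have "wp B (Branch (8*b) (\<lambda>s. s \<noteq> 0) (Pop (8*b)) (Push (8*b) 0)) Q (\<sigma>(8 * b := if ?b then [0] else []))"
    by (intro wp_Branch wp_Pop wp_Push back_subst[of Q, OF Neg.prems(7)]) (auto split: if_splits)
  moreover have "wp B (comp b f) R \<sigma>" if "R (\<sigma>(8 * b := if ?b then [0] else []))" for R
    by (rule Neg.IH; (rule that)?) (use Neg.prems in auto)
  ultimately show ?case unfolding comp.simps by (intro wp_Seq) blast
next
  case (And f g)
  let ?e = "\<lambda>v. \<sigma> (8 * v)"
  have \<sigma>: "\<sigma>(8 * b := []) = \<sigma>" using And.prems(3) by auto
  have cf: "cost f * ((m + 1) * (m + 1)) \<le> B" "cost g * ((m + 1) * (m + 1)) \<le> B"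
    using And.prems(6) by (auto simp: algebra_simps)
  have "wp B (Branch (8*b) (\<lambda>s. s \<noteq> 0) (Pop (8*b) ;; comp b g) Done) Q (\<sigma>(8 * b := if eval b ?e f then [0] else []))"
  proof (cases "eval b ?e f")
    case True
    have "wp B (comp b g) Q \<sigma>" by (rule And.IH(2)) (use And.prems cf True in auto)
    then have "wp B (comp b g) Q (\<sigma>(8 * b := []))" using \<sigma> by simp
    with True show ?thesis by (intro wp_BranchT wp_Seq wp_Pop) simp_all
  next
    case False
    then show ?thesis by (intro wp_BranchF wp_Done back_subst[of Q, OF And.prems(7)]) auto
  qed
  moreover have "wp B (comp b f) R \<sigma>" if "R (\<sigma>(8 * b := if eval b ?e f then [0] else []))" for R
    by (rule And.IH(1); (rule that)?) (use And.prems cf in auto)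
  ultimately show ?case unfolding comp.simps by (intro wp_Seq) blast
next
  case (Ex f)
  have m: "length (\<sigma> 0) = m" using Ex.prems(5) by simp
  have "4 * (m + 1) \<le> cost (Ex f) * ((m + 1) * (m + 1))" by (intro mult_mono) auto
  then have B: "4 * (m + 1) \<le> B" using Ex.prems(6) by linarith
  have cf: "cost f * ((m + 1) * (m + 1)) \<le> B" using Ex.prems(6) by (auto simp: algebra_simps)
  let ?P = "\<lambda>a. eval (Suc b) ((\<lambda>v. \<sigma> (8 * v))(b := a)) f"
  have sub: "wp B (comp (Suc b) f) (\<lambda>\<tau>. \<tau> = \<sigma>(8*b := a, 8*b+8 := if ?P a then [0] else [])) (\<sigma>(8*b := a))"
    if "a \<in> words m" for a
    by (rule Ex.IH) (use Ex.prems cf that in \<open>auto simp: env_upd less_Suc_eq add.commute\<close>)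
  show ?case unfolding comp.simps
    by (rule wp_search[where m = m and P = ?P])
      (use Ex.prems m B sub in \<open>auto\<close>)
next
  case (TC f x y)
  let ?e = "\<lambda>v. \<sigma> (8 * v)"
  let ?P = "\<lambda>x y. eval (b + 2) (?e(b := x, Suc b := y)) f"
  let ?L = "savitch_loop 0 (8*b) (8*b+8) (8*b+1) (8*b+2) (8*b+3) (8*b+4) (8*b+5) (8*b+6) (8*b+7) (8*b+9) (8*b+16)
       (comp (b + 2) f)"
  let ?E = "clear (8*b+2) ;; Branch (8*b+3) (\<lambda>s. s = 4) (Pop (8*b+3) ;; Push (8*b) 0) (Pop (8*b+3))"
  let ?h = "halving (8 * m) ?P (words m) (\<sigma> (8 * x)) (\<sigma> (8 * y))"
  have m: "length (\<sigma> 0) = m" "set (\<sigma> 0) \<subseteq> {..<15}" using TC.prems(5) by auto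
  have cf: "cost f * ((m + 1) * (m + 1)) \<le> B" "40 * ((m + 1) * (m + 1)) \<le> B"
    using TC.prems(6) by (auto simp: algebra_simps)
  then have B: "8 * m * (3 * m + 4) \<le> B" "m + 1 < B" "8 * m \<le> B" by (simp_all add: algebra_simps)
  have xy: "\<sigma> (8 * x) \<in> words m" "\<sigma> (8 * y) \<in> words m" "x < b" "y < b" using TC.prems by auto
  have ev: "eval b ?e (TC f x y) \<longleftrightarrow> ?h"
    using xy m by (simp add: halving_rtrancl)
  have sub: "wp B (comp (b + 2) f) (\<lambda>\<tau>. \<tau> = \<sigma>(8*b := u, 8*b+8 := v, 8*b+2 := replicate k 0, 8*b+1 := fr,
       8*b+16 := if ?P u v then [0] else [])) (\<sigma>(8*b := u, 8*b+8 := v, 8*b+2 := replicate k 0, 8*b+1 := fr))"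
    if "u \<in> words m" "v \<in> words m" for u v k fr
  proof (rule TC.IH)
    show "\<forall>va<b + 2. (\<sigma>(8*b := u, 8*b+8 := v, 8*b+2 := replicate k 0, 8*b+1 := fr)) (8 * va) \<in> words m"
      using env_upd2[of \<sigma> b u v "replicate k 0" fr] that TC.prems(4)
      by (auto simp: fun_eq_iff less_Suc_eq)
    have e: "8 * (b + 2) = 8 * b + 16" by simp
    show "(\<sigma>(8*b := u, 8*b+8 := v, 8*b+2 := replicate k 0, 8*b+1 := fr))(8 * (b + 2) :=
        if eval (b + 2) (\<lambda>va. (\<sigma>(8*b := u, 8*b+8 := v, 8*b+2 := replicate k 0, 8*b+1 := fr)) (8 * va)) f
        then [0] else []) =
      \<sigma>(8*b := u, 8*b+8 := v, 8*b+2 := replicate k 0, 8*b+1 := fr, 8*b+16 := if ?P u v then [0] else [])"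
      unfolding env_upd2 e ..
  qed (use TC.prems(1-6) cf in auto)
  have e: "\<sigma>(8*b := []) = \<sigma>" "\<sigma>(8*b+2 := []) = \<sigma>" "\<sigma>(8*b+3 := []) = \<sigma>" using TC.prems(3) by auto
  have "wp B ?E Q (\<sigma>(8*b+3 := [if ?h then 3 else 4], 8*b+2 := replicate (8 * m) 0))"
    by (intro wp_Seq wp_clear wp_Branch wp_Pop wp_Push back_subst[of Q, OF TC.prems(7)[unfolded ev]])
      (use TC.prems(3) B in \<open>auto simp: fun_eq_iff split: if_splits\<close>)
  then have "wp B ?L (wp B ?E Q) (\<sigma>(8*b := \<sigma> (8 * x), 8*b+8 := \<sigma> (8 * y), 8*b+2 := replicate (8 * m) 0, 8*b+3 := [0]))"
    by (intro wp_savitch[where m = m and P = ?P]) (use TC.prems(3) m B xy sub in \<open>auto simp: mult.assoc\<close>)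
  then have L: "wp B ?L (wp B ?E Q) s"
    if "\<sigma>(8*b := \<sigma> (8 * x), 8*b+8 := \<sigma> (8 * y), 8*b+2 := replicate (8 * m) 0, 8*b+3 := [0]) = s" for s
    using that by simp
  have "wp B (copies 8 0 (8*b+2) (8*b+5)) (wp B (Push (8*b+3) 0 ;; ?L ;; ?E) Q)
      (\<sigma>(8*b := \<sigma> (8 * x), 8*b+8 := \<sigma> (8 * y)))"
    by (intro wp_copies[where m = m] wp_Seq[of _ "Push _ _"] wp_Push wp_Seq[of _ ?L] L) (use TC.prems(2,3,5) B m in \<open>auto simp: fun_eq_iff\<close>)
  then have L2: "wp B (copies 8 0 (8*b+2) (8*b+5)) (wp B (Push (8*b+3) 0 ;; ?L ;; ?E) Q) s"
    if "\<sigma>(8*b := \<sigma> (8 * x), 8*b+8 := \<sigma> (8 * y)) = s" for s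
    using that by simp
  show ?case unfolding comp.simps
    by (intro wp_Seq[of _ "copy _ _ _ _"] wp_Seq[of _ "copies _ _ _ _"] wp_Seq[of _ "Push _ _"] wp_Seq[of _ ?L] wp_copy L2)
      (use TC.prems(2,3) xy B in \<open>auto simp: words_def fun_eq_iff\<close>)
qed

text \<open>The interface of the membership proofs. Since the formula is fixed,
  \<open>cost f\<close> is a constant and the height bound is quadratic in the length of the
  ruler.\<close>

theorem PSPACE_logic:
  assumes "ok 2 f" "1 \<le> c" "1 \<le> d" "k \<le> 15"
  shows "{w \<in> lists {..<k}. eval 2 ((\<lambda>_. [])(0 := replicate (c * (length w + 1) ^ d) 0, 1 := w)) f} \<in> PSPACE k"
proof -
  define R where "R = (\<lambda>n. c * (n + 1) ^ d)"
  define BB where "BB = (\<lambda>n. cost f * ((R n + 1) * (R n + 1)) + R n + n + 2)"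
  have "poly_bounded R" unfolding R_def
    by (intro poly_bounded_mult poly_bounded_power poly_bounded_add) auto
  then have "poly_bounded BB" unfolding BB_def
    by (intro poly_bounded_mult poly_bounded_add) auto
  then obtain p where p: "\<And>n. BB n \<le> poly p n" by (auto simp: poly_bounded_def)
  let ?c = "ruler 15 c d 0 9 8 10 11 ;; comp 2 f"
  show ?thesis
  \<comment> \<open>\<open>comp 2\<close> leaves its answer on stack \<open>8 * 2\<close>.\<close>
  proof (rule PSPACE_I[where c = ?c and r = 16 and p = p])
    fix w assume w: "w \<in> lists {..<k}"
    let ?n = "length w"
    let ?e = "(\<lambda>_. [])(0 := replicate (c * (?n + 1) ^ d) 0, 1 := w) :: store"
    let ?s = "(\<lambda>_. [])(8 := w, 9 := replicate (?n + 1) 0, 0 := replicate (c * (?n + 1) ^ d) 0) :: store"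
    have w15: "set w \<subseteq> {..<15}" using w assms(4) by force
    have env: "(\<lambda>v. ?s (8 * v)) = ?e"
    proof -
      have "8 * v \<noteq> 9" for v :: nat by presburger
      then show ?thesis by (auto simp: fun_eq_iff)
    qed
    have "?n + 1 \<le> (?n + 1) ^ d" using assms(3) self_le_power[of "?n + 1" d] by simp
    then have "?n \<le> 1 * (?n + 1) ^ d" by simp
    also have "\<dots> \<le> c * (?n + 1) ^ d" using assms(2) by (intro mult_right_mono) auto
    finally have n: "?n \<le> R ?n" by (simp add: R_def)
    have "wp (BB ?n) (comp 2 f) (\<lambda>\<tau>. \<tau> 16 \<noteq> [] \<longleftrightarrow> eval 2 ?e f) ?s"
    proof (rule wp_comp[where m = "R ?n"])
      show "\<forall>v<2. ?s (8 * v) \<in> words (R ?n)"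
        using n w15 by (auto simp: less_2_cases_iff words_def R_def)
    qed (use assms env in \<open>auto simp: R_def BB_def\<close>)
    moreover have "wp (BB ?n) (ruler 15 c d 0 9 8 10 11) (\<lambda>\<tau>. \<tau> = ?s) ((\<lambda>_. [])(0 := w))"
      by (rule wp_run[OF run_ruler]) (use w15 in \<open>auto simp: R_def BB_def\<close>)
    ultimately have "wp (BB ?n) ?c (\<lambda>\<tau>. \<tau> 16 \<noteq> [] \<longleftrightarrow> eval 2 ?e f) ((\<lambda>_. [])(0 := w))"
      by (intro wp_Seq) (auto elim: wp_mono)
    then obtain t \<tau> where E: "exec (BB ?n) ?c ((\<lambda>_. [])(0 := w)) t [] \<tau>"
      and ev: "\<tau> 16 \<noteq> [] \<longleftrightarrow> eval 2 ?e f"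
      by (auto simp: wp_def run_def)
    have i0: "(\<lambda>_. [])(0 := w) = (\<lambda>i. if i = 0 then w else [])" by auto
    have nB: "?n \<le> BB ?n" by (simp add: BB_def)
    show "\<exists>B t \<sigma>. length w \<le> B \<and> B \<le> poly p (length w) \<and>
      exec B ?c (\<lambda>i. if i = 0 then w else []) t [] \<sigma> \<and>
      (\<sigma> 16 \<noteq> [] \<longleftrightarrow> w \<in> {w \<in> lists {..<k}. eval 2 ((\<lambda>_. [])(0 := replicate (c * (length w + 1) ^ d) 0, 1 := w)) f})"
      by (rule exI[of _ "BB ?n"], rule exI[of _ t], rule exI[of _ \<tau>], intro conjI nB p E[unfolded i0])
        (simp only: ev mem_Collect_eq w simp_thms)
  qed auto
qed

section \<open>Deciding convexity and closedness\<close>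

subsection \<open>Derived formulas\<close>

definition Or :: "fm \<Rightarrow> fm \<Rightarrow> fm" where "Or f g = Neg (And (Neg f) (Neg g))"
definition All :: "fm \<Rightarrow> fm" where "All f = Neg (Ex (Neg f))"
definition Iff :: "fm \<Rightarrow> fm \<Rightarrow> fm" where "Iff f g = Or (And f g) (And (Neg f) (Neg g))"
text \<open>\<open>Eq 0 [Var 0]\<close> plays the part of the constant truth; variable 0 exists at
  every positive level.\<close>

definition Ands :: "fm list \<Rightarrow> fm" where "Ands fs = foldr And fs (Eq 0 [Var 0])"
definition Ors :: "fm list \<Rightarrow> fm" where "Ors fs = foldr Or fs (Neg (Eq 0 [Var 0]))"

lemma eval_derived [simp]:
  "eval b e (Or f g) \<longleftrightarrow> eval b e f \<or> eval b e g"
  "eval b e (All f) \<longleftrightarrow> (\<forall>a\<in>words (length (e 0)). eval (Suc b) (e(b := a)) f)"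
  "eval b e (Iff f g) \<longleftrightarrow> (eval b e f \<longleftrightarrow> eval b e g)"
  "eval b e (Ands fs) \<longleftrightarrow> (\<forall>f\<in>set fs. eval b e f)"
  "eval b e (Ors fs) \<longleftrightarrow> (\<exists>f\<in>set fs. eval b e f)"
proof -
  show "eval b e (Ands fs) \<longleftrightarrow> (\<forall>f\<in>set fs. eval b e f)" by (induction fs) (auto simp: Ands_def)
  show or: "eval b e (Or f g) \<longleftrightarrow> eval b e f \<or> eval b e g" for f g by (auto simp: Or_def)
  show "eval b e (Ors fs) \<longleftrightarrow> (\<exists>f\<in>set fs. eval b e f)" by (induction fs) (auto simp: Ors_def or)
  show "eval b e (Iff f g) \<longleftrightarrow> (eval b e f \<longleftrightarrow> eval b e g)" by (auto simp: Iff_def or)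
qed (auto simp: All_def)

lemma ok_derived [simp]:
  "ok b (Or f g) \<longleftrightarrow> ok b f \<and> ok b g"
  "ok b (All f) \<longleftrightarrow> ok (Suc b) f"
  "ok b (Iff f g) \<longleftrightarrow> ok b f \<and> ok b g"
  "0 < b \<Longrightarrow> ok b (Ands fs) \<longleftrightarrow> (\<forall>f\<in>set fs. ok b f)"
  "0 < b \<Longrightarrow> ok b (Ors fs) \<longleftrightarrow> (\<forall>f\<in>set fs. ok b f)"
proof -
  show "0 < b \<Longrightarrow> ok b (Ands fs) \<longleftrightarrow> (\<forall>f\<in>set fs. ok b f)" by (induction fs) (auto simp: Ands_def)
  show or: "ok b (Or f g) \<longleftrightarrow> ok b f \<and> ok b g" for f g by (auto simp: Or_def)
  show "0 < b \<Longrightarrow> ok b (Ors fs) \<longleftrightarrow> (\<forall>f\<in>set fs. ok b f)" by (induction fs) (auto simp: Ors_def or)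
  show "ok b (Iff f g) \<longleftrightarrow> ok b f \<and> ok b g" by (auto simp: Iff_def or)
qed (auto simp: All_def)

lemma fun_upd_less: "x < b \<Longrightarrow> (e(b := a)) x = e x" for x b :: nat
  by simp

lemmas lookup = fun_upd_same fun_upd_less

lemma words_append [simp]: "xs @ ys \<in> words m \<longleftrightarrow> set xs \<subseteq> {..<15} \<and> set ys \<subseteq> {..<15} \<and> length xs + length ys \<le> m"
  by (auto simp: words_def)

lemma words_appendD: "xs @ ys \<in> words m \<Longrightarrow> xs \<in> words m" "xs @ ys \<in> words m \<Longrightarrow> ys \<in> words m"
  by (auto simp: words_def)

lemma words_ConsD: "k # ys \<in> words m \<Longrightarrow> ys \<in> words m"
  by (auto simp: words_def)

section \<open>Letters and bit strings in formulas\<close>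

definition fhas :: "nat \<Rightarrow> nat \<Rightarrow> nat \<Rightarrow> fm" where
  "fhas b x k = Ex (Ex (Eq x [Var b, Lit [k], Var (Suc b)]))"

lemma ok_fhas [simp]: "x < b \<Longrightarrow> k < 15 \<Longrightarrow> ok b (fhas b x k)"
  by (simp add: fhas_def)

lemma eval_fhas [simp]:
  assumes "0 < b" "x < b" "e x \<in> words (length (e 0))"
  shows "eval b e (fhas b x k) \<longleftrightarrow> k \<in> set (e x)"
proof -
  have "eval b e (fhas b x k) \<longleftrightarrow>
      (\<exists>a\<in>words (length (e 0)). \<exists>r\<in>words (length (e 0)). e x = a @ k # r)"
    using assms by (simp add: fhas_def lookup del: fun_upd_apply)
  also have "\<dots> \<longleftrightarrow> (\<exists>a r. e x = a @ k # r)"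
    using assms(3) by (metis words_appendD words_ConsD)
  finally show ?thesis by (simp add: in_set_conv_decomp)
qed

definition fnone :: "nat \<Rightarrow> nat \<Rightarrow> nat list \<Rightarrow> fm" where
  "fnone b x ks = Ands (map (\<lambda>k. Neg (fhas b x k)) ks)"

lemma ok_fnone [simp]: "x < b \<Longrightarrow> set ks \<subseteq> {..<15} \<Longrightarrow> ok b (fnone b x ks)"
  by (auto simp: fnone_def)

lemma eval_fnone [simp]:
  "0 < b \<Longrightarrow> x < b \<Longrightarrow> e x \<in> words (length (e 0)) \<Longrightarrow> eval b e (fnone b x ks) \<longleftrightarrow> set (e x) \<inter> set ks = {}"
  by (auto simp: fnone_def)

definition fbits :: "nat \<Rightarrow> nat \<Rightarrow> fm" where
  "fbits b x = fnone b x [2..<15]"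

lemma ok_fbits [simp]: "x < b \<Longrightarrow> ok b (fbits b x)"
  by (auto simp: fbits_def)

definition nm :: "name \<Rightarrow> nat list" where
  "nm a = map of_bool a"

lemma range_nm: "x \<in> range nm \<longleftrightarrow> set x \<subseteq> {0, 1}"
proof
  assume x: "set x \<subseteq> {0, 1}"
  have "nm (map (\<lambda>k. k = 1) x) = x"
    unfolding nm_def map_map using x by (intro map_idI) auto
  then show "x \<in> range nm" by (metis rangeI)
qed (auto simp: nm_def)

lemma inj_nm: "inj nm"
  unfolding nm_def by (rule injI) (auto simp: inj_map_eq_map inj_def)

lemma nm_eq [simp]: "nm a = nm b \<longleftrightarrow> a = b"
  using inj_nm by (auto dest: injD)

lemma length_nm [simp]: "length (nm a) = length a"
  by (simp add: nm_def)

lemma set_nm: "set (nm a) \<subseteq> {0, 1}"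
  by (auto simp: nm_def)

lemma notin_nm [simp]: "1 < k \<Longrightarrow> k \<notin> set (nm a)"
  using set_nm[of a] by auto

lemma nm_in_words: "nm a \<in> words m \<longleftrightarrow> length a \<le> m"
  using set_nm[of a] by (auto simp: words_def)

lemma eval_fbits [simp]:
  assumes "0 < b" "x < b" "e x \<in> words (length (e 0))"
  shows "eval b e (fbits b x) \<longleftrightarrow> e x \<in> range nm"
proof -
  have "set (e x) \<subseteq> {..<15}" using assms by (auto simp: words_def)
  moreover have "y < 2 \<Longrightarrow> y = 0 \<or> y = 1" for y :: nat by auto
  ultimately have "set (e x) \<inter> {2..<15} = {} \<longleftrightarrow> set (e x) \<subseteq> {0, 1}"
    by (auto simp: disjoint_iff subset_iff not_le)
  then show ?thesis using eval_fnone[OF assms, of "[2..<15]"] unfolding fbits_def range_nm set_upt by simp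
qed

subsection \<open>Sets of words as words\<close>

text \<open>Reads a word as a set of blocks between letters 8. One set has many codes, so formulas
  describe codes only by their elements.\<close>

definition elems :: "nat list \<Rightarrow> nat list set" where
  "elems S = {x. 8 \<notin> set x \<and> (\<exists>p r. S = p @ 8 # x @ 8 # r)}"

definition set_word :: "nat list list \<Rightarrow> nat list" where
  "set_word qs = 8 # concat (map (\<lambda>q. q @ [8]) qs)"

lemma split_unique:
  "k \<notin> set a \<Longrightarrow> k \<notin> set a' \<Longrightarrow> a @ k # r = a' @ k # r' \<longleftrightarrow> a = a' \<and> r = r'"
proof (induction a arbitrary: a')
  case Nil
  then show ?case by (cases a') auto
next
  case (Cons c a)
  then show ?case by (cases a') auto
qed

lemma elems_set_word: "\<forall>q\<in>set qs. 8 \<notin> set q \<Longrightarrow> elems (set_word qs) = set qs"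
proof (induction qs)
  case Nil
  then show ?case by (auto simp: elems_def set_word_def Cons_eq_append_conv)
next
  case (Cons q qs)
  have sw: "set_word (q # qs) = 8 # q @ set_word qs" by (simp add: set_word_def)
  obtain W where W: "set_word qs = 8 # W" by (simp add: set_word_def)
  have "elems (8 # q @ 8 # W) = insert q (elems (8 # W))"
  proof (intro set_eqI iffI)
    fix x assume "x \<in> elems (8 # q @ 8 # W)"
    then obtain p r where x: "8 \<notin> set x" and eq: "8 # q @ 8 # W = p @ 8 # x @ 8 # r"
      by (auto simp: elems_def)
    show "x \<in> insert q (elems (8 # W))"
    proof (cases p)
      case Nil
      with eq x Cons.prems show ?thesis by (simp add: split_unique)
    next
      case (Cons c p')
      with eq have eq': "q @ 8 # W = p' @ 8 # x @ 8 # r" by simp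
      show ?thesis
      proof (cases "8 \<in> set p'")
        case True
        then obtain p1 p2 where p': "p' = p1 @ 8 # p2" "8 \<notin> set p1" by (meson split_list_first)
        with eq' Cons.prems have "W = p2 @ 8 # x @ 8 # r" by (simp add: split_unique)
        then have "8 # W = (8 # p2) @ 8 # x @ 8 # r" by simp
        with x show ?thesis unfolding elems_def by blast
      next
        case False
        with eq' Cons.prems have "W = x @ 8 # r" by (simp add: split_unique)
        then have "8 # W = [] @ 8 # x @ 8 # r" by simp
        with x show ?thesis unfolding elems_def by blast
      qed
    qed
  next
    fix x assume "x \<in> insert q (elems (8 # W))"
    then consider "x = q" | p r where "8 \<notin> set x" "8 # W = p @ 8 # x @ 8 # r"
      by (auto simp: elems_def)
    then show "x \<in> elems (8 # q @ 8 # W)"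
    proof cases
      case 1
      then have "8 # q @ 8 # W = [] @ 8 # x @ 8 # W" by simp
      with 1 Cons.prems show ?thesis unfolding elems_def by auto
    next
      case 2
      then have "8 # q @ 8 # W = (8 # q @ p) @ 8 # x @ 8 # r" by simp
      with 2 show ?thesis unfolding elems_def by blast
    qed
  qed
  with Cons W sw show ?case by simp
qed

lemma elems_words: "S \<in> words m \<Longrightarrow> x \<in> elems S \<Longrightarrow> x \<in> words m"
  by (auto simp: elems_def words_def)

definition felem :: "nat \<Rightarrow> nat \<Rightarrow> nat \<Rightarrow> fm" where
  "felem b x S = And (Neg (fhas b x 8)) (Ex (Ex (Eq S [Var b, Lit [8], Var x, Lit [8], Var (Suc b)])))"

lemma ok_felem [simp]: "x < b \<Longrightarrow> S < b \<Longrightarrow> ok b (felem b x S)"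
  by (simp add: felem_def)

lemma eval_felem [simp]:
  assumes "0 < b" "x < b" "S < b" "e x \<in> words (length (e 0))" "e S \<in> words (length (e 0))"
  shows "eval b e (felem b x S) \<longleftrightarrow> e x \<in> elems (e S)"
proof -
  have "eval b e (felem b x S) \<longleftrightarrow> 8 \<notin> set (e x) \<and>
      (\<exists>p\<in>words (length (e 0)). \<exists>r\<in>words (length (e 0)). e S = p @ 8 # e x @ 8 # r)"
    using assms by (simp add: felem_def lookup del: fun_upd_apply)
  also have "\<dots> \<longleftrightarrow> 8 \<notin> set (e x) \<and> (\<exists>p r. e S = p @ 8 # e x @ 8 # r)"
    using assms(5) by (metis words_appendD words_ConsD)
  finally show ?thesis by (simp add: elems_def)
qed

subsection \<open>Automata whose states are words\<close>

fun runs :: "('q \<Rightarrow> 'a \<Rightarrow> 'q \<Rightarrow> bool) \<Rightarrow> 'q set \<Rightarrow> 'a list \<Rightarrow> 'q set" where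
  "runs D S [] = S"
| "runs D S (a # w) = runs D {y. \<exists>x\<in>S. D x a y} w"

lemma runs_append: "runs D S (u @ v) = runs D (runs D S u) v"
  by (induction u arbitrary: S) auto

lemma runs_snoc: "runs D S (u @ [a]) = {y. \<exists>x\<in>runs D S u. D x a y}"
  by (simp add: runs_append)

definition aut_lang :: "('q \<Rightarrow> bool) \<Rightarrow> ('q \<Rightarrow> 'a \<Rightarrow> 'q \<Rightarrow> bool) \<Rightarrow> ('q \<Rightarrow> bool) \<Rightarrow> 'a list set" where
  "aut_lang I D F = {w. \<exists>x\<in>runs D {x. I x} w. F x}"

fun mrun :: "(nat \<times> nat \<times> nat) list \<Rightarrow> nat \<Rightarrow> nat list \<Rightarrow> nat \<Rightarrow> bool" where
  "mrun tr k [] k' \<longleftrightarrow> k = k'"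
| "mrun tr k (a # as) k' \<longleftrightarrow> (\<exists>j. (k, a, j) \<in> set tr \<and> mrun tr j as k')"

lemma mrun_append: "mrun tr k (as @ bs) k' \<longleftrightarrow> (\<exists>j. mrun tr k as j \<and> mrun tr j bs k')"
  by (induction as arbitrary: k) auto

text \<open>
  Position \<open>i\<close> of \<open>w\<close> carries the activity 0, 1 or 2 if its letter belongs to \<open>w\<close> only, to \<open>v\<close> and
  \<open>w\<close>, or to all of \<open>u\<close>, \<open>v\<close>, \<open>w\<close>.
\<close>

definition part :: "nat \<Rightarrow> ('a \<times> nat) list \<Rightarrow> 'a list" where
  "part k zs = map fst (filter (\<lambda>z. k \<le> snd z) zs)"

lemma part_simps [simp]: "part k [] = []" "part k (zs @ zs') = part k zs @ part k zs'"
  "part k (z # zs) = (if k \<le> snd z then fst z # part k zs else part k zs)"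
  by (auto simp: part_def)

text \<open>\<open>tr\<close> is a finite automaton over the activities with start state 0 in which
  every state is final. It describes which markings of the positions of \<open>w\<close> yield
  \<open>u\<close> and \<open>v\<close> in the relation; this is all that the search needs to know
  about \<open>le\<close>.\<close>

definition traces :: "(nat \<times> nat \<times> nat) list \<Rightarrow> ('a list \<Rightarrow> 'a list \<Rightarrow> bool) \<Rightarrow> bool" where
  "traces tr le \<longleftrightarrow> (\<forall>u v w. le u v \<and> le v w \<longleftrightarrow>
     (\<exists>zs k. mrun tr 0 (map snd zs) k \<and> u = part 2 zs \<and> v = part 1 zs \<and> w = part 0 zs))"

fun fnode :: "trm list \<Rightarrow> nat \<Rightarrow> nat \<Rightarrow> nat \<Rightarrow> trm list" where
  "fnode k S1 S2 S3 = k @ [Lit [9], Var S1, Lit [9], Var S2, Lit [9], Var S3]"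

text \<open>A vertex of the search graph: the state of the marking automaton and codes of the sets
  of states reached on \<open>u\<close>, \<open>v\<close> and \<open>w\<close>. As elements use
  letters below 8 and 8 separates them, 9 is free as separator here.\<close>

definition node :: "nat \<Rightarrow> nat list \<Rightarrow> nat list \<Rightarrow> nat list \<Rightarrow> nat list" where
  "node k S1 S2 S3 = k # 9 # S1 @ 9 # S2 @ 9 # S3"

text \<open>Counting the letters 9: the left side has exactly three, which are the displayed ones on
  the right, so no block on the right contains a 9. Then both sides are cut at the same
  places.\<close>

lemma node_unique:
  assumes "node k S1 S2 S3 = ks @ 9 # T1 @ 9 # T2 @ 9 # T3" "k < 9" "9 \<notin> set S1" "9 \<notin> set S2" "9 \<notin> set S3"
  shows "ks = [k] \<and> T1 = S1 \<and> T2 = S2 \<and> T3 = S3"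
proof -
  have z: "count_list S1 9 = 0" "count_list S2 9 = 0" "count_list S3 9 = 0"
    using assms(3-5) by (simp_all add: count_list_0_iff)
  have "count_list (ks @ 9 # T1 @ 9 # T2 @ 9 # T3) 9 = 3"
    using assms(2) z unfolding assms(1)[symmetric] node_def by simp
  then have "count_list ks 9 = 0" "count_list T1 9 = 0" "count_list T2 9 = 0" "count_list T3 9 = 0"
    by simp_all
  then have t: "9 \<notin> set ks" "9 \<notin> set T1" "9 \<notin> set T2" "9 \<notin> set T3"
    by (simp_all add: count_list_0_iff)
  have "[k] @ 9 # S1 @ 9 # S2 @ 9 # S3 = ks @ 9 # T1 @ 9 # T2 @ 9 # T3"
    using assms(1) by (simp add: node_def)
  then have "ks = [k]" "S1 @ 9 # S2 @ 9 # S3 = T1 @ 9 # T2 @ 9 # T3"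
    using t assms(2) split_unique[of 9 "[k]" ks] by auto
  moreover from this(2) have "T1 = S1" "S2 @ 9 # S3 = T2 @ 9 # T3"
    using t assms(3) split_unique[of 9 S1 T1] by auto
  moreover from this(2) have "T2 = S2" "T3 = S3"
    using t assms(4) split_unique[of 9 S2 T2] by auto
  ultimately show ?thesis by blast
qed

lemma node_words: "node k S1 S2 S3 \<in> words m \<Longrightarrow> S1 \<in> words m \<and> S2 \<in> words m \<and> S3 \<in> words m"
  by (auto simp: node_def words_def)

section \<open>Formulas for the search through triples of state sets\<close>

definition fset :: "(nat \<Rightarrow> nat \<Rightarrow> nat \<Rightarrow> nat \<Rightarrow> fm) \<Rightarrow> nat \<Rightarrow> nat \<Rightarrow> nat \<Rightarrow> nat \<Rightarrow> fm" where
  "fset fD b S a T = And (Neg (fhas b T 9))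
     (All (Iff (felem (b + 1) b T) (Ex (And (felem (b + 2) (b + 1) S) (fD (b + 2) (b + 1) a b)))))"

text \<open>The third set belongs to \<open>w\<close> and moves with every letter, the second to
  \<open>v\<close> and moves from activity 1 on, the first to \<open>u\<close> and moves only with
  activity 2.\<close>

definition fstep :: "(nat \<Rightarrow> nat \<Rightarrow> nat \<Rightarrow> nat \<Rightarrow> fm) \<Rightarrow> (nat \<times> nat \<times> nat) list \<Rightarrow> nat \<Rightarrow> nat \<Rightarrow> nat \<Rightarrow> fm" where
  "fstep fD tr b X Y = Ex (Ex (Ex (Ex (Ex (Ex (Ex (Ors (map (\<lambda>(i, a, j).
     Ands [Eq X (fnode [Lit [i]] (b + 1) (b + 2) (b + 3)), Eq Y (fnode [Lit [j]] (b + 4) (b + 5) (b + 6)),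
       fbits (b + 7) b, fset fD (b + 7) (b + 3) b (b + 6),
       if 1 \<le> a then fset fD (b + 7) (b + 2) b (b + 5) else Eq (b + 5) [Var (b + 2)],
       if 2 \<le> a then fset fD (b + 7) (b + 1) b (b + 4) else Eq (b + 4) [Var (b + 1)]]) tr))))))))"

definition fmeets :: "(nat \<Rightarrow> nat \<Rightarrow> fm) \<Rightarrow> nat \<Rightarrow> nat \<Rightarrow> fm" where
  "fmeets fF b S = Ex (And (felem (b + 1) b S) (fF (b + 1) b))"

definition fstart :: "(nat \<Rightarrow> nat \<Rightarrow> fm) \<Rightarrow> nat \<Rightarrow> nat \<Rightarrow> fm" where
  "fstart fI b X = Ex (Ands [Eq X (fnode [Lit [0]] b b b), Neg (fhas (b + 1) b 9),
     All (Iff (felem (b + 2) (b + 1) b) (fI (b + 2) (b + 1)))])"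

definition ffinish :: "(nat \<Rightarrow> nat \<Rightarrow> fm) \<Rightarrow> bool \<Rightarrow> nat \<Rightarrow> nat \<Rightarrow> fm" where
  "ffinish fF flag b Y = Ex (Ex (Ex (Ex (Ands [Eq Y (fnode [Var b] (b + 1) (b + 2) (b + 3)),
     if flag then fmeets fF (b + 4) (b + 1) else Eq 0 [Var 0],
     Neg (fmeets fF (b + 4) (b + 2)), fmeets fF (b + 4) (b + 3)]))))"

text \<open>With \<open>flag\<close> the word \<open>u\<close> must belong to the language, as for
  convexity. Without it \<open>u\<close> is free, and for a reflexive relation \<open>u = v\<close>
  is possible, which leaves a violation of closedness.\<close>

definition fviolation where
  "fviolation fI fD fF tr flag =
     Ex (Ex (Ands [fstart fI 4 2, TC (fstep fD tr 6 4 5) 2 3, ffinish fF flag 4 3]))"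

lemma ok_fviolation:
  assumes "\<And>b x. 2 \<le> b \<Longrightarrow> x < b \<Longrightarrow> ok b (fI b x)" "\<And>b x. 2 \<le> b \<Longrightarrow> x < b \<Longrightarrow> ok b (fF b x)"
    "\<And>b x a y. 2 \<le> b \<Longrightarrow> x < b \<Longrightarrow> a < b \<Longrightarrow> y < b \<Longrightarrow> ok b (fD b x a y)"
    "\<forall>(i, a, j)\<in>set tr. i < 9 \<and> j < 9"
  shows "ok 2 (fviolation fI fD fF tr flag)"
proof -
  have s: "ok b (fset fD b S a T)" if "2 \<le> b" "S < b" "a < b" "T < b" for b S a T
    using that assms(3) by (auto simp: fset_def)
  have "ok 6 (fstep fD tr 6 4 5)"
    unfolding fstep_def using assms(4) by (force intro!: s)
  then show ?thesis
    unfolding fviolation_def fstart_def ffinish_def fmeets_def using assms(1,2)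
    by auto
qed

text \<open>The common view of automata and expressions: states are words over letters below 8, and
  initial states, steps and final states are definable from the input. A node consists of three
  coded sets and four more letters; \<open>Q_len\<close> makes it fit within the quantifier
  bound.\<close>

locale word_automaton =
  fixes m :: nat and inp :: "nat list"
    and I :: "nat list \<Rightarrow> bool" and D :: "nat list \<Rightarrow> name \<Rightarrow> nat list \<Rightarrow> bool" and F :: "nat list \<Rightarrow> bool"
    and fI fF :: "nat \<Rightarrow> nat \<Rightarrow> fm" and fD :: "nat \<Rightarrow> nat \<Rightarrow> nat \<Rightarrow> nat \<Rightarrow> fm" and qs :: "nat list list"
  assumes I_Q: "\<And>x. I x \<Longrightarrow> x \<in> set qs"
    and D_Q: "\<And>x a y. x \<in> set qs \<Longrightarrow> D x a y \<Longrightarrow> y \<in> set qs \<and> length a \<le> m"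
    and Q: "\<And>q. q \<in> set qs \<Longrightarrow> set q \<subseteq> {..<8}" and Q_len: "3 * length (set_word qs) + 4 \<le> m"
    and fI: "\<And>b x e. 2 \<le> b \<Longrightarrow> x < b \<Longrightarrow> e 0 = replicate m 0 \<Longrightarrow> e 1 = inp \<Longrightarrow> e x \<in> words m \<Longrightarrow>
      eval b e (fI b x) \<longleftrightarrow> I (e x)"
    and fF: "\<And>b x e. 2 \<le> b \<Longrightarrow> x < b \<Longrightarrow> e 0 = replicate m 0 \<Longrightarrow> e 1 = inp \<Longrightarrow> e x \<in> set qs \<Longrightarrow>
      eval b e (fF b x) \<longleftrightarrow> F (e x)"
    and fD: "\<And>b x a y e. 2 \<le> b \<Longrightarrow> x < b \<Longrightarrow> a < b \<Longrightarrow> y < b \<Longrightarrow> e 0 = replicate m 0 \<Longrightarrow> e 1 = inp \<Longrightarrow>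
      e x \<in> set qs \<Longrightarrow> e a \<in> words m \<Longrightarrow> e y \<in> words m \<Longrightarrow>
      eval b e (fD b x a y) \<longleftrightarrow> (\<exists>n. e a = nm n \<and> D (e x) n (e y))"
begin

lemma set_word_len: "q \<in> set ps \<Longrightarrow> length q \<le> length (set_word ps)"
  by (induction ps) (auto simp: set_word_def)

lemma Q_words: "q \<in> set qs \<Longrightarrow> q \<in> words m"
  using Q[of q] set_word_len[of q qs] Q_len by (force simp: words_def)

lemma ex_set_word:
  assumes "A \<subseteq> set qs"
  shows "\<exists>S. elems S = A \<and> 9 \<notin> set S \<and> set S \<subseteq> {..<15} \<and> length S \<le> length (set_word qs)"
proof (intro exI conjI)
  let ?ps = "filter (\<lambda>q. q \<in> A) qs"
  show "elems (set_word ?ps) = A"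
    using assms Q by (subst elems_set_word) force+
  have "x = 8 \<or> (\<exists>q\<in>set qs. x \<in> set q)" if "x \<in> set (set_word ?ps)" for x
    using that by (auto simp: set_word_def split: if_splits)
  then have le: "x \<le> 8" if "x \<in> set (set_word ?ps)" for x
    using that Q by fastforce
  show "9 \<notin> set (set_word ?ps)" using le[of 9] by auto
  show "set (set_word ?ps) \<subseteq> {..<15}" using le by force
  have "length (concat (map (\<lambda>q. q @ [8]) (filter P ps))) \<le> length (concat (map (\<lambda>q. q @ [8]) ps))"
    for P and ps :: "nat list list" by (induction ps) auto
  then show "length (set_word ?ps) \<le> length (set_word qs)" by (simp add: set_word_def)
qed

lemma runs_Q: "runs D {x. I x} w \<subseteq> set qs"
  by (induction w rule: rev_induct) (auto simp: runs_snoc dest: I_Q D_Q)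

lemma eval_fset:
  assumes "2 \<le> b" "S < b" "a < b" "T < b" "e 0 = replicate m 0" "e 1 = inp"
    "e S \<in> words m" "e a \<in> words m" "e T \<in> words m" "elems (e S) \<subseteq> set qs"
  shows "eval b e (fset fD b S a T) \<longleftrightarrow>
    9 \<notin> set (e T) \<and> elems (e T) = {y. \<exists>x\<in>elems (e S). \<exists>n. e a = nm n \<and> D x n y}"
proof -
  have "eval b e (fset fD b S a T) \<longleftrightarrow> 9 \<notin> set (e T) \<and>
    (\<forall>y\<in>words m. y \<in> elems (e T) \<longleftrightarrow> (\<exists>x\<in>words m. x \<in> elems (e S) \<and> (\<exists>n. e a = nm n \<and> D x n y)))"
  proof -
    have 1: "eval (b + 2) (e(b := y, b + 1 := x)) (fD (b + 2) (b + 1) a b) \<longleftrightarrow> (\<exists>n. e a = nm n \<and> D x n y)"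
      if "y \<in> words m" "x \<in> elems (e S)" for x y
      using fD[of "b + 2" "b + 1" a b "e(b := y, b + 1 := x)"] assms that by (auto simp: subset_iff)
    show ?thesis
      using assms 1 by (simp add: fset_def cong: conj_cong)
  qed
  also have "\<dots> \<longleftrightarrow> 9 \<notin> set (e T) \<and> elems (e T) = {y. \<exists>x\<in>elems (e S). \<exists>n. e a = nm n \<and> D x n y}"
  proof -
    let ?A = "{y. \<exists>x\<in>elems (e S). \<exists>n. e a = nm n \<and> D x n y}"
    have "elems (e T) \<subseteq> words m" "elems (e S) \<subseteq> words m" using assms(7,9) elems_words by blast+
    moreover have "?A \<subseteq> words m" using assms(10) D_Q Q_words by blast
    ultimately show ?thesis by blast
  qed
  finally show ?thesis .
qed

lemma eval_fmeets:
  assumes "2 \<le> b" "S < b" "e 0 = replicate m 0" "e 1 = inp" "e S \<in> words m" "elems (e S) \<subseteq> set qs"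
  shows "eval b e (fmeets fF b S) \<longleftrightarrow> (\<exists>x\<in>elems (e S). F x)"
proof -
  have "eval (b + 1) (e(b := x)) (fF (b + 1) b) \<longleftrightarrow> F x" if "x \<in> elems (e S)" for x
    using fF[of "b + 1" b "e(b := x)"] assms that by (auto simp: subset_iff)
  then show ?thesis
    using assms elems_words[of "e S" m] by (auto simp: fmeets_def)
qed

definition step_set :: "nat list \<Rightarrow> nat list set \<Rightarrow> nat list set" where
  "step_set a A = {y. \<exists>x\<in>A. \<exists>n. a = nm n \<and> D x n y}"

definition next_node :: "(nat \<times> nat \<times> nat) list \<Rightarrow> nat list \<Rightarrow> nat list \<Rightarrow> bool" where
  "next_node tr X Y \<longleftrightarrow> (\<exists>a S1 S2 S3 T1 T2 T3 i c j. (i, c, j) \<in> set tr \<and> a \<in> words m \<and> a \<in> range nm \<and>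
     X = node i S1 S2 S3 \<and> Y = node j T1 T2 T3 \<and>
     (9 \<notin> set T3 \<and> elems T3 = step_set a (elems S3)) \<and>
     (if 1 \<le> c then 9 \<notin> set T2 \<and> elems T2 = step_set a (elems S2) else T2 = S2) \<and>
     (if 2 \<le> c then 9 \<notin> set T1 \<and> elems T1 = step_set a (elems S1) else T1 = S1))"

text \<open>The formulas are known to be correct only for genuine states. This invariant of the
  search confines the comparison of the defined relation with \<open>next_node\<close> to vertices
  where they agree.\<close>

definition good_node :: "nat list \<Rightarrow> bool" where
  "good_node X \<longleftrightarrow> (\<exists>k S1 S2 S3. X = node k S1 S2 S3 \<and> k < 9 \<and>
     (\<forall>S\<in>{S1, S2, S3}. 9 \<notin> set S \<and> elems S \<subseteq> set qs))"

lemma eval_fstep: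
  assumes e: "e 0 = replicate m 0" "e 1 = inp" and X: "e 4 \<in> words m" "e 5 \<in> words m" "good_node (e 4)"
    and tr: "\<forall>(i, a, j)\<in>set tr. i < 9 \<and> j < 9"
  shows "eval 6 e (fstep fD tr 6 4 5) \<longleftrightarrow> next_node tr (e 4) (e 5)"
proof -
  have st: "eval 13 (e(6 := a, 7 := S1, 8 := S2, 9 := S3, 10 := T1, 11 := T2, 12 := T3)) (fset fD 13 p 6 q) \<longleftrightarrow>
     9 \<notin> set T \<and> elems T = step_set a (elems S)"
    if "a \<in> words m" "(p, q, S, T) \<in> {(7, 10, S1, T1), (8, 11, S2, T2), (9, 12, S3, T3)}"
      "S \<in> words m" "T \<in> words m" "elems S \<subseteq> set qs"
    for a S1 S2 S3 T1 T2 T3 p q S T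
    using eval_fset[of 13 p 6 q "e(6 := a, 7 := S1, 8 := S2, 9 := S3, 10 := T1, 11 := T2, 12 := T3)"] that e
    by (auto simp: step_set_def)
  let ?g = "\<lambda>i c j. Ands [Eq 4 (fnode [Lit [i]] 7 8 9), Eq 5 (fnode [Lit [j]] 10 11 12),
       fbits 13 6, fset fD 13 9 6 12,
       if 1 \<le> c then fset fD 13 8 6 11 else Eq 11 [Var 8],
       if 2 \<le> c then fset fD 13 7 6 10 else Eq 10 [Var 7]]"
  have ex: "eval 6 e (fstep fD tr 6 4 5) \<longleftrightarrow> (\<exists>a\<in>words m. \<exists>S1\<in>words m. \<exists>S2\<in>words m. \<exists>S3\<in>words m.
      \<exists>T1\<in>words m. \<exists>T2\<in>words m. \<exists>T3\<in>words m.
      eval 13 (e(6 := a, 7 := S1, 8 := S2, 9 := S3, 10 := T1, 11 := T2, 12 := T3))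
        (Ors (map (\<lambda>(i, c, j). ?g i c j) tr)))"
    using e(1) by (simp add: fstep_def del: eval_derived(5) cong del: if_weak_cong)
  show ?thesis
  proof
    assume "eval 6 e (fstep fD tr 6 4 5)"
    then obtain a S1 S2 S3 T1 T2 T3 where w: "a \<in> words m" "S1 \<in> words m" "S2 \<in> words m" "S3 \<in> words m"
      "T1 \<in> words m" "T2 \<in> words m" "T3 \<in> words m" and
      or: "eval 13 (e(6 := a, 7 := S1, 8 := S2, 9 := S3, 10 := T1, 11 := T2, 12 := T3))
        (Ors (map (\<lambda>(i, c, j). ?g i c j) tr))" unfolding ex by (elim bexE) (rule that; assumption)
    let ?e = "e(6 := a, 7 := S1, 8 := S2, 9 := S3, 10 := T1, 11 := T2, 12 := T3)"
    from or obtain i c j where ijc: "(i, c, j) \<in> set tr" and ands: "eval 13 ?e (?g i c j)"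
      unfolding eval_derived(5) by auto
    from ands have eqs: "e 4 = i # 9 # S1 @ 9 # S2 @ 9 # S3" "e 5 = j # 9 # T1 @ 9 # T2 @ 9 # T3" and
      bits: "eval 13 ?e (fbits 13 6)" and
      ev: "eval 13 ?e (fset fD 13 9 6 12)"
      "eval 13 ?e (if 1 \<le> c then fset fD 13 8 6 11 else Eq 11 [Var 8])"
      "eval 13 ?e (if 2 \<le> c then fset fD 13 7 6 10 else Eq 10 [Var 7])"
      unfolding eval_derived(4) by simp_all
    have "a \<in> range nm" using bits w e(1) by simp
    note * = ijc w(1) this w(2-) eqs
    from X(3) obtain k S1' S2' S3' where g: "e 4 = node k S1' S2' S3'" "k < 9"
      "\<forall>S\<in>{S1', S2', S3'}. 9 \<notin> set S \<and> elems S \<subseteq> set qs" by (auto simp: good_node_def)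
    have "node k S1' S2' S3' = [i] @ 9 # S1 @ 9 # S2 @ 9 # S3" using g(1) *(10) by simp
    from node_unique[OF this] g have q: "elems S1 \<subseteq> set qs" "elems S2 \<subseteq> set qs" "elems S3 \<subseteq> set qs" by auto
    have "9 \<notin> set T3 \<and> elems T3 = step_set a (elems S3)"
      using ev(1) w q st[of a 9 12 S3 T3 S1 T1 S2 T2 S3 T3] by simp
    moreover have "if 1 \<le> c then 9 \<notin> set T2 \<and> elems T2 = step_set a (elems S2) else T2 = S2"
      using ev(2) w q st[of a 8 11 S2 T2 S1 T1 S2 T2 S3 T3] by (cases "1 \<le> c") simp_all
    moreover have "if 2 \<le> c then 9 \<notin> set T1 \<and> elems T1 = step_set a (elems S1) else T1 = S1"
      using ev(3) w q st[of a 7 10 S1 T1 S1 T1 S2 T2 S3 T3] by (cases "2 \<le> c") simp_all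
    moreover have "e 4 = node i S1 S2 S3" "e 5 = node j T1 T2 T3" using eqs by (simp_all add: node_def)
    ultimately show "next_node tr (e 4) (e 5)"
      unfolding next_node_def using * by blast
  next
    assume "next_node tr (e 4) (e 5)"
    then obtain a S1 S2 S3 T1 T2 T3 i c j where *: "(i, c, j) \<in> set tr" "a \<in> words m" "a \<in> range nm"
      "e 4 = node i S1 S2 S3" "e 5 = node j T1 T2 T3"
      "9 \<notin> set T3 \<and> elems T3 = step_set a (elems S3)"
      "if 1 \<le> c then 9 \<notin> set T2 \<and> elems T2 = step_set a (elems S2) else T2 = S2"
      "if 2 \<le> c then 9 \<notin> set T1 \<and> elems T1 = step_set a (elems S1) else T1 = S1"
      unfolding next_node_def by blast
    from X(3) obtain k S1' S2' S3' where g: "e 4 = node k S1' S2' S3'" "k < 9"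
      "\<forall>S\<in>{S1', S2', S3'}. 9 \<notin> set S \<and> elems S \<subseteq> set qs" by (auto simp: good_node_def)
    have "node k S1' S2' S3' = [i] @ 9 # S1 @ 9 # S2 @ 9 # S3" using g(1) *(4) by (simp add: node_def)
    from node_unique[OF this] g have q: "elems S1 \<subseteq> set qs" "elems S2 \<subseteq> set qs" "elems S3 \<subseteq> set qs" by auto
    have w: "S1 \<in> words m" "S2 \<in> words m" "S3 \<in> words m" "T1 \<in> words m" "T2 \<in> words m" "T3 \<in> words m"
      using X *(4,5) node_words by metis+
    let ?e = "e(6 := a, 7 := S1, 8 := S2, 9 := S3, 10 := T1, 11 := T2, 12 := T3)"
    have "eval 13 ?e (fset fD 13 9 6 12)" "eval 13 ?e (if 1 \<le> c then fset fD 13 8 6 11 else Eq 11 [Var 8])"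
      "eval 13 ?e (if 2 \<le> c then fset fD 13 7 6 10 else Eq 10 [Var 7])" "eval 13 ?e (fbits 13 6)"
      using * w q st[of a 9 12 S3 T3 S1 T1 S2 T2 S3 T3] st[of a 8 11 S2 T2 S1 T1 S2 T2 S3 T3]
        st[of a 7 10 S1 T1 S1 T1 S2 T2 S3 T3] e(1)
      by (cases "1 \<le> c"; cases "2 \<le> c"; simp)+
    then have "eval 13 ?e (?g i c j)" unfolding eval_derived(4) using *(4,5) by (simp add: node_def)
    then have "eval 13 ?e (Ors (map (\<lambda>(i, c, j). ?g i c j) tr))"
      unfolding eval_derived(5) using *(1) by force
    then show "eval 6 e (fstep fD tr 6 4 5)" unfolding ex using *(2) w by blast
  qed
qed

lemma step_set_Q: "A \<subseteq> set qs \<Longrightarrow> step_set a A \<subseteq> set qs"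
  using D_Q by (auto simp: step_set_def)

lemma good_next_node:
  assumes "good_node X" "next_node tr X Y" "\<forall>(i, a, j)\<in>set tr. i < 9 \<and> j < 9"
  shows "good_node Y"
proof -
  from assms(2) obtain a S1 S2 S3 T1 T2 T3 i c j where *: "(i, c, j) \<in> set tr"
      "X = node i S1 S2 S3" "Y = node j T1 T2 T3"
      "9 \<notin> set T3 \<and> elems T3 = step_set a (elems S3)"
      "if 1 \<le> c then 9 \<notin> set T2 \<and> elems T2 = step_set a (elems S2) else T2 = S2"
      "if 2 \<le> c then 9 \<notin> set T1 \<and> elems T1 = step_set a (elems S1) else T1 = S1"
    unfolding next_node_def by blast
  from assms(1) obtain k S1' S2' S3' where g: "X = node k S1' S2' S3'" "k < 9"
      "\<forall>S\<in>{S1', S2', S3'}. 9 \<notin> set S \<and> elems S \<subseteq> set qs" by (auto simp: good_node_def)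
  have "node k S1' S2' S3' = [i] @ 9 # S1 @ 9 # S2 @ 9 # S3" using g(1) *(2) by (simp add: node_def)
  from node_unique[OF this] g have q: "S1 = S1'" "S2 = S2'" "S3 = S3'" by auto
  have "j < 9" using *(1) assms(3) by auto
  moreover have "9 \<notin> set T1 \<and> elems T1 \<subseteq> set qs" "9 \<notin> set T2 \<and> elems T2 \<subseteq> set qs" "9 \<notin> set T3 \<and> elems T3 \<subseteq> set qs"
    using *(4-6) g(3) q step_set_Q by (auto split: if_splits)
  ultimately show ?thesis unfolding good_node_def *(3) by blast
qed

definition graph :: "(nat \<times> nat \<times> nat) list \<Rightarrow> (nat list \<times> nat list) set" where
  "graph tr = {(X, Y). X \<in> words m \<and> Y \<in> words m \<and> next_node tr X Y}"

lemma eval_TC: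
  assumes e: "e 0 = replicate m 0" "e 1 = inp" and X: "good_node (e 2)"
    and tr: "\<forall>(i, a, j)\<in>set tr. i < 9 \<and> j < 9"
  shows "eval 4 e (TC (fstep fD tr 6 4 5) 2 3) \<longleftrightarrow> (e 2, e 3) \<in> (graph tr)\<^sup>*"
proof -
  let ?R = "{(a, a'). a \<in> words m \<and> a' \<in> words m \<and> eval 6 (e(4 := a, 5 := a')) (fstep fD tr 6 4 5)}"
  have eq: "(a, a') \<in> ?R \<longleftrightarrow> (a, a') \<in> graph tr" if "good_node a" for a a'
    using eval_fstep[of "e(4 := a, 5 := a')" tr] that e tr by (auto simp: graph_def)
  have "(e 2, y) \<in> ?R\<^sup>* \<longleftrightarrow> (e 2, y) \<in> (graph tr)\<^sup>*" for y
  proof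
    assume "(e 2, y) \<in> ?R\<^sup>*"
    then have "(e 2, y) \<in> (graph tr)\<^sup>* \<and> good_node y"
    proof (induction rule: rtrancl_induct)
      case (step y z)
      with eq[of y z] have "(y, z) \<in> graph tr" by blast
      with step show ?case using good_next_node[OF _ _ tr, of y z]
        by (auto simp: graph_def intro: rtrancl_into_rtrancl)
    qed (use X in auto)
    then show "(e 2, y) \<in> (graph tr)\<^sup>*" by blast
  next
    assume "(e 2, y) \<in> (graph tr)\<^sup>*"
    then have "(e 2, y) \<in> ?R\<^sup>* \<and> good_node y"
    proof (induction rule: rtrancl_induct)
      case (step y z)
      with eq[of y z] have "(y, z) \<in> ?R" by blast
      moreover have "good_node z" using step good_next_node[OF _ _ tr, of y z] by (auto simp: graph_def)
      ultimately show ?case using step by (blast intro: rtrancl_into_rtrancl)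
    qed (use X in auto)
    then show "(e 2, y) \<in> ?R\<^sup>*" by blast
  qed
  then show ?thesis using e by simp
qed

lemma eval_fstart:
  assumes e: "e 0 = replicate m 0" "e 1 = inp" "e 2 \<in> words m"
  shows "eval 4 e (fstart fI 4 2) \<longleftrightarrow> (\<exists>S. e 2 = node 0 S S S \<and> 9 \<notin> set S \<and> elems S = {x. I x})"
proof -
  have 1: "eval 6 (e(4 := S, 5 := y)) (fI 6 5) \<longleftrightarrow> I y" if "y \<in> words m" for S y
    using fI[of 6 5 "e(4 := S, 5 := y)"] that e by simp
  have 2: "(\<forall>y\<in>words m. y \<in> elems S \<longleftrightarrow> I y) \<longleftrightarrow> elems S = {x. I x}" if "S \<in> words m" for S
    using that elems_words I_Q Q_words by blast
  have "eval 4 e (fstart fI 4 2) \<longleftrightarrow> (\<exists>S\<in>words m. e 2 = 0 # 9 # S @ 9 # S @ 9 # S \<and> 9 \<notin> set S \<and>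
      (\<forall>y\<in>words m. y \<in> elems S \<longleftrightarrow> I y))"
    using e 1 by (auto simp: fstart_def)
  also have "\<dots> \<longleftrightarrow> (\<exists>S. e 2 = node 0 S S S \<and> 9 \<notin> set S \<and> elems S = {x. I x})"
    using e(3) 2 node_words unfolding node_def[symmetric] by metis
  finally show ?thesis .
qed

lemma eval_ffinish:
  assumes e: "e 0 = replicate m 0" "e 1 = inp" "e 3 \<in> words m"
    and n: "e 3 = node k S1 S2 S3" "k < 9" "\<forall>S\<in>{S1, S2, S3}. 9 \<notin> set S \<and> elems S \<subseteq> set qs"
  shows "eval 4 e (ffinish fF flag 4 3) \<longleftrightarrow>
    (flag \<longrightarrow> (\<exists>x\<in>elems S1. F x)) \<and> \<not> (\<exists>x\<in>elems S2. F x) \<and> (\<exists>x\<in>elems S3. F x)"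
proof -
  let ?e = "\<lambda>ks T1 T2 T3. e(4 := ks, 5 := T1, 6 := T2, 7 := T3)"
  have w: "[k] \<in> words m" "S1 \<in> words m" "S2 \<in> words m" "S3 \<in> words m"
    using e(3) n by (auto simp: node_def words_def)
  have "e 3 = ks @ 9 # T1 @ 9 # T2 @ 9 # T3 \<longleftrightarrow> ks = [k] \<and> T1 = S1 \<and> T2 = S2 \<and> T3 = S3" for ks T1 T2 T3
    using node_unique[of k S1 S2 S3 ks T1 T2 T3] n by (auto simp: node_def)
  then have "eval 4 e (ffinish fF flag 4 3) \<longleftrightarrow>
      eval 8 (?e [k] S1 S2 S3) (if flag then fmeets fF 8 5 else Eq 0 [Var 0]) \<and>
      \<not> eval 8 (?e [k] S1 S2 S3) (fmeets fF 8 6) \<and> eval 8 (?e [k] S1 S2 S3) (fmeets fF 8 7)"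
    using e(1) w by (auto simp: ffinish_def)
  also have "\<dots> \<longleftrightarrow> (flag \<longrightarrow> (\<exists>x\<in>elems S1. F x)) \<and> \<not> (\<exists>x\<in>elems S2. F x) \<and> (\<exists>x\<in>elems S3. F x)"
    using eval_fmeets[of 8 5 "?e [k] S1 S2 S3"] eval_fmeets[of 8 6 "?e [k] S1 S2 S3"]
      eval_fmeets[of 8 7 "?e [k] S1 S2 S3"] e w n by auto
  finally show ?thesis .
qed

section \<open>Paths of the search graph and marked words\<close>

abbreviation "R0 \<equiv> runs D {x. I x}"

lemma step_set_nm: "step_set (nm n) (R0 u) = R0 (u @ [n])"
  by (auto simp: step_set_def runs_snoc)

lemma graph_sound:
  assumes "(node 0 S S S, Y) \<in> (graph tr)\<^sup>*" "9 \<notin> set S" "elems S = {x. I x}"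
    "\<forall>(i, a, j)\<in>set tr. i < 9 \<and> j < 9"
  shows "\<exists>k S1 S2 S3 zs. Y = node k S1 S2 S3 \<and> k < 9 \<and> (\<forall>S\<in>{S1, S2, S3}. 9 \<notin> set S) \<and>
    mrun tr 0 (map snd zs) k \<and> elems S1 = R0 (part 2 zs) \<and> elems S2 = R0 (part 1 zs) \<and> elems S3 = R0 (part 0 zs)"
  using assms(1)
proof (induction rule: rtrancl_induct)
  case base
  show ?case
    by (rule exI[of _ 0], rule exI[of _ S], rule exI[of _ S], rule exI[of _ S], rule exI[of _ "[]"])
      (use assms in auto)
next
  case (step Y Z)
  then obtain k S1 S2 S3 zs where Y: "Y = node k S1 S2 S3" "k < 9" "\<forall>S\<in>{S1, S2, S3}. 9 \<notin> set S"
    "mrun tr 0 (map snd zs) k" "elems S1 = R0 (part 2 zs)" "elems S2 = R0 (part 1 zs)" "elems S3 = R0 (part 0 zs)"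
    by blast
  from step(2) obtain n S1' S2' S3' T1 T2 T3 i c j where *: "(i, c, j) \<in> set tr"
      "Y = node i S1' S2' S3'" "Z = node j T1 T2 T3"
      "9 \<notin> set T3 \<and> elems T3 = step_set (nm n) (elems S3')"
      "if 1 \<le> c then 9 \<notin> set T2 \<and> elems T2 = step_set (nm n) (elems S2') else T2 = S2'"
      "if 2 \<le> c then 9 \<notin> set T1 \<and> elems T1 = step_set (nm n) (elems S1') else T1 = S1'"
    unfolding graph_def next_node_def by blast
  have "node k S1 S2 S3 = [i] @ 9 # S1' @ 9 # S2' @ 9 # S3'" using Y(1) *(2) by (simp add: node_def)
  from node_unique[OF this] Y have q: "i = k" "S1' = S1" "S2' = S2" "S3' = S3" by auto
  show ?case
    by (rule exI[of _ j], rule exI[of _ T1], rule exI[of _ T2], rule exI[of _ T3], rule exI[of _ "zs @ [(n, c)]"])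
      (use * Y q assms(4) in \<open>auto simp: step_set_nm mrun_append split: if_splits\<close>)
qed

text \<open>Only the elements of the new sets are prescribed, so at each step codes can be chosen
  that are no longer than the code of all states; this keeps every node on the path within
  \<open>m\<close>.\<close>

lemma graph_complete:
  assumes S: "9 \<notin> set S" "elems S = {x. I x}" "node 0 S S S \<in> words m" "length S \<le> length (set_word qs)"
    and tr: "\<forall>(i, a, j)\<in>set tr. i < 9 \<and> j < 9"
    and zs: "mrun tr 0 (map snd zs) k" "\<forall>z\<in>set zs. length (fst z) \<le> m"
  shows "\<exists>S1 S2 S3. (node 0 S S S, node k S1 S2 S3) \<in> (graph tr)\<^sup>* \<and> node k S1 S2 S3 \<in> words m \<and>
    (\<forall>S\<in>{S1, S2, S3}. 9 \<notin> set S \<and> length S \<le> length (set_word qs)) \<and>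
    elems S1 = R0 (part 2 zs) \<and> elems S2 = R0 (part 1 zs) \<and> elems S3 = R0 (part 0 zs)"
  using zs
proof (induction zs arbitrary: k rule: rev_induct)
  case Nil
  then show ?case using S by auto
next
  case (snoc z zs)
  obtain n c where z: "z = (n, c)" by (cases z)
  from snoc.prems(1) obtain i where i: "mrun tr 0 (map snd zs) i" "(i, c, k) \<in> set tr"
    by (auto simp: z mrun_append)
  from snoc.IH[OF i(1)] snoc.prems(2) obtain S1 S2 S3 where IH: "(node 0 S S S, node i S1 S2 S3) \<in> (graph tr)\<^sup>*" "node i S1 S2 S3 \<in> words m"
    "\<forall>S\<in>{S1, S2, S3}. 9 \<notin> set S \<and> length S \<le> length (set_word qs)"
    "elems S1 = R0 (part 2 zs)" "elems S2 = R0 (part 1 zs)" "elems S3 = R0 (part 0 zs)"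
    by auto
  have w: "set S1 \<subseteq> {..<15}" "set S2 \<subseteq> {..<15}" using IH(2) by (auto simp: node_def words_def)
  have ex: "\<exists>T. elems T = step_set (nm n) (R0 u) \<and> 9 \<notin> set T \<and> set T \<subseteq> {..<15} \<and> length T \<le> length (set_word qs)" for u
    by (rule ex_set_word[OF step_set_Q[OF runs_Q]])
  from ex obtain T3 where T3: "elems T3 = step_set (nm n) (R0 (part 0 zs))" "9 \<notin> set T3" "set T3 \<subseteq> {..<15}"
    "length T3 \<le> length (set_word qs)" by blast
  have "\<exists>T2. (if 1 \<le> c then 9 \<notin> set T2 \<and> elems T2 = step_set (nm n) (elems S2) else T2 = S2) \<and>
      9 \<notin> set T2 \<and> set T2 \<subseteq> {..<15} \<and> length T2 \<le> length (set_word qs)"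
    using ex[of "part 1 zs"] IH(3,5) w by (cases "1 \<le> c") (simp_all, blast)
  then obtain T2 where T2: "if 1 \<le> c then 9 \<notin> set T2 \<and> elems T2 = step_set (nm n) (elems S2) else T2 = S2"
      "9 \<notin> set T2" "set T2 \<subseteq> {..<15}" "length T2 \<le> length (set_word qs)" by blast
  have "\<exists>T1. (if 2 \<le> c then 9 \<notin> set T1 \<and> elems T1 = step_set (nm n) (elems S1) else T1 = S1) \<and>
      9 \<notin> set T1 \<and> set T1 \<subseteq> {..<15} \<and> length T1 \<le> length (set_word qs)"
    using ex[of "part 2 zs"] IH(3,4) w by (cases "2 \<le> c") (simp_all, blast)
  then obtain T1 where T1: "if 2 \<le> c then 9 \<notin> set T1 \<and> elems T1 = step_set (nm n) (elems S1) else T1 = S1"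
      "9 \<notin> set T1" "set T1 \<subseteq> {..<15}" "length T1 \<le> length (set_word qs)" by blast
  have k: "k < 9" using i tr by auto
  have nw: "node k T1 T2 T3 \<in> words m"
    using T1 T2 T3 k Q_len by (auto simp: node_def words_def)
  have "nm n \<in> words m" using snoc.prems(2) z by (simp add: nm_in_words)
  note nn = this
  have "next_node tr (node i S1 S2 S3) (node k T1 T2 T3)"
    unfolding next_node_def
    by (rule exI[of _ "nm n"], rule exI[of _ S1], rule exI[of _ S2], rule exI[of _ S3],
        rule exI[of _ T1], rule exI[of _ T2], rule exI[of _ T3],
        rule exI[of _ i], rule exI[of _ c], rule exI[of _ k])
      (use nn i(2) T1(1) T2(1) T3(1,2) IH(6) in simp)
  with IH nw have "(node 0 S S S, node k T1 T2 T3) \<in> (graph tr)\<^sup>*"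
    by (auto simp: graph_def intro: rtrancl_into_rtrancl)
  moreover have "elems T1 = R0 (part 2 (zs @ [z]))" "elems T2 = R0 (part 1 (zs @ [z]))" "elems T3 = R0 (part 0 (zs @ [z]))"
    using T1(1) T2(1) T3(1) IH by (auto simp: z step_set_nm split: if_splits)
  ultimately show ?case using nw T1 T2 T3 by blast
qed

text \<open>The search guesses only letters of length at most \<open>m\<close>. Nothing is lost:
  every marked letter occurs in the accepted word \<open>w\<close>, and a letter that is read occurs
  in a transition.\<close>

lemma letters_bounded: "R0 w \<noteq> {} \<Longrightarrow> a \<in> set w \<Longrightarrow> length a \<le> m"
proof (induction w rule: rev_induct)
  case (snoc c w)
  then have "R0 w \<noteq> {}" by (auto simp: runs_snoc)
  moreover from snoc.prems(1) obtain x y where "x \<in> R0 w" "D x c y" by (auto simp: runs_snoc)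
  then have "length c \<le> m" using runs_Q D_Q by blast
  ultimately show ?case using snoc by auto
qed simp

theorem eval_fviolation:
  assumes e: "e 0 = replicate m 0" "e 1 = inp" and tr: "\<forall>(i, a, j)\<in>set tr. i < 9 \<and> j < 9"
    and le: "traces tr le"
  shows "eval 2 e (fviolation fI fD fF tr flag) \<longleftrightarrow>
    (\<exists>u v w. le u v \<and> le v w \<and> (flag \<longrightarrow> u \<in> aut_lang I D F) \<and> v \<notin> aut_lang I D F \<and> w \<in> aut_lang I D F)"
proof -
  let ?L = "aut_lang I D F"
  have L: "u \<in> ?L \<longleftrightarrow> (\<exists>x\<in>R0 u. F x)" for u by (simp add: aut_lang_def)
  have gn: "good_node (node 0 S S S)" if "9 \<notin> set S" "elems S = {x. I x}" for S
    unfolding good_node_def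
    by (rule exI[of _ 0], rule exI[of _ S], rule exI[of _ S], rule exI[of _ S]) (use that I_Q in auto)
  have "eval 2 e (fviolation fI fD fF tr flag) \<longleftrightarrow> (\<exists>X\<in>words m. \<exists>Y\<in>words m.
      eval 4 (e(2 := X, 3 := Y)) (fstart fI 4 2) \<and>
      eval 4 (e(2 := X, 3 := Y)) (TC (fstep fD tr 6 4 5) 2 3) \<and>
      eval 4 (e(2 := X, 3 := Y)) (ffinish fF flag 4 3))"
    using e(1) by (simp add: fviolation_def del: eval.simps(5))
  also have "\<dots> \<longleftrightarrow> (\<exists>S. node 0 S S S \<in> words m \<and> 9 \<notin> set S \<and> elems S = {x. I x} \<and>
      (\<exists>Y\<in>words m. (node 0 S S S, Y) \<in> (graph tr)\<^sup>* \<and>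
        eval 4 (e(2 := node 0 S S S, 3 := Y)) (ffinish fF flag 4 3)))"
  proof -
    have st1: "eval 4 (e(2 := X, 3 := Y)) (fstart fI 4 2) \<longleftrightarrow>
      (\<exists>S. X = node 0 S S S \<and> 9 \<notin> set S \<and> elems S = {x. I x})" if "X \<in> words m" for X Y
      using eval_fstart[of "e(2 := X, 3 := Y)"] e that by simp
    have st2: "eval 4 (e(2 := node 0 S S S, 3 := Y)) (TC (fstep fD tr 6 4 5) 2 3) \<longleftrightarrow>
        (node 0 S S S, Y) \<in> (graph tr)\<^sup>*" if "9 \<notin> set S" "elems S = {x. I x}" for S Y
      using eval_TC[of "e(2 := node 0 S S S, 3 := Y)" tr] e tr gn[OF that] by simp
    show ?thesis
    proof
      assume "\<exists>X\<in>words m. \<exists>Y\<in>words m. eval 4 (e(2 := X, 3 := Y)) (fstart fI 4 2) \<and>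
        eval 4 (e(2 := X, 3 := Y)) (TC (fstep fD tr 6 4 5) 2 3) \<and> eval 4 (e(2 := X, 3 := Y)) (ffinish fF flag 4 3)"
      then obtain X Y where *: "X \<in> words m" "Y \<in> words m" "eval 4 (e(2 := X, 3 := Y)) (fstart fI 4 2)"
        "eval 4 (e(2 := X, 3 := Y)) (TC (fstep fD tr 6 4 5) 2 3)" "eval 4 (e(2 := X, 3 := Y)) (ffinish fF flag 4 3)"
        by blast
      from st1[OF *(1)] *(3) obtain S where S: "X = node 0 S S S" "9 \<notin> set S" "elems S = {x. I x}" by blast
      from st2[OF S(2,3)] *(4) S(1) have "(node 0 S S S, Y) \<in> (graph tr)\<^sup>*" by blast
      with * S show "\<exists>S. node 0 S S S \<in> words m \<and> 9 \<notin> set S \<and> elems S = {x. I x} \<and>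
        (\<exists>Y\<in>words m. (node 0 S S S, Y) \<in> (graph tr)\<^sup>* \<and>
        eval 4 (e(2 := node 0 S S S, 3 := Y)) (ffinish fF flag 4 3))" by blast
    next
      assume "\<exists>S. node 0 S S S \<in> words m \<and> 9 \<notin> set S \<and> elems S = {x. I x} \<and>
        (\<exists>Y\<in>words m. (node 0 S S S, Y) \<in> (graph tr)\<^sup>* \<and>
        eval 4 (e(2 := node 0 S S S, 3 := Y)) (ffinish fF flag 4 3))"
      then obtain S Y where *: "node 0 S S S \<in> words m" "9 \<notin> set S" "elems S = {x. I x}" "Y \<in> words m"
        "(node 0 S S S, Y) \<in> (graph tr)\<^sup>*" "eval 4 (e(2 := node 0 S S S, 3 := Y)) (ffinish fF flag 4 3)" by blast
      from st1[OF *(1)] st2[OF *(2,3)] * show "\<exists>X\<in>words m. \<exists>Y\<in>words m. eval 4 (e(2 := X, 3 := Y)) (fstart fI 4 2) \<and>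
        eval 4 (e(2 := X, 3 := Y)) (TC (fstep fD tr 6 4 5) 2 3) \<and> eval 4 (e(2 := X, 3 := Y)) (ffinish fF flag 4 3)"
        by blast
    qed
  qed
  also have "\<dots> \<longleftrightarrow> (\<exists>zs k. mrun tr 0 (map snd zs) k \<and> (flag \<longrightarrow> part 2 zs \<in> ?L) \<and> part 1 zs \<notin> ?L \<and> part 0 zs \<in> ?L)"
  proof
    assume "\<exists>S. node 0 S S S \<in> words m \<and> 9 \<notin> set S \<and> elems S = {x. I x} \<and>
      (\<exists>Y\<in>words m. (node 0 S S S, Y) \<in> (graph tr)\<^sup>* \<and>
        eval 4 (e(2 := node 0 S S S, 3 := Y)) (ffinish fF flag 4 3))"
    then obtain S Y where *: "9 \<notin> set S" "elems S = {x. I x}" "Y \<in> words m" "(node 0 S S S, Y) \<in> (graph tr)\<^sup>*"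
      "eval 4 (e(2 := node 0 S S S, 3 := Y)) (ffinish fF flag 4 3)" by blast
    from graph_sound[OF *(4,1,2) tr] obtain k S1 S2 S3 zs where Y: "Y = node k S1 S2 S3" "k < 9"
      "\<forall>S\<in>{S1, S2, S3}. 9 \<notin> set S"
      "mrun tr 0 (map snd zs) k" "elems S1 = R0 (part 2 zs)" "elems S2 = R0 (part 1 zs)" "elems S3 = R0 (part 0 zs)"
      by blast
    then have "(flag \<longrightarrow> (\<exists>x\<in>elems S1. F x)) \<and> \<not> (\<exists>x\<in>elems S2. F x) \<and> (\<exists>x\<in>elems S3. F x)"
      using eval_ffinish[of "e(2 := node 0 S S S, 3 := Y)" k S1 S2 S3 flag] * e runs_Q by simp
    then show "\<exists>zs k. mrun tr 0 (map snd zs) k \<and> (flag \<longrightarrow> part 2 zs \<in> ?L) \<and> part 1 zs \<notin> ?L \<and> part 0 zs \<in> ?L"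
      using Y unfolding L by auto
  next
    assume "\<exists>zs k. mrun tr 0 (map snd zs) k \<and> (flag \<longrightarrow> part 2 zs \<in> ?L) \<and> part 1 zs \<notin> ?L \<and> part 0 zs \<in> ?L"
    then obtain zs k where zs: "mrun tr 0 (map snd zs) k" "flag \<longrightarrow> part 2 zs \<in> ?L" "part 1 zs \<notin> ?L" "part 0 zs \<in> ?L"
      by blast
    obtain S where S: "elems S = {x. I x}" "9 \<notin> set S" "set S \<subseteq> {..<15}" "length S \<le> length (set_word qs)"
      using ex_set_word[of "{x. I x}"] I_Q by blast
    have nS: "node 0 S S S \<in> words m" using S Q_len by (auto simp: node_def words_def)
    have "R0 (part 0 zs) \<noteq> {}" using zs(4) by (auto simp: L)
    then have "\<forall>z\<in>set zs. length (fst z) \<le> m"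
      using letters_bounded[of "part 0 zs"] by (auto simp: part_def)
    from graph_complete[OF S(2,1) nS S(4) tr zs(1) this] obtain S1 S2 S3 where
      g: "(node 0 S S S, node k S1 S2 S3) \<in> (graph tr)\<^sup>*" "node k S1 S2 S3 \<in> words m"
      "\<forall>S\<in>{S1, S2, S3}. 9 \<notin> set S \<and> length S \<le> length (set_word qs)"
      "elems S1 = R0 (part 2 zs)" "elems S2 = R0 (part 1 zs)" "elems S3 = R0 (part 0 zs)" by blast
    have "mrun tr j as k \<Longrightarrow> j < 9 \<Longrightarrow> k < 9" for j as
      using tr by (induction as arbitrary: j) auto
    with zs(1) have k: "k < 9" by (metis zero_less_numeral)
    have "eval 4 (e(2 := node 0 S S S, 3 := node k S1 S2 S3)) (ffinish fF flag 4 3)"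
      using eval_ffinish[of "e(2 := node 0 S S S, 3 := node k S1 S2 S3)" k S1 S2 S3 flag] e g k runs_Q zs(2-4)
      by (simp add: L)
    with S nS g show "\<exists>S. node 0 S S S \<in> words m \<and> 9 \<notin> set S \<and> elems S = {x. I x} \<and>
      (\<exists>Y\<in>words m. (node 0 S S S, Y) \<in> (graph tr)\<^sup>* \<and>
        eval 4 (e(2 := node 0 S S S, 3 := Y)) (ffinish fF flag 4 3))" by blast
  qed
  also have "\<dots> \<longleftrightarrow> (\<exists>u v w. le u v \<and> le v w \<and> (flag \<longrightarrow> u \<in> ?L) \<and> v \<notin> ?L \<and> w \<in> ?L)"
  proof
    assume "\<exists>zs k. mrun tr 0 (map snd zs) k \<and> (flag \<longrightarrow> part 2 zs \<in> ?L) \<and> part 1 zs \<notin> ?L \<and> part 0 zs \<in> ?L"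
    then obtain zs k where zs: "mrun tr 0 (map snd zs) k" "flag \<longrightarrow> part 2 zs \<in> ?L" "part 1 zs \<notin> ?L" "part 0 zs \<in> ?L"
      by blast
    from le zs(1) have "le (part 2 zs) (part 1 zs)" "le (part 1 zs) (part 0 zs)" unfolding traces_def by blast+
    with zs show "\<exists>u v w. le u v \<and> le v w \<and> (flag \<longrightarrow> u \<in> ?L) \<and> v \<notin> ?L \<and> w \<in> ?L" by blast
  next
    assume "\<exists>u v w. le u v \<and> le v w \<and> (flag \<longrightarrow> u \<in> ?L) \<and> v \<notin> ?L \<and> w \<in> ?L"
    then obtain u v w where *: "le u v" "le v w" "flag \<longrightarrow> u \<in> ?L" "v \<notin> ?L" "w \<in> ?L" by blast
    with le obtain zs k where "mrun tr 0 (map snd zs) k" "u = part 2 zs" "v = part 1 zs" "w = part 0 zs"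
      unfolding traces_def by blast
    with * show "\<exists>zs k. mrun tr 0 (map snd zs) k \<and> (flag \<longrightarrow> part 2 zs \<in> ?L) \<and> part 1 zs \<notin> ?L \<and> part 0 zs \<in> ?L"
      by blast
  qed
  finally show ?thesis .
qed

end

section \<open>From definable automata to membership in PSPACE\<close>

theorem membership:
  fixes Lang :: "nat list \<Rightarrow> name list set" and le :: "name list \<Rightarrow> name list \<Rightarrow> bool"
  assumes ok: "ok 2 fV" "\<And>b x. 2 \<le> b \<Longrightarrow> x < b \<Longrightarrow> ok b (fI b x)" "\<And>b x. 2 \<le> b \<Longrightarrow> x < b \<Longrightarrow> ok b (fF b x)"
      "\<And>b x a y. 2 \<le> b \<Longrightarrow> x < b \<Longrightarrow> a < b \<Longrightarrow> y < b \<Longrightarrow> ok b (fD b x a y)"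
    and cd: "1 \<le> c" "1 \<le> d" "k \<le> 15"
    and tr: "traces tr le" "\<forall>(i, a, j)\<in>set tr. i < 9 \<and> j < 9" and refl: "\<And>v. le v v"
    and valid: "\<And>w. w \<in> lists {..<k} \<Longrightarrow>
      eval 2 ((\<lambda>_. [])(0 := replicate (c * (length w + 1) ^ d) 0, 1 := w)) fV \<longleftrightarrow> valid w"
    and aut: "\<And>w. w \<in> lists {..<k} \<Longrightarrow> valid w \<Longrightarrow> \<exists>I D F qs.
      word_automaton (c * (length w + 1) ^ d) w I D F fI fF fD qs \<and> Lang w = aut_lang I D F"
  shows "{w \<in> lists {..<k}. valid w \<and> convex_lang le (Lang w)} \<in> PSPACE k"
    and "{w \<in> lists {..<k}. valid w \<and> closed_lang le (Lang w)} \<in> PSPACE k"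
proof -
  have main: "{w \<in> lists {..<k}. valid w \<and> \<not> (\<exists>u v x. le u v \<and> le v x \<and>
      (flag \<longrightarrow> u \<in> Lang w) \<and> v \<notin> Lang w \<and> x \<in> Lang w)} \<in> PSPACE k" for flag
  proof -
    let ?f = "And fV (Neg (fviolation fI fD fF tr flag))"
    have "ok 2 ?f" using ok(1) ok_fviolation[OF ok(2,3,4) tr(2)] by simp
    from PSPACE_logic[OF this cd] have
      "{w \<in> lists {..<k}. eval 2 ((\<lambda>_. [])(0 := replicate (c * (length w + 1) ^ d) 0, 1 := w)) ?f} \<in> PSPACE k" .
    moreover have "eval 2 ((\<lambda>_. [])(0 := replicate (c * (length w + 1) ^ d) 0, 1 := w)) ?f \<longleftrightarrow>
        valid w \<and> \<not> (\<exists>u v x. le u v \<and> le v x \<and> (flag \<longrightarrow> u \<in> Lang w) \<and> v \<notin> Lang w \<and> x \<in> Lang w)"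
      if w: "w \<in> lists {..<k}" for w
    proof (cases "valid w")
      case True
      from aut[OF w True] obtain I D F qs where
        wa: "word_automaton (c * (length w + 1) ^ d) w I D F fI fF fD qs" "Lang w = aut_lang I D F" by blast
      show ?thesis using valid[OF w] word_automaton.eval_fviolation[OF wa(1) _ _ tr(2,1)] wa(2) by simp
    qed (use valid[OF w] in simp)
    ultimately show ?thesis by (simp cong: conj_cong)
  qed
  show "{w \<in> lists {..<k}. valid w \<and> convex_lang le (Lang w)} \<in> PSPACE k"
    by (rule back_subst[of "\<lambda>A. A \<in> PSPACE k", OF main[of True]]) (auto simp: convex_lang_def)
  show "{w \<in> lists {..<k}. valid w \<and> closed_lang le (Lang w)} \<in> PSPACE k"
    by (rule back_subst[of "\<lambda>A. A \<in> PSPACE k", OF main[of False]]) (use refl in \<open>auto simp: closed_lang_def; blast\<close>)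
qed

subsection \<open>The four relations\<close>

text \<open>The phases of a marking in their order: a step may stay in its phase or skip to any
  later one, so phases may be empty. Prefixes have the markings \<open>2* 1* 0*\<close>, suffixes
  \<open>0* 1* 2*\<close>, factors \<open>0* 1* 2* 1* 0*\<close>; for subwords all markings are
  allowed.\<close>

definition phase_trans :: "nat list \<Rightarrow> (nat \<times> nat \<times> nat) list" where
  "phase_trans al = [(i, al ! j, j). j \<leftarrow> [0..<length al], i \<leftarrow> [0..<Suc j]]"

lemma set_phase_trans: "(i, a, j) \<in> set (phase_trans al) \<longleftrightarrow> i \<le> j \<and> j < length al \<and> a = al ! j"
  by (auto simp: phase_trans_def image_iff le_less)

fun phased :: "nat list \<Rightarrow> ('a \<times> nat) list \<Rightarrow> bool" where
  "phased [] zs \<longleftrightarrow> zs = []"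
| "phased (a # al) zs \<longleftrightarrow> (\<exists>b zs'. zs = map (\<lambda>x. (x, a)) b @ zs' \<and> phased al zs')"

lemma phasedI: "phased al zs \<Longrightarrow> phased (a # al) (map (\<lambda>x. (x, a)) b @ zs)"
  by auto

lemma phased_last: "phased [a] (map (\<lambda>x. (x, a)) b)"
  by auto

lemma phased_Nil: "phased al []"
  by (induction al) auto

lemma phased_Cons: "phased al ((x, c) # zs) \<longleftrightarrow> (\<exists>j<length al. al ! j = c \<and> phased (drop j al) zs)"
proof (induction al)
  case (Cons a al)
  have "phased (a # al) ((x, c) # zs) \<longleftrightarrow> phased al ((x, c) # zs) \<or> (a = c \<and> phased (a # al) zs)"
  proof
    assume "phased (a # al) ((x, c) # zs)"
    then obtain b zs' where *: "(x, c) # zs = map (\<lambda>x. (x, a)) b @ zs'" "phased al zs'" by auto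
    then show "phased al ((x, c) # zs) \<or> (a = c \<and> phased (a # al) zs)" by (cases b) auto
  next
    assume "phased al ((x, c) # zs) \<or> (a = c \<and> phased (a # al) zs)"
    then show "phased (a # al) ((x, c) # zs)"
    proof
      assume "phased al ((x, c) # zs)"
      then show ?thesis using phasedI[of al _ a "[]"] by simp
    next
      assume "a = c \<and> phased (a # al) zs"
      then obtain b zs' where "a = c" "zs = map (\<lambda>x. (x, a)) b @ zs'" "phased al zs'" by auto
      then show ?thesis by (auto intro!: exI[of _ "x # b"])
    qed
  qed
  also have "\<dots> \<longleftrightarrow> (\<exists>j<length (a # al). (a # al) ! j = c \<and> phased (drop j (a # al)) zs)"
    unfolding Cons.IH length_Cons Ex_less_Suc2 by (auto simp del: phased.simps)
  finally show ?case .
qed simp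

lemma mrun_phase_trans:
  "i < length al \<Longrightarrow> (\<exists>k. mrun (phase_trans al) i (map snd zs) k) \<longleftrightarrow> phased (drop i al) zs"
proof (induction zs arbitrary: i)
  case Nil
  then show ?case by (simp add: phased_Nil)
next
  case (Cons z zs)
  obtain x c where z: "z = (x, c)" by (cases z)
  have "(\<exists>k. mrun (phase_trans al) i (map snd (z # zs)) k) \<longleftrightarrow>
      (\<exists>j. i \<le> j \<and> j < length al \<and> c = al ! j \<and> (\<exists>k. mrun (phase_trans al) j (map snd zs) k))"
    by (auto simp: z set_phase_trans)
  also have "\<dots> \<longleftrightarrow> (\<exists>j. i \<le> j \<and> j < length al \<and> c = al ! j \<and> phased (drop j al) zs)"
    using Cons.IH by auto
  also have "\<dots> \<longleftrightarrow> (\<exists>j<length al - i. al ! (i + j) = c \<and> phased (drop (i + j) al) zs)"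
    by (auto simp: le_iff_add less_diff_conv add.commute)
  also have "\<dots> \<longleftrightarrow> phased (drop i al) (z # zs)"
    using Cons.prems by (simp add: z phased_Cons add.commute)
  finally show ?case .
qed

lemma part_map: "part k (map (\<lambda>x. (x, a)) b) = (if k \<le> a then b else [])"
  by (induction b) auto

lemma traces_phased:
  assumes "al \<noteq> []" "\<And>u v w. le u v \<and> le v w \<longleftrightarrow> (\<exists>zs. phased al zs \<and> u = part 2 zs \<and> v = part 1 zs \<and> w = part 0 zs)"
  shows "traces (phase_trans al) le"
  unfolding traces_def assms(2) using mrun_phase_trans[of 0 al] assms(1) by auto

lemma traces_prefix: "traces (phase_trans [2, 1, 0]) prefix"
proof (rule traces_phased)
  fix u v w :: "'a list"
  show "prefix u v \<and> prefix v w \<longleftrightarrow> (\<exists>zs. phased [2, 1, 0] zs \<and> u = part 2 zs \<and> v = part 1 zs \<and> w = part 0 zs)"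
    (is "?L \<longleftrightarrow> ?R")
  proof
    assume ?L
    then obtain x y where "v = u @ x" "w = u @ x @ y" by (auto simp: prefix_def)
    then show ?R
      by (intro exI[of _ "map (\<lambda>x. (x, 2)) u @ map (\<lambda>x. (x, 1)) x @ map (\<lambda>x. (x, 0)) y"]) (auto simp: part_map simp del: phased.simps intro!: phasedI phased_last)
  qed (auto simp: part_map prefix_def)
qed simp

lemma traces_suffix: "traces (phase_trans [0, 1, 2]) suffix"
proof (rule traces_phased)
  fix u v w :: "'a list"
  show "suffix u v \<and> suffix v w \<longleftrightarrow> (\<exists>zs. phased [0, 1, 2] zs \<and> u = part 2 zs \<and> v = part 1 zs \<and> w = part 0 zs)"
    (is "?L \<longleftrightarrow> ?R")
  proof
    assume ?L
    then obtain x y where "v = x @ u" "w = y @ x @ u" by (auto simp: suffix_def)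
    then show ?R
      by (intro exI[of _ "map (\<lambda>x. (x, 0)) y @ map (\<lambda>x. (x, 1)) x @ map (\<lambda>x. (x, 2)) u"]) (auto simp: part_map simp del: phased.simps intro!: phasedI phased_last)
  qed (auto simp: part_map suffix_def)
qed simp

lemma traces_sublist: "traces (phase_trans [0, 1, 2, 1, 0]) sublist"
proof (rule traces_phased)
  fix u v w :: "'a list"
  show "sublist u v \<and> sublist v w \<longleftrightarrow>
      (\<exists>zs. phased [0, 1, 2, 1, 0] zs \<and> u = part 2 zs \<and> v = part 1 zs \<and> w = part 0 zs)" (is "?L \<longleftrightarrow> ?R")
  proof
    assume ?L
    then obtain x x' y y' where "v = x @ u @ x'" "w = y @ x @ u @ x' @ y'" by (auto simp: sublist_def)
    then show ?R
      by (intro exI[of _ "map (\<lambda>x. (x, 0)) y @ map (\<lambda>x. (x, 1)) x @ map (\<lambda>x. (x, 2)) u @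
          map (\<lambda>x. (x, 1)) x' @ map (\<lambda>x. (x, 0)) y'"]) (auto simp: part_map simp del: phased.simps intro!: phasedI phased_last)
  qed (auto simp: part_map sublist_def; metis append.assoc)
qed simp

lemma subseq_part: "k \<le> k' \<Longrightarrow> subseq (part k' zs) (part k zs)"
  by (induction zs) auto

text \<open>Induction on the embedding of \<open>v\<close> in \<open>w\<close>. A letter of
  \<open>w\<close> that is skipped gets activity 0; a matched one gets 2 or 1 depending on whether
  the embedding of \<open>u\<close> in \<open>v\<close> uses it.\<close>

lemma subseq_trace:
  "subseq v w \<Longrightarrow> subseq u v \<Longrightarrow>
    \<exists>zs. (\<forall>z\<in>set zs. snd z \<le> 2) \<and> u = part 2 zs \<and> v = part 1 zs \<and> w = part 0 zs"
proof (induction arbitrary: u rule: list_emb.induct)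
  case (list_emb_Nil w)
  then show ?case by (intro exI[of _ "map (\<lambda>x. (x, 0)) w"]) (auto simp: part_map)
next
  case (list_emb_Cons v w y)
  then obtain zs where "\<forall>z\<in>set zs. snd z \<le> 2" "u = part 2 zs" "v = part 1 zs" "w = part 0 zs" by blast
  then show ?case by (intro exI[of _ "(y, 0) # zs"]) auto
next
  case (list_emb_Cons2 x y v w)
  from list_emb_Cons2.prems consider "subseq u v" | u' where "u = x # u'" "subseq u' v"
    by (cases rule: list_emb.cases) auto
  then show ?case
  proof cases
    case 1
    with list_emb_Cons2 obtain zs where "\<forall>z\<in>set zs. snd z \<le> 2" "u = part 2 zs" "v = part 1 zs" "w = part 0 zs" by blast
    with list_emb_Cons2 show ?thesis by (intro exI[of _ "(y, 1) # zs"]) auto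
  next
    case 2
    with list_emb_Cons2 obtain zs where "\<forall>z\<in>set zs. snd z \<le> 2" "u' = part 2 zs" "v = part 1 zs" "w = part 0 zs" by blast
    with list_emb_Cons2 2 show ?thesis by (intro exI[of _ "(y, 2) # zs"]) auto
  qed
qed

lemma traces_subseq: "traces [(0, 0, 0), (0, 1, 0), (0, 2, 0)] subseq"
proof -
  have m: "(\<exists>k. mrun [(0, 0, 0), (0, 1, 0), (0, 2, 0)] 0 as k) \<longleftrightarrow> (\<forall>a\<in>set as. a \<le> 2)" for as
  proof (induction as)
    case (Cons a as)
    have "a \<le> 2 \<longleftrightarrow> a = 0 \<or> a = 1 \<or> a = 2" by auto
    then show ?case using Cons by auto
  qed simp
  show ?thesis
    unfolding traces_def
  proof (intro allI iffI)
    fix u v w :: "'a list"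
    assume "subseq u v \<and> subseq v w"
    then obtain zs where "\<forall>z\<in>set zs. snd z \<le> 2" "u = part 2 zs" "v = part 1 zs" "w = part 0 zs"
      using subseq_trace by blast
    with m[of "map snd zs"]
    show "\<exists>zs k. mrun [(0, 0, 0), (0, 1, 0), (0, 2, 0)] 0 (map snd zs) k \<and> u = part 2 zs \<and> v = part 1 zs \<and> w = part 0 zs"
      by auto
  next
    fix u v w :: "'a list"
    assume "\<exists>zs k. mrun [(0, 0, 0), (0, 1, 0), (0, 2, 0)] 0 (map snd zs) k \<and> u = part 2 zs \<and> v = part 1 zs \<and> w = part 0 zs"
    then show "subseq u v \<and> subseq v w" by (auto intro: subseq_part)
  qed
qed

lemma ex_traces:
  assumes "le \<in> {prefix, suffix, sublist, subseq}"
  shows "\<exists>tr. traces tr le \<and> (\<forall>(i, a, j)\<in>set tr. i < 9 \<and> j < 9)"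
proof -
  have "\<forall>(i, a, j)\<in>set (phase_trans al). i < 9 \<and> j < 9" if "length al \<le> 5" for al
    using that by (auto simp: set_phase_trans)
  from this[of "[2, 1, 0]"] this[of "[0, 1, 2]"] this[of "[0, 1, 2, 1, 0]"] assms
  show ?thesis using traces_prefix traces_suffix traces_sublist traces_subseq by fastforce
qed

lemma le_refl: "le \<in> {prefix, suffix, sublist, subseq} \<Longrightarrow> le v v"
  by auto

subsection \<open>Sequences of code words\<close>

definition prefix_code :: "'a list set \<Rightarrow> bool" where
  "prefix_code U \<longleftrightarrow> (\<forall>u\<in>U. \<forall>u'\<in>U. \<forall>x y. u @ x = u' @ y \<longrightarrow> u = u' \<and> x = y)"

text \<open>Two factorizations into words of a prefix code agree from the left; so a code word that
  starts at the end of \<open>us1\<close> is an entry of \<open>us\<close>.\<close>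

lemma prefix_code_concat:
  assumes "prefix_code U" "set us \<subseteq> U" "set us1 \<subseteq> U" "u \<in> U" "[] \<notin> U" "concat us = concat us1 @ u @ r"
  shows "\<exists>us2. us = us1 @ u # us2"
  using assms(2,3,6)
proof (induction us1 arbitrary: us)
  case Nil
  then obtain u' us' where us: "us = u' # us'"
    using assms(4,5) by (cases us) auto
  with Nil have "u' @ concat us' = u @ r" "u' \<in> U" by auto
  with assms(1,4) have "u' = u" unfolding prefix_code_def by blast
  with us show ?case by simp
next
  case (Cons v us1)
  then obtain u' us' where us: "us = u' # us'"
    using assms(5) by (cases us) auto
  with Cons.prems have eq: "u' @ concat us' = v @ (concat us1 @ u @ r)" and U: "u' \<in> U" "v \<in> U" by auto
  from assms(1) eq U have "u' = v" "concat us' = concat us1 @ u @ r"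
    unfolding prefix_code_def by blast+
  moreover have "\<exists>us2. us' = us1 @ u # us2"
    by (rule Cons.IH) (use Cons.prems us \<open>concat us' = concat us1 @ u @ r\<close> in auto)
  ultimately show ?case using us by auto
qed

text \<open>Kleene star as reachability: code words are removed from the front until the empty word,
  bound to variable \<open>b\<close>, remains.\<close>

definition fstar :: "(nat \<Rightarrow> nat \<Rightarrow> fm) \<Rightarrow> nat \<Rightarrow> nat \<Rightarrow> fm" where
  "fstar fU b x = Ex (And (Eq b []) (TC (Ex (And (fU (b + 4) (b + 3)) (Eq (b + 1) [Var (b + 3), Var (b + 2)]))) x b))"

text \<open>Requiring that the part before \<open>u\<close> is itself a sequence of code words
  ensures that \<open>u\<close> is an entry of the list and not a suffix of a longer entry.\<close>

definition fitem :: "(nat \<Rightarrow> nat \<Rightarrow> fm) \<Rightarrow> nat \<Rightarrow> nat \<Rightarrow> nat \<Rightarrow> fm" where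
  "fitem fU b u x = Ex (Ex (Ands [fstar fU (b + 2) b, fU (b + 2) u, Eq x [Var b, Var u, Var (b + 1)]]))"

definition definable :: "(nat \<Rightarrow> nat \<Rightarrow> fm) \<Rightarrow> nat list set \<Rightarrow> bool" where
  "definable fU U \<longleftrightarrow> (\<forall>b x e. 0 < b \<longrightarrow> x < b \<longrightarrow> e x \<in> words (length (e 0)) \<longrightarrow> (eval b e (fU b x) \<longleftrightarrow> e x \<in> U)) \<and>
     (\<forall>b x. 0 < b \<longrightarrow> x < b \<longrightarrow> ok b (fU b x))"

lemma ok_fstar: "definable fU U \<Longrightarrow> 0 < b \<Longrightarrow> x < b \<Longrightarrow> ok b (fstar fU b x)"
  by (simp add: definable_def fstar_def numeral_eq_Suc)

lemma ok_fitem: "definable fU U \<Longrightarrow> 0 < b \<Longrightarrow> x < b \<Longrightarrow> u < b \<Longrightarrow> ok b (fitem fU b u x)"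
  by (simp add: fitem_def ok_fstar) (simp add: definable_def)

lemma peel_rtrancl:
  assumes "x \<in> words m"
  shows "(x, []) \<in> {(X, Y). X \<in> words m \<and> Y \<in> words m \<and> (\<exists>u\<in>U. X = u @ Y)}\<^sup>* \<longleftrightarrow> (\<exists>us. set us \<subseteq> U \<and> x = concat us)"
    (is "_ \<in> ?R\<^sup>* \<longleftrightarrow> _")
proof
  assume "(x, []) \<in> ?R\<^sup>*"
  then show "\<exists>us. set us \<subseteq> U \<and> x = concat us"
  proof (induction rule: converse_rtrancl_induct)
    case base
    then show ?case by (intro exI[of _ "[]"]) simp
  next
    case (step X Y)
    then obtain u us where "u \<in> U" "X = u @ Y" "set us \<subseteq> U" "Y = concat us" by auto
    then show ?case by (intro exI[of _ "u # us"]) simp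
  qed
next
  assume "\<exists>us. set us \<subseteq> U \<and> x = concat us"
  then obtain us where "set us \<subseteq> U" "x = concat us" by blast
  then show "(x, []) \<in> ?R\<^sup>*" using assms
  proof (induction us arbitrary: x)
    case (Cons u us)
    then have "(x, concat us) \<in> ?R" by (auto simp: words_def)
    moreover have "(concat us, []) \<in> ?R\<^sup>*" using Cons by (intro Cons.IH) (auto simp: words_def)
    ultimately show ?case by (rule converse_rtrancl_into_rtrancl)
  qed simp
qed

lemma eval_fstar:
  assumes "definable fU U" "0 < b" "x < b" "e x \<in> words (length (e 0))"
  shows "eval b e (fstar fU b x) \<longleftrightarrow> (\<exists>us. set us \<subseteq> U \<and> e x = concat us)"
proof -
  let ?m = "length (e 0)"
  have U: "eval b e (fU b x) \<longleftrightarrow> e x \<in> U" if "0 < b" "x < b" "e x \<in> words (length (e 0))" for b x e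
    using assms(1) that unfolding definable_def by blast
  have 1: "eval (b + 3) (e(b := [], b + 1 := X, b + 2 := Y))
      (Ex (And (fU (b + 4) (b + 3)) (Eq (b + 1) [Var (b + 3), Var (b + 2)]))) \<longleftrightarrow> (\<exists>u\<in>U. X = u @ Y)"
    if "X \<in> words ?m" for X Y
  proof -
    have "eval (b + 3) (e(b := [], b + 1 := X, b + 2 := Y))
      (Ex (And (fU (b + 4) (b + 3)) (Eq (b + 1) [Var (b + 3), Var (b + 2)]))) \<longleftrightarrow>
      (\<exists>u\<in>words ?m. u \<in> U \<and> X = u @ Y)"
      using assms(2) U[of "b + 4" "b + 3" "e(b := [], b + 1 := X, b + 2 := Y, b + 3 := u)" for u] 
      by (simp add: numeral_eq_Suc cong: conj_cong)
    also have "\<dots> \<longleftrightarrow> (\<exists>u\<in>U. X = u @ Y)" using that by (auto simp: words_def)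
    finally show ?thesis .
  qed
  have "eval b e (fstar fU b x) \<longleftrightarrow> (e x, []) \<in> {(X, Y). X \<in> words ?m \<and> Y \<in> words ?m \<and>
      eval (b + 3) (e(b := [], b + 1 := X, b + 2 := Y))
        (Ex (And (fU (b + 4) (b + 3)) (Eq (b + 1) [Var (b + 3), Var (b + 2)])))}\<^sup>*"
    using assms(2,3) by (simp add: fstar_def words_def numeral_eq_Suc)
  also have "\<dots> \<longleftrightarrow> (e x, []) \<in> {(X, Y). X \<in> words ?m \<and> Y \<in> words ?m \<and> (\<exists>u\<in>U. X = u @ Y)}\<^sup>*"
    using 1 by (simp cong: conj_cong)
  also have "\<dots> \<longleftrightarrow> (\<exists>us. set us \<subseteq> U \<and> e x = concat us)" by (rule peel_rtrancl[OF assms(4)])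
  finally show ?thesis .
qed

lemma eval_fitem:
  assumes d: "definable fU U" "prefix_code U" "[] \<notin> U" and b: "0 < b" "x < b" "u < b"
    and w: "e x \<in> words (length (e 0))" "e u \<in> words (length (e 0))" and us: "set us \<subseteq> U" "e x = concat us"
  shows "eval b e (fitem fU b u x) \<longleftrightarrow> e u \<in> set us"
proof -
  let ?m = "length (e 0)"
  have U: "eval (b + 2) (e(b := p, b + 1 := r)) (fU (b + 2) u) \<longleftrightarrow> e u \<in> U" for p r
    using d(1) b w unfolding definable_def by simp
  have 1: "eval b e (fitem fU b u x) \<longleftrightarrow>
      (\<exists>p\<in>words ?m. \<exists>r\<in>words ?m. (\<exists>us1. set us1 \<subseteq> U \<and> p = concat us1) \<and> e u \<in> U \<and> e x = p @ e u @ r)"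
    using b U eval_fstar[OF d(1), of "b + 2" b "e(b := p, b + 1 := r)" for p r] unfolding fitem_def
    by simp
  show ?thesis
  proof
    assume "eval b e (fitem fU b u x)"
    with 1 obtain us1 r where "set us1 \<subseteq> U" "e u \<in> U" "e x = concat us1 @ e u @ r" by blast
    with prefix_code_concat[OF d(2) us(1), of us1 "e u" r] d(3) us(2) show "e u \<in> set us" by auto
  next
    assume "e u \<in> set us"
    then obtain us1 us2 where s: "us = us1 @ e u # us2" by (auto dest: split_list)
    then have x: "e x = concat us1 @ e u @ concat us2" using us by simp
    then have "concat us1 \<in> words ?m" "concat us2 \<in> words ?m" using w(1) by (auto simp: words_def)
    then show "eval b e (fitem fU b u x)" unfolding 1 using s us x by auto
  qed
qed

subsection \<open>Nondeterministic automata\<close>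

lemma enc_name_nm: "enc_name a = nm a @ [2]"
  by (simp add: enc_name_def nm_def)

definition fname :: "nat \<Rightarrow> nat \<Rightarrow> fm" where
  "fname b x = Ex (And (fbits (b + 1) b) (Eq x [Var b, Lit [2]]))"

lemma definable_fname: "definable fname (range enc_name)"
proof -
  have "eval b e (fname b x) \<longleftrightarrow> e x \<in> range enc_name" if "0 < b" "x < b" "e x \<in> words (length (e 0))" for b x e
  proof -
    have "eval b e (fname b x) \<longleftrightarrow> (\<exists>y\<in>words (length (e 0)). y \<in> range nm \<and> e x = y @ [2])"
      using that by (simp add: fname_def cong: conj_cong)
    also have "\<dots> \<longleftrightarrow> e x \<in> range enc_name"
      using that(3) by (auto simp: enc_name_nm words_def)
    finally show ?thesis .
  qed
  moreover have "0 < b \<Longrightarrow> x < b \<Longrightarrow> ok b (fname b x)" for b x by (simp add: fname_def)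
  ultimately show ?thesis unfolding definable_def by blast
qed

lemma prefix_code_name: "prefix_code (range enc_name)"
  unfolding prefix_code_def using enc_name_append_eq by blast

lemma Nil_notin_name: "[] \<notin> range enc_name"
  by (auto simp: enc_name_def)

definition enc_tr :: "name \<times> name \<times> name \<Rightarrow> nat list" where
  "enc_tr = (\<lambda>(p, a, q). enc_name p @ enc_name a @ enc_name q)"

definition ftriple :: "nat \<Rightarrow> nat \<Rightarrow> fm" where
  "ftriple b x = Ex (Ex (Ex (Ands [fbits (b + 3) b, fbits (b + 3) (b + 1), fbits (b + 3) (b + 2),
     Eq x [Var b, Lit [2], Var (b + 1), Lit [2], Var (b + 2), Lit [2]]])))"

lemma definable_ftriple: "definable ftriple (range enc_tr)"
proof -
  have "eval b e (ftriple b x) \<longleftrightarrow> e x \<in> range enc_tr" if "0 < b" "x < b" "e x \<in> words (length (e 0))" for b x e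
  proof -
    let ?m = "length (e 0)"
    have "eval b e (ftriple b x) \<longleftrightarrow> (\<exists>p\<in>words ?m. \<exists>a\<in>words ?m. \<exists>q\<in>words ?m.
        p \<in> range nm \<and> a \<in> range nm \<and> q \<in> range nm \<and> e x = p @ 2 # a @ 2 # q @ [2])"
      using that by (simp add: ftriple_def numeral_eq_Suc cong: conj_cong)
    also have "\<dots> \<longleftrightarrow> e x \<in> range enc_tr"
    proof
      assume "e x \<in> range enc_tr"
      then obtain p a q where "e x = nm p @ 2 # nm a @ 2 # nm q @ [2]"
        by (auto simp: enc_tr_def enc_name_nm)
      moreover from this that(3) have "nm p \<in> words ?m" "nm a \<in> words ?m" "nm q \<in> words ?m"
        by (auto simp: words_def)
      ultimately show "\<exists>p\<in>words ?m. \<exists>a\<in>words ?m. \<exists>q\<in>words ?m.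
        p \<in> range nm \<and> a \<in> range nm \<and> q \<in> range nm \<and> e x = p @ 2 # a @ 2 # q @ [2]" by blast
    next
      assume "\<exists>p\<in>words ?m. \<exists>a\<in>words ?m. \<exists>q\<in>words ?m.
        p \<in> range nm \<and> a \<in> range nm \<and> q \<in> range nm \<and> e x = p @ 2 # a @ 2 # q @ [2]"
      then obtain p a q where "e x = nm p @ 2 # nm a @ 2 # nm q @ [2]" by blast
      then have "e x = enc_tr (p, a, q)" by (simp add: enc_tr_def enc_name_nm)
      then show "e x \<in> range enc_tr" by blast
    qed
    finally show ?thesis .
  qed
  moreover have "0 < b \<Longrightarrow> x < b \<Longrightarrow> ok b (ftriple b x)" for b x by (simp add: ftriple_def numeral_eq_Suc)
  ultimately show ?thesis unfolding definable_def by blast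
qed

lemma enc_tr_append_eq: "enc_tr t @ x = enc_tr t' @ y \<Longrightarrow> t = t' \<and> x = y"
  by (auto simp: enc_tr_def split: prod.splits dest!: enc_name_append_eq)

lemma inj_enc_tr: "enc_tr a = enc_tr b \<longleftrightarrow> a = b"
  using enc_tr_append_eq[of a "[]" b "[]"] by auto

lemma prefix_code_triple: "prefix_code (range enc_tr)"
  unfolding prefix_code_def using enc_tr_append_eq by blast

lemma Nil_notin_triple: "[] \<notin> range enc_tr"
  by (auto simp: enc_tr_def enc_name_def)

section \<open>Entries of encoded lists and the parsing of encoded automata\<close>

definition fin_name :: "nat \<Rightarrow> nat \<Rightarrow> nat \<Rightarrow> fm" where
  "fin_name b x A = Ex (And (Eq b [Var x, Lit [2]]) (fitem fname (b + 1) b A))"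

lemma ok_fin_name: "0 < b \<Longrightarrow> x < b \<Longrightarrow> A < b \<Longrightarrow> ok b (fin_name b x A)"
  by (simp add: fin_name_def ok_fitem[OF definable_fname])

lemma eval_fin_name:
  assumes b: "0 < b" "x < b" "A < b" and w: "e A \<in> words (length (e 0))" "set (e x) \<subseteq> {..<15}"
    and A: "e A = concat (map enc_name ns)"
  shows "eval b e (fin_name b x A) \<longleftrightarrow> (\<exists>n\<in>set ns. e x = nm n)"
proof -
  let ?m = "length (e 0)"
  have 1: "eval (b + 1) (e(b := u)) (fitem fname (b + 1) b A) \<longleftrightarrow> u \<in> set (map enc_name ns)" if "u \<in> words ?m" for u
    using eval_fitem[OF definable_fname prefix_code_name Nil_notin_name, of "b + 1" A b "e(b := u)" "map enc_name ns"]
      that b w A by (auto simp: image_iff)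
  have "eval b e (fin_name b x A) \<longleftrightarrow> (\<exists>u\<in>words ?m. u = e x @ [2] \<and> u \<in> set (map enc_name ns))"
    using b 1 by (simp add: fin_name_def cong: conj_cong)
  also have "\<dots> \<longleftrightarrow> (\<exists>n\<in>set ns. e x = nm n)"
  proof
    assume "\<exists>n\<in>set ns. e x = nm n"
    then obtain n where n: "n \<in> set ns" "e x = nm n" by blast
    then have "enc_name n \<in> words ?m" using w(1) unfolding A by (auto simp: words_def dest!: split_list)
    with n show "\<exists>u\<in>words ?m. u = e x @ [2] \<and> u \<in> set (map enc_name ns)" by (auto simp: enc_name_nm)
  qed (auto simp: enc_name_nm)
  finally show ?thesis .
qed

definition fin_trans :: "nat \<Rightarrow> nat \<Rightarrow> nat \<Rightarrow> nat \<Rightarrow> nat \<Rightarrow> fm" where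
  "fin_trans b p a q T = Ex (And (Eq b [Var p, Lit [2], Var a, Lit [2], Var q, Lit [2]]) (fitem ftriple (b + 1) b T))"

lemma ok_fin_trans: "0 < b \<Longrightarrow> p < b \<Longrightarrow> a < b \<Longrightarrow> q < b \<Longrightarrow> T < b \<Longrightarrow> ok b (fin_trans b p a q T)"
  by (simp add: fin_trans_def ok_fitem[OF definable_ftriple])

lemma eval_fin_trans:
  assumes b: "0 < b" "p < b" "a < b" "q < b" "T < b" and w: "e T \<in> words (length (e 0))"
    and T: "e T = concat (map enc_tr ts)" and bits: "e p \<in> range nm" "e a \<in> range nm" "e q \<in> range nm"
  shows "eval b e (fin_trans b p a q T) \<longleftrightarrow> (\<exists>(p', a', q')\<in>set ts. e p = nm p' \<and> e a = nm a' \<and> e q = nm q')"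
proof -
  let ?m = "length (e 0)"
  have 1: "eval (b + 1) (e(b := u)) (fitem ftriple (b + 1) b T) \<longleftrightarrow> u \<in> set (map enc_tr ts)" if "u \<in> words ?m" for u
    using eval_fitem[OF definable_ftriple prefix_code_triple Nil_notin_triple, of "b + 1" T b "e(b := u)" "map enc_tr ts"]
      that b w T by (auto simp: image_iff)
  from bits obtain p' a' q' where n: "e p = nm p'" "e a = nm a'" "e q = nm q'" by blast
  have u: "e p @ 2 # e a @ 2 # e q @ [2] = enc_tr (p', a', q')" by (simp add: n enc_tr_def enc_name_nm)
  have "eval b e (fin_trans b p a q T) \<longleftrightarrow> (\<exists>u\<in>words ?m. u = enc_tr (p', a', q') \<and> u \<in> set (map enc_tr ts))"
    using b 1 u by (simp add: fin_trans_def cong: conj_cong)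
  also have "\<dots> \<longleftrightarrow> (p', a', q') \<in> set ts"
  proof
    assume t: "(p', a', q') \<in> set ts"
    then have "enc_tr (p', a', q') \<in> words ?m" using w unfolding T by (auto simp: words_def dest!: split_list)
    with t show "\<exists>u\<in>words ?m. u = enc_tr (p', a', q') \<and> u \<in> set (map enc_tr ts)" by auto
  qed (auto simp: inj_enc_tr)
  also have "\<dots> \<longleftrightarrow> (\<exists>(p', a', q')\<in>set ts. e p = nm p' \<and> e a = nm a' \<and> e q = nm q')" by (auto simp: n)
  finally show ?thesis .
qed

text \<open>Guesses the five components of the automaton in variable 1 and passes them to
  \<open>g\<close> as variables \<open>b\<close> to \<open>b + 4\<close>. Since the encoding is
  injective, the guess is unique; so every formula about the automaton can parse it anew.\<close>

definition fparse :: "nat \<Rightarrow> fm \<Rightarrow> fm" where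
  "fparse b g = Ex (Ex (Ex (Ex (Ex (And
     (Ands [Eq 1 [Var b, Lit [3], Var (b + 1), Lit [3], Var (b + 2), Lit [3], Var (b + 3), Lit [2], Var (b + 4), Lit [3]],
       fstar fname (b + 5) b, fstar fname (b + 5) (b + 1), fstar ftriple (b + 5) (b + 2),
       fbits (b + 5) (b + 3), fstar fname (b + 5) (b + 4)]) g)))))"

lemma ok_fparse: "2 \<le> b \<Longrightarrow> ok (b + 5) g \<Longrightarrow> ok b (fparse b g)"
  unfolding fparse_def
  by (simp add: numeral_eq_Suc ok_fstar[OF definable_fname] ok_fstar[OF definable_ftriple])

definition parts :: "(name, name) nfa \<Rightarrow> nat \<Rightarrow> store \<Rightarrow> store" where
  "parts N b e = e(b := concat (map enc_name (nfa_states N)), b + 1 := concat (map enc_name (nfa_alphabet N)),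
     b + 2 := concat (map enc_tr (nfa_trans N)), b + 3 := nm (nfa_start N),
     b + 4 := concat (map enc_name (nfa_final N)))"

lemma enc_nfa_parts:
  "enc_nfa N = concat (map enc_name (nfa_states N)) @ 3 # concat (map enc_name (nfa_alphabet N)) @ 3 #
     concat (map enc_tr (nfa_trans N)) @ 3 # nm (nfa_start N) @ 2 # concat (map enc_name (nfa_final N)) @ [3]"
  by (simp add: enc_nfa_def enc_names_def enc_trans_def enc_tr_def enc_name_nm)

lemma ex_list: "set us \<subseteq> range f \<Longrightarrow> \<exists>ns. us = map f ns"
  by (metis ex_map_conv subset_iff rangeE)

lemma eval_fparse:
  assumes b: "2 \<le> b" and w: "e 1 \<in> words (length (e 0))"
  shows "eval b e (fparse b g) \<longleftrightarrow> (\<exists>N. e 1 = enc_nfa N \<and> eval (b + 5) (parts N b e) g)"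
proof -
  let ?m = "length (e 0)"
  let ?e = "\<lambda>A B T S E. e(b := A, b + 1 := B, b + 2 := T, b + 3 := S, b + 4 := E)"
  let ?is = "\<lambda>U x. \<exists>us. set us \<subseteq> range U \<and> x = concat us"
  have 1: "eval b e (fparse b g) \<longleftrightarrow> (\<exists>A\<in>words ?m. \<exists>B\<in>words ?m. \<exists>T\<in>words ?m. \<exists>S\<in>words ?m. \<exists>E\<in>words ?m.
     (e 1 = A @ 3 # B @ 3 # T @ 3 # S @ 2 # E @ [3] \<and> ?is enc_name A \<and> ?is enc_name B \<and> ?is enc_tr T \<and>
      S \<in> range nm \<and> ?is enc_name E) \<and> eval (b + 5) (?e A B T S E) g)"
  proof -
    have "eval (b + 5) (?e A B T S E) (Ands [Eq 1 [Var b, Lit [3], Var (b + 1), Lit [3], Var (b + 2), Lit [3], Var (b + 3), Lit [2], Var (b + 4), Lit [3]],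
       fstar fname (b + 5) b, fstar fname (b + 5) (b + 1), fstar ftriple (b + 5) (b + 2),
       fbits (b + 5) (b + 3), fstar fname (b + 5) (b + 4)]) \<longleftrightarrow>
     e 1 = A @ 3 # B @ 3 # T @ 3 # S @ 2 # E @ [3] \<and> ?is enc_name A \<and> ?is enc_name B \<and> ?is enc_tr T \<and>
      S \<in> range nm \<and> ?is enc_name E"
      if "A \<in> words ?m" "B \<in> words ?m" "T \<in> words ?m" "S \<in> words ?m" "E \<in> words ?m" for A B T S E
      using b that
        eval_fstar[OF definable_fname, of "b + 5" b "?e A B T S E"]
        eval_fstar[OF definable_fname, of "b + 5" "b + 1" "?e A B T S E"]
        eval_fstar[OF definable_ftriple, of "b + 5" "b + 2" "?e A B T S E"]
        eval_fstar[OF definable_fname, of "b + 5" "b + 4" "?e A B T S E"]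
      by simp
    then show ?thesis using b unfolding fparse_def
      by (simp add: numeral_eq_Suc cong: bex_cong conj_cong)
  qed
  show ?thesis
  proof
    assume "eval b e (fparse b g)"
    then obtain A B T S E where *: "e 1 = A @ 3 # B @ 3 # T @ 3 # S @ 2 # E @ [3]" "?is enc_name A" "?is enc_name B"
      "?is enc_tr T" "S \<in> range nm" "?is enc_name E" "eval (b + 5) (?e A B T S E) g"
      unfolding 1 by blast
    from *(2) obtain ns where ns: "A = concat (map enc_name ns)" using ex_list by metis
    from *(3) obtain bs where bs: "B = concat (map enc_name bs)" using ex_list by metis
    from *(4) obtain ts where ts: "T = concat (map enc_tr ts)" using ex_list by metis
    from *(5) obtain s where s: "S = nm s" by blast
    from *(6) obtain fs where fs: "E = concat (map enc_name fs)" using ex_list by metis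
    let ?N = "\<lparr>nfa_states = ns, nfa_alphabet = bs, nfa_trans = ts, nfa_start = s, nfa_final = fs\<rparr>"
    have "e 1 = enc_nfa ?N" using *(1) by (simp add: enc_nfa_parts ns bs ts s fs)
    moreover have "parts ?N b e = ?e A B T S E" by (simp add: parts_def ns bs ts s fs)
    ultimately show "\<exists>N. e 1 = enc_nfa N \<and> eval (b + 5) (parts N b e) g" using *(7) by metis
  next
    assume "\<exists>N. e 1 = enc_nfa N \<and> eval (b + 5) (parts N b e) g"
    then obtain N where N: "e 1 = enc_nfa N" "eval (b + 5) (parts N b e) g" by blast
    let ?A = "concat (map enc_name (nfa_states N))" and ?B = "concat (map enc_name (nfa_alphabet N))"
      and ?T = "concat (map enc_tr (nfa_trans N))" and ?S = "nm (nfa_start N)" and ?E = "concat (map enc_name (nfa_final N))"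
    have "?is enc_name ?A" "?is enc_name ?B" "?is enc_tr ?T" "?is enc_name ?E"
      by (rule exI[of _ "map _ _"], auto)+
    moreover have "?A \<in> words ?m" "?B \<in> words ?m" "?T \<in> words ?m" "?S \<in> words ?m" "?E \<in> words ?m"
      using w unfolding N(1) enc_nfa_parts by (auto simp: words_def)
    ultimately show "eval b e (fparse b g)"
      unfolding 1 using N(2)[unfolded parts_def] N(1)[unfolded enc_nfa_parts] by blast
  qed
qed

text \<open>Variables 2 to 6 are the states, the letters, the transitions, the start state and the
  final states, as bound by \<open>fparse 2\<close>.\<close>

definition fwf :: fm where
  "fwf = Ands [fin_name 7 5 2,
     All (Or (Neg (fin_name 8 7 6)) (fin_name 8 7 2)),
     All (All (All (Or (Neg (And (Ands [fbits 10 7, fbits 10 8, fbits 10 9]) (fin_trans 10 7 8 9 4)))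
       (Ands [fin_name 10 7 2, fin_name 10 8 3, fin_name 10 9 2]))))]"

definition nfa_I :: "nat \<Rightarrow> nat \<Rightarrow> fm" where "nfa_I b x = fparse b (Eq x [Var (b + 3)])"
definition nfa_F :: "nat \<Rightarrow> nat \<Rightarrow> fm" where "nfa_F b x = fparse b (fin_name (b + 5) x (b + 4))"
definition nfa_D :: "nat \<Rightarrow> nat \<Rightarrow> nat \<Rightarrow> nat \<Rightarrow> fm" where
  "nfa_D b x a y = fparse b (And (Ands [fbits (b + 5) x, fbits (b + 5) a, fbits (b + 5) y]) (fin_trans (b + 5) x a y (b + 2)))"

lemma ok_nfa:
  "ok 2 (fparse 2 fwf)"
  "2 \<le> b \<Longrightarrow> x < b \<Longrightarrow> ok b (nfa_I b x)"
  "2 \<le> b \<Longrightarrow> x < b \<Longrightarrow> ok b (nfa_F b x)"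
  "2 \<le> b \<Longrightarrow> x < b \<Longrightarrow> a < b \<Longrightarrow> y < b \<Longrightarrow> ok b (nfa_D b x a y)"
  by (auto simp: fwf_def nfa_I_def nfa_F_def nfa_D_def ok_fin_name ok_fin_trans intro!: ok_fparse)

lemma parts_less: "x < b \<Longrightarrow> parts N b e x = e x"
  by (simp add: parts_def)

lemma parts_get [simp]:
  "parts N b e b = concat (map enc_name (nfa_states N))"
  "parts N b e (b + 1) = concat (map enc_name (nfa_alphabet N))"
  "parts N b e (b + 2) = concat (map enc_tr (nfa_trans N))"
  "parts N b e (b + 3) = nm (nfa_start N)"
  "parts N b e (b + 4) = concat (map enc_name (nfa_final N))"
  by (simp_all add: parts_def)

lemma parts_words:
  assumes "enc_nfa N \<in> words m"
  shows "concat (map enc_name (nfa_states N)) \<in> words m" "concat (map enc_name (nfa_alphabet N)) \<in> words m"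
    "concat (map enc_tr (nfa_trans N)) \<in> words m" "nm (nfa_start N) \<in> words m" "concat (map enc_name (nfa_final N)) \<in> words m"
  using assms unfolding enc_nfa_parts by (auto simp: words_def)

lemma in_concat_words: "concat (map f xs) \<in> words m \<Longrightarrow> x \<in> set xs \<Longrightarrow> f x \<in> words m"
  by (auto simp: words_def dest!: split_list)

lemma eval_fwf:
  assumes "e 0 = replicate m 0" "e 1 = enc_nfa N" "enc_nfa N \<in> words m"
  shows "eval 7 (parts N 2 e) fwf \<longleftrightarrow> wf_nfa N"
proof -
  note w = parts_words[OF assms(3)]
  let ?e = "parts N 2 e"
  have p: "?e 0 = replicate m 0" "?e 2 = concat (map enc_name (nfa_states N))" "?e 3 = concat (map enc_name (nfa_alphabet N))"
    "?e 4 = concat (map enc_tr (nfa_trans N))" "?e 5 = nm (nfa_start N)" "?e 6 = concat (map enc_name (nfa_final N))"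
    using assms by (simp_all add: parts_def)
  have f1: "eval 7 ?e (fin_name 7 5 2) \<longleftrightarrow> nfa_start N \<in> set (nfa_states N)"
    using eval_fin_name[of 7 5 2 ?e "nfa_states N"] w p by (auto simp: words_def)
  have f2: "eval 8 (?e(7 := x)) (fin_name 8 7 A) \<longleftrightarrow> (\<exists>n\<in>set ns. x = nm n)"
    if "(A, ns) \<in> {(2, nfa_states N), (6, nfa_final N)}" "x \<in> words m" for x A ns
    using eval_fin_name[of 8 7 A "?e(7 := x)" ns] that w p by (auto simp: words_def)
  have f3: "eval 10 (?e(7 := x, 8 := y, 9 := z)) (fin_name 10 v A) \<longleftrightarrow> (\<exists>n\<in>set ns. c = nm n)"
    if "(A, ns) \<in> {(2, nfa_states N), (3, nfa_alphabet N)}" "(v, c) \<in> {(7, x), (8, y), (9, z)}"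
      "c \<in> words m" for x y z v c A ns
    using eval_fin_name[of 10 v A "?e(7 := x, 8 := y, 9 := z)" ns] that w p by (auto simp: words_def)
  have f4: "eval 10 (?e(7 := x, 8 := y, 9 := z)) (fin_trans 10 7 8 9 4) \<longleftrightarrow>
      (\<exists>(p', a', q')\<in>set (nfa_trans N). x = nm p' \<and> y = nm a' \<and> z = nm q')"
    if "x \<in> range nm" "y \<in> range nm" "z \<in> range nm" for x y z
    using eval_fin_trans[of 10 7 8 9 4 "?e(7 := x, 8 := y, 9 := z)" "nfa_trans N"] that w p by simp
  have "eval 7 ?e (All (Or (Neg (fin_name 8 7 6)) (fin_name 8 7 2))) \<longleftrightarrow> set (nfa_final N) \<subseteq> set (nfa_states N)"
  proof -
    have "eval 7 ?e (All (Or (Neg (fin_name 8 7 6)) (fin_name 8 7 2))) \<longleftrightarrow>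
      (\<forall>x\<in>words m. (\<exists>n\<in>set (nfa_final N). x = nm n) \<longrightarrow> (\<exists>n\<in>set (nfa_states N). x = nm n))"
      using p(1) f2 by (auto simp del: fun_upd_apply)
    also have "\<dots> \<longleftrightarrow> set (nfa_final N) \<subseteq> set (nfa_states N)"
    proof -
      have "nm n \<in> words m" if "n \<in> set (nfa_final N)" for n
        using in_concat_words[OF w(5) that] by (simp add: enc_name_nm words_def)
      then show ?thesis by auto
    qed
    finally show ?thesis .
  qed
  moreover have "eval 7 ?e (All (All (All (Or (Neg (And (Ands [fbits 10 7, fbits 10 8, fbits 10 9]) (fin_trans 10 7 8 9 4)))
       (Ands [fin_name 10 7 2, fin_name 10 8 3, fin_name 10 9 2]))))) \<longleftrightarrow>
     set (nfa_trans N) \<subseteq> set (nfa_states N) \<times> set (nfa_alphabet N) \<times> set (nfa_states N)"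
  proof -
    have "eval 10 (?e(7 := x, 8 := y, 9 := z)) (Or (Neg (And (Ands [fbits 10 7, fbits 10 8, fbits 10 9]) (fin_trans 10 7 8 9 4)))
       (Ands [fin_name 10 7 2, fin_name 10 8 3, fin_name 10 9 2])) \<longleftrightarrow>
      ((\<exists>(p', a', q')\<in>set (nfa_trans N). x = nm p' \<and> y = nm a' \<and> z = nm q') \<longrightarrow>
       (\<exists>n\<in>set (nfa_states N). x = nm n) \<and> (\<exists>n\<in>set (nfa_alphabet N). y = nm n) \<and> (\<exists>n\<in>set (nfa_states N). z = nm n))"
      if "x \<in> words m" "y \<in> words m" "z \<in> words m" for x y z
    proof -
      have bits: "eval 10 (?e(7 := x, 8 := y, 9 := z)) (Ands [fbits 10 7, fbits 10 8, fbits 10 9]) \<longleftrightarrow>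
          x \<in> range nm \<and> y \<in> range nm \<and> z \<in> range nm"
        using that p(1) by simp
      have names: "eval 10 (?e(7 := x, 8 := y, 9 := z)) (Ands [fin_name 10 7 2, fin_name 10 8 3, fin_name 10 9 2]) \<longleftrightarrow>
          (\<exists>n\<in>set (nfa_states N). x = nm n) \<and> (\<exists>n\<in>set (nfa_alphabet N). y = nm n) \<and> (\<exists>n\<in>set (nfa_states N). z = nm n)"
        using f3[of 2 "nfa_states N" 7 x x y z] f3[of 3 "nfa_alphabet N" 8 y x y z] f3[of 2 "nfa_states N" 9 z x y z] that
        by (simp del: fun_upd_apply)
      show ?thesis
        unfolding eval_derived(1) eval.simps(2,3) bits names using f4[of x y z] by blast
    qed
    then have "eval 7 ?e (All (All (All (Or (Neg (And (Ands [fbits 10 7, fbits 10 8, fbits 10 9]) (fin_trans 10 7 8 9 4)))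
       (Ands [fin_name 10 7 2, fin_name 10 8 3, fin_name 10 9 2]))))) \<longleftrightarrow>
      (\<forall>x\<in>words m. \<forall>y\<in>words m. \<forall>z\<in>words m. (\<exists>(p', a', q')\<in>set (nfa_trans N). x = nm p' \<and> y = nm a' \<and> z = nm q') \<longrightarrow>
       (\<exists>n\<in>set (nfa_states N). x = nm n) \<and> (\<exists>n\<in>set (nfa_alphabet N). y = nm n) \<and> (\<exists>n\<in>set (nfa_states N). z = nm n))"
      using p(1) by (simp add: eval_derived(2) del: eval_derived(1,4) eval.simps)
    also have "\<dots> \<longleftrightarrow> set (nfa_trans N) \<subseteq> set (nfa_states N) \<times> set (nfa_alphabet N) \<times> set (nfa_states N)"
    proof -
      have t: "nm p \<in> words m \<and> nm a \<in> words m \<and> nm q \<in> words m" if "(p, a, q) \<in> set (nfa_trans N)" for p a q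
        using in_concat_words[OF w(3) that] by (simp add: enc_tr_def enc_name_nm words_def)
      show ?thesis
      proof (intro iffI subsetI)
        fix t assume *: "\<forall>x\<in>words m. \<forall>y\<in>words m. \<forall>z\<in>words m. (\<exists>(p', a', q')\<in>set (nfa_trans N). x = nm p' \<and> y = nm a' \<and> z = nm q') \<longrightarrow>
         (\<exists>n\<in>set (nfa_states N). x = nm n) \<and> (\<exists>n\<in>set (nfa_alphabet N). y = nm n) \<and> (\<exists>n\<in>set (nfa_states N). z = nm n)"
          and tin: "t \<in> set (nfa_trans N)"
        obtain p a q where tt: "t = (p, a, q)" by (cases t)
        with tin t have "nm p \<in> words m" "nm a \<in> words m" "nm q \<in> words m" by blast+
        with * tin tt have "(\<exists>n\<in>set (nfa_states N). nm p = nm n) \<and> (\<exists>n\<in>set (nfa_alphabet N). nm a = nm n) \<and> (\<exists>n\<in>set (nfa_states N). nm q = nm n)"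
          by blast
        with tt show "t \<in> set (nfa_states N) \<times> set (nfa_alphabet N) \<times> set (nfa_states N)" by auto
      qed auto
    qed
    finally show ?thesis .
  qed
  ultimately show ?thesis
    using f1 unfolding fwf_def eval_derived(4) wf_nfa_def by (simp del: eval_derived eval.simps) blast
qed

section \<open>Nondeterministic automata as automata on words\<close>

lemma set_word_map_nm: "length (set_word (map nm ns)) = Suc (length (concat (map enc_name ns)))"
  by (induction ns) (auto simp: set_word_def enc_name_nm)

lemma runs_nm:
  "runs (\<lambda>x a y. \<exists>p q. x = nm p \<and> y = nm q \<and> (p, a, q) \<in> T) (nm ` S) w = nm ` nfa_reach N S w"
  if "T = set (nfa_trans N)"
proof (induction w arbitrary: S)
  case (Cons a w)
  have "{y. \<exists>x\<in>nm ` S. \<exists>p q. x = nm p \<and> y = nm q \<and> (p, a, q) \<in> T} = nm ` {q. \<exists>p\<in>S. (p, a, q) \<in> T}"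
    by auto
  with Cons that show ?case by simp
qed simp

lemma nfa_word_automaton:
  assumes "wf_nfa N" "inp = enc_nfa N" "inp \<in> words m" "3 * length inp + 7 \<le> m"
  shows "word_automaton m inp (\<lambda>x. x = nm (nfa_start N))
    (\<lambda>x a y. \<exists>p q. x = nm p \<and> y = nm q \<and> (p, a, q) \<in> set (nfa_trans N)) (\<lambda>x. \<exists>p\<in>set (nfa_final N). x = nm p)
    nfa_I nfa_F nfa_D (map nm (nfa_states N))"
proof
  show "x \<in> set (map nm (nfa_states N))" if "x = nm (nfa_start N)" for x
    using that assms(1) by (auto simp: wf_nfa_def)
  show "y \<in> set (map nm (nfa_states N)) \<and> length a \<le> m"
    if "\<exists>p q. x = nm p \<and> y = nm q \<and> (p, a, q) \<in> set (nfa_trans N)" for x a y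
  proof -
    from that obtain p q where *: "y = nm q" "(p, a, q) \<in> set (nfa_trans N)" by blast
    have "enc_tr (p, a, q) \<in> words m"
      using in_concat_words[OF _ *(2)] assms(2,3) unfolding enc_nfa_parts by (auto simp: words_def)
    then have "length a \<le> m" by (auto simp: enc_tr_def enc_name_nm words_def)
    with * assms(1) show ?thesis by (auto simp: wf_nfa_def)
  qed
  show "set q \<subseteq> {..<8}" if "q \<in> set (map nm (nfa_states N))" for q
    using that set_nm by fastforce
  show "3 * length (set_word (map nm (nfa_states N))) + 4 \<le> m"
    using assms(2,4) unfolding set_word_map_nm enc_nfa_parts by simp
next
  fix b x :: nat and e :: store assume e: "2 \<le> b" "x < b" "e 0 = replicate m 0" "e 1 = inp" "e x \<in> words m"
  then show "eval b e (nfa_I b x) \<longleftrightarrow> e x = nm (nfa_start N)"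
    unfolding nfa_I_def using assms(2,3) by (subst eval_fparse) (auto simp: parts_less dest: injD[OF inj_enc_nfa])
next
  fix b x :: nat and e :: store assume e: "2 \<le> b" "x < b" "e 0 = replicate m 0" "e 1 = inp" "e x \<in> set (map nm (nfa_states N))"
  then have x: "set (e x) \<subseteq> {..<15}" using set_nm by fastforce
  have "eval b e (nfa_F b x) \<longleftrightarrow> eval (b + 5) (parts N b e) (fin_name (b + 5) x (b + 4))"
    unfolding nfa_F_def using assms(2,3) e by (subst eval_fparse) (auto dest: injD[OF inj_enc_nfa])
  also have "\<dots> \<longleftrightarrow> (\<exists>p\<in>set (nfa_final N). e x = nm p)"
    using eval_fin_name[of "b + 5" x "b + 4" "parts N b e" "nfa_final N"] e x parts_words(5)[of N m] assms(2,3)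
    by (simp add: parts_less)
  finally show "eval b e (nfa_F b x) \<longleftrightarrow> (\<exists>p\<in>set (nfa_final N). e x = nm p)" .
next
  fix b x a y :: nat and e :: store assume e: "2 \<le> b" "x < b" "a < b" "y < b" "e 0 = replicate m 0" "e 1 = inp"
    "e x \<in> set (map nm (nfa_states N))" "e a \<in> words m" "e y \<in> words m"
  have xw: "e x \<in> words m" using e(7) in_concat_words[OF parts_words(1)[of N m]] e(6) assms(2,3)
    by (force simp: enc_name_nm words_def)
  have "eval b e (nfa_D b x a y) \<longleftrightarrow> eval (b + 5) (parts N b e)
     (And (Ands [fbits (b + 5) x, fbits (b + 5) a, fbits (b + 5) y]) (fin_trans (b + 5) x a y (b + 2)))"
    unfolding nfa_D_def using assms(2,3) e by (subst eval_fparse) (auto dest: injD[OF inj_enc_nfa])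
  also have "\<dots> \<longleftrightarrow> (e x \<in> range nm \<and> e a \<in> range nm \<and> e y \<in> range nm) \<and>
      eval (b + 5) (parts N b e) (fin_trans (b + 5) x a y (b + 2))"
    using e xw by (simp add: parts_less)
  also have "\<dots> \<longleftrightarrow> (e x \<in> range nm \<and> e a \<in> range nm \<and> e y \<in> range nm) \<and>
      (\<exists>(p', a', q')\<in>set (nfa_trans N). e x = nm p' \<and> e a = nm a' \<and> e y = nm q')"
    using eval_fin_trans[of "b + 5" x a y "b + 2" "parts N b e" "nfa_trans N"] e parts_words(3)[of N m] assms(2,3)
      parts_get(3)[of N b e]
    by (auto simp: parts_less)
  also have "\<dots> \<longleftrightarrow> (\<exists>n. e a = nm n \<and> (\<exists>p q. e x = nm p \<and> e y = nm q \<and> (p, n, q) \<in> set (nfa_trans N)))"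
    by auto
  finally show "eval b e (nfa_D b x a y) \<longleftrightarrow>
    (\<exists>n. e a = nm n \<and> (\<exists>p q. e x = nm p \<and> e y = nm q \<and> (p, n, q) \<in> set (nfa_trans N)))" .
qed

lemma nfa_lang_aut_lang:
  "nfa_lang N = aut_lang (\<lambda>x. x = nm (nfa_start N))
    (\<lambda>x a y. \<exists>p q. x = nm p \<and> y = nm q \<and> (p, a, q) \<in> set (nfa_trans N)) (\<lambda>x. \<exists>p\<in>set (nfa_final N). x = nm p)"
proof -
  have "{x. x = nm (nfa_start N)} = nm ` {nfa_start N}" by auto
  then show ?thesis unfolding aut_lang_def nfa_lang_def using runs_nm[OF refl, of N "{nfa_start N}"] by auto
qed

lemma ruler_bound: "20 * n + 20 \<le> 20 * (n + 1) ^ 3" for n :: nat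
proof -
  have "(n + 1) ^ 1 \<le> (n + 1) ^ 3" by (rule power_increasing) auto
  then show ?thesis by simp
qed

theorem nfa_problem_PSPACE:
  assumes "le \<in> {prefix, suffix, sublist, subseq}"
  shows "nfa_problem (convex_lang le) \<in> PSPACE 4" "nfa_problem (closed_lang le) \<in> PSPACE 4"
proof -
  obtain tr where tr: "traces tr le" "\<forall>(i, a, j)\<in>set tr. i < 9 \<and> j < 9" using ex_traces[OF assms] by blast
  define Lang where "Lang = (\<lambda>w. nfa_lang (inv enc_nfa w))"
  let ?valid = "\<lambda>w. \<exists>N. w = enc_nfa N \<and> wf_nfa N"
  have inv: "inv enc_nfa (enc_nfa N) = N" for N by (simp add: inj_enc_nfa)
  have lists: "enc_nfa N \<in> lists {..<4}" for N
    by (auto simp: enc_nfa_def enc_names_def enc_name_def enc_trans_def of_bool_def split: if_splits)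
  have words: "w \<in> words (20 * (length w + 1) ^ 3)" if "w \<in> lists {..<4}" for w
    using that ruler_bound[of "length w"] by (auto simp: words_def)
  have valid: "eval 2 ((\<lambda>_. [])(0 := replicate (20 * (length w + 1) ^ 3) 0, 1 := w)) (fparse 2 fwf) \<longleftrightarrow> ?valid w"
    if w: "w \<in> lists {..<4}" for w
  proof -
    let ?m = "20 * (length w + 1) ^ 3"
    let ?e = "(\<lambda>_. [])(0 := replicate ?m 0, 1 := w) :: store"
    have "eval 2 ?e (fparse 2 fwf) \<longleftrightarrow> (\<exists>N. w = enc_nfa N \<and> eval 7 (parts N 2 ?e) fwf)"
      using eval_fparse[of 2 ?e fwf] words[OF w] by simp
    also have "\<dots> \<longleftrightarrow> ?valid w"
      using eval_fwf[of ?e ?m] words[OF w] by (auto simp del: fun_upd_apply simp: fun_upd_same fun_upd_other)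
    finally show ?thesis .
  qed
  have aut: "\<exists>I D F qs. word_automaton (20 * (length w + 1) ^ 3) w I D F nfa_I nfa_F nfa_D qs \<and> Lang w = aut_lang I D F"
    if w: "w \<in> lists {..<4}" "?valid w" for w
  proof -
    from w(2) obtain N where N: "w = enc_nfa N" "wf_nfa N" by blast
    have "3 * length w + 7 \<le> 20 * (length w + 1) ^ 3" using ruler_bound[of "length w"] by linarith
    from nfa_word_automaton[OF N(2,1) words[OF w(1)] this] nfa_lang_aut_lang[of N] show ?thesis
      unfolding Lang_def N(1) inv by blast
  qed
  note mem = membership[where fV = "fparse 2 fwf" and fI = nfa_I and fF = nfa_F and fD = nfa_D and c = 20
      and d = 3 and k = 4 and tr = tr and le = le and valid = ?valid and Lang = Lang,
      OF ok_nfa _ _ _ tr le_refl[OF assms] valid aut]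
  have eq: "nfa_problem P = {w \<in> lists {..<4}. ?valid w \<and> P (Lang w)}" for P
    using lists by (auto simp: nfa_problem_def Lang_def inv)
  show "nfa_problem (convex_lang le) \<in> PSPACE 4" "nfa_problem (closed_lang le) \<in> PSPACE 4"
    unfolding eq by (rule mem; simp)+
qed

subsection \<open>Regular expressions\<close>

text \<open>
  The recogniser of Polish notation works on words \<open>x 9 0^n\<close>, where \<open>n\<close> is the number of expressions
  still to be read from \<open>x\<close>. The length of these words never increases.
\<close>

definition fcount :: "nat \<Rightarrow> nat \<Rightarrow> nat \<Rightarrow> fm" where
  "fcount b X Y = Ex (Ex (Ex (And (fbits (b + 3) (b + 2)) (Ors [
     And (Eq X [Lit [3], Var b, Lit [9, 0], Var (b + 1)]) (Eq Y [Var b, Lit [9], Var (b + 1)]),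
     And (Eq X [Lit [4], Var b, Lit [9, 0], Var (b + 1)]) (Eq Y [Var b, Lit [9], Var (b + 1)]),
     And (Eq X [Var (b + 2), Lit [2], Var b, Lit [9, 0], Var (b + 1)]) (Eq Y [Var b, Lit [9], Var (b + 1)]),
     And (Eq X [Lit [5], Var b, Lit [9, 0], Var (b + 1)]) (Eq Y [Var b, Lit [9, 0, 0], Var (b + 1)]),
     And (Eq X [Lit [6], Var b, Lit [9, 0], Var (b + 1)]) (Eq Y [Var b, Lit [9, 0, 0], Var (b + 1)]),
     And (Eq X [Lit [7], Var b, Lit [9, 0], Var (b + 1)]) (Eq Y [Var b, Lit [9, 0], Var (b + 1)])]))))"

definition frexp :: "nat \<Rightarrow> nat \<Rightarrow> fm" where
  "frexp b x = And (Neg (fhas b x 9)) (Ex (Ex (And (And (Eq b [Var x, Lit [9, 0]]) (Eq (b + 1) [Lit [9]]))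
     (TC (fcount (b + 4) (b + 2) (b + 3)) b (b + 1)))))"

lemma ok_frexp: "0 < b \<Longrightarrow> x < b \<Longrightarrow> ok b (frexp b x)"
  by (simp add: frexp_def fcount_def numeral_eq_Suc)

definition count_step :: "nat list \<Rightarrow> nat list \<Rightarrow> bool" where
  "count_step X Y \<longleftrightarrow> (\<exists>x n a.
     (X \<in> {3 # x @ 9 # 0 # n, 4 # x @ 9 # 0 # n, nm a @ 2 # x @ 9 # 0 # n} \<and> Y = x @ 9 # n) \<or>
     (X \<in> {5 # x @ 9 # 0 # n, 6 # x @ 9 # 0 # n} \<and> Y = x @ 9 # 0 # 0 # n) \<or>
     (X = 7 # x @ 9 # 0 # n \<and> Y = x @ 9 # 0 # n))"

lemma count_stepI:
  "count_step (5 # x @ 9 # 0 # n) (x @ 9 # 0 # 0 # n)"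
  "count_step (6 # x @ 9 # 0 # n) (x @ 9 # 0 # 0 # n)"
  "count_step (7 # x @ 9 # 0 # n) (x @ 9 # 0 # n)"
  unfolding count_step_def by blast+

lemma eval_fcount:
  assumes "0 < b" "X < b" "Y < b" "e X \<in> words (length (e 0))"
  shows "eval b e (fcount b X Y) \<longleftrightarrow> count_step (e X) (e Y)"
proof -
  let ?m = "length (e 0)"
  have 1: "eval b e (fcount b X Y) \<longleftrightarrow> (\<exists>x\<in>words ?m. \<exists>n\<in>words ?m. \<exists>a\<in>words ?m. a \<in> range nm \<and>
     ((e X = 3 # x @ 9 # 0 # n \<and> e Y = x @ 9 # n) \<or> (e X = 4 # x @ 9 # 0 # n \<and> e Y = x @ 9 # n) \<or>
      (e X = a @ 2 # x @ 9 # 0 # n \<and> e Y = x @ 9 # n) \<or>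
      (e X = 5 # x @ 9 # 0 # n \<and> e Y = x @ 9 # 0 # 0 # n) \<or> (e X = 6 # x @ 9 # 0 # n \<and> e Y = x @ 9 # 0 # 0 # n) \<or>
      (e X = 7 # x @ 9 # 0 # n \<and> e Y = x @ 9 # 0 # n)))"
    using assms by (simp add: fcount_def numeral_eq_Suc cong: conj_cong)
  show ?thesis
  proof
    assume "eval b e (fcount b X Y)"
    then show "count_step (e X) (e Y)" unfolding 1 count_step_def by blast
  next
    assume "count_step (e X) (e Y)"
    then obtain x n a where *: "(e X \<in> {3 # x @ 9 # 0 # n, 4 # x @ 9 # 0 # n, nm a @ 2 # x @ 9 # 0 # n} \<and> e Y = x @ 9 # n) \<or>
     (e X \<in> {5 # x @ 9 # 0 # n, 6 # x @ 9 # 0 # n} \<and> e Y = x @ 9 # 0 # 0 # n) \<or>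
     (e X = 7 # x @ 9 # 0 # n \<and> e Y = x @ 9 # 0 # n)" unfolding count_step_def by blast
    then have w: "x \<in> words ?m" "n \<in> words ?m" using assms(4) by (auto simp: words_def)
    show "eval b e (fcount b X Y)"
    proof (cases "e X = nm a @ 2 # x @ 9 # 0 # n \<and> e Y = x @ 9 # n")
      case True
      then have "nm a \<in> words ?m" using assms(4) by (auto simp: words_def)
      with True w show ?thesis unfolding 1 by blast
    next
      case False
      have "nm [] \<in> words ?m" "nm [] \<in> range nm" by (auto simp: words_def nm_def)
      with False * w show ?thesis unfolding 1 by blast
    qed
  qed
qed

text \<open>Counts from the first 9 on, hence one more than the number of expressions still
  expected. The steps do not inspect the tail after that 9, so the invariant is stated for arbitrary
  words rather than for those ending in zeros.\<close>

definition pending :: "nat list \<Rightarrow> nat" where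
  "pending X = length (dropWhile (\<lambda>c. c \<noteq> 9) X)"

lemma pending_Cons: "c \<noteq> 9 \<Longrightarrow> pending (c # X) = pending X"
  by (simp add: pending_def)

lemma take_pending:
  "\<exists>t p. 1 \<le> p \<and> (\<forall>z. takeWhile (\<lambda>c. c \<noteq> 9) (x @ 9 # z) = t \<and> pending (x @ 9 # z) = p + length z)"
proof (induction x)
  case (Cons a x)
  then show ?case by (cases "a = 9") (auto simp: pending_def)
qed (auto simp: pending_def)

lemma take_pending_bits:
  "takeWhile (\<lambda>c. c \<noteq> 9) (nm a @ 2 # y) = nm a @ 2 # takeWhile (\<lambda>c. c \<noteq> 9) y"
  "pending (nm a @ 2 # y) = pending y"
proof -
  have "\<forall>c\<in>set (nm a). c \<noteq> 9" using notin_nm[of 9 a] by auto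
  then show "takeWhile (\<lambda>c. c \<noteq> 9) (nm a @ 2 # y) = nm a @ 2 # takeWhile (\<lambda>c. c \<noteq> 9) y"
    "pending (nm a @ 2 # y) = pending y"
    by (simp_all add: takeWhile_append2 dropWhile_append2 pending_def)
qed

abbreviation encs :: "name rexp list \<Rightarrow> nat list" where
  "encs rs \<equiv> concat (map enc_rexp rs)"

text \<open>Induction from the end of the path. Undoing a step puts a symbol back in front, which
  combines as many leading expressions as its arity into one; \<open>pending\<close> guarantees that
  there are enough of them.\<close>

lemma count_sound:
  assumes "(X, [9]) \<in> {(X, Y). count_step X Y}\<^sup>*"
  shows "\<exists>rs. length rs + 1 = pending X \<and> takeWhile (\<lambda>c. c \<noteq> 9) X = encs rs"
  using assms
proof (induction rule: converse_rtrancl_induct)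
  case base
  then show ?case by (intro exI[of _ "[]"]) (simp add: pending_def)
next
  case (step X Y)
  then obtain rs where rs: "length rs + 1 = pending Y" "takeWhile (\<lambda>c. c \<noteq> 9) Y = encs rs" by blast
  from step(1) obtain x n a where
    "(X \<in> {3 # x @ 9 # 0 # n, 4 # x @ 9 # 0 # n, nm a @ 2 # x @ 9 # 0 # n} \<and> Y = x @ 9 # n) \<or>
     (X \<in> {5 # x @ 9 # 0 # n, 6 # x @ 9 # 0 # n} \<and> Y = x @ 9 # 0 # 0 # n) \<or>
     (X = 7 # x @ 9 # 0 # n \<and> Y = x @ 9 # 0 # n)" by (auto simp: count_step_def)
  note cases = this
  obtain t p where tp: "1 \<le> p" "\<And>z. takeWhile (\<lambda>c. c \<noteq> 9) (x @ 9 # z) = t" "\<And>z. pending (x @ 9 # z) = p + length z"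
    using take_pending[of x] by blast
  from cases consider (Z) "X = 3 # x @ 9 # 0 # n" "Y = x @ 9 # n" | (O) "X = 4 # x @ 9 # 0 # n" "Y = x @ 9 # n"
    | (A) "X = nm a @ 2 # x @ 9 # 0 # n" "Y = x @ 9 # n" | (P) "X = 5 # x @ 9 # 0 # n" "Y = x @ 9 # 0 # 0 # n"
    | (T) "X = 6 # x @ 9 # 0 # n" "Y = x @ 9 # 0 # 0 # n" | (S) "X = 7 # x @ 9 # 0 # n" "Y = x @ 9 # 0 # n"
    by blast
  then show ?case
  proof cases
    case Z
    with rs tp show ?thesis by (intro exI[of _ "Zero # rs"]) (simp add: pending_Cons)
  next
    case O
    with rs tp show ?thesis by (intro exI[of _ "One # rs"]) (simp add: pending_Cons)
  next
    case A
    with rs tp show ?thesis by (intro exI[of _ "Atom a # rs"]) (simp add: enc_name_nm take_pending_bits)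
  next
    case P
    with rs(1) tp have "2 \<le> length rs" by simp
    then obtain r s rs' where "rs = r # s # rs'" by (metis Suc_le_length_iff numeral_2_eq_2)
    with P rs tp show ?thesis by (intro exI[of _ "Plus r s # rs'"]) (simp add: pending_Cons)
  next
    case T
    with rs(1) tp have "2 \<le> length rs" by simp
    then obtain r s rs' where "rs = r # s # rs'" by (metis Suc_le_length_iff numeral_2_eq_2)
    with T rs tp show ?thesis by (intro exI[of _ "Times r s # rs'"]) (simp add: pending_Cons)
  next
    case S
    with rs(1) tp have "1 \<le> length rs" by simp
    then obtain r rs' where "rs = r # rs'" by (metis Suc_le_length_iff One_nat_def)
    with S rs tp show ?thesis by (intro exI[of _ "Star r # rs'"]) (simp add: pending_Cons)
  qed
qed

lemma set_enc_rexp: "set (enc_rexp r) \<subseteq> {..<8}"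
proof (induction r)
  case (Atom a)
  then show ?case using set_nm[of a] by (auto simp: enc_name_nm)
qed auto

lemma count_complete:
  assumes "enc_rexp r @ x @ 9 # 0 # n \<in> words m"
  shows "(enc_rexp r @ x @ 9 # 0 # n, x @ 9 # n) \<in> {(X, Y). X \<in> words m \<and> Y \<in> words m \<and> count_step X Y}\<^sup>*"
    (is "_ \<in> ?R\<^sup>*")
  using assms
proof (induction r arbitrary: x n)
  case Zero
  then have "(enc_rexp Zero @ x @ 9 # 0 # n, x @ 9 # n) \<in> ?R" by (auto simp: count_step_def words_def)
  then show ?case by blast
next
  case One
  then have "(enc_rexp One @ x @ 9 # 0 # n, x @ 9 # n) \<in> ?R" by (auto simp: count_step_def words_def)
  then show ?case by blast
next
  case (Atom a)
  then have "(enc_rexp (Atom a) @ x @ 9 # 0 # n, x @ 9 # n) \<in> ?R"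
    by (auto simp: count_step_def words_def enc_name_nm)
  then show ?case by blast
next
  case (Plus r s)
  let ?X = "enc_rexp r @ (enc_rexp s @ x) @ 9 # 0 # 0 # n"
  have 1: "(enc_rexp (Plus r s) @ x @ 9 # 0 # n, ?X) \<in> ?R"
    using Plus.prems count_stepI(1)[of "enc_rexp r @ enc_rexp s @ x" n] by (auto simp: words_def)
  have 2: "(?X, (enc_rexp s @ x) @ 9 # 0 # n) \<in> ?R\<^sup>*"
    using Plus.prems by (intro Plus.IH(1)) (auto simp: words_def)
  have 3: "(enc_rexp s @ x @ 9 # 0 # n, x @ 9 # n) \<in> ?R\<^sup>*"
    using Plus.prems by (intro Plus.IH(2)) (auto simp: words_def)
  from 2 3 have "(?X, x @ 9 # n) \<in> ?R\<^sup>*" by (simp only: append_assoc)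
  with 1 show ?case by (rule converse_rtrancl_into_rtrancl)
next
  case (Times r s)
  let ?X = "enc_rexp r @ (enc_rexp s @ x) @ 9 # 0 # 0 # n"
  have 1: "(enc_rexp (Times r s) @ x @ 9 # 0 # n, ?X) \<in> ?R"
    using Times.prems count_stepI(2)[of "enc_rexp r @ enc_rexp s @ x" n] by (auto simp: words_def)
  have 2: "(?X, (enc_rexp s @ x) @ 9 # 0 # n) \<in> ?R\<^sup>*"
    using Times.prems by (intro Times.IH(1)) (auto simp: words_def)
  have 3: "(enc_rexp s @ x @ 9 # 0 # n, x @ 9 # n) \<in> ?R\<^sup>*"
    using Times.prems by (intro Times.IH(2)) (auto simp: words_def)
  from 2 3 have "(?X, x @ 9 # n) \<in> ?R\<^sup>*" by (simp only: append_assoc)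
  with 1 show ?case by (rule converse_rtrancl_into_rtrancl)
next
  case (Star r)
  have 1: "(enc_rexp (Star r) @ x @ 9 # 0 # n, enc_rexp r @ x @ 9 # 0 # n) \<in> ?R"
    using Star.prems count_stepI(3)[of "enc_rexp r @ x" n] by (auto simp: words_def)
  have "(enc_rexp r @ x @ 9 # 0 # n, x @ 9 # n) \<in> ?R\<^sup>*"
    using Star.prems by (intro Star.IH) (auto simp: words_def)
  with 1 show ?case by (rule converse_rtrancl_into_rtrancl)
qed

text \<open>The two directions differ in their hypotheses: a successful run always certifies an
  expression, but a run exists only if the additional letters 9 and 0 fit within the ruler.\<close>

lemma eval_frexp:
  assumes b: "0 < b" "x < b" and w: "e x \<in> words (length (e 0))"
  shows "eval b e (frexp b x) \<Longrightarrow> e x \<in> range enc_rexp"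
    and "length (e x) + 2 \<le> length (e 0) \<Longrightarrow> e x \<in> range enc_rexp \<Longrightarrow> eval b e (frexp b x)"
proof -
  let ?m = "length (e 0)"
  let ?R = "{(X, Y). X \<in> words ?m \<and> Y \<in> words ?m \<and> count_step X Y}"
  have c: "eval (b + 4) (e(b := s, b + 1 := t, b + 2 := X, b + 3 := Y)) (fcount (b + 4) (b + 2) (b + 3)) \<longleftrightarrow> count_step X Y"
    if "X \<in> words ?m" for s t X Y
    using eval_fcount[of "b + 4" "b + 2" "b + 3" "e(b := s, b + 1 := t, b + 2 := X, b + 3 := Y)"] that b by simp
  have ev: "eval b e (frexp b x) \<longleftrightarrow> 9 \<notin> set (e x) \<and> (\<exists>s\<in>words ?m. \<exists>t\<in>words ?m. (s = e x @ [9, 0] \<and> t = [9]) \<and> (s, t) \<in> ?R\<^sup>*)"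
  proof -
    have t: "eval (b + 2) (e(b := s, b + 1 := t)) (TC (fcount (b + 4) (b + 2) (b + 3)) b (b + 1)) \<longleftrightarrow> (s, t) \<in> ?R\<^sup>*" for s t
    proof -
      have "eval (b + 2) (e(b := s, b + 1 := t)) (TC (fcount (b + 4) (b + 2) (b + 3)) b (b + 1)) \<longleftrightarrow> (s, t) \<in>
        {(X, Y). X \<in> words ?m \<and> Y \<in> words ?m \<and>
          eval (b + 4) (e(b := s, b + 1 := t, b + 2 := X, b + 3 := Y)) (fcount (b + 4) (b + 2) (b + 3))}\<^sup>*"
        using b by (simp add: numeral_eq_Suc)
      also have "\<dots> \<longleftrightarrow> (s, t) \<in> ?R\<^sup>*" using c by (simp cong: conj_cong)
      finally show ?thesis .
    qed
    show ?thesis unfolding frexp_def using b w t by (simp del: eval.simps(5))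
  qed
  show "e x \<in> range enc_rexp" if "eval b e (frexp b x)"
  proof -
    from that ev have 9: "9 \<notin> set (e x)" and "(e x @ [9, 0], [9]) \<in> ?R\<^sup>*" by auto
    then have "(e x @ [9, 0], [9]) \<in> {(X, Y). count_step X Y}\<^sup>*"
      by (auto elim!: rtrancl_mono[THEN subsetD, rotated])
    from count_sound[OF this] obtain rs where rs: "length rs + 1 = pending (e x @ [9, 0])"
      "takeWhile (\<lambda>c. c \<noteq> 9) (e x @ [9, 0]) = encs rs" by blast
    have "takeWhile (\<lambda>c. c \<noteq> 9) (e x @ [9, 0]) = e x" "pending (e x @ [9, 0]) = 2"
      using 9 by (subst takeWhile_append2, auto) (simp add: pending_def, subst dropWhile_append2, auto)
    with rs have "length rs = 1" "e x = encs rs" by auto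
    then show ?thesis by (auto simp: length_Suc_conv)
  qed
  show "eval b e (frexp b x)" if l: "length (e x) + 2 \<le> ?m" and r: "e x \<in> range enc_rexp"
  proof -
    from r obtain r where r: "e x = enc_rexp r" by blast
    have sw: "enc_rexp r @ [] @ 9 # 0 # [] \<in> words ?m" using l w r by (auto simp: words_def)
    from count_complete[OF this] have "(e x @ [9, 0], [9]) \<in> ?R\<^sup>*" by (simp add: r)
    moreover have "9 \<notin> set (e x)" using set_enc_rexp[of r] r by auto
    moreover have "e x @ [9, 0] \<in> words ?m" "[9] \<in> words ?m" using sw r by (auto simp: words_def)
    ultimately show ?thesis unfolding ev by blast
  qed
qed

text \<open>Moves without reading a letter, on a list of expressions still to be matched. A product
  merely loses its symbol, because Polish notation already lists its factors in order; a star
  disappears or puts a copy of its body before itself.\<close>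

definition eps_step :: "nat list \<Rightarrow> nat list \<Rightarrow> bool" where
  "eps_step X Y \<longleftrightarrow> X = 4 # Y \<or> X = 6 # Y \<or>
     (\<exists>r s Z. X = 5 # enc_rexp r @ enc_rexp s @ Z \<and> (Y = enc_rexp r @ Z \<or> Y = enc_rexp s @ Z)) \<or>
     (\<exists>r Z. X = 7 # enc_rexp r @ Z \<and> (Y = Z \<or> Y = enc_rexp r @ 7 # enc_rexp r @ Z))"

definition feps1 :: "nat \<Rightarrow> nat \<Rightarrow> nat \<Rightarrow> fm" where
  "feps1 b X Y = Or (Or (Eq X [Lit [4], Var Y]) (Eq X [Lit [6], Var Y]))
     (Ex (Ex (Ex (And (frexp (b + 3) b) (Or
       (And (frexp (b + 3) (b + 1)) (And (Eq X [Lit [5], Var b, Var (b + 1), Var (b + 2)])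
          (Or (Eq Y [Var b, Var (b + 2)]) (Eq Y [Var (b + 1), Var (b + 2)]))))
       (And (Eq X [Lit [7], Var b, Var (b + 2)]) (Or (Eq Y [Var (b + 2)]) (Eq Y [Var b, Lit [7], Var b, Var (b + 2)]))))))))"

lemma ok_feps1: "0 < b \<Longrightarrow> X < b \<Longrightarrow> Y < b \<Longrightarrow> ok b (feps1 b X Y)"
  by (simp add: feps1_def numeral_eq_Suc ok_frexp)

lemma eval_feps1:
  assumes b: "0 < b" "X < b" "Y < b" and w: "e X \<in> words (length (e 0))" "length (e X) + 2 \<le> length (e 0)"
  shows "eval b e (feps1 b X Y) \<longleftrightarrow> eps_step (e X) (e Y)"
proof -
  let ?m = "length (e 0)"
  let ?e = "\<lambda>r s Z. e(b := r, b + 1 := s, b + 2 := Z)"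
  have 1: "eval b e (feps1 b X Y) \<longleftrightarrow> e X = 4 # e Y \<or> e X = 6 # e Y \<or>
    (\<exists>r\<in>words ?m. \<exists>s\<in>words ?m. \<exists>Z\<in>words ?m. eval (b + 3) (?e r s Z) (frexp (b + 3) b) \<and>
      ((eval (b + 3) (?e r s Z) (frexp (b + 3) (b + 1)) \<and> e X = 5 # r @ s @ Z \<and> (e Y = r @ Z \<or> e Y = s @ Z)) \<or>
       (e X = 7 # r @ Z \<and> (e Y = Z \<or> e Y = r @ 7 # r @ Z))))"
    using b by (simp add: feps1_def numeral_eq_Suc)
  have sound: "eval (b + 3) (?e r s Z) (frexp (b + 3) b) \<Longrightarrow> r \<in> range enc_rexp"
    "eval (b + 3) (?e r s Z) (frexp (b + 3) (b + 1)) \<Longrightarrow> s \<in> range enc_rexp"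
    if "r \<in> words ?m" "s \<in> words ?m" for r s Z
    using eval_frexp(1)[of "b + 3" b "?e r s Z"] eval_frexp(1)[of "b + 3" "b + 1" "?e r s Z"] that b by simp_all
  have complete: "length r + 2 \<le> ?m \<Longrightarrow> r \<in> range enc_rexp \<Longrightarrow> eval (b + 3) (?e r s Z) (frexp (b + 3) b)"
    "length s + 2 \<le> ?m \<Longrightarrow> s \<in> range enc_rexp \<Longrightarrow> eval (b + 3) (?e r s Z) (frexp (b + 3) (b + 1))"
    if "r \<in> words ?m" "s \<in> words ?m" for r s Z
    using eval_frexp(2)[of "b + 3" b "?e r s Z"] eval_frexp(2)[of "b + 3" "b + 1" "?e r s Z"] that b by simp_all
  show ?thesis
  proof
    assume "eval b e (feps1 b X Y)"
    then have "e X = 4 # e Y \<or> e X = 6 # e Y \<or>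
      (\<exists>r\<in>words ?m. \<exists>s\<in>words ?m. \<exists>Z\<in>words ?m. eval (b + 3) (?e r s Z) (frexp (b + 3) b) \<and>
      ((eval (b + 3) (?e r s Z) (frexp (b + 3) (b + 1)) \<and> e X = 5 # r @ s @ Z \<and> (e Y = r @ Z \<or> e Y = s @ Z)) \<or>
       (e X = 7 # r @ Z \<and> (e Y = Z \<or> e Y = r @ 7 # r @ Z))))" (is "?A \<or> ?B \<or> ?C") unfolding 1 .
    then show "eps_step (e X) (e Y)"
    proof (elim disjE)
      assume ?C
      then obtain r s Z where w': "r \<in> words ?m" "s \<in> words ?m" and r: "eval (b + 3) (?e r s Z) (frexp (b + 3) b)" and
        *: "(eval (b + 3) (?e r s Z) (frexp (b + 3) (b + 1)) \<and> e X = 5 # r @ s @ Z \<and> (e Y = r @ Z \<or> e Y = s @ Z)) \<or>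
         (e X = 7 # r @ Z \<and> (e Y = Z \<or> e Y = r @ 7 # r @ Z))" by (elim bexE conjE) (rule that)
      from sound(1)[OF w' r] obtain r' where r': "r = enc_rexp r'" by blast
      from * show ?thesis
      proof
        assume s: "eval (b + 3) (?e r s Z) (frexp (b + 3) (b + 1)) \<and> e X = 5 # r @ s @ Z \<and> (e Y = r @ Z \<or> e Y = s @ Z)"
        with sound(2)[OF w', of Z] obtain s' where "s = enc_rexp s'" by blast
        with s r' show ?thesis unfolding eps_step_def by blast
      next
        assume "e X = 7 # r @ Z \<and> (e Y = Z \<or> e Y = r @ 7 # r @ Z)"
        with r' show ?thesis unfolding eps_step_def by blast
      qed
    qed (simp_all add: eps_step_def)
  next
    assume "eps_step (e X) (e Y)"
    then consider "e X = 4 # e Y \<or> e X = 6 # e Y"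
      | r s Z where "e X = 5 # enc_rexp r @ enc_rexp s @ Z" "e Y = enc_rexp r @ Z \<or> e Y = enc_rexp s @ Z"
      | r Z where "e X = 7 # enc_rexp r @ Z" "e Y = Z \<or> e Y = enc_rexp r @ 7 # enc_rexp r @ Z"
      unfolding eps_step_def by blast
    then show "eval b e (feps1 b X Y)"
    proof cases
      case eps: 1
      then show ?thesis unfolding 1 by blast
    next
      case (2 r s Z)
      have w': "enc_rexp r \<in> words ?m" "enc_rexp s \<in> words ?m" "Z \<in> words ?m"
        "length (enc_rexp r) + 2 \<le> ?m" "length (enc_rexp s) + 2 \<le> ?m"
        using w unfolding 2 by (auto simp: words_def)
      have "eval (b + 3) (?e (enc_rexp r) (enc_rexp s) Z) (frexp (b + 3) b)"
        "eval (b + 3) (?e (enc_rexp r) (enc_rexp s) Z) (frexp (b + 3) (b + 1))"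
        using complete[of "enc_rexp r" "enc_rexp s" Z] w' by blast+
      with w' 2 show ?thesis unfolding 1
        by (intro disjI2 bexI[of _ "enc_rexp r"] bexI[of _ "enc_rexp s"] bexI[of _ Z]) simp_all
    next
      case (3 r Z)
      have w': "enc_rexp r \<in> words ?m" "Z \<in> words ?m" "length (enc_rexp r) + 2 \<le> ?m"
        using w unfolding 3 by (auto simp: words_def)
      have "eval (b + 3) (?e (enc_rexp r) Z Z) (frexp (b + 3) b)"
        using complete(1)[of "enc_rexp r" Z Z] w' by blast
      with w' 3 show ?thesis unfolding 1
        by (intro disjI2) (rule bexI[of _ "enc_rexp r"], rule bexI[of _ Z], rule bexI[of _ Z], simp_all)
    qed
  qed
qed

section \<open>Continuations of a regular expression\<close>

text \<open>
  The states reachable from an expression are continuations: lists of subexpressions, of which there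
  is one for each node of the syntax tree.
\<close>

fun conts :: "name rexp \<Rightarrow> name rexp list \<Rightarrow> name rexp list list" where
  "conts (Plus r s) K = (Plus r s # K) # conts r K @ conts s K"
| "conts (Times r s) K = (Times r s # K) # conts r (s # K) @ conts s K"
| "conts (Star r) K = (Star r # K) # conts r (Star r # K)"
| "conts r K = [r # K]"

inductive cstep_eps :: "name rexp list \<Rightarrow> name rexp list \<Rightarrow> bool" where
  "cstep_eps (One # K) K"
| "cstep_eps (Plus r s # K) (r # K)"
| "cstep_eps (Plus r s # K) (s # K)"
| "cstep_eps (Times r s # K) (r # s # K)"
| "cstep_eps (Star r # K) K"
| "cstep_eps (Star r # K) (r # Star r # K)"

lemma self_in_conts: "r # K \<in> set (conts r K)"
  by (cases r) auto

lemma conts_closed: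
  "L \<in> set (conts r K) \<Longrightarrow> cstep_eps L L' \<or> L = Atom a # L' \<Longrightarrow> L' \<in> set (conts r K) \<or> L' = K"
proof (induction r arbitrary: K)
  case (Plus r s)
  then show ?case using self_in_conts[of r K] self_in_conts[of s K] by (auto elim: cstep_eps.cases)
next
  case (Times r s)
  then show ?case using self_in_conts[of r "s # K"] self_in_conts[of s K] by (auto elim: cstep_eps.cases)
next
  case (Star r)
  then show ?case using self_in_conts[of r "Star r # K"] by (auto elim: cstep_eps.cases)
qed (auto elim: cstep_eps.cases)

lemma length_conts: "length (conts r K) \<le> length (enc_rexp r)"
proof (induction r arbitrary: K)
  case (Plus r s)
  from Plus(1)[of K] Plus(2)[of K] show ?case by simp
next
  case (Times r s)
  from Times(1)[of "s # K"] Times(2)[of K] show ?case by simp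
qed (auto simp: enc_name_def)

text \<open>Descending one level of the syntax tree adds at most one subexpression to the
  continuation. Both the depth and the length of a subexpression are at most the length of the
  expression, which gives the square.\<close>

lemma length_encs_conts:
  "L \<in> set (conts r K) \<Longrightarrow> length (encs L) \<le> length (encs K) + length (enc_rexp r) * length (enc_rexp r)"
proof (induction r arbitrary: K)
  case (Plus r s)
  then show ?case by (fastforce simp: algebra_simps)
next
  case (Times r s)
  then show ?case by (fastforce simp: algebra_simps)
next
  case (Star r)
  then show ?case by (fastforce simp: algebra_simps)
qed (auto simp: enc_name_def)

text \<open>Unique readability of Polish notation: the expressions that \<open>eps_step\<close> cuts
  off a word can only be the first arguments in the encoded list.\<close>

lemma encs_eps_step: "eps_step (encs L) Y \<Longrightarrow> \<exists>L'. cstep_eps L L' \<and> Y = encs L'"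
proof -
  assume e: "eps_step (encs L) Y"
  show ?thesis
  proof (cases L)
    case Nil
    with e show ?thesis by (simp add: eps_step_def)
  next
    case (Cons c K)
    have hd: "enc_name a @ x \<noteq> k # y" if "k \<in> {4, 5, 6, 7}" for a x k y
      using enc_name_hd(1)[of k a x y] that by auto
    show ?thesis
    proof (cases c)
      case (Atom a)
      with e Cons show ?thesis by (auto simp: eps_step_def hd)
    next
      case (Plus r s)
      with e Cons have "\<exists>r' s' Z. enc_rexp r @ enc_rexp s @ encs K = enc_rexp r' @ enc_rexp s' @ Z \<and>
          (Y = enc_rexp r' @ Z \<or> Y = enc_rexp s' @ Z)" by (auto simp: eps_step_def)
      then have "Y = encs (r # K) \<or> Y = encs (s # K)" by (auto dest!: enc_rexp_append_eq)
      with Cons Plus show ?thesis by (blast intro: cstep_eps.intros)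
    next
      case (Times r s)
      with e Cons have "Y = encs (r # s # K)" by (auto simp: eps_step_def)
      with Cons Times show ?thesis by (blast intro: cstep_eps.intros)
    next
      case (Star r)
      with e Cons have "\<exists>r' Z. enc_rexp r @ encs K = enc_rexp r' @ Z \<and> (Y = Z \<or> Y = enc_rexp r' @ 7 # enc_rexp r' @ Z)"
        by (auto simp: eps_step_def)
      then have "Y = encs K \<or> Y = encs (r # Star r # K)" by (auto dest!: enc_rexp_append_eq)
      with Cons Star show ?thesis by (blast intro: cstep_eps.intros)
    next
      case One
      with e Cons have "Y = encs K" by (auto simp: eps_step_def)
      with Cons One show ?thesis by (blast intro: cstep_eps.intros)
    next
      case Zero
      with e Cons show ?thesis by (auto simp: eps_step_def)
    qed
  qed
qed

lemma eps_step_encs: "cstep_eps L L' \<Longrightarrow> eps_step (encs L) (encs L')"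
  by (induction rule: cstep_eps.induct) (auto simp: eps_step_def)

lemma encs_letter: "encs L = enc_name a @ Y \<Longrightarrow> \<exists>K. L = Atom a # K \<and> Y = encs K"
proof (cases L)
  case (Cons c K)
  assume "encs L = enc_name a @ Y"
  with Cons show ?thesis by (cases c) (auto simp: enc_name_hd dest!: enc_name_append_eq)
qed (simp add: enc_name_def)

fun langs :: "name rexp list \<Rightarrow> name list set" where
  "langs [] = {[]}"
| "langs (r # K) = {u @ v | u v. u \<in> rexp_lang r \<and> v \<in> langs K}"

lemma langs_eps: "cstep_eps L L' \<Longrightarrow> langs L' \<subseteq> langs L"
proof (induction rule: cstep_eps.induct)
  case (6 r K)
  show ?case
  proof
    fix w assume "w \<in> langs (r # Star r # K)"
    then obtain u ws v where "w = u @ concat ws @ v" "u \<in> rexp_lang r" "set ws \<subseteq> rexp_lang r" "v \<in> langs K" by auto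
    then have "w = concat (u # ws) @ v" "set (u # ws) \<subseteq> rexp_lang r" "v \<in> langs K" by auto
    moreover from this(2) have "concat (u # ws) \<in> rexp_lang (Star r)" unfolding rexp_lang.simps by blast
    ultimately show "w \<in> langs (Star r # K)" unfolding langs.simps by blast
  qed
next
  case (5 r K)
  have "[] \<in> rexp_lang (Star r)" by (auto intro!: exI[of _ "[]"])
  then show ?case unfolding langs.simps by fastforce
next
  case (4 r s K)
  show ?case by (auto) (metis append.assoc)
qed auto

text \<open>Silent moves come before the letter; those after the last letter are left to
  \<open>rexp_F\<close>.\<close>

definition rexp_D :: "nat list \<Rightarrow> name \<Rightarrow> nat list \<Rightarrow> bool" where
  "rexp_D x a y \<longleftrightarrow> (x, enc_name a @ y) \<in> {(X, Y). eps_step X Y}\<^sup>*"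

definition rexp_F :: "nat list \<Rightarrow> bool" where
  "rexp_F x \<longleftrightarrow> (x, []) \<in> {(X, Y). eps_step X Y}\<^sup>*"

lemma eps_rtrancl_encs:
  "(X, Y) \<in> {(X, Y). eps_step X Y}\<^sup>* \<Longrightarrow> X = encs L \<Longrightarrow> \<exists>L'. Y = encs L' \<and> (L, L') \<in> {(L, L'). cstep_eps L L'}\<^sup>*"
proof (induction rule: rtrancl_induct)
  case (step Y Z)
  then obtain L' where "Y = encs L'" "(L, L') \<in> {(L, L'). cstep_eps L L'}\<^sup>*" by blast
  moreover from this step(2) obtain L'' where "cstep_eps L' L''" "Z = encs L''" using encs_eps_step by blast
  ultimately show ?case by (blast intro: rtrancl_into_rtrancl)
qed blast

lemma langs_eps_rtrancl: "(L, L') \<in> {(L, L'). cstep_eps L L'}\<^sup>* \<Longrightarrow> langs L' \<subseteq> langs L"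
  by (induction rule: rtrancl_induct) (auto dest: langs_eps)

lemma rexp_sound:
  "y \<in> runs rexp_D {encs L} w \<Longrightarrow> rexp_F y \<Longrightarrow> w \<in> langs L"
proof (induction w arbitrary: L)
  case Nil
  then obtain L' where "[] = encs L'" "(L, L') \<in> {(L, L'). cstep_eps L L'}\<^sup>*"
    using eps_rtrancl_encs[of "encs L" "[]" L] by (auto simp: rexp_F_def)
  moreover have "enc_rexp r \<noteq> []" for r by (cases r) (auto simp: enc_name_def)
  then have "[] = encs L' \<Longrightarrow> L' = []" by (cases L') auto
  ultimately show ?case using langs_eps_rtrancl by fastforce
next
  case (Cons a w)
  have split: "runs D S w = (\<Union>x\<in>S. runs D {x} w)" for D :: "nat list \<Rightarrow> name \<Rightarrow> nat list \<Rightarrow> bool" and S w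
  proof (induction w arbitrary: S)
    case (Cons a w)
    have "runs D S (a # w) = (\<Union>y\<in>{y. \<exists>x\<in>S. D x a y}. runs D {y} w)"
      unfolding runs.simps by (rule Cons.IH)
    also have "\<dots> = (\<Union>x\<in>S. \<Union>y\<in>{y. D x a y}. runs D {y} w)" by auto
    also have "\<dots> = (\<Union>x\<in>S. runs D {x} (a # w))" using Cons.IH[of "{y. D x a y}" for x] by simp
    finally show ?case .
  qed simp
  from Cons.prems(1) obtain x where x: "rexp_D (encs L) a x" "y \<in> runs rexp_D {x} w"
    using split[of rexp_D "{y. rexp_D (encs L) a y}" w] by auto
  from x(1) obtain L' where L': "enc_name a @ x = encs L'" "(L, L') \<in> {(L, L'). cstep_eps L L'}\<^sup>*"
    using eps_rtrancl_encs unfolding rexp_D_def by blast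
  from encs_letter[OF L'(1)[symmetric]] obtain K where K: "L' = Atom a # K" "x = encs K" by blast
  have "w \<in> langs K" using Cons.IH[of K] Cons.prems(2) x(2) K(2) by simp
  then have "a # w \<in> langs L'" using K(1) by auto
  then show ?case using langs_eps_rtrancl[OF L'(2)] by blast
qed

inductive reads :: "name rexp list \<Rightarrow> name list \<Rightarrow> name rexp list \<Rightarrow> bool" where
  reads_refl: "reads L [] L"
| reads_eps: "cstep_eps L L' \<Longrightarrow> reads L' w K \<Longrightarrow> reads L w K"
| reads_letter: "reads L w K \<Longrightarrow> reads (Atom a # L) (a # w) K"

lemma reads_trans: "reads L u L' \<Longrightarrow> reads L' v K \<Longrightarrow> reads L (u @ v) K"
  by (induction rule: reads.induct) (auto intro: reads.intros)

lemma reads_rexp: "u \<in> rexp_lang r \<Longrightarrow> reads (r # K) u K"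
proof (induction r arbitrary: u K)
  case One
  then show ?case by (auto intro: reads.intros cstep_eps.intros)
next
  case (Atom a)
  then show ?case by (auto intro: reads.intros)
next
  case (Plus r s)
  then show ?case by (auto intro: reads_eps cstep_eps.intros)
next
  case (Times r s)
  then obtain v w where "u = v @ w" "v \<in> rexp_lang r" "w \<in> rexp_lang s" by auto
  with Times.IH have "reads (r # s # K) u K" by (metis reads_trans)
  then show ?case by (auto intro: reads_eps cstep_eps.intros)
next
  case (Star r)
  then obtain ws where ws: "u = concat ws" "set ws \<subseteq> rexp_lang r" by auto
  then have "reads (Star r # K) (concat ws) K"
  proof (induction ws arbitrary: u)
    case Nil
    then show ?case by (auto intro: reads.intros cstep_eps.intros)
  next
    case (Cons w ws)
    then have "reads (r # Star r # K) (w @ concat ws) K"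
      using Star.IH by (auto intro: reads_trans)
    then show ?case by (auto intro: reads_eps cstep_eps.intros)
  qed
  with ws show ?case by simp
qed simp

lemma reads_runs:
  "reads L w [] \<Longrightarrow> encs L \<in> S \<Longrightarrow> \<exists>y\<in>runs rexp_D S w. rexp_F y"
proof -
  let ?E = "{(X, Y). eps_step X Y}\<^sup>*"
  \<comment> \<open>Generalized to the state \<open>x\<close> at the last letter, from which the
    current list has been reached by silent moves only.\<close>
  have "reads L w K \<Longrightarrow> K = [] \<Longrightarrow> x \<in> S \<Longrightarrow> (x, encs L) \<in> ?E \<Longrightarrow> \<exists>y\<in>runs rexp_D S w. rexp_F y" for L w K x S
  proof (induction arbitrary: x S rule: reads.induct)
    case (reads_refl L)
    then show ?case by (auto simp: rexp_F_def)
  next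
    case (reads_eps L L' w K)
    then have "(x, encs L') \<in> ?E" using eps_step_encs by (auto intro: rtrancl_into_rtrancl)
    with reads_eps show ?case by blast
  next
    case (reads_letter L w K a)
    then have "rexp_D x a (encs L)" by (simp add: rexp_D_def)
    with reads_letter show ?case by (auto intro!: reads_letter.IH[of "encs L"])
  qed
  then show "reads L w [] \<Longrightarrow> encs L \<in> S \<Longrightarrow> \<exists>y\<in>runs rexp_D S w. rexp_F y" by blast
qed

lemma rexp_aut_lang: "rexp_lang r = aut_lang (\<lambda>x. x = enc_rexp r) rexp_D rexp_F"
proof (intro set_eqI iffI)
  fix w assume "w \<in> rexp_lang r"
  from reads_runs[OF reads_rexp[OF this, of "[]"]] show "w \<in> aut_lang (\<lambda>x. x = enc_rexp r) rexp_D rexp_F"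
    by (simp add: aut_lang_def)
next
  fix w assume "w \<in> aut_lang (\<lambda>x. x = enc_rexp r) rexp_D rexp_F"
  then obtain y where "y \<in> runs rexp_D {encs [r]} w" "rexp_F y" by (auto simp: aut_lang_def)
  from rexp_sound[OF this] show "w \<in> rexp_lang r" by auto
qed

definition feps :: "nat \<Rightarrow> nat \<Rightarrow> nat \<Rightarrow> fm" where
  "feps b x y = TC (feps1 (b + 2) b (b + 1)) x y"

definition rexp_fI :: "nat \<Rightarrow> nat \<Rightarrow> fm" where "rexp_fI b x = Eq x [Var 1]"
definition rexp_fF :: "nat \<Rightarrow> nat \<Rightarrow> fm" where "rexp_fF b x = Ex (And (Eq b []) (feps (b + 1) x b))"
definition rexp_fD :: "nat \<Rightarrow> nat \<Rightarrow> nat \<Rightarrow> nat \<Rightarrow> fm" where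
  "rexp_fD b x a y = Ex (And (And (fbits (b + 1) a) (Eq b [Var a, Lit [2], Var y])) (feps (b + 1) x b))"

lemma ok_rexp:
  "ok 2 (frexp 2 1)"
  "2 \<le> b \<Longrightarrow> x < b \<Longrightarrow> ok b (rexp_fI b x)"
  "2 \<le> b \<Longrightarrow> x < b \<Longrightarrow> ok b (rexp_fF b x)"
  "2 \<le> b \<Longrightarrow> x < b \<Longrightarrow> a < b \<Longrightarrow> y < b \<Longrightarrow> ok b (rexp_fD b x a y)"
  by (auto simp: rexp_fI_def rexp_fF_def rexp_fD_def feps_def intro!: ok_frexp ok_feps1)

text \<open>The formula restricts the path to short words. On a set \<open>Q\<close> of short words
  that is closed under silent moves this restriction changes nothing, although unfolding a star
  lengthens the word.\<close>

lemma eval_feps: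
  assumes b: "0 < b" "x < b" "y < b" and m: "length (e 0) = m"
    and Q: "e x \<in> Q" "\<And>X Y. X \<in> Q \<Longrightarrow> eps_step X Y \<Longrightarrow> Y \<in> Q" "\<And>X. X \<in> Q \<Longrightarrow> X \<in> words m \<and> length X + 2 \<le> m"
  shows "eval b e (feps b x y) \<longleftrightarrow> (e x, e y) \<in> {(X, Y). eps_step X Y}\<^sup>*"
proof -
  let ?E = "{(X, Y). eps_step X Y}"
  let ?R = "{(X, Y). X \<in> words m \<and> Y \<in> words m \<and> eval (b + 2) (e(b := X, Suc b := Y)) (feps1 (b + 2) b (b + 1))}"
  have eq: "eval (b + 2) (e(b := X, Suc b := Y)) (feps1 (b + 2) b (b + 1)) \<longleftrightarrow> eps_step X Y" if "X \<in> Q" for X Y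
    using eval_feps1[of "b + 2" b "b + 1" "e(b := X, Suc b := Y)"] Q(3)[OF that] b m by simp
  have "(e x, z) \<in> ?R\<^sup>* \<longleftrightarrow> (e x, z) \<in> ?E\<^sup>*" for z
  proof
    assume "(e x, z) \<in> ?R\<^sup>*"
    then have "(e x, z) \<in> ?E\<^sup>* \<and> z \<in> Q"
    proof (induction rule: rtrancl_induct)
      case (step Y Z)
      then have "eps_step Y Z" using eq[of Y Z] by auto
      with step Q(2)[of Y Z] show ?case by (auto intro: rtrancl_into_rtrancl)
    qed (use Q in auto)
    then show "(e x, z) \<in> ?E\<^sup>*" ..
  next
    assume "(e x, z) \<in> ?E\<^sup>*"
    then have "(e x, z) \<in> ?R\<^sup>* \<and> z \<in> Q"
    proof (induction rule: rtrancl_induct)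
      case (step Y Z)
      then have "eps_step Y Z" "Y \<in> Q" "Z \<in> Q" using Q(2)[of Y Z] by auto
      then have "(Y, Z) \<in> ?R" using eq[of Y Z] Q(3) by blast
      with step \<open>Z \<in> Q\<close> show ?case by (blast intro: rtrancl_into_rtrancl)
    qed (use Q in auto)
    then show "(e x, z) \<in> ?R\<^sup>*" ..
  qed
  then show ?thesis using m by (simp add: feps_def)
qed

lemma length_set_word: "(\<forall>q\<in>set qs. length q \<le> k) \<Longrightarrow> length (set_word qs) \<le> 1 + length qs * (k + 1)"
  by (induction qs) (auto simp: set_word_def)

text \<open>The origin of the cubic ruler. With \<open>n\<close> the length of the input, at most
  \<open>n + 1\<close> states of length at most \<open>n^2\<close> give a set code of length at most
  \<open>1 + (n + 1)^3\<close>; three such codes and four letters must fit.\<close>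

lemma rexp_word_automaton:
  assumes "inp = enc_rexp r" "m = 20 * (length inp + 1) ^ 3"
  shows "word_automaton m inp (\<lambda>x. x = enc_rexp r) rexp_D rexp_F rexp_fI rexp_fF rexp_fD (map encs ([] # conts r []))"
proof -
  let ?Ls = "[] # conts r []"
  let ?Q = "set (map encs ?Ls)"
  let ?n = "length inp"
  have cube: "?n * ?n + 1 \<le> (?n + 1) ^ 3" "(?n + 1) * (?n * ?n + 1) \<le> (?n + 1) ^ 3" "1 \<le> (?n + 1) ^ 3"
    by (auto simp: power3_eq_cube algebra_simps)
  have len: "length X \<le> ?n * ?n" if "X \<in> ?Q" for X
    using that length_encs_conts[of _ r "[]"] assms(1) by auto
  have Qw: "X \<in> words m \<and> length X + 2 \<le> m \<and> set X \<subseteq> {..<8}" if "X \<in> ?Q" for X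
  proof -
    have "set X \<subseteq> {..<8}" using that set_enc_rexp by fastforce
    moreover have "length X + 2 \<le> m" using len[OF that] cube unfolding assms(2) by linarith
    ultimately show ?thesis by (force simp: words_def)
  qed
  have closed: "Y \<in> ?Q" if "X \<in> ?Q" "eps_step X Y" for X Y
  proof -
    from that(1) obtain L where L: "L \<in> set ?Ls" "X = encs L" unfolding set_map by blast
    with that(2) obtain L' where "cstep_eps L L'" "Y = encs L'" using encs_eps_step by blast
    moreover from this L have "L' \<in> set ?Ls"
      using conts_closed[of L r "[]" L'] by (auto elim: cstep_eps.cases)
    ultimately show ?thesis by auto
  qed
  have closed_star: "Y \<in> ?Q" if "X \<in> ?Q" "(X, Y) \<in> {(X, Y). eps_step X Y}\<^sup>*" for X Y
    using that(2)
  proof (induction rule: rtrancl_induct)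
    case (step Y Z)
    then show ?case using closed[of Y Z] by blast
  qed (rule that(1))
  have DQ: "y \<in> ?Q \<and> enc_name a @ y \<in> ?Q" if x: "x \<in> ?Q" and d: "rexp_D x a y" for x a y
  proof -
    have z: "enc_name a @ y \<in> ?Q" using closed_star[OF x] d by (auto simp: rexp_D_def)
    then obtain L where L: "L \<in> set ?Ls" "encs L = enc_name a @ y" by force
    from encs_letter[OF L(2)] obtain K where "L = Atom a # K" "y = encs K" by blast
    with L conts_closed[of L r "[]" K a] have "K \<in> set ?Ls" by auto
    with \<open>y = encs K\<close> z show ?thesis by auto
  qed
  show ?thesis
  proof
    show "x \<in> ?Q" if "x = enc_rexp r" for x
      using that self_in_conts[of r "[]"] by (auto intro!: image_eqI[of _ _ "[r]"])
    show "y \<in> ?Q \<and> length a \<le> m" if "x \<in> ?Q" "rexp_D x a y" for x a y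
      using DQ[OF that] Qw[of "enc_name a @ y"] by (auto simp: words_def enc_name_nm)
    show "set q \<subseteq> {..<8}" if "q \<in> ?Q" for q using Qw[OF that] by blast
    have "length (map encs ?Ls) \<le> ?n + 1" using length_conts[of r "[]"] assms(1) by simp
    then have "length (map encs ?Ls) * (?n * ?n + 1) \<le> (?n + 1) * (?n * ?n + 1)" by (rule mult_right_mono) simp
    then have "length (set_word (map encs ?Ls)) \<le> 1 + (?n + 1) ^ 3"
      using length_set_word[of "map encs ?Ls" "?n * ?n"] len cube(2) by fastforce
    then show "3 * length (set_word (map encs ?Ls)) + 4 \<le> m" using cube(3) unfolding assms(2) by linarith
  next
    fix b x :: nat and e :: store
    assume "2 \<le> b" "x < b" "e 0 = replicate m 0" "e 1 = inp" "e x \<in> words m"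
    then show "eval b e (rexp_fI b x) \<longleftrightarrow> e x = enc_rexp r" by (simp add: rexp_fI_def assms(1))
  next
    fix b x :: nat and e :: store
    assume e: "2 \<le> b" "x < b" "e 0 = replicate m 0" "e 1 = inp" "e x \<in> ?Q"
    have "eval (b + 1) (e(b := [])) (feps (b + 1) x b) \<longleftrightarrow> rexp_F (e x)"
      using eval_feps[of "b + 1" x b "e(b := [])" m ?Q] e closed Qw by (auto simp: rexp_F_def)
    then show "eval b e (rexp_fF b x) \<longleftrightarrow> rexp_F (e x)"
      using e(1,3) by (auto simp: rexp_fF_def words_def)
  next
    fix b x a y :: nat and e :: store
    assume e: "2 \<le> b" "x < b" "a < b" "y < b" "e 0 = replicate m 0" "e 1 = inp"
      "e x \<in> ?Q" "e a \<in> words m" "e y \<in> words m"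
    have 1: "eval (b + 1) (e(b := z)) (feps (b + 1) x b) \<longleftrightarrow> (e x, z) \<in> {(X, Y). eps_step X Y}\<^sup>*" for z
      using eval_feps[of "b + 1" x b "e(b := z)" m ?Q] e closed Qw by auto
    have "eval b e (rexp_fD b x a y) \<longleftrightarrow> (\<exists>z\<in>words m. (e a \<in> range nm \<and> z = e a @ 2 # e y) \<and>
        (e x, z) \<in> {(X, Y). eps_step X Y}\<^sup>*)"
      using e 1 by (simp add: rexp_fD_def)
    also have "\<dots> \<longleftrightarrow> (\<exists>n. e a = nm n \<and> rexp_D (e x) n (e y))"
    proof
      assume "\<exists>n. e a = nm n \<and> rexp_D (e x) n (e y)"
      then obtain n where n: "e a = nm n" "rexp_D (e x) n (e y)" by blast
      from DQ[OF e(7) n(2)] Qw have "enc_name n @ e y \<in> words m" by blast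
      with n show "\<exists>z\<in>words m. (e a \<in> range nm \<and> z = e a @ 2 # e y) \<and> (e x, z) \<in> {(X, Y). eps_step X Y}\<^sup>*"
        by (intro bexI[of _ "enc_name n @ e y"]) (auto simp: rexp_D_def enc_name_nm)
    qed (auto simp: rexp_D_def enc_name_nm)
    finally show "eval b e (rexp_fD b x a y) \<longleftrightarrow> (\<exists>n. e a = nm n \<and> rexp_D (e x) n (e y))" .
  qed
qed

theorem rexp_problem_PSPACE:
  assumes "le \<in> {prefix, suffix, sublist, subseq}"
  shows "rexp_problem (convex_lang le) \<in> PSPACE 8" "rexp_problem (closed_lang le) \<in> PSPACE 8"
proof -
  obtain tr where tr: "traces tr le" "\<forall>(i, a, j)\<in>set tr. i < 9 \<and> j < 9" using ex_traces[OF assms] by blast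
  define Lang where "Lang = (\<lambda>w. rexp_lang (inv enc_rexp w))"
  let ?valid = "\<lambda>w. w \<in> range enc_rexp"
  have inv: "inv enc_rexp (enc_rexp r) = r" for r by (simp add: inj_enc_rexp)
  have lists: "enc_rexp r \<in> lists {..<8}" for r using set_enc_rexp[of r] by auto
  have valid: "eval 2 ((\<lambda>_. [])(0 := replicate (20 * (length w + 1) ^ 3) 0, 1 := w)) (frexp 2 1) \<longleftrightarrow> ?valid w"
    if w: "w \<in> lists {..<8}" for w
  proof -
    let ?e = "(\<lambda>_. [])(0 := replicate (20 * (length w + 1) ^ 3) 0, 1 := w) :: store"
    have "length w + 2 \<le> 20 * (length w + 1) ^ 3" using ruler_bound[of "length w"] by linarith
    moreover from this have "w \<in> words (20 * (length w + 1) ^ 3)" using w by (auto simp: words_def)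
    ultimately show ?thesis using eval_frexp[of 2 1 ?e] by auto
  qed
  have aut: "\<exists>I D F qs. word_automaton (20 * (length w + 1) ^ 3) w I D F rexp_fI rexp_fF rexp_fD qs \<and> Lang w = aut_lang I D F"
    if w: "w \<in> lists {..<8}" "?valid w" for w
  proof -
    from w(2) obtain r where r: "w = enc_rexp r" by blast
    from rexp_word_automaton[OF r refl] rexp_aut_lang[of r] show ?thesis unfolding Lang_def r inv by blast
  qed
  note mem = membership[where fV = "frexp 2 1" and fI = rexp_fI and fF = rexp_fF and fD = rexp_fD and c = 20
      and d = 3 and k = 8 and tr = tr and le = le and valid = ?valid and Lang = Lang,
      OF ok_rexp _ _ _ tr le_refl[OF assms] valid aut]
  have eq: "rexp_problem P = {w \<in> lists {..<8}. ?valid w \<and> P (Lang w)}" for P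
    using lists by (auto simp: rexp_problem_def Lang_def inv)
  show "rexp_problem (convex_lang le) \<in> PSPACE 8" "rexp_problem (closed_lang le) \<in> PSPACE 8"
    unfolding eq by (rule mem; simp)+
qed

section \<open>Hardness\<close>

subsection \<open>Rows of letters as computation histories\<close>

text \<open>
  A word is good if it can be cut into rows of the length of \<open>row\<close> such that the first row matches
  \<open>row\<close>, horizontally adjacent letters are related by \<open>H\<close>, vertically adjacent ones by \<open>W\<close>, and the
  last letter satisfies \<open>E\<close>.
\<close>

definition good :: "'a set \<Rightarrow> ('c \<Rightarrow> 'a \<Rightarrow> bool) \<Rightarrow> ('a \<Rightarrow> 'a \<Rightarrow> bool) \<Rightarrow> ('a \<Rightarrow> 'a \<Rightarrow> bool) \<Rightarrow> ('a \<Rightarrow> bool) \<Rightarrow>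
    'c list \<Rightarrow> 'a list \<Rightarrow> bool" where
  "good G A H W E row x \<longleftrightarrow> x \<noteq> [] \<and> set x \<subseteq> G \<and>
     (\<forall>j. j < length row \<and> j < length x \<longrightarrow> A (row ! j) (x ! j)) \<and>
     (\<forall>i. Suc i < length x \<longrightarrow> H (x ! i) (x ! Suc i)) \<and>
     (\<forall>i. i + length row < length x \<longrightarrow> W (x ! i) (x ! (i + length row))) \<and> E (last x)"

datatype kind = Lend | Mid | Rend
datatype side = Before | At | After

instance kind :: countable by countable_datatype
instance side :: countable by countable_datatype

text \<open>
  A letter describes one cell of all tapes: whether it is at an end of the row, the state, the list
  of symbols scanned by all heads, and for each tape the symbol in the cell and where the cell lies
  relative to the head. Repeating state and scanned symbols in all cells makes transitions local.
\<close>

type_synonym letter = "kind \<times> nat \<times> nat list \<times> (nat \<times> side) list"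

text \<open>The conditions on the ends keep each head inside the row, since the left end is never
  right of a head nor the right end left of one. The condition on \<open>At\<close> ties the
  announced symbol to the scanned cell.\<close>

definition letters :: "tm \<Rightarrow> letter set" where
  "letters M = {(kd, q, ss, cs). q < tm_states M \<and> length ss = tm_tapes M \<and> set ss \<subseteq> {..<tm_symbols M} \<and>
     length cs = tm_tapes M \<and> fst ` set cs \<subseteq> {..<tm_symbols M} \<and>
     (\<forall>i<tm_tapes M. (snd (cs ! i) = At \<longrightarrow> fst (cs ! i) = ss ! i) \<and>
       (kd = Lend \<longrightarrow> snd (cs ! i) \<noteq> After) \<and> (kd = Rend \<longrightarrow> snd (cs ! i) \<noteq> Before))}"

lemma letters_iff:
  "a \<in> letters M \<longleftrightarrow> fst (snd a) < tm_states M \<and> length (fst (snd (snd a))) = tm_tapes M \<and>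
     set (fst (snd (snd a))) \<subseteq> {..<tm_symbols M} \<and> length (snd (snd (snd a))) = tm_tapes M \<and>
     fst ` set (snd (snd (snd a))) \<subseteq> {..<tm_symbols M} \<and>
     (\<forall>i<tm_tapes M. (snd (snd (snd (snd a)) ! i) = At \<longrightarrow> fst (snd (snd (snd a)) ! i) = fst (snd (snd a)) ! i) \<and>
       (fst a = Lend \<longrightarrow> snd (snd (snd (snd a)) ! i) \<noteq> After) \<and>
       (fst a = Rend \<longrightarrow> snd (snd (snd (snd a)) ! i) \<noteq> Before))"
  by (cases a) (simp add: letters_def)

lemma letterD:
  assumes "a \<in> letters M"
  shows "fst (snd a) < tm_states M" "length (fst (snd (snd a))) = tm_tapes M" "length (snd (snd (snd a))) = tm_tapes M"
    "i < tm_tapes M \<Longrightarrow> snd (snd (snd (snd a)) ! i) = At \<Longrightarrow> fst (snd (snd (snd a)) ! i) = fst (snd (snd a)) ! i"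
    "i < tm_tapes M \<Longrightarrow> fst a = Lend \<Longrightarrow> snd (snd (snd (snd a)) ! i) \<noteq> After"
    "i < tm_tapes M \<Longrightarrow> fst a = Rend \<Longrightarrow> snd (snd (snd (snd a)) ! i) \<noteq> Before"
  using assms by (auto simp: letters_def)

lemma finite_letters: "finite (letters M)"
proof -
  have UK: "(UNIV :: kind set) = {Lend, Mid, Rend}" "(UNIV :: side set) = {Before, At, After}"
    using kind.exhaust side.exhaust by blast+
  let ?S = "{..<tm_symbols M}"
  have "letters M \<subseteq> UNIV \<times> {..<tm_states M} \<times> {ss. set ss \<subseteq> ?S \<and> length ss = tm_tapes M} \<times>
      {cs. set cs \<subseteq> ?S \<times> UNIV \<and> length cs = tm_tapes M}"
    unfolding letters_def by fastforce
  moreover have "finite \<dots>"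
    by (intro finite_cartesian_product finite_lists_length_eq) (simp_all add: UK)
  ultimately show ?thesis by (rule finite_subset)
qed

definition side_ok :: "side \<Rightarrow> side \<Rightarrow> bool" where
  "side_ok s s' \<longleftrightarrow> (s, s') \<in> {(Before, Before), (Before, At), (At, After), (After, After)}"

text \<open>Between the right end of a row and the next letter nothing is demanded; there the rows
  are tied together by \<open>vrel\<close>.\<close>

fun hrel :: "letter \<Rightarrow> letter \<Rightarrow> bool" where
  "hrel (kd, q, ss, cs) (kd', q', ss', cs') \<longleftrightarrow> kd = Rend \<or>
     (q' = q \<and> ss' = ss \<and> (\<forall>i<length cs. side_ok (snd (cs ! i)) (snd (cs' ! i))))"

text \<open>For a real move only one border is fixed: after a move to the right, the cells left of
  the head are those that were left of it or scanned. The exact position follows from the shape of a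
  row, with one scanned cell on each tape.\<close>

fun shifted :: "move \<Rightarrow> side \<Rightarrow> side \<Rightarrow> bool" where
  "shifted MStay s s' \<longleftrightarrow> s' = s"
| "shifted MRight s s' \<longleftrightarrow> (s' = Before \<longleftrightarrow> s \<noteq> After)"
| "shifted MLeft s s' \<longleftrightarrow> (s' = After \<longleftrightarrow> s \<noteq> Before)"

text \<open>The new scanned symbols \<open>ss'\<close> cannot be determined from the cell above;
  they are fixed within the new row by its scanned cells. Since \<open>q\<close> must not be
  halting, a history cannot run past the end of a computation.\<close>

fun vrel :: "tm \<Rightarrow> letter \<Rightarrow> letter \<Rightarrow> bool" where
  "vrel M (kd, q, ss, cs) (kd', q', ss', cs') \<longleftrightarrow> kd' = kd \<and> q \<notin> {tm_accept M, tm_reject M} \<and>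
     q' = fst (tm_delta M q ss) \<and> (\<forall>i<tm_tapes M.
       fst (cs' ! i) = (if snd (cs ! i) = At then fst (snd (tm_delta M q ss) ! i) else fst (cs ! i)) \<and>
       shifted (snd (snd (tm_delta M q ss) ! i)) (snd (cs ! i)) (snd (cs' ! i)))"

lemma vrelD:
  assumes "vrel M a a'"
  shows "fst (snd a') = fst (tm_delta M (fst (snd a)) (fst (snd (snd a))))"
    "i < tm_tapes M \<Longrightarrow> fst (snd (snd (snd a')) ! i) = (if snd (snd (snd (snd a)) ! i) = At
       then fst (snd (tm_delta M (fst (snd a)) (fst (snd (snd a)))) ! i) else fst (snd (snd (snd a)) ! i))"
    "i < tm_tapes M \<Longrightarrow> shifted (snd (snd (tm_delta M (fst (snd a)) (fst (snd (snd a)))) ! i))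
       (snd (snd (snd (snd a)) ! i)) (snd (snd (snd (snd a')) ! i))"
  using assms by (cases a; cases a'; simp)+

fun final_letter :: "tm \<Rightarrow> letter \<Rightarrow> bool" where
  "final_letter M (kd, q, ss, cs) \<longleftrightarrow> kd = Rend \<and> q = tm_reject M"

text \<open>
  The classes of cells of the initial configuration are numbered: 0 and 3 are the left and the right
  end, 1 and 2 are blank cells left and right of the heads, 4 is the scanned cell if the input is
  empty, and \<open>5 + 2a\<close> and \<open>6 + 2a\<close> are cells with the input letter \<open>a\<close> that are scanned and that
  are right of the head, respectively.
\<close>

definition cell_class :: "nat \<Rightarrow> kind \<times> nat \<times> side" where
  "cell_class c = (if c = 0 then (Lend, 0, Before) else if c = 1 then (Mid, 0, Before)
     else if c = 2 then (Mid, 0, After) else if c = 3 then (Rend, 0, After) else if c = 4 then (Mid, 0, At)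
     else (Mid, Suc ((c - 5) div 2), if odd c then At else After))"

fun matches :: "tm \<Rightarrow> nat \<Rightarrow> letter \<Rightarrow> bool" where
  "matches M c (kd, q, ss, cs) \<longleftrightarrow> (case cell_class c of (kd', s, sd) \<Rightarrow>
     kd = kd' \<and> q = tm_start M \<and> cs ! 0 = (s, sd) \<and> (\<forall>i. 0 < i \<and> i < tm_tapes M \<longrightarrow> cs ! i = (0, sd)))"

lemma matches_iff:
  "matches M c a \<longleftrightarrow> fst a = fst (cell_class c) \<and> fst (snd a) = tm_start M \<and>
     snd (snd (snd a)) ! 0 = snd (cell_class c) \<and>
     (\<forall>i. 0 < i \<and> i < tm_tapes M \<longrightarrow> snd (snd (snd a)) ! i = (0, snd (snd (cell_class c))))"
  by (cases a; cases "cell_class c") auto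

fun input_row :: "nat list \<Rightarrow> nat list" where
  "input_row [] = [4]"
| "input_row (a # w) = (5 + 2 * a) # map (\<lambda>b. 6 + 2 * b) w"

text \<open>The margins of \<open>B\<close> blanks and the end cells leave room for all heads of a
  computation in space \<open>B\<close>. The start position of the heads has index
  \<open>B + 1\<close>, and it exists even if the input is empty.\<close>

definition first_row :: "nat \<Rightarrow> nat list \<Rightarrow> nat list" where
  "first_row B w = 0 # replicate B 1 @ input_row w @ replicate B 2 @ [3]"

lemma length_input_row: "length (input_row w) = max 1 (length w)"
  by (cases w) auto

lemma length_first_row: "length (first_row B w) = 2 * B + 2 + max 1 (length w)"
  by (simp add: first_row_def length_input_row)

section \<open>The cells of a configuration\<close>

definition side_of :: "int \<Rightarrow> int \<Rightarrow> side" where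
  "side_of z h = (if z < h then Before else if z = h then At else After)"

definition cell_kind :: "nat \<Rightarrow> nat \<Rightarrow> kind" where
  "cell_kind N j = (if j = 0 then Lend else if Suc j = N then Rend else Mid)"

definition cell :: "nat \<Rightarrow> nat \<Rightarrow> tm_config \<Rightarrow> nat \<Rightarrow> letter" where
  "cell B N C j = (let z = int j - int (Suc B) in
     (cell_kind N j, fst C, map tape_read (snd C), map (\<lambda>(c, h). (c z, side_of z h)) (snd C)))"

lemma input_row_class:
  assumes "j < max 1 (length w)"
  shows "cell_class (input_row w ! j) = (Mid, word_contents w (int j), if j = 0 then At else After)"
proof (cases w)
  case Nil
  then show ?thesis using assms by (simp add: cell_class_def word_contents_def)
next
  case (Cons a v)
  show ?thesis
  proof (cases j)
    case 0
    with Cons show ?thesis by (simp add: cell_class_def word_contents_def)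
  next
    case (Suc i)
    then have "(6 + 2 * v ! i - 5) div 2 = v ! i" by presburger
    with Suc Cons assms show ?thesis by (auto simp: cell_class_def word_contents_def nat_add_distrib)
  qed
qed

lemma first_row_class:
  assumes "j < length (first_row B w)"
  shows "cell_class (first_row B w ! j) = (let z = int j - int (Suc B) in
    (cell_kind (length (first_row B w)) j, word_contents w z, side_of z 0))"
proof -
  let ?n = "max 1 (length w)"
  consider "j = 0" | "0 < j" "j < Suc B" | "Suc B \<le> j" "j < Suc B + ?n"
    | "Suc B + ?n \<le> j" "j < Suc B + ?n + B" | "j = Suc B + ?n + B"
    using assms by (fastforce simp: length_first_row)
  then show ?thesis
  proof cases
    case 1
    then show ?thesis by (simp add: first_row_def cell_class_def cell_kind_def word_contents_def side_of_def)
  next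
    case 2
    then have "first_row B w ! j = 1" by (cases j) (auto simp: first_row_def nth_append)
    with 2 show ?thesis
      by (auto simp: cell_class_def cell_kind_def word_contents_def side_of_def length_first_row)
  next
    case 3
    then obtain i where i: "j = Suc B + i" "i < ?n" by (auto simp: le_iff_add)
    then have "first_row B w ! j = input_row w ! i"
      by (simp add: first_row_def nth_append length_input_row)
    with i input_row_class[OF i(2)] show ?thesis
      by (auto simp: cell_kind_def side_of_def length_first_row Let_def)
  next
    case 4
    then obtain i where i: "j = Suc B + ?n + i" "i < B" by (auto simp: le_iff_add)
    then have "first_row B w ! j = 2"
      by (simp add: first_row_def nth_append length_input_row)
    moreover have "int j - int (Suc B) = int ?n + int i" "0 < int ?n" "int (length w) \<le> int ?n" using i by auto
    ultimately show ?thesis using i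
      by (auto simp: cell_class_def cell_kind_def word_contents_def side_of_def length_first_row Let_def)
  next
    case 5
    then have "first_row B w ! j = 3"
      by (simp add: first_row_def nth_append length_input_row)
    moreover have "int j - int (Suc B) = int ?n + int B" "0 < int ?n" "int (length w) \<le> int ?n" using 5 by auto
    ultimately show ?thesis using 5
      by (auto simp: cell_class_def cell_kind_def word_contents_def side_of_def length_first_row Let_def)
  qed
qed

text \<open>The head is at the first cell that is not \<open>Before\<close>. It exists because the
  last cell is not \<open>Before\<close>; it is \<open>At\<close> because the first cell is not
  \<open>After\<close> and \<open>Before\<close> is followed by \<open>Before\<close> or
  \<open>At\<close> only.\<close>

lemma ex_head:
  assumes "0 < N" "\<And>j. Suc j < N \<Longrightarrow> side_ok (s j) (s (Suc j))" "s 0 \<noteq> After" "s (N - 1) \<noteq> Before"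
  shows "\<exists>h<N. \<forall>j<N. s j = side_of (int j) (int h)"
proof -
  define h where "h = (LEAST j. s j \<noteq> Before)"
  have h: "s h \<noteq> Before" unfolding h_def by (rule LeastI[of _ "N - 1"]) (rule assms(4))
  have hle: "h \<le> N - 1" unfolding h_def by (rule Least_le) (rule assms(4))
  have lt: "s j = Before" if "j < h" for j using not_less_Least[OF that[unfolded h_def]] by blast
  have hN: "h < N" using assms(1) hle by simp
  have at: "s h = At"
  proof (cases h)
    case 0
    then show ?thesis using h assms(3) by (cases "s 0") auto
  next
    case (Suc i)
    then have "s i = Before" "side_ok (s i) (s h)" using lt[of i] assms(2)[of i] hN by auto
    then show ?thesis using h by (auto simp: side_ok_def)
  qed
  have "s j = After" if "h < j" "j < N" for j
    using that
  proof (induction j)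
    case (Suc j)
    then have "s j = At \<or> s j = After" using at by (cases "j = h") auto
    then show ?case using assms(2)[of j] Suc by (auto simp: side_ok_def)
  qed simp
  then have "\<forall>j<N. s j = side_of (int j) (int h)" using lt at by (auto simp: side_of_def)
  with hN show ?thesis by blast
qed

section \<open>Well-formed configurations and their steps\<close>

definition config_ok :: "tm \<Rightarrow> tm_config \<Rightarrow> bool" where
  "config_ok M C \<longleftrightarrow> fst C < tm_states M \<and> length (snd C) = tm_tapes M \<and>
     (\<forall>i<tm_tapes M. \<forall>z. fst (snd C ! i) z < tm_symbols M)"

lemma tape_act_eq: "tape_act a T = ((fst T)(snd T := fst a), snd T + offset (snd a))"
  by (cases a; cases T) simp

lemma tape_read_eq: "tape_read T = fst T (snd T)"
  by (cases T) simp

lemma config_ok_reads: "config_ok M C \<Longrightarrow> set (map tape_read (snd C)) \<subseteq> {..<tm_symbols M}"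
proof
  fix s assume C: "config_ok M C" "s \<in> set (map tape_read (snd C))"
  then obtain i where "i < tm_tapes M" "s = tape_read (snd C ! i)"
    by (auto simp del: tape_read.simps simp: config_ok_def in_set_conv_nth)
  then show "s \<in> {..<tm_symbols M}" using C(1) by (simp add: config_ok_def tape_read_eq)
qed

lemma delta_ok:
  assumes "wf_tm M" "config_ok M C"
  shows "fst (tm_delta M (fst C) (map tape_read (snd C))) < tm_states M"
    "length (snd (tm_delta M (fst C) (map tape_read (snd C)))) = tm_tapes M"
    "i < tm_tapes M \<Longrightarrow> fst (snd (tm_delta M (fst C) (map tape_read (snd C))) ! i) < tm_symbols M"
proof -
  let ?d = "tm_delta M (fst C) (map tape_read (snd C))"
  have "fst C < tm_states M" "length (map tape_read (snd C)) = tm_tapes M" using assms(2) by (auto simp: config_ok_def)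
  with assms(1) config_ok_reads[OF assms(2)] have *: "fst ?d < tm_states M \<and> length (snd ?d) = tm_tapes M \<and>
      fst ` set (snd ?d) \<subseteq> {..<tm_symbols M}" unfolding wf_tm_def by blast
  then show "fst ?d < tm_states M" "length (snd ?d) = tm_tapes M" by auto
  show "i < tm_tapes M \<Longrightarrow> fst (snd ?d ! i) < tm_symbols M" using * by (metis image_subset_iff lessThan_iff nth_mem)
qed

lemma config_ok_step:
  assumes "wf_tm M" "config_ok M C"
  shows "config_ok M (tm_step M C)"
  using assms delta_ok[OF assms]
  by (auto simp: tm_step_def config_ok_def split: prod.splits) (auto simp: tape_act_eq)

lemma config_ok_init:
  assumes "wf_tm M" "m < tm_symbols M" "w \<in> lists {..<m}"
  shows "config_ok M (tm_init M w)"
proof -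
  have "word_contents w z < tm_symbols M" "word_contents [] z < tm_symbols M" for z
  proof -
    have "w ! nat z < m" if "0 \<le> z" "z < int (length w)"
    proof -
      have "nat z < length w" using that by linarith
      then show ?thesis using assms(3) by (auto simp: in_lists_conv_set)
    qed
    then show "word_contents w z < tm_symbols M" using assms(2) by (auto simp: word_contents_def intro: le_less_trans Suc_leI)
    show "word_contents [] z < tm_symbols M" using assms(2) by (simp add: word_contents_def)
  qed
  moreover have "1 \<le> tm_tapes M" using assms(1) by (simp add: wf_tm_def)
  ultimately show ?thesis using assms(1) by (auto simp: config_ok_def tm_init_def wf_tm_def nth_Cons')
qed

lemma config_ok_run:
  assumes "wf_tm M" "m < tm_symbols M" "w \<in> lists {..<m}"
  shows "config_ok M (tm_run M w t)"
  by (induction t) (auto simp: tm_run_def intro: config_ok_init[OF assms] config_ok_step[OF assms(1)])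

lemma init_tapes:
  "i < tm_tapes M \<Longrightarrow> snd (tm_init M w) ! i = (if i = 0 then word_contents w else word_contents [], 0)"
  by (cases i) (auto simp: tm_init_def)

lemma step_tapes:
  assumes "wf_tm M" "config_ok M C" "\<not> halted M C" "i < tm_tapes M"
  shows "snd (tm_step M C) ! i =
    tape_act (snd (tm_delta M (fst C) (map tape_read (snd C))) ! i) (snd C ! i)"
    "fst (tm_step M C) = fst (tm_delta M (fst C) (map tape_read (snd C)))"
  using assms delta_ok[OF assms(1,2)] by (auto simp: tm_step_def config_ok_def split: prod.splits)

lemma cell_simps:
  assumes "config_ok M C"
  shows "cell B N C j = (cell_kind N j, fst C, map tape_read (snd C), snd (snd (snd (cell B N C j))))"
    and "length (snd (snd (snd (cell B N C j)))) = tm_tapes M"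
    and "i < tm_tapes M \<Longrightarrow> snd (snd (snd (cell B N C j))) ! i =
      (fst (snd C ! i) (int j - int (Suc B)), side_of (int j - int (Suc B)) (snd (snd C ! i)))"
  using assms by (auto simp: cell_def Let_def config_ok_def split: prod.splits)

lemma cell_parts:
  "fst (cell B N C j) = cell_kind N j" "fst (snd (cell B N C j)) = fst C"
  "fst (snd (snd (cell B N C j))) = map tape_read (snd C)"
  by (simp_all add: cell_def Let_def)

lemma letter_cell_eqI:
  assumes "config_ok M C" "a \<in> letters M" "fst a = cell_kind N j" "fst (snd a) = fst C"
    "fst (snd (snd a)) = map tape_read (snd C)"
    "\<And>i. i < tm_tapes M \<Longrightarrow> snd (snd (snd a)) ! i =
      (fst (snd C ! i) (int j - int (Suc B)), side_of (int j - int (Suc B)) (snd (snd C ! i)))"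
  shows "a = cell B N C j"
proof -
  have "snd (snd (snd a)) = snd (snd (snd (cell B N C j)))"
  proof (rule nth_equalityI)
    show "length (snd (snd (snd a))) = length (snd (snd (snd (cell B N C j))))"
      using letterD(3)[OF assms(2)] cell_simps(2)[OF assms(1)] by simp
    fix i assume "i < length (snd (snd (snd a)))"
    then have "i < tm_tapes M" using letterD(3)[OF assms(2)] by simp
    then show "snd (snd (snd a)) ! i = snd (snd (snd (cell B N C j))) ! i"
      using assms(6) cell_simps(3)[OF assms(1)] by simp
  qed
  then show ?thesis using assms(3-5) cell_simps(1)[OF assms(1), of B N j] by (metis prod.collapse)
qed

section \<open>Good words are exactly the rejecting computations\<close>

context
  fixes M :: tm and m :: nat and w :: "nat list" and B :: nat
  assumes wf: "wf_tm M" and m: "m < tm_symbols M" and w: "w \<in> lists {..<m}"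
begin

abbreviation (input) "frow \<equiv> first_row B w"
abbreviation (input) "flen \<equiv> length (first_row B w)"
abbreviation (input) "history \<equiv> good (letters M) (matches M) hrel (vrel M) (final_letter M) (first_row B w)"

lemma N_pos: "2 < flen"
  by (cases w) (simp_all add: length_first_row)

lemma N_pos': "0 < flen"
  by (rule less_trans[OF _ N_pos]) simp

lemma good_letter: "history x \<Longrightarrow> i < length x \<Longrightarrow> x ! i \<in> letters M"
  unfolding good_def by (meson nth_mem subsetD)

lemma row_uniform:
  assumes "history x" "b + flen \<le> length x" "\<And>j. j < flen \<Longrightarrow> fst (x ! (b + j)) = cell_kind flen j" "j < flen"
  shows "fst (snd (x ! (b + j))) = fst (snd (x ! b))" "fst (snd (snd (x ! (b + j)))) = fst (snd (snd (x ! b)))"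
proof -
  have "fst (snd (x ! (b + j))) = fst (snd (x ! b)) \<and> fst (snd (snd (x ! (b + j)))) = fst (snd (snd (x ! b)))"
    using assms(4)
  proof (induction j)
    case (Suc j)
    have "hrel (x ! (b + j)) (x ! (b + Suc j))" using assms(1,2) Suc.prems by (auto simp: good_def)
    moreover have "fst (x ! (b + j)) \<noteq> Rend" using assms(3)[of j] Suc.prems by (simp add: cell_kind_def)
    moreover have "hrel a a' \<Longrightarrow> fst a \<noteq> Rend \<Longrightarrow> fst (snd a') = fst (snd a) \<and> fst (snd (snd a')) = fst (snd (snd a))"
      for a a' by (cases a; cases a') simp
    ultimately show ?case using Suc by (metis Suc_lessD)
  qed simp
  then show "fst (snd (x ! (b + j))) = fst (snd (x ! b))" "fst (snd (snd (x ! (b + j)))) = fst (snd (snd (x ! b)))"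
    by auto
qed

lemma row_head:
  assumes "history x" "b + flen \<le> length x" "\<And>j. j < flen \<Longrightarrow> fst (x ! (b + j)) = cell_kind flen j" "i < tm_tapes M"
  shows "\<exists>h<flen. \<forall>j<flen. snd (snd (snd (snd (x ! (b + j)))) ! i) = side_of (int j) (int h)"
proof (rule ex_head)
  have G: "x ! (b + j) \<in> letters M" if "j < flen" for j
    by (rule good_letter[OF assms(1)]) (use assms(2) that in simp)
  show "side_ok (snd (snd (snd (snd (x ! (b + j)))) ! i)) (snd (snd (snd (snd (x ! (b + Suc j)))) ! i))"
    if "Suc j < flen" for j
  proof -
    have "hrel (x ! (b + j)) (x ! (b + Suc j))" using assms(1,2) that by (auto simp: good_def)
    moreover have "fst (x ! (b + j)) \<noteq> Rend" using assms(3)[of j] that by (simp add: cell_kind_def)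
    moreover have "hrel a a' \<Longrightarrow> fst a \<noteq> Rend \<Longrightarrow> i < length (snd (snd (snd a))) \<Longrightarrow>
        side_ok (snd (snd (snd (snd a)) ! i)) (snd (snd (snd (snd a')) ! i))" for a a' by (cases a; cases a') simp
    moreover have "length (snd (snd (snd (x ! (b + j))))) = tm_tapes M" using letterD(3)[OF G[of j]] that by simp
    ultimately show ?thesis using assms(4) by metis
  qed
  show "snd (snd (snd (snd (x ! (b + 0)))) ! i) \<noteq> After"
    using letterD(5)[OF G[OF N_pos'] assms(4)] assms(3)[OF N_pos'] by (simp add: cell_kind_def)
  show "snd (snd (snd (snd (x ! (b + (flen - 1))))) ! i) \<noteq> Before"
  proof -
    have l: "flen - 1 < flen" "cell_kind flen (flen - 1) = Rend" using N_pos by (auto simp: cell_kind_def)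
    show ?thesis using letterD(6)[OF G[OF l(1)] assms(4)] assms(3)[OF l(1)] l(2) by simp
  qed
  show "0 < flen" by (rule N_pos')
qed

text \<open>Each tape has a scanned cell in the row, and there the letter condition equates the
  announced symbol with the symbol of the cell; \<open>hrel\<close> repeats it along the row. So
  symbols, sides and state determine the whole row.\<close>

lemma row_scanned:
  assumes "history x" "b + flen \<le> length x" "\<And>j. j < flen \<Longrightarrow> fst (x ! (b + j)) = cell_kind flen j"
    and C: "config_ok M C" and cs: "\<And>i j. i < tm_tapes M \<Longrightarrow> j < flen \<Longrightarrow> snd (snd (snd (x ! (b + j)))) ! i =
      (fst (snd C ! i) (int j - int (Suc B)), side_of (int j - int (Suc B)) (snd (snd C ! i)))"
    and q: "fst (snd (x ! b)) = fst C" and j: "j < flen"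
  shows "x ! (b + j) = cell B flen C j"
proof (rule letter_cell_eqI[OF C])
  have G: "x ! (b + j) \<in> letters M" if "j < flen" for j
    by (rule good_letter[OF assms(1)]) (use assms(2) that in simp)
  show "x ! (b + j) \<in> letters M" by (rule G[OF j])
  have k: "length (fst (snd (snd (x ! b)))) = tm_tapes M" using letterD(2)[OF G[OF N_pos']] by simp
  have "fst (snd (snd (x ! b))) ! i = tape_read (snd C ! i)" if i: "i < tm_tapes M" for i
  proof -
    obtain h where h: "h < flen" "\<forall>j<flen. snd (snd (snd (snd (x ! (b + j)))) ! i) = side_of (int j) (int h)"
      using row_head[OF assms(1-3) i] by blast
    then have "side_of (int h - int (Suc B)) (snd (snd C ! i)) = At"
      using cs[OF i h(1)] h(2)[rule_format, OF h(1)] by (simp add: side_of_def split: if_splits)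
    then have z: "snd (snd C ! i) = int h - int (Suc B)" by (auto simp: side_of_def split: if_splits)
    have "snd (snd (snd (snd (x ! (b + h)))) ! i) = At" using h by (simp add: side_of_def)
    then have "fst (snd (snd (snd (x ! (b + h)))) ! i) = fst (snd (snd (x ! (b + h)))) ! i"
      by (rule letterD(4)[OF G[OF h(1)] i])
    with cs[OF i h(1)] row_uniform(2)[OF assms(1-3) h(1)] z show ?thesis by (simp add: tape_read_eq)
  qed
  then have "fst (snd (snd (x ! b))) = map tape_read (snd C)"
    using k C by (intro nth_equalityI) (auto simp: config_ok_def)
  then show "fst (snd (snd (x ! (b + j)))) = map tape_read (snd C)" using row_uniform(2)[OF assms(1-3) j] by simp
  show "fst (snd (x ! (b + j))) = fst C" using row_uniform(1)[OF assms(1-3) j] q by simp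
qed (use assms(3) j cs in auto)

text \<open>The first row fixes the kinds through its classes and \<open>vrel\<close> copies them
  downwards; so the division into rows is visible in the letters.\<close>

lemma good_kinds:
  assumes "history x" "i < length x"
  shows "fst (x ! i) = cell_kind flen (i mod flen)"
  using assms(2)
proof (induction i rule: less_induct)
  case (less i)
  show ?case
  proof (cases "i < flen")
    case True
    then have "matches M (frow ! i) (x ! i)" using assms(1) less.prems by (auto simp: good_def)
    with first_row_class[OF True] True show ?thesis by (cases "x ! i") (auto simp: Let_def)
  next
    case False
    then obtain i' where i': "i = i' + flen" by (metis le_Suc_ex not_less add.commute)
    then have "vrel M (x ! i') (x ! i)" using assms(1) less.prems by (auto simp: good_def)
    then have "fst (x ! i) = fst (x ! i')" by (cases "x ! i'"; cases "x ! i") auto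
    moreover have "i' < i" using i' N_pos' by linarith
    then have "fst (x ! i') = cell_kind flen (i' mod flen)" using less.IH[of i'] less.prems by simp
    moreover have "i mod flen = i' mod flen" using i' by simp
    ultimately show ?thesis by simp
  qed
qed

lemma good_rows:
  assumes "history x" "Suc t * flen \<le> length x"
  shows "(\<forall>j<flen. x ! (t * flen + j) = cell B flen (tm_run M w t) j) \<and>
    (\<forall>i<tm_tapes M. \<exists>h<flen. snd (snd (tm_run M w t) ! i) = int h - int (Suc B))"
  using assms(2)
proof (induction t)
  case 0
  have kd: "fst (x ! (0 + j)) = cell_kind flen j" if "j < flen" for j
    using good_kinds[OF assms(1), of j] that 0 by simp
  have mt: "matches M (frow ! j) (x ! j)" if "j < flen" for j
    using assms(1) 0 that by (auto simp: good_def)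
  have "x ! (0 + j) = cell B flen (tm_init M w) j" if j: "j < flen" for j
  proof (rule row_scanned[OF assms(1) _ kd _ _ _ j])
    show "config_ok M (tm_init M w)" using config_ok_run[OF wf m w, of 0] by (simp add: tm_run_def)
    show "snd (snd (snd (x ! (0 + j)))) ! i = (fst (snd (tm_init M w) ! i) (int j - int (Suc B)),
        side_of (int j - int (Suc B)) (snd (snd (tm_init M w) ! i)))" if "i < tm_tapes M" "j < flen" for i j
      using mt[OF that(2)] first_row_class[OF that(2)] init_tapes[OF that(1), of w] that(1)
      by (cases "x ! j"; cases "i = 0") (auto simp: Let_def word_contents_def[of "[]"])
    show "fst (snd (x ! 0)) = fst (tm_init M w)"
      using mt[OF N_pos'] by (cases "x ! 0"; cases "cell_class (frow ! 0)") (auto simp: tm_init_def)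
  qed (use 0 in auto)
  moreover have "Suc B < flen" by (simp add: length_first_row)
  ultimately show ?case using init_tapes[of _ M w]
    by (auto simp: tm_run_def intro!: exI[of _ "Suc B"])
next
  case (Suc t)
  let ?C = "tm_run M w t" and ?C' = "tm_run M w (Suc t)"
  let ?d = "tm_delta M (fst ?C) (map tape_read (snd ?C))"
  have l: "t * flen + flen + flen \<le> length x" using Suc.prems by (simp add: algebra_simps)
  have IH: "\<forall>j<flen. x ! (t * flen + j) = cell B flen ?C j"
    "\<forall>i<tm_tapes M. \<exists>h<flen. snd (snd ?C ! i) = int h - int (Suc B)" using Suc by auto
  have C: "config_ok M ?C" "config_ok M ?C'" using config_ok_run[OF wf m w] by auto
  let ?b = "t * flen + flen"
  have kd: "fst (x ! (?b + j)) = cell_kind flen j" if "j < flen" for j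
  proof -
    have "?b + j = (t + 1) * flen + j" by simp
    then have "(?b + j) mod flen = j" using that by (metis mod_less mod_mult_self3)
    then show ?thesis using good_kinds[OF assms(1), of "?b + j"] that l by simp
  qed
  have v: "vrel M (cell B flen ?C j) (x ! (?b + j))" if "j < flen" for j
  proof -
    have "vrel M (x ! (t * flen + j)) (x ! (t * flen + j + flen))" using assms(1) l that by (auto simp: good_def)
    then show ?thesis using IH(1) that by (simp add: add.commute add.left_commute)
  qed
  have nh: "\<not> halted M ?C" using v[OF N_pos'] by (cases "x ! ?b") (auto simp: cell_def Let_def halted_def)
  have step: "?C' = tm_step M ?C" by (simp add: tm_run_def)
  have st: "snd ?C' ! i = tape_act (snd ?d ! i) (snd ?C ! i)" "fst ?C' = fst ?d" if "i < tm_tapes M" for i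
    using step_tapes[OF wf C(1) nh that] by (simp_all add: step)
  have k1: "0 < tm_tapes M" using wf by (simp add: wf_tm_def)
  have vi: "fst (snd (snd (snd (x ! (?b + j)))) ! i) = (if side_of (int j - int (Suc B)) (snd (snd ?C ! i)) = At
        then fst (snd ?d ! i) else fst (snd ?C ! i) (int j - int (Suc B)))"
      "shifted (snd (snd ?d ! i)) (side_of (int j - int (Suc B)) (snd (snd ?C ! i))) (snd (snd (snd (snd (x ! (?b + j)))) ! i))"
      "fst (snd (x ! (?b + j))) = fst ?d"
    if "i < tm_tapes M" "j < flen" for i j
    using vrelD(1)[OF v[OF that(2)]] vrelD(2,3)[OF v[OF that(2)] that(1)] cell_simps(3)[OF C(1) that(1), of B flen j]
    by (simp_all add: cell_parts)
  have hd: "\<exists>h<flen. snd (snd ?C' ! i) = int h - int (Suc B) \<and>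
      (\<forall>j<flen. snd (snd (snd (snd (x ! (?b + j)))) ! i) = side_of (int j) (int h))" if i: "i < tm_tapes M" for i
  proof -
    from IH(2) i obtain h where h: "h < flen" "snd (snd ?C ! i) = int h - int (Suc B)" by blast
    have so: "side_of (int j - int (Suc B)) (snd (snd ?C ! i)) = side_of (int j) (int h)" for j
      unfolding h(2) by (simp add: side_of_def)
    obtain h' where h': "h' < flen" "\<forall>j<flen. snd (snd (snd (snd (x ! (?b + j)))) ! i) = side_of (int j) (int h')"
      using row_head[OF assms(1) _ kd i] l by auto
    then have sh: "shifted (snd (snd ?d ! i)) (side_of (int j) (int h)) (side_of (int j) (int h'))" if "j < flen" for j
      using vi(2)[OF i that] so that by simp
    \<comment> \<open>For a real move the condition at the old head cell bounds the new position on
      one side, and the condition at the neighbouring cell bounds it on the other side.\<close>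
    have "int h' = int h + offset (snd (snd ?d ! i))"
    proof (cases "snd (snd ?d ! i)")
      case MStay
      with sh[OF h(1)] show ?thesis by (auto simp: side_of_def split: if_splits)
    next
      case MRight
      from MRight sh[OF h(1)] have "h < h'" by (auto simp: side_of_def split: if_splits)
      moreover from this h'(1) have "Suc h < flen" by simp
      with MRight sh[of "Suc h"] have "h' \<le> Suc h" by (auto simp: side_of_def split: if_splits)
      ultimately show ?thesis using MRight by simp
    next
      case MLeft
      from MLeft sh[OF h(1)] have lt: "h' < h" by (auto simp: side_of_def split: if_splits)
      moreover from MLeft sh[OF less_imp_diff_less[OF h(1), of 1]] lt h(1) have "h - 1 \<le> h'" by (auto simp: side_of_def split: if_splits)
      ultimately show ?thesis using MLeft by simp
    qed
    then have "snd (snd ?C' ! i) = int h' - int (Suc B)" using st(1)[OF i] h(2) by (simp add: tape_act_eq)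
    with h' show ?thesis by blast
  qed
  have "x ! (?b + j) = cell B flen ?C' j" if j: "j < flen" for j
  proof (rule row_scanned[OF assms(1) _ kd C(2) _ _ j])
    show "fst (snd (x ! ?b)) = fst ?C'" using vi(3)[OF k1 N_pos'] st(2)[OF k1] by simp
    fix i j assume i: "i < tm_tapes M" and j: "j < flen"
    from hd[OF i] obtain h where h: "snd (snd ?C' ! i) = int h - int (Suc B)"
      "\<forall>j<flen. snd (snd (snd (snd (x ! (?b + j)))) ! i) = side_of (int j) (int h)" by blast
    have "snd (snd (snd (snd (x ! (?b + j)))) ! i) = side_of (int j - int (Suc B)) (snd (snd ?C' ! i))"
      using h j by (simp add: side_of_def)
    moreover have "fst (snd (snd (snd (x ! (?b + j)))) ! i) = fst (snd ?C' ! i) (int j - int (Suc B))"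
      using vi(1)[OF i j] st(1)[OF i] by (auto simp: tape_act_eq side_of_def)
    ultimately show "snd (snd (snd (x ! (?b + j)))) ! i =
      (fst (snd ?C' ! i) (int j - int (Suc B)), side_of (int j - int (Suc B)) (snd (snd ?C' ! i)))"
      by (metis prod.collapse)
  qed (use l in auto)
  moreover have "Suc t * flen = ?b" by simp
  ultimately show ?case using hd by (metis (no_types, lifting))
qed

text \<open>The final letter is a right end, so the word consists of complete rows; the last row
  then shows a configuration in the rejecting state.\<close>

theorem good_sound:
  assumes "history x"
  shows "\<exists>t. fst (tm_run M w t) = tm_reject M"
proof -
  let ?l = "length x - 1"
  have ne: "x \<noteq> []" and E: "final_letter M (x ! ?l)" using assms by (auto simp: good_def last_conv_nth)
  then have "fst (x ! ?l) = Rend" by (cases "x ! ?l") auto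
  then have "?l mod flen = flen - 1" using good_kinds[OF assms, of ?l] ne N_pos
    by (auto simp: cell_kind_def split: if_splits)
  then have l: "?l = (?l div flen) * flen + (flen - 1)" by (metis div_mult_mod_eq)
  define t where "t = ?l div flen"
  have len: "length x = Suc t * flen" using l ne N_pos unfolding t_def
    by (cases x) (auto simp: algebra_simps)
  have "x ! (t * flen + (flen - 1)) = cell B flen (tm_run M w t) (flen - 1)"
  proof -
    have "flen - 1 < flen" using N_pos' by (rule diff_less[rotated]) simp
    moreover have "Suc t * flen \<le> length x" using len by (rule eq_refl[OF sym])
    note conjunct1[OF good_rows[OF assms this]]
    ultimately show ?thesis by blast
  qed
  then have "x ! ?l = cell B flen (tm_run M w t) (flen - 1)" using l by (simp add: t_def)
  with E show ?thesis by (auto simp: cell_def Let_def)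
qed

theorem good_complete:
  assumes T: "fst (tm_run M w T) = tm_reject M" "\<And>t. t < T \<Longrightarrow> \<not> halted M (tm_run M w t)"
    and hB: "\<And>t i. t \<le> T \<Longrightarrow> i < tm_tapes M \<Longrightarrow> \<bar>snd (snd (tm_run M w t) ! i)\<bar> \<le> int B"
  shows "\<exists>x. history x"
proof -
  define x where "x = map (\<lambda>i. cell B flen (tm_run M w (i div flen)) (i mod flen)) [0..<Suc T * flen]"
  have x: "length x = Suc T * flen" "\<And>i. i < Suc T * flen \<Longrightarrow> x ! i = cell B flen (tm_run M w (i div flen)) (i mod flen)"
    by (auto simp: x_def simp del: upt_Suc)
  have C: "config_ok M (tm_run M w t)" for t by (rule config_ok_run[OF wf m w])
  have k1: "0 < tm_tapes M" using wf by (simp add: wf_tm_def)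
  have ND: "2 * B + 3 \<le> flen" by (simp add: length_first_row)
  have G: "cell B flen (tm_run M w t) j \<in> letters M" if t: "t \<le> T" and j: "j < flen" for t j
  proof -
    let ?C = "tm_run M w t"
    let ?z = "int j - int (Suc B)"
    have "snd (snd (snd (cell B flen ?C j))) ! i = (fst (snd ?C ! i) ?z, side_of ?z (snd (snd ?C ! i)))" if "i < tm_tapes M" for i
      using cell_simps(3)[OF C that] .
    moreover have "side_of ?z (snd (snd ?C ! i)) = At \<Longrightarrow> fst (snd ?C ! i) ?z = map tape_read (snd ?C) ! i"
      if "i < tm_tapes M" for i
      using that C[of t] by (auto simp: side_of_def tape_read_eq config_ok_def split: if_splits)
    moreover have "cell_kind flen j = Lend \<Longrightarrow> side_of ?z (snd (snd ?C ! i)) \<noteq> After" if "i < tm_tapes M" for i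
      using hB[OF t that] by (auto simp: side_of_def cell_kind_def split: if_splits)
    moreover have "cell_kind flen j = Rend \<Longrightarrow> side_of ?z (snd (snd ?C ! i)) \<noteq> Before" if "i < tm_tapes M" for i
      using hB[OF t that] ND by (auto simp: side_of_def cell_kind_def split: if_splits)
    moreover have "fst ` set (snd (snd (snd (cell B flen ?C j)))) \<subseteq> {..<tm_symbols M}"
    proof
      fix s assume "s \<in> fst ` set (snd (snd (snd (cell B flen ?C j))))"
      then obtain i where "i < tm_tapes M" "s = fst (snd (snd (snd (cell B flen ?C j))) ! i)"
        using cell_simps(2)[OF C] by (auto simp: in_set_conv_nth)
      then show "s \<in> {..<tm_symbols M}" using cell_simps(3)[OF C[of t]] C[of t] by (simp add: config_ok_def)
    qed
    ultimately show ?thesis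
      using C[of t, unfolded config_ok_def] config_ok_reads[OF C[of t]] cell_simps(2)[OF C[of t], of B flen j]
      unfolding letters_iff cell_parts by (intro conjI allI impI) simp_all
  qed
  have div: "i div flen \<le> T" if "i < Suc T * flen" for i
    using that by (metis less_mult_imp_div_less less_Suc_eq_le)
  have mod: "i mod flen < flen" for i by (rule mod_less_divisor[OF N_pos'])
  have "x \<noteq> []" using x(1) N_pos by auto
  moreover have "set x \<subseteq> letters M"
  proof
    fix a assume "a \<in> set x"
    then obtain i where "i < Suc T * flen" "a = x ! i" using x(1) by (metis in_set_conv_nth)
    then show "a \<in> letters M" using x(2)[of i] G[OF div mod, of i i] by simp
  qed
  moreover have "matches M (frow ! j) (x ! j)" if "j < flen" "j < length x" for j
  proof -
    have "x ! j = cell B flen (tm_init M w) j" using x(2)[of j] that x(1) by (simp add: tm_run_def)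
    moreover have "config_ok M (tm_init M w)" using C[of 0] by (simp add: tm_run_def)
    note cell_simps(3)[OF this]
    ultimately show ?thesis
      using first_row_class[OF that(1)] init_tapes[of _ M w] k1
      by (auto simp: matches_iff cell_parts Let_def word_contents_def[of "[]"] tm_init_def)
  qed
  moreover have "hrel (x ! i) (x ! Suc i)" if "Suc i < length x" for i
  proof (cases "Suc (i mod flen) = flen")
    case True
    then show ?thesis using x(2)[of i] that x(1) N_pos
      by (cases "x ! Suc i") (auto simp: cell_def Let_def cell_kind_def)
  next
    case False
    then have e: "Suc i mod flen = Suc (i mod flen)" "Suc i div flen = i div flen"
      by (auto simp: mod_Suc div_Suc)
    have so: "side_ok (side_of (z - (1 + int B)) h) (side_of (z - int B) h)" for z h
      by (auto simp: side_ok_def side_of_def)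
    show ?thesis using x(2)[of i] x(2)[of "Suc i"] that x(1) e C[of "i div flen"] so
      by (auto simp: cell_def Let_def config_ok_def split: prod.splits)
  qed
  moreover have "vrel M (x ! i) (x ! (i + flen))" if "i + flen < length x" for i
  proof -
    let ?t = "i div flen" and ?j = "i mod flen"
    let ?C = "tm_run M w ?t" and ?C' = "tm_run M w (Suc ?t)"
    have e: "(i + flen) div flen = Suc ?t" "(i + flen) mod flen = ?j" using N_pos' by simp_all
    have "Suc ?t \<le> T" using div[of "i + flen"] that x(1) e(1) by simp
    then have nh: "\<not> halted M ?C" using T(2) by simp
    have step: "?C' = tm_step M ?C" by (simp add: tm_run_def)
    have st: "snd ?C' ! k = tape_act (snd (tm_delta M (fst ?C) (map tape_read (snd ?C))) ! k) (snd ?C ! k)"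
      "fst ?C' = fst (tm_delta M (fst ?C) (map tape_read (snd ?C)))" if "k < tm_tapes M" for k
      using step_tapes[OF wf C nh that] by (simp_all add: step)
    have sh: "shifted d (side_of z h) (side_of z (h + offset d))" for d z h
      by (cases d) (auto simp: side_of_def)
    have at: "side_of z h = At \<longleftrightarrow> z = h" for z h by (auto simp: side_of_def)
    have xi: "x ! i = cell B flen ?C ?j" "x ! (i + flen) = cell B flen ?C' ?j" using x(2) that x(1) e by auto
    show ?thesis unfolding xi
      by (subst cell_simps(1)[OF C], subst (2) cell_simps(1)[OF C])
        (use nh st k1 cell_simps(3)[OF C] sh in \<open>auto simp: halted_def tape_act_eq at\<close>)
  qed
  moreover have "final_letter M (last x)"
  proof -
    have "last x = x ! (T * flen + (flen - 1))" using x(1) N_pos \<open>x \<noteq> []\<close> by (simp add: last_conv_nth add.commute)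
    moreover have "x ! (T * flen + j) = cell B flen (tm_run M w T) j" if "j < flen" for j
    proof -
      have "(T * flen + j) div flen = T" "(T * flen + j) mod flen = j" using that N_pos' by auto
      with x(2)[of "T * flen + j"] that show ?thesis by simp
    qed
    note this[of "flen - 1"]
    ultimately have "last x = cell B flen (tm_run M w T) (flen - 1)" using N_pos' by simp
    then show ?thesis using T(1) N_pos by (auto simp: cell_def Let_def cell_kind_def)
  qed
  ultimately show ?thesis unfolding good_def by blast
qed

end

text \<open>A head starts at 0 and moves by at most one cell, so by the discrete intermediate value
  theorem it attains all distances up to its current one. Hence the distance is bounded by the
  number of scanned cells, which is finite on a halting run.\<close>

lemma head_bound:
  assumes "tm_halts M w" "tm_space M w \<le> S" "i < tm_tapes M" "wf_tm M" "m < tm_symbols M" "w \<in> lists {..<m}"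
  shows "\<bar>snd (snd (tm_run M w t) ! i)\<bar> \<le> int S"
proof -
  let ?h = "\<lambda>t. snd (snd (tm_run M w t) ! i)"
  let ?P = "{?h t | t. True}"
  obtain T where T: "halted M (tm_run M w T)" using assms(1) by (auto simp: tm_halts_def)
  have "?P \<subseteq> ?h ` {..T}"
  proof
    fix z assume "z \<in> ?P"
    then obtain s where "z = ?h s" by blast
    then show "z \<in> ?h ` {..T}" using halted_stable[OF T, of s] by (cases "s \<le> T") auto
  qed
  then have fin: "finite ?P" using finite_subset by blast
  have "card ?P \<le> tm_space M w" unfolding tm_space_def
    using assms(3) by (intro member_le_sum) auto
  then have card: "card ?P \<le> S" using assms(2) by simp
  have h0: "?h 0 = 0" using init_tapes[OF assms(3), of w] by (simp add: tm_run_def)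
  have st: "\<bar>?h (Suc s) - ?h s\<bar> \<le> 1" for s
  proof (cases "halted M (tm_run M w s)")
    case True
    then show ?thesis using halted_stable[OF True, of "Suc s"] by simp
  next
    case False
    have "offset d \<in> {-1, 0, 1}" for d by (cases d) auto
    then have "\<bar>offset d\<bar> \<le> 1" for d by (metis abs_0 abs_1 abs_minus_cancel empty_iff insert_iff order_refl zero_le_one)
    moreover have "?h (Suc s) = ?h s + offset (snd (snd (tm_delta M (fst (tm_run M w s)) (map tape_read (snd (tm_run M w s)))) ! i))"
      using step_tapes(1)[OF assms(4) config_ok_run[OF assms(4-6)] False assms(3)]
      by (simp add: tm_run_def tape_act_eq)
    ultimately show ?thesis by simp
  qed
  have "{0..\<bar>?h t\<bar>} \<subseteq> abs ` ?P"
  proof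
    fix z assume z: "z \<in> {0..\<bar>?h t\<bar>}"
    have "\<exists>s\<le>t. \<bar>?h s\<bar> = z"
    proof (rule nat0_intermed_int_val)
      show "\<forall>j<t. \<bar>\<bar>?h (j + 1)\<bar> - \<bar>?h j\<bar>\<bar> \<le> 1" using st by (smt (verit) Suc_eq_plus1)
    qed (use z h0 in auto)
    then show "z \<in> abs ` ?P" by blast
  qed
  then have "card {0..\<bar>?h t\<bar>} \<le> card (abs ` ?P)" using fin by (intro card_mono) auto
  also have "\<dots> \<le> card ?P" using fin by (rule card_image_le)
  finally show ?thesis using card by simp
qed

text \<open>Since the machine halts, it rejects if it does not accept; the first halting time gives
  a history without halted rows before its end. Conversely a run cannot reach both halting states,
  because halted configurations are fixed.\<close>

theorem rejects_iff_good:
  assumes "wf_tm M" "m < tm_symbols M" "w \<in> lists {..<m}" "tm_halts M w" "tm_space M w \<le> B"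
  shows "\<not> tm_accepts M w \<longleftrightarrow> (\<exists>x. good (letters M) (matches M) hrel (vrel M) (final_letter M) (first_row B w) x)"
proof
  assume na: "\<not> tm_accepts M w"
  define T where "T = (LEAST t. halted M (tm_run M w t))"
  have "halted M (tm_run M w T)" using assms(4) unfolding T_def tm_halts_def by (rule LeastI_ex)
  then have "fst (tm_run M w T) = tm_reject M" using na by (auto simp: halted_def tm_accepts_def)
  moreover have "\<not> halted M (tm_run M w t)" if "t < T" for t
    using that not_less_Least unfolding T_def by blast
  ultimately show "\<exists>x. good (letters M) (matches M) hrel (vrel M) (final_letter M) (first_row B w) x"
    using good_complete[OF assms(1-3), of T B] head_bound[OF assms(4,5) _ assms(1-3)] by blast
next
  assume "\<exists>x. good (letters M) (matches M) hrel (vrel M) (final_letter M) (first_row B w) x"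
  then obtain s where s: "fst (tm_run M w s) = tm_reject M" using good_sound[OF assms(1-3)] by blast
  show "\<not> tm_accepts M w"
  proof
    assume "tm_accepts M w"
    then obtain t where t: "fst (tm_run M w t) = tm_accept M" by (auto simp: tm_accepts_def)
    have "tm_run M w (max s t) = tm_run M w s" "tm_run M w (max s t) = tm_run M w t"
      using s t by (intro halted_stable; simp add: halted_def)+
    with s t assms(1) show False by (simp add: wf_tm_def)
  qed
qed

subsection \<open>Languages of words that are not histories\<close>

lemma closed_imp_convex: "closed_lang le L \<Longrightarrow> convex_lang le L"
  unfolding closed_lang_def convex_lang_def by blast

definition bad_words :: "'a set \<Rightarrow> ('c \<Rightarrow> 'a \<Rightarrow> bool) \<Rightarrow> ('a \<Rightarrow> 'a \<Rightarrow> bool) \<Rightarrow> ('a \<Rightarrow> 'a \<Rightarrow> bool) \<Rightarrow> ('a \<Rightarrow> bool) \<Rightarrow>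
    'c list \<Rightarrow> 'a list set" where
  "bad_words G A H W E row = {x \<in> lists G. \<not> good G A H W E row x}"

lemma bad_words_iff:
  "x \<in> bad_words G A H W E row \<longleftrightarrow> x \<in> lists G \<and> (x = [] \<or> \<not> E (last x) \<or>
     (\<exists>j. j < length row \<and> j < length x \<and> \<not> A (row ! j) (x ! j)) \<or>
     (\<exists>i. Suc i < length x \<and> \<not> H (x ! i) (x ! Suc i)) \<or>
     (\<exists>i. i + length row < length x \<and> \<not> W (x ! i) (x ! (i + length row))))"
  unfolding bad_words_def good_def mem_Collect_eq in_lists_conv_set subset_iff by blast

text \<open>
  A good word \<open>x\<close> is spoilt by an additional letter on either side, so it lies between the empty word
  and a longer bad word.
\<close>

theorem bad_words_closed_or_convex:
  assumes le: "le \<in> {prefix, suffix, sublist, subseq}" and P: "P \<in> {convex_lang le, closed_lang le}"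
    and c: "c \<in> G" "row \<noteq> []" "\<not> A (hd row) c" "\<not> E c"
  shows "P (bad_words G A H W E row) \<longleftrightarrow> (\<nexists>x. good G A H W E row x)"
proof
  assume nx: "\<nexists>x. good G A H W E row x"
  then have L: "bad_words G A H W E row = lists G" by (simp add: bad_words_def)
  have "set v \<subseteq> set w" if "le v w" for v w
    using le that by (auto dest: set_mono_prefix set_mono_suffix set_mono_sublist simp: subseq_conv_nths set_nths)
  then have "closed_lang le (lists G)" unfolding closed_lang_def in_lists_conv_set by blast
  then show "P (bad_words G A H W E row)" using P L closed_imp_convex by auto
next
  let ?L = "bad_words G A H W E row"
  assume PL: "P ?L"
  then have conv: "convex_lang le ?L" using P closed_imp_convex by auto
  show "\<nexists>x. good G A H W E row x"
  proof
    assume "\<exists>x. good G A H W E row x"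
    then obtain x where x: "good G A H W E row x" by blast
    then have "x \<in> lists G" by (auto simp: good_def)
    have "\<not> A (row ! 0) ((c # x) ! 0)" "0 < length row" using c by (auto simp: hd_conv_nth)
    then have "\<not> good G A H W E row (c # x)" unfolding good_def by fastforce
    moreover have "\<not> good G A H W E row (x @ [c])" "\<not> good G A H W E row []" using c by (simp_all add: good_def)
    ultimately have "[] \<in> ?L" "c # x \<in> ?L" "x @ [c] \<in> ?L" "x \<notin> ?L"
      using x c(1) \<open>x \<in> lists G\<close> by (simp_all add: bad_words_def)
    moreover have "le [] x" using le by auto
    \<comment> \<open>Prefixes need the letter behind and suffixes the letter in front; for factors
      and subwords either would do.\<close>
    moreover have "le x (c # x) \<or> le x (x @ [c])"
      using le suffix_ConsI[of x x c] prefixI[of "x @ [c]" x "[c]"] list_emb_Cons[of "(=)" x x c]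
        suffix_imp_sublist[of x "c # x"] by auto
    ultimately show False using conv unfolding convex_lang_def by blast
  qed
qed

lemma good_map:
  assumes "inj g"
  shows "good (g ` G) (\<lambda>c x. A c (inv g x)) (\<lambda>x y. H (inv g x) (inv g y)) (\<lambda>x y. W (inv g x) (inv g y))
    (\<lambda>x. E (inv g x)) row (map g x) \<longleftrightarrow> good G A H W E row x"
proof -
  have "g ` set x \<subseteq> g ` G \<longleftrightarrow> set x \<subseteq> G" using assms by (rule inj_image_subset_iff)
  then show ?thesis using assms by (auto simp: good_def last_map)
qed

lemma ex_good_map:
  assumes "inj g"
  shows "(\<exists>y. good (g ` G) (\<lambda>c x. A c (inv g x)) (\<lambda>x y. H (inv g x) (inv g y)) (\<lambda>x y. W (inv g x) (inv g y))
    (\<lambda>x. E (inv g x)) row y) \<longleftrightarrow> (\<exists>x. good G A H W E row x)"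
proof
  assume "\<exists>y. good (g ` G) (\<lambda>c x. A c (inv g x)) (\<lambda>x y. H (inv g x) (inv g y)) (\<lambda>x y. W (inv g x) (inv g y))
    (\<lambda>x. E (inv g x)) row y"
  then obtain y where y: "good (g ` G) (\<lambda>c x. A c (inv g x)) (\<lambda>x y. H (inv g x) (inv g y)) (\<lambda>x y. W (inv g x) (inv g y))
    (\<lambda>x. E (inv g x)) row y" by blast
  then have "set y \<subseteq> g ` G" by (simp add: good_def)
  then have "g (inv g z) = z" if "z \<in> set y" for z using that assms by auto
  then have "map g (map (inv g) y) = y" by (simp add: map_idI)
  then show "\<exists>x. good G A H W E row x" using y good_map[OF assms, of G A H W E row "map (inv g) y"] by auto
qed (use good_map[OF assms] in blast)

subsection \<open>Expressions for bad words\<close>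

definition sum_rexp :: "'a rexp list \<Rightarrow> 'a rexp" where
  "sum_rexp rs = foldr Plus rs Zero"

lemma lang_sum_rexp: "rexp_lang (sum_rexp rs) = (\<Union>r\<in>set rs. rexp_lang r)"
  by (induction rs) (auto simp: sum_rexp_def)

lemma enc_sum_rexp: "enc_rexp (sum_rexp rs) = concat (map (\<lambda>r. 5 # enc_rexp r) rs) @ [3]"
  by (induction rs) (auto simp: sum_rexp_def)

definition atoms :: "'a list \<Rightarrow> ('a \<Rightarrow> bool) \<Rightarrow> 'a rexp" where
  "atoms G P = sum_rexp (map Atom (filter P G))"

lemma lang_atoms: "rexp_lang (atoms G P) = {[a] | a. a \<in> set G \<and> P a}"
  by (auto simp: atoms_def lang_sum_rexp)

lemma lang_Times_atoms:
  "x \<in> rexp_lang (Times (atoms G P) r) \<longleftrightarrow> (\<exists>a y. x = a # y \<and> a \<in> set G \<and> P a \<and> y \<in> rexp_lang r)"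
proof
  assume "\<exists>a y. x = a # y \<and> a \<in> set G \<and> P a \<and> y \<in> rexp_lang r"
  then obtain a y where "x = [a] @ y" "a \<in> set G" "P a" "y \<in> rexp_lang r" by auto
  then show "x \<in> rexp_lang (Times (atoms G P) r)" unfolding rexp_lang.simps lang_atoms by blast
qed (auto simp: lang_atoms)

definition any_rexp :: "'a list \<Rightarrow> 'a rexp" where
  "any_rexp G = atoms G (\<lambda>_. True)"

definition all_rexp :: "'a list \<Rightarrow> 'a rexp" where
  "all_rexp G = Star (any_rexp G)"

lemma lang_any: "rexp_lang (any_rexp G) = {[a] | a. a \<in> set G}"
  by (simp add: any_rexp_def lang_atoms)

lemma lang_all: "rexp_lang (all_rexp G) = lists (set G)"
proof
  show "rexp_lang (all_rexp G) \<subseteq> lists (set G)" by (fastforce simp: all_rexp_def lang_any in_lists_conv_set)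
  show "lists (set G) \<subseteq> rexp_lang (all_rexp G)"
  proof
    fix x assume x: "x \<in> lists (set G)"
    have "concat (map (\<lambda>a. [a]) x) = x" by simp
    moreover have "set (map (\<lambda>a. [a]) x) \<subseteq> rexp_lang (any_rexp G)" using x by (auto simp: lang_any)
    ultimately show "x \<in> rexp_lang (all_rexp G)" unfolding all_rexp_def rexp_lang.simps
      by (metis (mono_tags, lifting) mem_Collect_eq)
  qed
qed

text \<open>Nested like a Horner scheme: the error is at the current position, or one letter is
  skipped. So the size is linear in the length of the row.\<close>

definition first_rexp :: "'a list \<Rightarrow> ('c \<Rightarrow> 'a \<Rightarrow> bool) \<Rightarrow> 'c list \<Rightarrow> 'a rexp" where
  "first_rexp G A row = foldr (\<lambda>c r. Plus (Times (atoms G (\<lambda>x. \<not> A c x)) (all_rexp G)) (Times (any_rexp G) r)) row Zero"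

lemma lang_first_rexp:
  "rexp_lang (first_rexp G A row) = {x \<in> lists (set G). \<exists>j. j < length row \<and> j < length x \<and> \<not> A (row ! j) (x ! j)}"
proof (induction row)
  case (Cons c row)
  have ex0: "(\<exists>j. P j) \<longleftrightarrow> P 0 \<or> (\<exists>j. P (Suc j))" for P :: "nat \<Rightarrow> bool" by (metis not0_implies_Suc)
  have "x \<in> rexp_lang (first_rexp G A (c # row)) \<longleftrightarrow>
    x \<in> lists (set G) \<and> (\<exists>j. j < length (c # row) \<and> j < length x \<and> \<not> A ((c # row) ! j) (x ! j))" for x
  proof (cases x)
    case Nil
    then show ?thesis by (auto simp: first_rexp_def lang_atoms lang_any)
  next
    case (Cons a y)
    have "x \<in> rexp_lang (first_rexp G A (c # row)) \<longleftrightarrow>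
      a \<in> set G \<and> (\<not> A c a \<and> y \<in> lists (set G) \<or> y \<in> rexp_lang (first_rexp G A row))"
      unfolding Cons first_rexp_def foldr.simps o_apply rexp_lang.simps(4) any_rexp_def Un_iff lang_Times_atoms lang_all by auto
    also have "\<dots> \<longleftrightarrow> x \<in> lists (set G) \<and> (\<exists>j. j < length (c # row) \<and> j < length x \<and> \<not> A ((c # row) ! j) (x ! j))"
      unfolding Cons.IH Cons by (subst ex0) auto
    finally show ?thesis .
  qed
  then show ?case by blast
qed (simp add: first_rexp_def)

lemma enc_first_rexp:
  "enc_rexp (first_rexp G A row) =
    concat (map (\<lambda>c. 5 # 6 # enc_rexp (atoms G (\<lambda>x. \<not> A c x)) @ enc_rexp (all_rexp G) @ 6 # enc_rexp (any_rexp G)) row) @ [3]"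
  by (induction row) (auto simp: first_rexp_def)

text \<open>
  A row starts with its only occurrence of the class 0, so \<open>skip\<close> skips one letter less than the
  length of the row.
\<close>

definition skip :: "'a list \<Rightarrow> nat list \<Rightarrow> 'a rexp \<Rightarrow> 'a rexp" where
  "skip G row r = foldr (\<lambda>c r. if c = 0 then r else Times (any_rexp G) r) row r"

lemma lang_skip:
  "rexp_lang (skip G row r) = {u @ v | u v. u \<in> lists (set G) \<and> length u = length (filter (\<lambda>c. c \<noteq> 0) row) \<and> v \<in> rexp_lang r}"
proof (induction row)
  case (Cons c row)
  show ?case
  proof (cases "c = 0")
    case True
    then show ?thesis using Cons by (simp add: skip_def)
  next
    case False
    then have "rexp_lang (skip G (c # row) r) = {a # x | a x. a \<in> set G \<and> x \<in> rexp_lang (skip G row r)}"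
      unfolding skip_def any_rexp_def by (auto simp del: rexp_lang.simps simp: lang_Times_atoms)
    also have "\<dots> = {u @ v | u v. u \<in> lists (set G) \<and> length u = length (filter (\<lambda>c. c \<noteq> 0) (c # row)) \<and> v \<in> rexp_lang r}"
    proof (intro set_eqI iffI)
      fix z assume "z \<in> {a # x | a x. a \<in> set G \<and> x \<in> rexp_lang (skip G row r)}"
      then obtain a u v where "z = (a # u) @ v" "a # u \<in> lists (set G)" "length (a # u) = length (filter (\<lambda>c. c \<noteq> 0) (c # row))"
        "v \<in> rexp_lang r" unfolding Cons.IH using False by auto
      then show "z \<in> {u @ v | u v. u \<in> lists (set G) \<and> length u = length (filter (\<lambda>c. c \<noteq> 0) (c # row)) \<and> v \<in> rexp_lang r}"
        by blast
    next
      fix z assume "z \<in> {u @ v | u v. u \<in> lists (set G) \<and> length u = length (filter (\<lambda>c. c \<noteq> 0) (c # row)) \<and> v \<in> rexp_lang r}"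
      then obtain u v where z: "z = u @ v" "u \<in> lists (set G)" "length u = Suc (length (filter (\<lambda>c. c \<noteq> 0) row))"
        "v \<in> rexp_lang r" using False by auto
      then obtain a u' where "u = a # u'" by (cases u) auto
      with z have "z = a # (u' @ v)" "a \<in> set G" "u' \<in> lists (set G)" "length u' = length (filter (\<lambda>c. c \<noteq> 0) row)" by auto
      with z(4) show "z \<in> {a # x | a x. a \<in> set G \<and> x \<in> rexp_lang (skip G row r)}" unfolding Cons.IH by blast
    qed
    finally show ?thesis .
  qed
qed (auto simp: skip_def)

lemma enc_skip:
  "enc_rexp (skip G row r) = concat (map (\<lambda>c. if c = 0 then [] else 6 # enc_rexp (any_rexp G)) row) @ enc_rexp r"
  by (induction row) (auto simp: skip_def)

text \<open>One summand for each left letter \<open>a\<close>. With an empty row nothing is skipped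
  and the two letters are adjacent; with a first row, in which one cell has class 0, they are one
  row apart.\<close>

definition pair_rexp :: "'a list \<Rightarrow> ('a \<Rightarrow> 'a \<Rightarrow> bool) \<Rightarrow> nat list \<Rightarrow> 'a rexp" where
  "pair_rexp G R row = sum_rexp (map (\<lambda>a. Times (all_rexp G) (Times (Atom a)
     (skip G row (Times (atoms G (\<lambda>b. \<not> R a b)) (all_rexp G))))) G)"

lemma lang_pair_rexp:
  assumes "k = Suc (length (filter (\<lambda>c. c \<noteq> 0) row))"
  shows "rexp_lang (pair_rexp G R row) = {x \<in> lists (set G). \<exists>i. i + k < length x \<and> \<not> R (x ! i) (x ! (i + k))}"
proof (intro set_eqI iffI)
  fix x assume "x \<in> rexp_lang (pair_rexp G R row)"
  then obtain a where a: "a \<in> set G" "x \<in> rexp_lang (Times (all_rexp G) (Times (Atom a)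
     (skip G row (Times (atoms G (\<lambda>b. \<not> R a b)) (all_rexp G)))))"
    by (auto simp del: rexp_lang.simps simp: pair_rexp_def lang_sum_rexp)
  then obtain u y where u: "x = u @ a # y" "u \<in> lists (set G)"
    "y \<in> rexp_lang (skip G row (Times (atoms G (\<lambda>b. \<not> R a b)) (all_rexp G)))"
    unfolding rexp_lang.simps(3,5)[of "all_rexp G"] rexp_lang.simps(5)[of "Atom a"] lang_all by auto
  then obtain v t where v: "y = v @ t" "v \<in> lists (set G)" "length v = length (filter (\<lambda>c. c \<noteq> 0) row)"
    "t \<in> rexp_lang (Times (atoms G (\<lambda>b. \<not> R a b)) (all_rexp G))" unfolding lang_skip by blast
  then obtain b z where t: "t = b # z" "b \<in> set G" "\<not> R a b" "z \<in> lists (set G)" unfolding lang_Times_atoms lang_all by blast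
  have x: "x = u @ a # v @ b # z" using u v t by simp
  have "x ! length u = a" "x ! (length u + k) = b" "length u + k < length x"
    unfolding x using v(3) assms by (auto simp: nth_append)
  moreover have "x \<in> lists (set G)" unfolding x using a(1) u(2) v(2) t by simp
  ultimately show "x \<in> {x \<in> lists (set G). \<exists>i. i + k < length x \<and> \<not> R (x ! i) (x ! (i + k))}"
    using t(3) by blast
next
  fix x assume "x \<in> {x \<in> lists (set G). \<exists>i. i + k < length x \<and> \<not> R (x ! i) (x ! (i + k))}"
  then obtain i where x: "x \<in> lists (set G)" "i + k < length x" "\<not> R (x ! i) (x ! (i + k))" by blast
  let ?y = "drop (Suc i) x"
  have xy: "x = take i x @ x ! i # take (k - 1) ?y @ x ! (i + k) # drop (i + k + 1) x"
  proof -
    have "x = take i x @ x ! i # ?y" using x(2) by (simp add: id_take_nth_drop)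
    moreover have "k - 1 < length ?y" using x(2) assms by simp
    then have "?y = take (k - 1) ?y @ ?y ! (k - 1) # drop (Suc (k - 1)) ?y" by (rule id_take_nth_drop)
    moreover have "?y ! (k - 1) = x ! (i + k)" "drop (Suc (k - 1)) ?y = drop (i + k + 1) x"
      using x(2) assms by (auto simp: add.commute)
    ultimately show ?thesis by metis
  qed
  have G: "x ! i \<in> set G" "x ! (i + k) \<in> set G" using x(1,2) by (auto simp: in_lists_conv_set)
  have ls: "take i x \<in> lists (set G)" "take (k - 1) ?y \<in> lists (set G)" "drop (i + k + 1) x \<in> lists (set G)"
    using x(1) by (auto simp: in_lists_conv_set dest: in_set_takeD in_set_dropD)
  have "[x ! (i + k)] @ drop (i + k + 1) x \<in> rexp_lang (Times (atoms G (\<lambda>b. \<not> R (x ! i) b)) (all_rexp G))"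
    unfolding rexp_lang.simps lang_atoms lang_all using G ls x(3) by blast
  then have "take (k - 1) ?y @ [x ! (i + k)] @ drop (i + k + 1) x \<in>
      rexp_lang (skip G row (Times (atoms G (\<lambda>b. \<not> R (x ! i) b)) (all_rexp G)))"
    unfolding lang_skip using ls(2) x(2) assms by fastforce
  then have "take i x @ [x ! i] @ take (k - 1) ?y @ [x ! (i + k)] @ drop (i + k + 1) x \<in> rexp_lang (Times (all_rexp G) (Times (Atom (x ! i))
     (skip G row (Times (atoms G (\<lambda>b. \<not> R (x ! i) b)) (all_rexp G)))))"
    unfolding rexp_lang.simps(3,5) lang_all using ls(1) by blast
  then have "x \<in> rexp_lang (Times (all_rexp G) (Times (Atom (x ! i))
     (skip G row (Times (atoms G (\<lambda>b. \<not> R (x ! i) b)) (all_rexp G)))))" using xy by simp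
  with G(1) show "x \<in> rexp_lang (pair_rexp G R row)" unfolding pair_rexp_def lang_sum_rexp by auto
qed

definition bad_rexp :: "'a list \<Rightarrow> (nat \<Rightarrow> 'a \<Rightarrow> bool) \<Rightarrow> ('a \<Rightarrow> 'a \<Rightarrow> bool) \<Rightarrow> ('a \<Rightarrow> 'a \<Rightarrow> bool) \<Rightarrow> ('a \<Rightarrow> bool) \<Rightarrow>
    nat list \<Rightarrow> 'a rexp" where
  "bad_rexp G A H W E row = Plus (Plus One (Times (all_rexp G) (atoms G (\<lambda>x. \<not> E x))))
     (Plus (first_rexp G A row) (Plus (pair_rexp G H []) (pair_rexp G W row)))"

theorem lang_bad_rexp:
  assumes "length row = Suc (length (filter (\<lambda>c. c \<noteq> 0) row))"
  shows "rexp_lang (bad_rexp G A H W E row) = bad_words (set G) A H W E row"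
proof -
  have "rexp_lang (Plus One (Times (all_rexp G) (atoms G (\<lambda>x. \<not> E x)))) = {x \<in> lists (set G). x = [] \<or> \<not> E (last x)}"
  proof (intro set_eqI)
    fix x
    show "x \<in> rexp_lang (Plus One (Times (all_rexp G) (atoms G (\<lambda>x. \<not> E x)))) \<longleftrightarrow>
      x \<in> {x \<in> lists (set G). x = [] \<or> \<not> E (last x)}"
      by (cases x rule: rev_cases) (auto simp: lang_all lang_atoms)
  qed
  then have "x \<in> rexp_lang (bad_rexp G A H W E row) \<longleftrightarrow> x \<in> bad_words (set G) A H W E row" for x
    using lang_pair_rexp[of 1 "[]" G H] lang_pair_rexp[OF assms, of G W] lang_first_rexp[of G A row]
    unfolding bad_rexp_def rexp_lang.simps(4)[of "Plus _ _"] rexp_lang.simps(4)[of "first_rexp _ _ _"]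
      rexp_lang.simps(4)[of "pair_rexp _ _ _"] bad_words_iff
    by (simp del: rexp_lang.simps) blast
  then show ?thesis by blast
qed

subsection \<open>Automata for bad words\<close>

text \<open>
  The states \<open>QF j\<close> compare the first row, \<open>QH a\<close> has just read \<open>a\<close>, \<open>QV a j\<close> has read \<open>a\<close> and \<open>j\<close>
  further letters, \<open>QE\<close> has just read a letter that is not final, \<open>QL\<close> waits and \<open>QA\<close> has seen an error.
\<close>

datatype 'a state = QF nat | QL | QA | QE | QH 'a | QV 'a nat

text \<open>Shifts the index of a state. The part of the automaton that belongs to cell
  \<open>j\<close> is thereby a shifted copy of a list that depends only on the class of the cell,
  as is needed for writing it cell by cell.\<close>

fun inst :: "nat \<Rightarrow> 'a state \<Rightarrow> 'a state" where
  "inst j (QF k) = QF (k + j)"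
| "inst j (QV a k) = QV a (k + j)"
| "inst j s = s"

lemma nfa_reach_snoc: "nfa_reach N S (u @ [a]) = {q. \<exists>p \<in> nfa_reach N S u. (p, a, q) \<in> set (nfa_trans N)}"
  by (induction u arbitrary: S) auto

fun tag :: "name state \<Rightarrow> nat \<times> name" where
  "tag (QF j) = (j, [False, False, False])"
| "tag QL = (0, [False, False, True])"
| "tag QA = (0, [False, True, False])"
| "tag QE = (0, [False, True, True])"
| "tag (QH a) = (0, [True, False] @ a)"
| "tag (QV a j) = (j, [True, True] @ a)"

text \<open>The index is in unary so that it can be copied from a counter while the encoding is
  written; the bit \<open>False\<close> ends it, and the rest tells the states of one index
  apart.\<close>

definition state_name :: "name state \<Rightarrow> name" where
  "state_name s = replicate (fst (tag s)) True @ False # snd (tag s)"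

lemma unary_inj: "replicate i True @ False # x = replicate j True @ False # y \<longleftrightarrow> i = j \<and> x = y"
proof (induction i arbitrary: j)
  case 0
  then show ?case by (cases j) auto
next
  case (Suc i)
  then show ?case by (cases j) auto
qed

lemma inj_state_name: "inj state_name"
proof (rule injI)
  fix s t assume "state_name s = state_name t"
  then have "tag s = tag t" by (simp add: state_name_def unary_inj prod_eq_iff)
  then show "s = t" by (cases s; cases t) auto
qed

context
  fixes G :: "name list" and A :: "nat \<Rightarrow> name \<Rightarrow> bool" and H W :: "name \<Rightarrow> name \<Rightarrow> bool" and E :: "name \<Rightarrow> bool"
begin

definition fixed_states :: "name state list" where
  "fixed_states = [QL, QA, QE] @ map QH G"

definition row_states :: "name state list" where
  "row_states = [QF 0, QF 1] @ concat (map (\<lambda>a. [QV a 0, QV a 1]) G)"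

text \<open>At each letter the automaton guesses: it waits, remembers the letter for the comparison
  with its neighbour or with the letter one row later, or claims that the letter is the last and not
  final. No transition leaves \<open>QE\<close>, so a wrong claim dies.\<close>

definition fixed_trans :: "(name state \<times> name \<times> name state) list" where
  "fixed_trans = concat (map (\<lambda>p. concat (map (\<lambda>x. [(p, x, QL), (p, x, QH x), (p, x, QV x 0)]) G) @
       map (\<lambda>x. (p, x, QE)) (filter (\<lambda>x. \<not> E x) G)) [QF 0, QL]) @
     concat (map (\<lambda>a. map (\<lambda>x. (QH a, x, QA)) (filter (\<lambda>x. \<not> H a x) G)) G) @
     map (\<lambda>x. (QA, x, QA)) G"

text \<open>The class 3 marks the last cell of a row.\<close>

definition row_trans :: "nat \<Rightarrow> (name state \<times> name \<times> name state) list" where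
  "row_trans c = map (\<lambda>x. (QF 0, x, QF 1)) G @ map (\<lambda>x. (QF 0, x, QA)) (filter (\<lambda>x. \<not> A c x) G) @
     concat (map (\<lambda>a. map (\<lambda>x. (QV a 0, x, QV a 1)) G @
       (if c = 3 then map (\<lambda>x. (QV a 0, x, QA)) (filter (\<lambda>x. \<not> W a x) G) else [])) G)"

definition name_trans :: "name state \<times> name \<times> name state \<Rightarrow> name \<times> name \<times> name" where
  "name_trans = (\<lambda>(p, a, q). (state_name p, a, state_name q))"

definition inst_trans :: "nat \<Rightarrow> name state \<times> name \<times> name state \<Rightarrow> name state \<times> name \<times> name state" where
  "inst_trans j = (\<lambda>(p, a, q). (inst j p, a, inst j q))"

definition bad_nfa :: "nat list \<Rightarrow> (name, name) nfa" where
  "bad_nfa row = \<lparr>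
     nfa_states = map state_name (fixed_states @ concat (map (\<lambda>j. map (inst j) row_states) [0..<length row])),
     nfa_alphabet = G,
     nfa_trans = map name_trans (fixed_trans @ concat (map (\<lambda>j. map (inst_trans j) (row_trans (row ! j))) [0..<length row])),
     nfa_start = state_name (QF 0),
     nfa_final = map state_name [QF 0, QA, QE]\<rparr>"

fun step_to :: "nat list \<Rightarrow> name state \<Rightarrow> name \<Rightarrow> name state \<Rightarrow> bool" where
  "step_to row p x (QF j) \<longleftrightarrow> (\<exists>i<length row. p = QF i \<and> j = Suc i)"
| "step_to row p x QL \<longleftrightarrow> p \<in> {QF 0, QL}"
| "step_to row p x (QH a) \<longleftrightarrow> p \<in> {QF 0, QL} \<and> x = a"
| "step_to row p x (QV a j) \<longleftrightarrow> p \<in> {QF 0, QL} \<and> x = a \<and> j = 0 \<or> a \<in> set G \<and> (\<exists>i<length row. p = QV a i \<and> j = Suc i)"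
| "step_to row p x QE \<longleftrightarrow> p \<in> {QF 0, QL} \<and> \<not> E x"
| "step_to row p x QA \<longleftrightarrow> p = QA \<or> (\<exists>i<length row. p = QF i \<and> \<not> A (row ! i) x) \<or>
     (\<exists>a\<in>set G. p = QH a \<and> \<not> H a x \<or> (\<exists>i<length row. p = QV a i \<and> row ! i = 3 \<and> \<not> W a x))"

lemma set_concat_upt: "z \<in> set (concat (map f [0..<n])) \<longleftrightarrow> (\<exists>j<n. z \<in> set (f j))"
  by auto

lemma set_fixed_trans: "(p, x, q) \<in> set fixed_trans \<longleftrightarrow> x \<in> set G \<and>
  (p \<in> {QF 0, QL} \<and> (q \<in> {QL, QH x, QV x 0} \<or> q = QE \<and> \<not> E x) \<or>
   (\<exists>a\<in>set G. p = QH a \<and> q = QA \<and> \<not> H a x) \<or> p = QA \<and> q = QA)"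
  unfolding fixed_trans_def by auto

lemma set_row_trans: "(p, x, q) \<in> set (map (inst_trans j) (row_trans c)) \<longleftrightarrow> x \<in> set G \<and>
  (p = QF j \<and> (q = QF (Suc j) \<or> q = QA \<and> \<not> A c x) \<or>
   (\<exists>a\<in>set G. p = QV a j \<and> (q = QV a (Suc j) \<or> c = 3 \<and> q = QA \<and> \<not> W a x)))"
proof -
  have "map (inst_trans j) (row_trans c) = map (\<lambda>x. (QF j, x, QF (Suc j))) G @ map (\<lambda>x. (QF j, x, QA)) (filter (\<lambda>x. \<not> A c x) G) @
     concat (map (\<lambda>a. map (\<lambda>x. (QV a j, x, QV a (Suc j))) G @
       (if c = 3 then map (\<lambda>x. (QV a j, x, QA)) (filter (\<lambda>x. \<not> W a x) G) else [])) G)"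
    by (cases "c = 3") (simp_all add: row_trans_def inst_trans_def map_concat comp_def)
  then show ?thesis by auto
qed

lemma trans_bad_nfa:
  "set (nfa_trans (bad_nfa row)) = {(state_name p, x, state_name q) | p x q. x \<in> set G \<and> step_to row p x q}"
proof -
  let ?T = "set (fixed_trans @ concat (map (\<lambda>j. map (inst_trans j) (row_trans (row ! j))) [0..<length row]))"
  have "(p, x, q) \<in> ?T \<longleftrightarrow> (p, x, q) \<in> set fixed_trans \<or> (\<exists>j<length row. (p, x, q) \<in> set (map (inst_trans j) (row_trans (row ! j))))"
    for p x q by (simp only: set_append Un_iff set_concat_upt)
  then have "(p, x, q) \<in> ?T \<longleftrightarrow> x \<in> set G \<and> step_to row p x q" for p x q
    unfolding set_fixed_trans set_row_trans by (cases q) auto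
  note T' = this
  have T: "?T = {(p, x, q). x \<in> set G \<and> step_to row p x q}"
  proof (rule set_eqI)
    fix z :: "name state \<times> name \<times> name state"
    obtain p x q where z: "z = (p, x, q)" by (cases z)
    show "z \<in> ?T \<longleftrightarrow> z \<in> {(p, x, q). x \<in> set G \<and> step_to row p x q}"
      unfolding z T' by simp
  qed
  have "set (nfa_trans (bad_nfa row)) = name_trans ` ?T" by (simp only: bad_nfa_def nfa.select_convs set_map)
  also have "\<dots> = {(state_name p, x, state_name q) | p x q. x \<in> set G \<and> step_to row p x q}"
    unfolding T name_trans_def by (auto simp: image_iff) blast
  finally show ?thesis .
qed

lemma states_bad_nfa:
  "set (nfa_states (bad_nfa row)) = state_name ` ({QL, QA, QE} \<union> QH ` set G \<union>
    (\<Union>j<length row. {QF j, QF (Suc j)} \<union> (\<Union>a\<in>set G. {QV a j, QV a (Suc j)})))"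
proof -
  have "set (fixed_states @ concat (map (\<lambda>j. map (inst j) row_states) [0..<length row])) =
    {QL, QA, QE} \<union> QH ` set G \<union> (\<Union>j<length row. {QF j, QF (Suc j)} \<union> (\<Union>a\<in>set G. {QV a j, QV a (Suc j)}))"
    unfolding fixed_states_def row_states_def by (simp add: atLeast0LessThan image_UN insert_commute)
  then show ?thesis by (simp only: bad_nfa_def nfa.select_convs set_map)
qed

lemma wf_bad_nfa: "row \<noteq> [] \<Longrightarrow> wf_nfa (bad_nfa row)"
proof -
  assume ne: "row \<noteq> []"
  then have 0: "0 < length row" by simp
  let ?Q = "{QL, QA, QE} \<union> QH ` set G \<union> (\<Union>j<length row. {QF j, QF (Suc j)} \<union> (\<Union>a\<in>set G. {QV a j, QV a (Suc j)}))"
  have pq: "p \<in> ?Q \<and> q \<in> ?Q" if "x \<in> set G" "step_to row p x q" for p x q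
    using that 0 by (cases q) auto
  have "set (nfa_trans (bad_nfa row)) \<subseteq> state_name ` ?Q \<times> set G \<times> state_name ` ?Q"
    unfolding trans_bad_nfa
  proof (intro subsetI, elim CollectE exE conjE)
    fix z p x q assume *: "z = (state_name p, x, state_name q)" "x \<in> set G" "step_to row p x q"
    then have "p \<in> ?Q" "q \<in> ?Q" using pq by blast+
    with * show "z \<in> state_name ` ?Q \<times> set G \<times> state_name ` ?Q" by (simp only: mem_Sigma_iff image_eqI[OF refl] simp_thms)
  qed
  moreover have "QF 0 \<in> ?Q" using 0 by auto
  ultimately show ?thesis unfolding wf_nfa_def states_bad_nfa
    by (simp add: bad_nfa_def)
qed

section \<open>The language of the automaton for bad words\<close>

definition error :: "nat list \<Rightarrow> name list \<Rightarrow> bool" where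
  "error row u \<longleftrightarrow> (\<exists>j. j < length row \<and> j < length u \<and> \<not> A (row ! j) (u ! j)) \<or>
     (\<exists>i. Suc i < length u \<and> \<not> H (u ! i) (u ! Suc i)) \<or>
     (\<exists>i. i + length row < length u \<and> \<not> W (u ! i) (u ! (i + length row)))"

lemma error_snoc:
  assumes "row \<noteq> []"
  shows "error row (u @ [x]) \<longleftrightarrow> error row u \<or> (length u < length row \<and> \<not> A (row ! length u) x) \<or>
    (u \<noteq> [] \<and> \<not> H (last u) x) \<or> (length row \<le> length u \<and> \<not> W (u ! (length u - length row)) x)"
proof -
  have 1: "(\<exists>j. j < length row \<and> j < length (u @ [x]) \<and> \<not> A (row ! j) ((u @ [x]) ! j)) \<longleftrightarrow>
    (\<exists>j. j < length row \<and> j < length u \<and> \<not> A (row ! j) (u ! j)) \<or> (length u < length row \<and> \<not> A (row ! length u) x)"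
    (is "?l \<longleftrightarrow> ?r")
  proof
    assume ?l
    then obtain j where "j < length row" "j < Suc (length u)" "\<not> A (row ! j) ((u @ [x]) ! j)" by auto
    then show ?r by (cases "j = length u") (auto simp: nth_append)
  next
    assume ?r
    then show ?l
    proof (elim disjE exE conjE)
      fix j assume "j < length row" "j < length u" "\<not> A (row ! j) (u ! j)"
      then show ?l by (intro exI[of _ j]) (auto simp: nth_append)
    next
      assume "length u < length row" "\<not> A (row ! length u) x"
      then show ?l by (intro exI[of _ "length u"]) auto
    qed
  qed
  have 2: "(\<exists>i. Suc i < length (u @ [x]) \<and> \<not> H ((u @ [x]) ! i) ((u @ [x]) ! Suc i)) \<longleftrightarrow>
    (\<exists>i. Suc i < length u \<and> \<not> H (u ! i) (u ! Suc i)) \<or> (u \<noteq> [] \<and> \<not> H (last u) x)" (is "?l \<longleftrightarrow> ?r")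
  proof
    assume ?l
    then obtain i where i: "i < length u" "\<not> H (u ! i) ((u @ [x]) ! Suc i)" by (auto simp: nth_append)
    show ?r
    proof (cases "Suc i = length u")
      case True
      then have "last u = u ! i" using i(1) by (metis diff_Suc_1 last_conv_nth list.size(3) not_less_zero)
      with i True show ?thesis by auto
    next
      case False
      with i have "Suc i < length u" "\<not> H (u ! i) (u ! Suc i)" by (auto simp: nth_append)
      then show ?thesis by blast
    qed
  next
    assume ?r
    then show ?l
    proof (elim disjE exE conjE)
      fix i assume "Suc i < length u" "\<not> H (u ! i) (u ! Suc i)"
      then show ?l by (intro exI[of _ i]) (auto simp: nth_append)
    next
      assume "u \<noteq> []" "\<not> H (last u) x"
      then show ?l by (intro exI[of _ "length u - 1"]) (auto simp: nth_append last_conv_nth)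
    qed
  qed
  have 3: "(\<exists>i. i + length row < length (u @ [x]) \<and> \<not> W ((u @ [x]) ! i) ((u @ [x]) ! (i + length row))) \<longleftrightarrow>
    (\<exists>i. i + length row < length u \<and> \<not> W (u ! i) (u ! (i + length row))) \<or>
    (length row \<le> length u \<and> \<not> W (u ! (length u - length row)) x)" (is "?l \<longleftrightarrow> ?r")
  proof
    assume ?l
    then obtain i where i: "i + length row < Suc (length u)" "\<not> W ((u @ [x]) ! i) ((u @ [x]) ! (i + length row))" by auto
    show ?r
    proof (cases "i + length row < length u")
      case True
      with i show ?thesis by (auto simp: nth_append)
    next
      case False
      with i have "i + length row = length u" by simp
      moreover from this assms have "i < length u" by (cases row) auto
      moreover from calculation have "length u - length row = i" "length row \<le> length u" by linarith+
      ultimately show ?thesis using i by (auto simp: nth_append)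
    qed
  next
    assume ?r
    then show ?l
    proof (elim disjE exE conjE)
      fix i assume "i + length row < length u" "\<not> W (u ! i) (u ! (i + length row))"
      then show ?l by (intro exI[of _ i]) (auto simp: nth_append)
    next
      assume "length row \<le> length u" "\<not> W (u ! (length u - length row)) x"
      moreover from this have "length u - length row < length u" using assms by (intro diff_less) auto
      ultimately show ?l by (intro exI[of _ "length u - length row"]) (auto simp: nth_append)
    qed
  qed
  show ?thesis unfolding error_def 1 2 3 by blast
qed

text \<open>A closed form of the states reachable on \<open>u\<close>, which turns the correctness
  proof into an induction that appends one letter at a time.\<close>

fun reached :: "nat list \<Rightarrow> name list \<Rightarrow> name state \<Rightarrow> bool" where
  "reached row u (QF j) \<longleftrightarrow> j = length u \<and> j \<le> length row"
| "reached row u QL \<longleftrightarrow> u \<noteq> []"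
| "reached row u (QH a) \<longleftrightarrow> u \<noteq> [] \<and> last u = a"
| "reached row u (QV a j) \<longleftrightarrow> j \<le> length row \<and> j < length u \<and> u ! (length u - 1 - j) = a"
| "reached row u QE \<longleftrightarrow> u \<noteq> [] \<and> \<not> E (last u)"
| "reached row u QA \<longleftrightarrow> error row u"

lemma reached_snoc:
  assumes "row \<noteq> []" "\<And>i. i < length row \<Longrightarrow> row ! i = 3 \<longleftrightarrow> Suc i = length row" "set (u @ [x]) \<subseteq> set G"
  shows "reached row (u @ [x]) s \<longleftrightarrow> (\<exists>p. reached row u p \<and> step_to row p x s)"
proof -
  have st: "\<exists>p. reached row u p \<and> p \<in> {QF 0, QL}"
  proof (cases "u = []")
    case True
    then show ?thesis by (intro exI[of _ "QF 0"]) simp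
  next
    case False
    then show ?thesis by (intro exI[of _ QL]) simp
  qed
  show ?thesis
  proof (cases s)
    case (QF j)
    then show ?thesis by auto
  next
    case QL
    then show ?thesis using st by simp
  next
    case QE
    then show ?thesis using st by auto
  next
    case (QH a)
    then show ?thesis using st by auto
  next
    case (QV a j)
    show ?thesis
    proof (cases j)
      case 0
      then show ?thesis using QV st by auto
    next
      case (Suc i)
      then have "reached row (u @ [x]) s \<longleftrightarrow> i < length row \<and> i < length u \<and> u ! (length u - 1 - i) = a"
        using QV by (auto simp: nth_append)
      also have "\<dots> \<longleftrightarrow> a \<in> set G \<and> i < length row \<and> reached row u (QV a i)"
        using assms(3) by (auto dest: nth_mem simp: subset_iff)
      also have "\<dots> \<longleftrightarrow> (\<exists>p. reached row u p \<and> step_to row p x s)" using QV Suc by auto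
      finally show ?thesis .
    qed
  next
    case QA
    have N: "0 < length row" using assms(1) by simp
    have "(\<exists>p. reached row u p \<and> step_to row p x QA) \<longleftrightarrow> error row u \<or>
      (length u < length row \<and> \<not> A (row ! length u) x) \<or> (u \<noteq> [] \<and> last u \<in> set G \<and> \<not> H (last u) x) \<or>
      (\<exists>i<length row. i < length u \<and> row ! i = 3 \<and> u ! (length u - 1 - i) \<in> set G \<and> \<not> W (u ! (length u - 1 - i)) x)"
      by (auto 0 3 intro: less_imp_le exI[of _ QA] exI[of _ "QF (length u)"] exI[of _ "QH (last u)"] exI[of _ "QV (u ! (length u - Suc i)) i" for i])
    also have "(u \<noteq> [] \<and> last u \<in> set G \<and> \<not> H (last u) x) \<longleftrightarrow> (u \<noteq> [] \<and> \<not> H (last u) x)"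
      using assms(3) by auto
    \<comment> \<open>Class 3 occurs only at the last index, so the vertical test takes place when
      \<open>length row - 1\<close> further letters have been read; the next letter is then exactly
      one row later.\<close>
    also have "(\<exists>i<length row. i < length u \<and> row ! i = 3 \<and> u ! (length u - 1 - i) \<in> set G \<and> \<not> W (u ! (length u - 1 - i)) x) \<longleftrightarrow>
      (length row \<le> length u \<and> \<not> W (u ! (length u - length row)) x)" (is "?l \<longleftrightarrow> ?r")
    proof
      assume ?l
      then obtain i where "i < length row" "i < length u" "row ! i = 3" "\<not> W (u ! (length u - 1 - i)) x" by blast
      moreover from this assms(2) have "length row = Suc i" by simp
      ultimately show ?r by simp
    next
      assume r: ?r
      have "length u - 1 - (length row - 1) = length u - length row" "length u - length row < length u"
        "length row - 1 < length row" "length row - 1 < length u" using N conjunct1[OF r] by linarith+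
      moreover from this(3) have "row ! (length row - 1) = 3" using assms(2)[of "length row - 1"] N by simp
      moreover from calculation(2) have "u ! (length u - length row) \<in> set G" using assms(3) by (auto dest: nth_mem)
      ultimately show ?l using r by (intro exI[of _ "length row - 1"]) simp
    qed
    finally show ?thesis unfolding QA reached.simps error_snoc[OF assms(1)] by blast
  qed
qed

theorem lang_bad_nfa:
  assumes "row \<noteq> []" "\<And>i. i < length row \<Longrightarrow> row ! i = 3 \<longleftrightarrow> Suc i = length row"
  shows "nfa_lang (bad_nfa row) = bad_words (set G) A H W E row"
proof -
  have re: "nfa_reach (bad_nfa row) {state_name (QF 0)} u = state_name ` {s. set u \<subseteq> set G \<and> reached row u s}" for u
  proof (induction u rule: rev_induct)
    case Nil
    have "reached row [] s \<longleftrightarrow> s = QF 0" for s by (cases s) (auto simp: error_def)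
    then show ?case by simp
  next
    case (snoc x u)
    have sn: "(state_name p, x, state_name q) \<in> set (nfa_trans (bad_nfa row)) \<longleftrightarrow> x \<in> set G \<and> step_to row p x q" for p q
      unfolding trans_bad_nfa using inj_state_name by (auto dest: injD)
    have "nfa_reach (bad_nfa row) {state_name (QF 0)} (u @ [x]) =
      {q. \<exists>p. set u \<subseteq> set G \<and> reached row u p \<and> (state_name p, x, q) \<in> set (nfa_trans (bad_nfa row))}"
      unfolding nfa_reach_snoc snoc by blast
    also have "\<dots> = state_name ` {s. \<exists>p. set u \<subseteq> set G \<and> reached row u p \<and> (state_name p, x, state_name s) \<in> set (nfa_trans (bad_nfa row))}"
      by (auto simp: image_iff trans_bad_nfa)
    also have "{s. \<exists>p. set u \<subseteq> set G \<and> reached row u p \<and> (state_name p, x, state_name s) \<in> set (nfa_trans (bad_nfa row))} =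
       {s. set (u @ [x]) \<subseteq> set G \<and> reached row (u @ [x]) s}"
      unfolding sn using reached_snoc[OF assms, of u x] by auto
    finally show ?case .
  qed
  have "u \<in> nfa_lang (bad_nfa row) \<longleftrightarrow> set u \<subseteq> set G \<and> (\<exists>s\<in>{QF 0, QA, QE}. reached row u s)" for u
  proof -
    have int: "state_name ` {s. set u \<subseteq> set G \<and> reached row u s} \<inter> state_name ` {QF 0, QA, QE} =
        state_name ` ({s. set u \<subseteq> set G \<and> reached row u s} \<inter> {QF 0, QA, QE})"
      using inj_state_name by (rule image_Int[symmetric])
    have sf: "nfa_start (bad_nfa row) = state_name (QF 0)" "set (nfa_final (bad_nfa row)) = state_name ` {QF 0, QA, QE}"
      by (simp_all add: bad_nfa_def)
    show ?thesis unfolding nfa_lang_def mem_Collect_eq sf re int image_is_empty by blast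
  qed
  moreover have "(\<exists>s\<in>{QF 0, QA, QE}. reached row u s) \<longleftrightarrow> u = [] \<or> \<not> E (last u) \<or> error row u" for u
    by (cases "u = []") auto
  ultimately show ?thesis unfolding set_eq_iff bad_words_iff in_lists_conv_set error_def by blast
qed

end

subsection \<open>Writing the encodings\<close>

text \<open>
  Both encodings consist of fixed words and of words obtained by replacing each cell of the first row
  by a word that depends on its class and on its index in unary; \<open>None\<close> stands for the latter.
\<close>

datatype segment = Const "nat list" | Row "nat \<Rightarrow> nat list option list"

definition items_out :: "nat \<Rightarrow> nat list option list \<Rightarrow> nat list" where
  "items_out j its = concat (map (\<lambda>it. case it of Some s \<Rightarrow> s | None \<Rightarrow> replicate j 1) its)"

fun segment_out :: "nat list \<Rightarrow> segment \<Rightarrow> nat list" where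
  "segment_out row (Const s) = s"
| "segment_out row (Row f) = concat (map (\<lambda>j. items_out j (f (row ! j))) [0..<length row])"

lemma items_out_simps [simp]:
  "items_out j [] = []" "items_out j (Some s # its) = s @ items_out j its"
  "items_out j (None # its) = replicate j 1 @ items_out j its"
  "items_out j (its @ its') = items_out j its @ items_out j its'"
  by (simp_all add: items_out_def)

lemma items_out_concat: "items_out j (concat itss) = concat (map (items_out j) itss)"
  by (induction itss) auto

lemma segment_out_words: "segment_out row (Row (\<lambda>c. [Some (h c)])) = concat (map h row)"
proof -
  have "map (\<lambda>j. h (row ! j)) [0..<length row] = map h (map ((!) row) [0..<length row])" by simp
  then show ?thesis by (simp add: map_nth)
qed

fun emit_items :: "nat list option list \<Rightarrow> com" where
  "emit_items [] = Done"
| "emit_items (Some s # its) = emit_word s ;; emit_items its"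
| "emit_items (None # its) = (foreach 1 9 (\<lambda>_. Emit 1 ;; Push 10 0) ;; mv 1 10 9) ;; emit_items its"

fun items_time :: "nat \<Rightarrow> nat list option list \<Rightarrow> nat" where
  "items_time n [] = 0"
| "items_time n (Some s # its) = 2 * length s + items_time n its + 1"
| "items_time n (None # its) = n * 18 + items_time n its + 4"

lemma items_time_mono: "j \<le> n \<Longrightarrow> items_time j its \<le> items_time n its"
  by (induction n its rule: items_time.induct) auto

lemma poly_bounded_items_time: "poly_bounded f \<Longrightarrow> poly_bounded (\<lambda>n. items_time (f n) its)"
proof (induction its)
  case (Cons it its)
  then show ?case by (cases it) (auto intro!: poly_bounded_add poly_bounded_mult poly_bounded_Suc)
qed simp

lemma suffix_concat_const: "suffix_concat (\<lambda>_. [a]) xs = replicate (length xs) a"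
  by (induction xs) auto

lemma run_emit_unary:
  assumes "\<sigma> 9 = replicate j 0" "\<sigma> 10 = []" "j \<le> B"
  shows "run B (foreach 1 9 (\<lambda>_. Emit 1 ;; Push 10 0) ;; mv 1 10 9) \<sigma> (j * 18 + 3) (replicate j 1) \<sigma>"
proof -
  let ?S = "\<lambda>ys. \<sigma>(9 := ys, 10 := replicate (j - length ys) 0)"
  let ?t = "\<sigma>(9 := [], 10 := replicate j 0)"
  have "run B (foreach 1 9 (\<lambda>_. Emit 1 ;; Push 10 0)) \<sigma> (length (\<sigma> 9) * (4 + 1 + 5) + 1) (suffix_concat (\<lambda>_. [1]) (\<sigma> 9)) (?S [])"
  proof (rule run_foreach[where S = ?S])
    show "?S (\<sigma> 9) = \<sigma>" using assms by (auto simp: fun_eq_iff)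
    fix a ys assume "suffix (a # ys) (\<sigma> 9)"
    then have l: "Suc (length ys) \<le> j" using assms(1) by (auto dest: suffix_length_le)
    let ?r = "(?S (a # ys))(9 := ys)"
    have "run B (Emit 1 ;; Push 10 0) ?r (1 + 2 + 1) ([1] @ []) (?r(10 := 0 # ?r 10))"
      by (rule run_Seq[OF run_Emit run_Push]) (use l assms in auto)
    moreover have "0 # replicate (j - Suc (length ys)) 0 = replicate (j - length ys) (0::nat)"
      using l by (simp add: Suc_diff_Suc flip: replicate_Suc)
    ultimately show "run B (Emit 1 ;; Push 10 0) ?r 4 [1] (?S ys)"
      by (elim run_cong) (auto simp: fun_eq_iff)
  qed (use assms in auto)
  then have 1: "run B (foreach 1 9 (\<lambda>_. Emit 1 ;; Push 10 0)) \<sigma> (j * 10 + 1) (replicate j 1) ?t"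
    by (rule run_cong) (use assms in \<open>simp_all add: suffix_concat_const\<close>)
  have 2: "run B (mv 1 10 9) ?t (length (?t 10) * (1 + 7) + 1) [] (?t(10 := [], 9 := rev (?t 10) @ ?t 9))"
    by (rule run_mv) (use assms in auto)
  show ?thesis by (rule run_cong[OF run_Seq[OF 1 2]]) (use assms in \<open>auto simp: fun_eq_iff\<close>)
qed

lemma run_emit_items:
  assumes "\<sigma> 9 = replicate j 0" "\<sigma> 10 = []" "j \<le> B"
  shows "run B (emit_items its) \<sigma> (items_time j its) (items_out j its) \<sigma>"
proof (induction its)
  case Nil
  then show ?case by (simp add: run_Done)
next
  case (Cons it its)
  show ?case
  proof (cases it)
    case None
    show ?thesis unfolding None emit_items.simps
      by (rule run_cong[OF run_Seq[OF run_emit_unary[OF assms] Cons]]) simp_all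
  next
    case (Some s)
    show ?thesis unfolding Some emit_items.simps
      by (rule run_cong[OF run_Seq[OF run_emit_word Cons]]) simp_all
  qed
qed

lemma suffix_concat_index:
  "suffix_concat (\<lambda>zs. h (k + length xs - length zs) (hd zs)) xs = concat (map (\<lambda>j. h (k + j) (xs ! j)) [0..<length xs])"
proof (induction xs arbitrary: k)
  case (Cons a xs)
  have "[0..<Suc (length xs)] = 0 # [Suc 0..<Suc (length xs)]" by (rule upt_conv_Cons) simp
  then have "[0..<length (a # xs)] = 0 # map Suc [0..<length xs]" by (simp only: map_Suc_upt length_Cons)
  then show ?case using Cons[of "Suc k"] by (simp add: comp_def)
qed simp

text \<open>Stack 6 holds the row, stack 8 collects the processed cells to restore it afterwards,
  and stack 9 is the index of the current cell in unary. Stack 10 restores this index after each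
  copy to the output.\<close>

definition emit_row :: "nat \<Rightarrow> (nat \<Rightarrow> nat list option list) \<Rightarrow> com" where
  "emit_row K f = foreach K 6 (\<lambda>c. emit_items (f c) ;; Push 8 c ;; Push 9 0) ;; mv K 8 6 ;; clear 9"

definition row_time :: "nat \<Rightarrow> (nat \<Rightarrow> nat list option list) \<Rightarrow> nat \<Rightarrow> nat" where
  "row_time K f n = n * ((\<Sum>c<K. items_time n (f c)) + 2 * K + 21) + 5"

lemma poly_bounded_sum: "(\<And>c. poly_bounded (\<lambda>n. f c n)) \<Longrightarrow> poly_bounded (\<lambda>n. \<Sum>c<(K::nat). f c n)"
  by (induction K) auto

lemma poly_bounded_row_time: "poly_bounded g \<Longrightarrow> poly_bounded (\<lambda>n. row_time K f (g n))"
  unfolding row_time_def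
  by (intro poly_bounded_add poly_bounded_mult poly_bounded_sum poly_bounded_items_time poly_bounded_const) auto

lemma row_time_mono: "n \<le> n' \<Longrightarrow> row_time K f n \<le> row_time K f n'"
  unfolding row_time_def by (intro add_mono mult_le_mono sum_mono items_time_mono) auto

lemma run_emit_row:
  assumes "\<sigma> 6 = row" "set row \<subseteq> {..<K}" "\<sigma> 8 = []" "\<sigma> 9 = []" "\<sigma> 10 = []" "length row \<le> B"
  shows "run B (emit_row K f) \<sigma> (row_time K f (length row)) (segment_out row (Row f)) \<sigma>"
proof -
  let ?n = "length row"
  let ?S = "\<lambda>ys. \<sigma>(6 := ys, 8 := rev (take (?n - length ys) row), 9 := replicate (?n - length ys) 0)"
  let ?t = "\<sigma>(6 := [], 8 := rev row, 9 := replicate ?n 0)"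
  let ?I = "\<Sum>c<K. items_time ?n (f c)"
  have "run B (foreach K 6 (\<lambda>c. emit_items (f c) ;; Push 8 c ;; Push 9 0)) \<sigma> (?n * ((?I + 6) + K + 5) + 1)
     (suffix_concat (\<lambda>zs. items_out (0 + ?n - length zs) (f (hd zs))) row) (?S [])"
  proof (rule run_foreach[where S = ?S])
    show "?S row = \<sigma>" using assms by (auto simp: fun_eq_iff)
    fix c ys assume s: "suffix (c # ys) row"
    then obtain zs where r: "row = zs @ c # ys" by (auto simp: suffix_def)
    let ?j = "?n - length (c # ys)"
    have j: "?j = length zs" "?n - length ys = Suc (length zs)" using r by auto
    let ?r = "(?S (c # ys))(6 := ys)"
    let ?r' = "?r(8 := c # ?r 8)"
    have I: "items_time ?j (f c) \<le> ?I"
    proof -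
      have "c < K" using assms(2) r by auto
      then have "items_time ?n (f c) \<le> ?I" by (intro member_le_sum) auto
      moreover have "items_time ?j (f c) \<le> items_time ?n (f c)" by (rule items_time_mono) simp
      ultimately show ?thesis by simp
    qed
    have 1: "run B (emit_items (f c)) ?r (items_time ?j (f c)) (items_out ?j (f c)) ?r"
      by (rule run_emit_items) (use assms in auto)
    have 2: "run B (Push 8 c ;; Push 9 0) ?r (2 + 2 + 1) ([] @ []) (?r'(9 := 0 # ?r' 9))"
      by (rule run_Seq[OF run_Push run_Push]) (use assms(6) r in auto)
    show "run B (emit_items (f c) ;; Push 8 c ;; Push 9 0) ?r (?I + 6)
       (items_out (0 + ?n - length (c # ys)) (f (hd (c # ys)))) (?S ys)"
      by (rule run_cong[OF run_Seq[OF 1 2]]) (use r I in \<open>auto simp: fun_eq_iff\<close>)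
  qed (use assms in auto)
  then have 1: "run B (foreach K 6 (\<lambda>c. emit_items (f c) ;; Push 8 c ;; Push 9 0)) \<sigma> (?n * ((?I + 6) + K + 5) + 1)
     (segment_out row (Row f)) ?t"
    by (rule run_cong) (simp_all add: suffix_concat_index[of "\<lambda>j c. items_out j (f c)" 0, simplified])
  have 2: "run B (mv K 8 6) ?t (length (?t 8) * (K + 7) + 1) [] (?t(8 := [], 6 := rev (?t 8) @ ?t 6))"
    by (rule run_mv) (use assms in auto)
  let ?u = "\<sigma>(9 := replicate ?n 0)"
  have 3: "run B (mv K 8 6) ?t (?n * (K + 7) + 1) [] ?u"
    by (rule run_cong[OF 2]) (use assms in \<open>auto simp: fun_eq_iff\<close>)
  show ?thesis unfolding emit_row_def
    by (rule run_cong[OF run_Seq[OF 1 run_Seq[OF 3 run_clear]]])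
      (use assms in \<open>auto simp: fun_eq_iff row_time_def algebra_simps\<close>)
qed

fun emit_segments :: "nat \<Rightarrow> segment list \<Rightarrow> com" where
  "emit_segments K [] = Done"
| "emit_segments K (Const s # segs) = emit_word s ;; emit_segments K segs"
| "emit_segments K (Row f # segs) = emit_row K f ;; emit_segments K segs"

fun segments_time :: "nat \<Rightarrow> segment list \<Rightarrow> nat \<Rightarrow> nat" where
  "segments_time K [] n = 0"
| "segments_time K (Const s # segs) n = 2 * length s + segments_time K segs n + 1"
| "segments_time K (Row f # segs) n = row_time K f n + segments_time K segs n + 1"

lemma segments_time_mono: "n \<le> n' \<Longrightarrow> segments_time K segs n \<le> segments_time K segs n'"
  by (induction K segs n rule: segments_time.induct) (auto intro!: add_mono row_time_mono)

lemma poly_bounded_segments_time: "poly_bounded g \<Longrightarrow> poly_bounded (\<lambda>n. segments_time K segs (g n))"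
proof (induction segs)
  case (Cons s segs)
  then show ?case by (cases s) (auto intro!: poly_bounded_add poly_bounded_Suc poly_bounded_row_time)
qed simp

lemma run_emit_segments:
  assumes "\<sigma> 6 = row" "set row \<subseteq> {..<K}" "\<sigma> 8 = []" "\<sigma> 9 = []" "\<sigma> 10 = []" "length row \<le> B"
  shows "run B (emit_segments K segs) \<sigma> (segments_time K segs (length row)) (concat (map (segment_out row) segs)) \<sigma>"
proof (induction segs)
  case Nil
  then show ?case by (simp add: run_Done)
next
  case (Cons s segs)
  show ?case
  proof (cases s)
    case (Const u)
    show ?thesis unfolding Const emit_segments.simps
      by (rule run_cong[OF run_Seq[OF run_emit_word Cons]]) simp_all
  next
    case (Row f)
    show ?thesis unfolding Row emit_segments.simps
      by (rule run_cong[OF run_Seq[OF run_emit_row[OF assms] Cons]]) simp_all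
  qed
qed

section \<open>Writing the first row\<close>

lemma run_foreach_Push:
  assumes "i \<noteq> j" "set (\<sigma> i) \<subseteq> {..<K}" "length (\<sigma> i) + length (\<sigma> j) \<le> B"
  shows "run B (foreach K i (\<lambda>a. Push j (h a))) \<sigma> (length (\<sigma> i) * (K + 7) + 1) []
    (\<sigma>(i := [], j := rev (map h (\<sigma> i)) @ \<sigma> j))"
proof -
  let ?xs = "\<sigma> i"
  let ?S = "\<lambda>ys. \<sigma>(i := ys, j := rev (map h (take (length ?xs - length ys) ?xs)) @ \<sigma> j)"
  have "run B (foreach K i (\<lambda>a. Push j (h a))) \<sigma> (length ?xs * (2 + K + 5) + 1) (suffix_concat (\<lambda>_. []) ?xs) (?S [])"
  proof (rule run_foreach[where S = ?S])
    show "?S ?xs = \<sigma>" using assms(1) by (auto simp: fun_eq_iff)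
    fix a ys assume "suffix (a # ys) ?xs"
    then obtain zs where r: "?xs = zs @ a # ys" by (auto simp: suffix_def)
    let ?r = "(?S (a # ys))(i := ys)"
    have "run B (Push j (h a)) ?r 2 [] (?r(j := h a # ?r j))"
      by (rule run_Push) (use assms(1,3) r in auto)
    then show "run B (Push j (h a)) ?r 2 [] (?S ys)"
      by (rule run_cong) (use assms(1) r in \<open>auto simp: fun_eq_iff\<close>)
  qed (use assms in auto)
  then show ?thesis by (rule run_cong) (simp_all add: algebra_simps)
qed

definition build_input :: "nat \<Rightarrow> com" where
  "build_input m = Branch 3 (\<lambda>s. s = 0) (Push 6 4)
     (switch m 3 (\<lambda>a. Pop 3 ;; mv m 3 4 ;; foreach m 4 (\<lambda>b. Push 6 (6 + 2 * b)) ;; Push 6 (5 + 2 * a)))"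

lemma run_build_input:
  assumes "\<sigma> 3 = w" "\<sigma> 4 = []" "set w \<subseteq> {..<m}" "length w + length (\<sigma> 6) < B"
  shows "run B (build_input m) \<sigma> (2 * length w * (m + 7) + m + 10) [] (\<sigma>(3 := [], 6 := input_row w @ \<sigma> 6))"
proof (cases w)
  case Nil
  have "run B (build_input m) \<sigma> (2 + 1) [] (\<sigma>(6 := 4 # \<sigma> 6))"
    unfolding build_input_def by (rule run_BranchT[OF _ run_Push]) (use assms Nil in auto)
  then show ?thesis by (rule run_cong) (use Nil assms in \<open>auto simp: fun_eq_iff\<close>)
next
  case (Cons a v)
  let ?s1 = "\<sigma>(3 := v)"
  let ?s2 = "\<sigma>(3 := [], 4 := rev v)"
  let ?s3 = "\<sigma>(3 := [], 6 := map (\<lambda>b. 6 + 2 * b) v @ \<sigma> 6)"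
  have 1: "run B (Pop 3) \<sigma> 1 [] ?s1" by (rule run_cong[OF run_Pop]) (use assms Cons in auto)
  have "run B (mv m 3 4) ?s1 (length (?s1 3) * (m + 7) + 1) [] (?s1(3 := [], 4 := rev (?s1 3) @ ?s1 4))"
    by (rule run_mv) (use assms Cons in auto)
  then have 2: "run B (mv m 3 4) ?s1 (length v * (m + 7) + 1) [] ?s2"
    by (rule run_cong) (use assms in \<open>auto simp: fun_eq_iff\<close>)
  have "run B (foreach m 4 (\<lambda>b. Push 6 (6 + 2 * b))) ?s2 (length (?s2 4) * (m + 7) + 1) []
      (?s2(4 := [], 6 := rev (map (\<lambda>b. 6 + 2 * b) (?s2 4)) @ ?s2 6))"
    by (rule run_foreach_Push) (use assms Cons in auto)
  then have 3: "run B (foreach m 4 (\<lambda>b. Push 6 (6 + 2 * b))) ?s2 (length v * (m + 7) + 1) [] ?s3"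
    by (rule run_cong) (use assms in \<open>auto simp: fun_eq_iff rev_map\<close>)
  have 4: "run B (Push 6 (5 + 2 * a)) ?s3 2 [] (?s3(6 := (5 + 2 * a) # ?s3 6))"
    by (rule run_Push) (use assms Cons in auto)
  have 5: "run B (switch m 3 (\<lambda>a. Pop 3 ;; mv m 3 4 ;; foreach m 4 (\<lambda>b. Push 6 (6 + 2 * b)) ;; Push 6 (5 + 2 * a))) \<sigma>
     ((1 + ((length v * (m + 7) + 1) + ((length v * (m + 7) + 1) + 2 + 1) + 1) + 1) + m) ([] @ [] @ [] @ [])
     (?s3(6 := (5 + 2 * a) # ?s3 6))"
  proof (rule run_switch[where a = a and xs = v])
    show "run B (Pop 3 ;; mv m 3 4 ;; foreach m 4 (\<lambda>b. Push 6 (6 + 2 * b)) ;; Push 6 (5 + 2 * a)) \<sigma>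
     (1 + ((length v * (m + 7) + 1) + ((length v * (m + 7) + 1) + 2 + 1) + 1) + 1) ([] @ [] @ [] @ [])
     (?s3(6 := (5 + 2 * a) # ?s3 6))" by (rule run_Seq[OF 1 run_Seq[OF 2 run_Seq[OF 3 4]]])
  qed (use assms Cons in auto)
  show ?thesis unfolding build_input_def
    by (rule run_cong[OF run_BranchF[OF _ 5]]) (use assms Cons in \<open>auto simp: fun_eq_iff algebra_simps\<close>)
qed

text \<open>The row is pushed from its right end to its left end, so that its first cell ends up on
  top.\<close>

definition build_row :: "nat \<Rightarrow> com" where
  "build_row m = copy 1 1 7 8 ;; Push 6 3 ;; foreach 1 1 (\<lambda>_. Push 6 2) ;; build_input m ;;
     foreach 1 7 (\<lambda>_. Push 6 1) ;; Push 6 0"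

lemma run_build_row:
  assumes "set w \<subseteq> {..<m}" "2 * b + length w + 5 \<le> B" "\<sigma> = (\<lambda>_. [])(3 := w, 2 := x, 1 := replicate b 0)"
  shows "run B (build_row m) \<sigma> (b * 35 + 2 * length w * (m + 7) + m + 30) [] ((\<lambda>_. [])(2 := x, 6 := first_row b w))"
proof -
  let ?s1 = "(\<lambda>_::nat. [])(3 := w, 2 := x, 1 := replicate b 0, 7 := replicate b 0)"
  let ?s2 = "?s1(6 := [3])"
  let ?s3 = "(\<lambda>_::nat. [])(3 := w, 2 := x, 7 := replicate b 0, 6 := replicate b 2 @ [3])"
  let ?s4 = "(\<lambda>_::nat. [])(2 := x, 7 := replicate b 0, 6 := input_row w @ replicate b 2 @ [3])"
  let ?s5 = "(\<lambda>_::nat. [])(2 := x, 6 := replicate b 1 @ input_row w @ replicate b 2 @ [3])"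
  have il: "length (input_row w) \<le> length w + 1" by (simp add: length_input_row)
  have "run B (copy 1 1 7 8) \<sigma> (length (\<sigma> 1) * (2 * 1 + 17) + 3) [] (\<sigma>(7 := \<sigma> 1 @ \<sigma> 7))"
    by (rule run_copy) (use assms in auto)
  then have 1: "run B (copy 1 1 7 8) \<sigma> (b * 19 + 3) [] ?s1"
    by (rule run_cong) (use assms(3) in \<open>auto simp: fun_eq_iff\<close>)
  have "run B (Push 6 3) ?s1 2 [] (?s1(6 := 3 # ?s1 6))" by (rule run_Push) (use assms in auto)
  then have 2: "run B (Push 6 3) ?s1 2 [] ?s2" by (rule run_cong) (auto simp: fun_eq_iff)
  have "run B (foreach 1 1 (\<lambda>_. Push 6 2)) ?s2 (length (?s2 1) * (1 + 7) + 1) []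
      (?s2(1 := [], 6 := rev (map (\<lambda>_. 2) (?s2 1)) @ ?s2 6))"
    by (rule run_foreach_Push) (use assms in auto)
  then have 3: "run B (foreach 1 1 (\<lambda>_. Push 6 2)) ?s2 (b * 8 + 1) [] ?s3"
    by (rule run_cong) (auto simp: fun_eq_iff map_replicate_const)
  have "run B (build_input m) ?s3 (2 * length w * (m + 7) + m + 10) [] (?s3(3 := [], 6 := input_row w @ ?s3 6))"
    by (rule run_build_input) (use assms in auto)
  then have 4: "run B (build_input m) ?s3 (2 * length w * (m + 7) + m + 10) [] ?s4"
    by (rule run_cong) (auto simp: fun_eq_iff)
  have "run B (foreach 1 7 (\<lambda>_. Push 6 1)) ?s4 (length (?s4 7) * (1 + 7) + 1) []
      (?s4(7 := [], 6 := rev (map (\<lambda>_. 1) (?s4 7)) @ ?s4 6))"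
    by (rule run_foreach_Push) (use assms il in auto)
  then have 5: "run B (foreach 1 7 (\<lambda>_. Push 6 1)) ?s4 (b * 8 + 1) [] ?s5"
    by (rule run_cong) (auto simp: fun_eq_iff map_replicate_const)
  have 6: "run B (Push 6 0) ?s5 2 [] (?s5(6 := 0 # ?s5 6))"
    by (rule run_Push) (use assms il in auto)
  show ?thesis unfolding build_row_def
    by (rule run_cong[OF run_Seq[OF 1 run_Seq[OF 2 run_Seq[OF 3 run_Seq[OF 4 run_Seq[OF 5 6]]]]]])
      (auto simp: fun_eq_iff first_row_def)
qed

lemma set_input_row: "set w \<subseteq> {..<m} \<Longrightarrow> set (input_row w) \<subseteq> {4..<7 + 2 * m}"
  by (cases w) auto

lemma set_first_row: "set w \<subseteq> {..<m} \<Longrightarrow> set (first_row b w) \<subseteq> {..<7 + 2 * m}"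
  using set_input_row[of w m] by (auto simp: first_row_def)

theorem polytime_segments:
  "polytime_computable m (\<lambda>w. concat (map (segment_out (first_row (c * (length w + 1) ^ d) w)) segs))"
proof -
  \<comment> \<open>A strict bound on the cell classes for inputs over \<open>m\<close>
    letters.\<close>
  let ?K = "7 + 2 * m"
  let ?b = "\<lambda>n. c * (n + 1) ^ d"
  let ?T = "\<lambda>n. (n * (2 * m + 17) + 3 * c + power_time d c (n + 1) + 10) +
     ((?b n * 35 + 2 * n * (m + 7) + m + 30) + segments_time ?K segs (2 * ?b n + n + 3) + 1) + 1"
  have "poly_bounded ?T"
    by (intro poly_bounded_add poly_bounded_mult poly_bounded_power poly_bounded_power_time
      poly_bounded_segments_time poly_bounded_const poly_bounded_id)
  then obtain p :: "nat poly" where p: "\<And>n. ?T n \<le> poly p n" by (auto simp: poly_bounded_def)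
  show ?thesis
  proof (rule polytime_computableI[where p = p and c = "ruler m c d 1 2 3 4 5 ;; build_row m ;; emit_segments ?K segs"])
    fix w assume "w \<in> lists {..<m}"
    then have w: "set w \<subseteq> {..<m}" by auto
    let ?n = "length w"
    let ?B = "2 * ?b ?n + ?n + 5"
    let ?row = "first_row (?b ?n) w"
    have l: "length ?row \<le> 2 * ?b ?n + ?n + 3" by (simp add: length_first_row)
    have 1: "run ?B (ruler m c d 1 2 3 4 5) ((\<lambda>_. [])(0 := w)) (?n * (2 * m + 17) + 3 * c + power_time d c (?n + 1) + 10) []
      ((\<lambda>_. [])(3 := w, 2 := replicate (?n + 1) 0, 1 := replicate (?b ?n) 0))"
      by (rule run_ruler) (use w in auto)
    let ?t = "(\<lambda>_::nat. [])(2 := replicate (?n + 1) 0, 6 := ?row)"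
    have 2: "run ?B (build_row m) ((\<lambda>_. [])(3 := w, 2 := replicate (?n + 1) 0, 1 := replicate (?b ?n) 0))
      (?b ?n * 35 + 2 * ?n * (m + 7) + m + 30) [] ?t"
      by (rule run_build_row) (use w in auto)
    have 3: "run ?B (emit_segments ?K segs) ?t (segments_time ?K segs (length ?row)) (concat (map (segment_out ?row) segs)) ?t"
      by (rule run_emit_segments) (use set_first_row[OF w] l in auto)
    have "run ?B (ruler m c d 1 2 3 4 5 ;; build_row m ;; emit_segments ?K segs) ((\<lambda>_. [])(0 := w)) (?T ?n)
       (concat (map (segment_out ?row) segs)) ?t"
      by (rule run_cong[OF run_Seq[OF 1 run_Seq[OF 2 3]]]) (use segments_time_mono[OF l, of ?K segs] in auto)
    then obtain t where t: "t \<le> ?T ?n"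
      "exec ?B (ruler m c d 1 2 3 4 5 ;; build_row m ;; emit_segments ?K segs) ((\<lambda>_. [])(0 := w)) t (concat (map (segment_out ?row) segs)) ?t"
      unfolding run_def by blast
    have st: "(\<lambda>_. [])(0 := w) = (\<lambda>i. if i = 0 then w else [])" by auto
    have "?n \<le> ?B" by simp
    moreover have "t \<le> poly p ?n" using t(1) p[of ?n] by (rule order_trans)
    ultimately show "\<exists>B t \<sigma>. ?n \<le> B \<and> t \<le> poly p ?n \<and> exec B (ruler m c d 1 2 3 4 5 ;; build_row m ;; emit_segments ?K segs)
       (\<lambda>i. if i = 0 then w else []) t (concat (map (segment_out ?row) segs)) \<sigma>"
      using t(2) unfolding st by blast
  qed
qed

text \<open>Each summand of the vertical part contains a copy of the row, so there is one pass over
  the row for every letter of \<open>G\<close>. As \<open>G\<close> depends only on the machine, the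
  number of passes is constant.\<close>

definition rexp_segments :: "name list \<Rightarrow> (nat \<Rightarrow> name \<Rightarrow> bool) \<Rightarrow> (name \<Rightarrow> name \<Rightarrow> bool) \<Rightarrow> (name \<Rightarrow> name \<Rightarrow> bool) \<Rightarrow>
    (name \<Rightarrow> bool) \<Rightarrow> segment list" where
  "rexp_segments G A H W E =
     [Const (5 # enc_rexp (Plus One (Times (all_rexp G) (atoms G (\<lambda>x. \<not> E x)))) @ [5]),
      Row (\<lambda>c. [Some (5 # 6 # enc_rexp (atoms G (\<lambda>x. \<not> A c x)) @ enc_rexp (all_rexp G) @ 6 # enc_rexp (any_rexp G))]),
      Const (3 # 5 # enc_rexp (pair_rexp G H []))] @
     concat (map (\<lambda>a. [Const (5 # 6 # enc_rexp (all_rexp G) @ 6 # enc_name a),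
       Row (\<lambda>c. [Some (if c = 0 then [] else 6 # enc_rexp (any_rexp G))]),
       Const (enc_rexp (Times (atoms G (\<lambda>b. \<not> W a b)) (all_rexp G)))]) G) @ [Const [3]]"

lemma concat_map_concat: "concat (map f (concat xss)) = concat (map (\<lambda>xs. concat (map f xs)) xss)"
  by (induction xss) auto

lemma concat_concat: "concat (concat xsss) = concat (map concat xsss)"
  by (induction xsss) auto

lemma enc_bad_rexp: "enc_rexp (bad_rexp G A H W E row) = concat (map (segment_out row) (rexp_segments G A H W E))"
proof -
  have "enc_rexp (pair_rexp G W row) = concat (map (\<lambda>a. 5 # 6 # enc_rexp (all_rexp G) @ 6 # enc_name a @
      concat (map (\<lambda>c. if c = 0 then [] else 6 # enc_rexp (any_rexp G)) row) @
      enc_rexp (Times (atoms G (\<lambda>b. \<not> W a b)) (all_rexp G))) G) @ [3]"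
    unfolding pair_rexp_def enc_sum_rexp by (simp add: enc_skip comp_def)
  then show ?thesis unfolding bad_rexp_def rexp_segments_def
    by (simp add: enc_first_rexp segment_out_words concat_map_concat comp_def del: segment_out.simps(2))
qed

text \<open>Only the states \<open>QF\<close> and \<open>QV\<close> carry an index, which
  \<open>inst\<close> shifts; so \<open>None\<close>, the index of the cell in unary, is placed
  directly after their own unary index.\<close>

definition state_items :: "name state \<Rightarrow> nat list option list" where
  "state_items s = (if s \<in> range QF \<union> range (case_prod QV)
     then [Some (replicate (fst (tag s)) 1), None, Some (enc_name (False # snd (tag s)))]
     else [Some (enc_name (state_name s))])"

lemma items_out_state: "items_out j (state_items s) = enc_name (state_name (inst j s))"
  by (cases s) (auto simp: state_items_def state_name_def enc_name_def map_replicate_const replicate_add)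

definition trans_items :: "name state \<times> name \<times> name state \<Rightarrow> nat list option list" where
  "trans_items = (\<lambda>(p, a, q). state_items p @ [Some (enc_name a)] @ state_items q)"

definition enc_tran :: "name \<times> name \<times> name \<Rightarrow> nat list" where
  "enc_tran = (\<lambda>(p, a, q). enc_name p @ enc_name a @ enc_name q)"

lemma items_out_trans: "items_out j (trans_items t) = enc_tran (name_trans (inst_trans j t))"
  by (cases t) (simp add: trans_items_def items_out_state enc_tran_def name_trans_def inst_trans_def)

definition nfa_segments :: "name list \<Rightarrow> (nat \<Rightarrow> name \<Rightarrow> bool) \<Rightarrow> (name \<Rightarrow> name \<Rightarrow> bool) \<Rightarrow> (name \<Rightarrow> name \<Rightarrow> bool) \<Rightarrow>
    (name \<Rightarrow> bool) \<Rightarrow> segment list" where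
  "nfa_segments G A H W E =
     [Const (concat (map (enc_name \<circ> state_name) (fixed_states G))),
      Row (\<lambda>_. concat (map state_items (row_states G))),
      Const (3 # enc_names G @ concat (map (enc_tran \<circ> name_trans) (fixed_trans G H E))),
      Row (\<lambda>c. concat (map trans_items (row_trans G A W c))),
      Const (3 # enc_name (state_name (QF 0)) @ enc_names (map state_name [QF 0, QA, QE]))]"

lemma enc_bad_nfa: "enc_nfa (bad_nfa G A H W E row) = concat (map (segment_out row) (nfa_segments G A H W E))"
proof -
  have "enc_names (nfa_states (bad_nfa G A H W E row)) = concat (map (enc_name \<circ> state_name) (fixed_states G)) @
     segment_out row (Row (\<lambda>_. concat (map state_items (row_states G)))) @ [3]"
    by (simp add: bad_nfa_def enc_names_def items_out_concat items_out_state map_concat comp_def concat_map_concat concat_concat)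
  moreover have "enc_trans (nfa_trans (bad_nfa G A H W E row)) = concat (map (enc_tran \<circ> name_trans) (fixed_trans G H E)) @
     segment_out row (Row (\<lambda>c. concat (map trans_items (row_trans G A W c)))) @ [3]"
    by (simp add: bad_nfa_def enc_trans_def items_out_concat items_out_trans map_concat comp_def concat_map_concat concat_concat
      flip: enc_tran_def)
  ultimately show ?thesis
    by (simp add: enc_nfa_def nfa_segments_def del: segment_out.simps(2)) (simp add: bad_nfa_def)
qed

subsection \<open>Reductions\<close>

lemma first_row_facts:
  shows "first_row b w \<noteq> []" "hd (first_row b w) = 0"
    "length (first_row b w) = Suc (length (filter (\<lambda>c. c \<noteq> 0) (first_row b w)))"
    "i < length (first_row b w) \<Longrightarrow> first_row b w ! i = 3 \<longleftrightarrow> Suc i = length (first_row b w)"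
proof -
  obtain m where "set w \<subseteq> {..<m}" using finite_set[of w] by (meson finite_nat_iff_bounded)
  from set_input_row[OF this] have inp: "c \<noteq> 0" "c \<noteq> 3" if "c \<in> set (input_row w)" for c using that by force+
  show "first_row b w \<noteq> []" "hd (first_row b w) = 0" by (simp_all add: first_row_def)
  have "filter (\<lambda>c. c \<noteq> 0) (input_row w) = input_row w" using inp by simp
  then show "length (first_row b w) = Suc (length (filter (\<lambda>c. c \<noteq> 0) (first_row b w)))" by (simp add: first_row_def)
  let ?r = "0 # replicate b 1 @ input_row w @ replicate b 2"
  have r: "first_row b w = ?r @ [3]" by (simp add: first_row_def)
  have n3: "3 \<notin> set ?r" using inp by auto
  have "?r ! i \<noteq> 3" if "i < length ?r" using n3 nth_mem[OF that] by metis
  moreover assume "i < length (first_row b w)"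
  then have "i < length ?r \<or> i = length ?r" unfolding r by (simp add: less_Suc_eq)
  ultimately show "first_row b w ! i = 3 \<longleftrightarrow> Suc i = length (first_row b w)"
    unfolding r by (auto simp only: nth_append length_append list.size nth_append_length if_True) (auto simp: nth_append)
qed

lemma PSPACE_bad_words:
  assumes "A \<in> PSPACE m" and le: "le \<in> {prefix, suffix, sublist, subseq}" and P: "P \<in> {convex_lang le, closed_lang le}"
  obtains G :: "name list" and A' H W E c d where
    "\<And>w. w \<in> lists {..<m} \<Longrightarrow> P (bad_words (set G) A' H W E (first_row (c * (length w + 1) ^ d) w)) \<longleftrightarrow> w \<in> A"
proof -
  obtain M and p :: "nat poly" where M: "wf_tm M" "m < tm_symbols M"
    and Mw: "\<And>w. w \<in> lists {..<m} \<Longrightarrow> tm_halts M w \<and> (tm_accepts M w \<longleftrightarrow> w \<in> A) \<and> tm_space M w \<le> poly p (length w)"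
    using assms(1) unfolding PSPACE_def by blast
  obtain c d where cd: "\<And>n. poly p n \<le> c * (n + 1) ^ d" using poly_le_power[of p] by blast
  obtain ls where ls: "set ls = letters M" using finite_list[OF finite_letters] by blast
  \<comment> \<open>Any injective naming by bit strings serves. The letters depend only on the
    machine, so even unary names have constant length.\<close>
  define g :: "letter \<Rightarrow> name" where "g l = replicate (to_nat l) True" for l
  have g: "inj g" unfolding g_def by (auto intro!: injI simp: replicate_eq_replicate)
  let ?k = "tm_tapes M"
  \<comment> \<open>A cell of kind \<open>Mid\<close>: it is neither a left end, as the first
    position demands, nor a right end, as the last one does. So it spoils a good word on either
    side.\<close>
  define l where "l = (Mid, tm_start M, replicate ?k (0::nat), replicate ?k (0::nat, Before))"
  have l: "l \<in> letters M" using M by (auto simp: letters_def l_def wf_tm_def)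
  let ?G = "map g ls"
  let ?A = "\<lambda>c x. matches M c (inv g x)" and ?H = "\<lambda>x y. hrel (inv g x) (inv g y)"
    and ?W = "\<lambda>x y. vrel M (inv g x) (inv g y)" and ?E = "\<lambda>x. final_letter M (inv g x)"
  have G: "set ?G = g ` letters M" using ls by simp
  have "P (bad_words (set ?G) ?A ?H ?W ?E (first_row (c * (length w + 1) ^ d) w)) \<longleftrightarrow> w \<in> A" if w: "w \<in> lists {..<m}" for w
  proof -
    let ?row = "first_row (c * (length w + 1) ^ d) w"
    have "P (bad_words (set ?G) ?A ?H ?W ?E ?row) \<longleftrightarrow> (\<nexists>x. good (set ?G) ?A ?H ?W ?E ?row x)"
    proof (rule bad_words_closed_or_convex[OF le P])
      show "g l \<in> set ?G" using l G by simp
      show "\<not> ?A (hd ?row) (g l)" using g by (simp add: first_row_facts(2) matches_iff cell_class_def l_def)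
      show "\<not> ?E (g l)" using g by (simp add: l_def)
    qed (rule first_row_facts(1))
    also have "\<dots> \<longleftrightarrow> (\<nexists>x. good (letters M) (matches M) hrel (vrel M) (final_letter M) ?row x)"
      unfolding G ex_good_map[OF g] ..
    also have "\<dots> \<longleftrightarrow> tm_accepts M w"
      using rejects_iff_good[OF M w, of "c * (length w + 1) ^ d"] Mw[OF w] cd[of "length w"] by auto
    finally show ?thesis using Mw[OF w] by simp
  qed
  then show thesis by (rule that)
qed

theorem PSPACE_hard_convex_closed:
  assumes le: "le \<in> {prefix, suffix, sublist, subseq}" and P: "P \<in> {convex_lang le, closed_lang le}"
  shows "PSPACE_hard 4 (nfa_problem P)" "PSPACE_hard 8 (rexp_problem P)"
proof -
  show "PSPACE_hard 4 (nfa_problem P)"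
    unfolding PSPACE_hard_def
  proof (intro allI ballI)
    fix m A assume A: "A \<in> PSPACE m"
    obtain G :: "name list" and A' H W E c d where *:
      "\<And>w. w \<in> lists {..<m} \<Longrightarrow> P (bad_words (set G) A' H W E (first_row (c * (length w + 1) ^ d) w)) \<longleftrightarrow> w \<in> A"
      using PSPACE_bad_words[OF A le P] by blast
    let ?N = "\<lambda>w. bad_nfa G A' H W E (first_row (c * (length w + 1) ^ d) w)"
    have "enc_nfa N \<in> lists {..<4}" for N
      by (auto simp: enc_nfa_def enc_names_def enc_name_def enc_trans_def of_bool_def split: if_splits)
    moreover have "w \<in> A \<longleftrightarrow> enc_nfa (?N w) \<in> nfa_problem P" if "w \<in> lists {..<m}" for w
    proof -
      have "enc_nfa (?N w) \<in> nfa_problem P \<longleftrightarrow> P (nfa_lang (?N w))"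
        using wf_bad_nfa[OF first_row_facts(1)] inj_enc_nfa unfolding nfa_problem_def by (auto dest: injD)
      then show ?thesis using *[OF that] by (simp add: lang_bad_nfa[OF first_row_facts(1,4)])
    qed
    moreover have "polytime_computable m (\<lambda>w. enc_nfa (?N w))" unfolding enc_bad_nfa by (rule polytime_segments)
    ultimately show "polytime_reducible m A 4 (nfa_problem P)" unfolding polytime_reducible_def by blast
  qed
  show "PSPACE_hard 8 (rexp_problem P)"
    unfolding PSPACE_hard_def
  proof (intro allI ballI)
    fix m A assume A: "A \<in> PSPACE m"
    obtain G :: "name list" and A' H W E c d where *:
      "\<And>w. w \<in> lists {..<m} \<Longrightarrow> P (bad_words (set G) A' H W E (first_row (c * (length w + 1) ^ d) w)) \<longleftrightarrow> w \<in> A"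
      using PSPACE_bad_words[OF A le P] by blast
    let ?r = "\<lambda>w. bad_rexp G A' H W E (first_row (c * (length w + 1) ^ d) w)"
    have "enc_rexp r \<in> lists {..<8}" for r using set_enc_rexp[of r] by auto
    moreover have "w \<in> A \<longleftrightarrow> enc_rexp (?r w) \<in> rexp_problem P" if "w \<in> lists {..<m}" for w
    proof -
      have "enc_rexp (?r w) \<in> rexp_problem P \<longleftrightarrow> P (rexp_lang (?r w))"
        using inj_enc_rexp unfolding rexp_problem_def by (auto dest: injD)
      then show ?thesis using *[OF that] by (simp add: lang_bad_rexp[OF first_row_facts(3)])
    qed
    moreover have "polytime_computable m (\<lambda>w. enc_rexp (?r w))" unfolding enc_bad_rexp by (rule polytime_segments)
    ultimately show "polytime_reducible m A 8 (rexp_problem P)" unfolding polytime_reducible_def by blast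
  qed
qed

theorem theorem15:
  shows "\<forall>le \<in> {prefix, suffix, sublist, subseq}.
    PSPACE_complete 4 (nfa_problem (convex_lang le)) \<and>
    PSPACE_complete 8 (rexp_problem (convex_lang le)) \<and>
    PSPACE_complete 4 (nfa_problem (closed_lang le)) \<and>
    PSPACE_complete 8 (rexp_problem (closed_lang le))"
proof
  fix le :: "name list \<Rightarrow> name list \<Rightarrow> bool"
  assume le: "le \<in> {prefix, suffix, sublist, subseq}"
  note hard = PSPACE_hard_convex_closed[OF le]
  show "PSPACE_complete 4 (nfa_problem (convex_lang le)) \<and> PSPACE_complete 8 (rexp_problem (convex_lang le)) \<and>
    PSPACE_complete 4 (nfa_problem (closed_lang le)) \<and> PSPACE_complete 8 (rexp_problem (closed_lang le))"
    unfolding PSPACE_complete_def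
    using nfa_problem_PSPACE[OF le] rexp_problem_PSPACE[OF le] hard[of "convex_lang le"] hard[of "closed_lang le"]
    by simp
qed

end
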